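(* Let $n\geq 2$ be an integer. Let $P_{*}(f)$ be a differential polynomial in $f$ of degree $n-1$ with rational functions as its coefficients, and let $\alpha_{1},\alpha_{2},p_{1},p_{2}$ be nonzero complex constants such that $\alpha_{1}+\alpha_{2}\neq 0$ and $\alpha_{1}-\alpha_{2}\neq 0$. If $f$ is a transcendental meromorphic solution (in $\mathbb{C}$) of $$f^{n}(z)+P_{*}(f)=p_{1}e^{\alpha_{1}z}+p_{2}e^{\alpha_{2}z}$$ satisfying $N(r,f)=S(r,f)$, then $\sigma(f)=1$ and the following two cases occur: (I) If $N\left(r,\frac1f\right)=S(r,f)$, then one of the following holds: (a) $k_{1}\alpha_{1}=n\alpha_{2}$ and $f=s_{1}\exp(\alpha_{1}z/n)$; (b) $k_{2}\alpha_{2}=n\alpha_{1}$ and $f=s_{2}\exp(\alpha_{2}z/n)$; where $k_{1},k_{2}$ are integers satisfying $1\leq k_{1},k_{2}\leq n-1$, and $s_{1},s_{2}$ are constants with $s_{1}^{n}=p_{1}$ and $s_{2}^{n}=p_{2}$. (II) If $N\left(r,\frac1f\right)\neq S(r,f)$, then $$T(r,f)\leq N_{1)}\left(r,\frac{1}{f}\right)+\frac{1}{2}T(r,\varphi)+\frac{1}{2}N\left(r,\frac{1}{\varphi}\right)+S(r,f),$$ where $\varphi=\alpha_{1}\alpha_{2}f^{2}-n(\alpha_{1}+\alpha_{2})ff'+n(n-1)(f')^{2}+nff''\not\equiv 0$, and moreover: (1) if $\varphi$ is a nonzero constant, then one of the following holds: (a) $(n-1)\alpha_{1}=n\alpha_{2}$,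 and $f(z)=c_{1}e^{\alpha_{1}z/n}-\frac{1}{\alpha_{1}}\sqrt{\frac{n\varphi}{n-1}}$ with a constant $c_{1}$ satisfying $c_{1}^{n}=p_{1}$, or $f(z)=c_{3}e^{\alpha_{1}z/n}+\frac{1}{\alpha_{1}}\sqrt{\frac{n\varphi}{n-1}}$ with a constant $c_{3}$ satisfying $c_{3}^{n}=p_{1}$; (b) $(n-1)\alpha_{2}=n\alpha_{1}$, and $f(z)=c_{2}e^{\alpha_{2}z/n}-\frac{1}{\alpha_{2}}\sqrt{\frac{n\varphi}{n-1}}$ with a constant $c_{2}$ satisfying $c_{2}^{n}=p_{2}$, or $f(z)=c_{4}e^{\alpha_{2}z/n}+\frac{1}{\alpha_{2}}\sqrt{\frac{n\varphi}{n-1}}$ with a constant $c_{4}$ satisfying $c_{4}^{n}=p_{2}$; (2) if $\varphi$ is a nonconstant meromorphic function, then $T(r,\varphi)\neq S(r,f)$. In particular, suppose $n=2$ and $\varphi=P(z)e^{Q(z)}$, where $P$ and $Q$ are polynomials, not identically zero, with $\deg Q\geq 1$. Then $\deg Q=1$ and $f^{2}=d_{1}e^{\alpha_{1}z}+d_{2}e^{\alpha_{2}z}-R(z)e^{Q(z)}$, where $d_{1},d_{2}$ are constants and $R$ is a polynomial, not identically zero, with $\deg R\leq\deg P+2$.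
   Context: Standard Nevanlinna theory notation is used: $T(r,f)$ and $N(r,f)$ are the characteristic and the (integrated) counting function of poles (with multiplicity) of a meromorphic function $f$ on $\mathbb{C}$; $N_{1)}(r,1/f)$ is the counting function of the simple zeros of $f$; $\sigma(f)=\limsup_{r\to\infty}\frac{\log^{+}T(r,f)}{\log r}$ is the order of $f$. $S(r,f)$ denotes any quantity with $S(r,f)=o(T(r,f))$ as $r\to\infty$, possibly outside a set of finite linear measure (not necessarily the same at each occurrence); "$X(r)=S(r,f)$" means $X(r)$ has this property and "$X(r)\neq S(r,f)$" means that it does not. $\sqrt{\cdot}$ denotes a fixed choice of complex square root. A differential polynomial in $f$ is a finite sum of terms $a_\lambda f^{l_0}(f')^{l_1}\cdots(f^{(k)})^{l_k}$ with coefficients $a_\lambda$ (here rational functions of $z$) and nonnegative integers $l_j$; its degree is the maximum of $l_0+l_1+\cdots+l_k$ over its terms. *)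

theory Defs
  imports
    "HOL-Complex_Analysis.Complex_Analysis"
    "HOL-Computational_Algebra.Computational_Algebra"
    "HOL-Computational_Algebra.Field_as_Ring"
    "HOL-Library.Poly_Mapping"
begin

text \<open>
  A meromorphic function on the plane is represented by a function that is
  \<^const>\<open>nicely_meromorphic_on\<close> \<^const>\<open>UNIV\<close>: removable singularities are removed and the value
  at a pole is 0. Expressions built from such a function, like \<open>1/f\<close> or an expression in \<open>f\<close> and
  its derivatives, may have arbitrary values on a sparse set. The definitions below do not depend on
  these values, and identities between such expressions are stated on a cosparse set.
\<close>

definition log_plus :: "real \<Rightarrow> real" where
  "log_plus x = ln (max 1 x)"

definition pole_count :: "(complex \<Rightarrow> complex) \<Rightarrow> real \<Rightarrow> real" where
  "pole_count f t = (\<Sum>z | norm z \<le> t \<and> is_pole f z. real_of_int (- zorder f z))"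

definition simple_zero_count :: "(complex \<Rightarrow> complex) \<Rightarrow> real \<Rightarrow> real" where
  "simple_zero_count f t =
     real (card {z. norm z \<le> t \<and> isolated_zero f z \<and> zorder f z = 1})"

definition integrated_count :: "(real \<Rightarrow> real) \<Rightarrow> real \<Rightarrow> real" where
  "integrated_count \<nu> r = integral {0..r} (\<lambda>t. (\<nu> t - \<nu> 0) / t) + \<nu> 0 * ln r"

definition counting_N :: "real \<Rightarrow> (complex \<Rightarrow> complex) \<Rightarrow> real" where
  "counting_N r f = integrated_count (pole_count f) r"

text \<open>\<open>N\<^sub>1\<^sub>) (r, 1/f)\<close>; the argument is \<open>f\<close>, not \<open>1/f\<close>.\<close>

definition counting_N_simple_zeros :: "real \<Rightarrow> (complex \<Rightarrow> complex) \<Rightarrow> real" where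
  "counting_N_simple_zeros r f = integrated_count (simple_zero_count f) r"

definition proximity_m :: "real \<Rightarrow> (complex \<Rightarrow> complex) \<Rightarrow> real" where
  "proximity_m r f =
     1 / (2 * pi) * integral {0..2 * pi} (\<lambda>\<theta>. log_plus (norm (f (of_real r * cis \<theta>))))"

definition characteristic_T :: "real \<Rightarrow> (complex \<Rightarrow> complex) \<Rightarrow> real" where
  "characteristic_T r f = proximity_m r f + counting_N r f"

definition growth_order :: "(complex \<Rightarrow> complex) \<Rightarrow> ereal" where
  "growth_order f = Limsup at_top (\<lambda>r. ereal (log_plus (characteristic_T r f) / ln r))"

text \<open>\<open>X(r) = S(r, f)\<close>, with an exceptional set \<open>E\<close> of finite linear measure.\<close>

definition is_S :: "(complex \<Rightarrow> complex) \<Rightarrow> (real \<Rightarrow> real) \<Rightarrow> bool" where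
  "is_S f X \<longleftrightarrow>
     (\<exists>E \<in> lmeasurable. X \<in> o[inf at_top (principal (- E))](\<lambda>r. characteristic_T r f))"

definition ratfun_eval :: "complex poly fract \<Rightarrow> complex \<Rightarrow> complex" where
  "ratfun_eval q z = poly (fst (quot_of_fract q)) z / poly (snd (quot_of_fract q)) z"

definition transcendental_meromorphic :: "(complex \<Rightarrow> complex) \<Rightarrow> bool" where
  "transcendental_meromorphic f \<longleftrightarrow>
     f nicely_meromorphic_on UNIV \<and> \<not> (\<exists>q. \<forall>\<^sub>\<approx>z. f z = ratfun_eval q z)"

text \<open>
  A differential polynomial is a polynomial with rational coefficients in the variables
  \<open>f, f', f'', \<dots>\<close>. The monomial with exponents \<open>l\<close> stands for the product of the powers
  \<open>(f\<^sup>(\<^sup>j\<^sup>))\<close> to the \<open>l\<^sub>j\<close>.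
\<close>

type_synonym diff_poly = "(nat \<Rightarrow>\<^sub>0 nat) \<Rightarrow>\<^sub>0 complex poly fract"

definition diff_poly_eval :: "diff_poly \<Rightarrow> (complex \<Rightarrow> complex) \<Rightarrow> complex \<Rightarrow> complex" where
  "diff_poly_eval P f z =
     (\<Sum>l \<in> Poly_Mapping.keys P. ratfun_eval (Poly_Mapping.lookup P l) z *
        (\<Prod>j \<in> Poly_Mapping.keys l. (deriv ^^ j) f z ^ Poly_Mapping.lookup l j))"

text \<open>\<^term>\<open>insert 0\<close> only serves to give the zero polynomial degree 0.\<close>

definition diff_poly_degree :: "diff_poly \<Rightarrow> nat" where
  "diff_poly_degree P =
     Max (insert 0 ((\<lambda>l. \<Sum>j \<in> Poly_Mapping.keys l. Poly_Mapping.lookup l j) ` Poly_Mapping.keys P))"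

definition phi_aux :: "nat \<Rightarrow> complex \<Rightarrow> complex \<Rightarrow> (complex \<Rightarrow> complex) \<Rightarrow> complex \<Rightarrow> complex" where
  "phi_aux n \<alpha>1 \<alpha>2 f z =
     \<alpha>1 * \<alpha>2 * f z ^ 2 - of_nat n * (\<alpha>1 + \<alpha>2) * f z * deriv f z
     + of_nat n * (of_nat n - 1) * deriv f z ^ 2 + of_nat n * f z * deriv (deriv f) z"

end

theory Submission imports Defs "HOL-Real_Asymp.Real_Asymp"
begin

text \<open>
  The logarithmic derivative lemma is used in a pointwise form: off an exceptional set of radii,
  \<open>f'/f\<close> and its derivatives are bounded on \<open>|z| = r\<close> by a power of \<open>r\<close> and of the characteristic.
  With the equation and Borel's growth lemma this gives \<open>T(r, f) = O(r)\<close>, hence the bound \<open>r\<^sup>M\<close>, and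
  comparison with \<open>m(r, exp(\<alpha>\<^sub>1 z))\<close> shows that \<open>r\<close> is the exact growth.

  The operator \<open>D\<^sub>2 = (d/dz - \<alpha>\<^sub>1)(d/dz - \<alpha>\<^sub>2)\<close> annihilates the right-hand side, and
  \<open>D\<^sub>2(f\<^sup>n) = f\<^sup>n\<^sup>-\<^sup>2 \<phi>\<close>, so by Clunie's argument \<open>|\<phi>| \<le> r\<^sup>M |f|\<close>; on the other hand \<open>\<phi> = f\<^sup>2 L\<close> with
  \<open>L\<close> a polynomial in \<open>f'/f\<close> and its derivative. If \<open>N(r, 1/f)\<close> is small then so is \<open>m(r, 1/L)\<close> unless
  \<open>\<phi> = 0\<close>, and \<open>|f L| \<le> r\<^sup>M\<close> would make \<open>m(r, f)\<close> small; hence \<open>f\<^sup>n\<close> solves \<open>D\<^sub>2 u = 0\<close>.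

  If \<open>\<phi> \<noteq> 0\<close> is small, then \<open>f'' = t f' - w f\<close> with small \<open>t\<close>, \<open>w\<close>, and \<open>\<phi> = A f\<^sup>2 + B f f' + C f'\<^sup>2\<close>.
  Comparing \<open>\<phi>'\<close> with \<open>(\<phi>'/\<phi>) \<phi>\<close> gives \<open>f X + f' Y = 0\<close>, and \<open>Y \<noteq> 0\<close> would force \<open>Y = 0\<close> at most zeros
  of \<open>f\<close>; so \<open>X = Y = 0\<close>. These equations make the discriminant satisfy a linear equation which shows
  that it vanishes, and turn the double root of the quadratic form into a solution of the Riccati
  equation \<open>v' = (v + \<alpha>\<^sub>1)(v + \<alpha>\<^sub>2)\<close>, whose only small solutions are the constants \<open>-\<alpha>\<^sub>1\<close> and \<open>-\<alpha>\<^sub>2\<close>.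
  Then \<open>f' - (\<alpha>\<^sub>j/n) f\<close> is constant.
\<close>

section \<open>Circle means and the Poisson formula\<close>

text \<open>Pointwise bounds are used because they form a ring closed under differentiation: a bound
  in a disc of radius r^(-M) about each point of the circle passes to the derivative by Cauchy's
  estimate, only M changes. A coefficient counts as small if it is bounded in this way and its poles
  have bounded order and lie in a set with counting function o(r). Circle means behave well only on
  circles free of zeros, poles and badly valued points. T is therefore proved monotone along such
  radii; the order, a limsup over all radii, is reached from them by Fatou's lemma. The coefficient
  t is dictated by the simple zeros of f: there phi = n(n-1)f'^2 and phi' = n f'((2n-1)f'' -
  (\<alpha>1+\<alpha>2)f'), so phi'/phi determines f''/f'. A zero of f of order m \<ge> 2 is a zero
  of phi of order at least 2m-2 \<ge> m, hence the multiple zeros are charged to phi; this is also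
  why only simple zeros occur in the general inequality. The relations between n, \<alpha>1 and
  \<alpha>2 come from the independence of exponentials over the polynomials.\<close>

definition circ_mean :: "real \<Rightarrow> (complex \<Rightarrow> 'a::banach) \<Rightarrow> 'a" where
  "circ_mean r u = (1 / (2 * pi)) *\<^sub>R integral {0..2 * pi} (\<lambda>\<theta>. u (of_real r * cis \<theta>))"

lemma continuous_on_circle:
  assumes "continuous_on (sphere 0 r) u" "r \<ge> 0"
  shows "continuous_on A (\<lambda>\<theta>. u (of_real r * cis \<theta>))"
  by (rule continuous_on_compose2[OF assms(1)])
     (use assms(2) in \<open>auto intro!: continuous_intros simp: norm_mult\<close>)

lemma integrable_on_circle:
  fixes u :: "complex \<Rightarrow> 'a::banach"
  assumes "continuous_on (sphere 0 r) u" "r \<ge> 0"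
  shows "(\<lambda>\<theta>. u (of_real r * cis \<theta>)) integrable_on {0..2 * pi}"
  using continuous_on_circle[OF assms] by (rule integrable_continuous_interval)

lemma circ_mean_add:
  assumes "continuous_on (sphere 0 r) u" "continuous_on (sphere 0 r) v" "r \<ge> 0"
  shows "circ_mean r (\<lambda>z. u z + v z) = circ_mean r u + circ_mean r v"
  unfolding circ_mean_def
  by (subst integral_add) (use assms in \<open>auto intro!: integrable_on_circle simp: scaleR_add_right\<close>)

lemma circ_mean_diff:
  assumes "continuous_on (sphere 0 r) u" "continuous_on (sphere 0 r) v" "r \<ge> 0"
  shows "circ_mean r (\<lambda>z. u z - v z) = circ_mean r u - circ_mean r v"
  unfolding circ_mean_def
  by (subst integral_diff) (use assms in \<open>auto intro!: integrable_on_circle simp: scaleR_diff_right\<close>)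

lemma circ_mean_sum:
  assumes "\<And>i. i \<in> I \<Longrightarrow> continuous_on (sphere 0 r) (u i)" "r \<ge> 0" "finite I"
  shows "circ_mean r (\<lambda>z. \<Sum>i\<in>I. u i z) = (\<Sum>i\<in>I. circ_mean r (u i))"
  unfolding circ_mean_def
  by (subst integral_sum) (use assms in \<open>auto intro!: integrable_on_circle simp: scaleR_sum_right\<close>)

lemma circ_mean_cmult [simp]:
  fixes u :: "complex \<Rightarrow> 'a::{real_normed_field, banach}"
  shows "circ_mean r (\<lambda>z. c * u z) = c * circ_mean r u"
  unfolding circ_mean_def by simp

lemma circ_mean_const [simp]: "circ_mean r (\<lambda>z. c) = c"
  unfolding circ_mean_def by simp

lemma circ_mean_cong:
  "r \<ge> 0 \<Longrightarrow> (\<And>z. norm z = r \<Longrightarrow> u z = v z) \<Longrightarrow> circ_mean r u = circ_mean r v"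
  unfolding circ_mean_def by (auto intro!: integral_cong simp: norm_mult)

lemma circ_mean_mono:
  fixes u v :: "complex \<Rightarrow> real"
  assumes "continuous_on (sphere 0 r) u" "continuous_on (sphere 0 r) v" "r \<ge> 0"
    "\<And>z. norm z = r \<Longrightarrow> u z \<le> v z"
  shows "circ_mean r u \<le> circ_mean r v"
proof -
  have "integral {0..2 * pi} (\<lambda>\<theta>. u (of_real r * cis \<theta>)) \<le> integral {0..2 * pi} (\<lambda>\<theta>. v (of_real r * cis \<theta>))"
    using assms by (intro integral_le integrable_on_circle) (auto simp: norm_mult)
  thus ?thesis unfolding circ_mean_def by (intro scaleR_left_mono) auto
qed

lemma circ_mean_norm_le:
  fixes u :: "complex \<Rightarrow> 'a::euclidean_space"
  assumes "continuous_on (sphere 0 r) u" "r \<ge> 0"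
  shows "norm (circ_mean r u) \<le> circ_mean r (\<lambda>z. norm (u z))"
proof -
  have "norm (integral {0..2 * pi} (\<lambda>\<theta>. u (of_real r * cis \<theta>)))
        \<le> integral {0..2 * pi} (\<lambda>\<theta>. norm (u (of_real r * cis \<theta>)))"
    using assms by (intro integral_norm_bound_integral integrable_on_circle
        continuous_intros) (auto intro!: integrable_on_circle[where u = "\<lambda>z. norm (u z)"] continuous_intros)
  thus ?thesis unfolding circ_mean_def norm_scaleR by (auto intro!: scaleR_left_mono simp: abs_if divide_simps)
qed

lemma circ_mean_bounded_linear:
  assumes "bounded_linear L" "continuous_on (sphere 0 r) u" "r \<ge> 0"
  shows "L (circ_mean r u) = circ_mean r (\<lambda>z. L (u z))"
  unfolding circ_mean_def
  using integral_linear[OF integrable_on_circle[OF assms(2,3)] assms(1)]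
  by (simp add: linear_cmul[OF bounded_linear.linear[OF assms(1)]] o_def)

lemmas circ_mean_Re = circ_mean_bounded_linear[OF bounded_linear_Re]
lemmas circ_mean_cnj = circ_mean_bounded_linear[OF bounded_linear_cnj]
text \<open>On the circle dw = i w d\<theta>, so the factor w in the mean turns it into a contour
  integral. Cauchy's formulas thereby become statements about circle means.\<close>

lemma circ_mean_contour:
  assumes "(F has_contour_integral I) (circlepath 0 r)"
  shows "circ_mean r (\<lambda>w. w * F w) = I / (2 * pi * \<i>)"
proof -
  have "((\<lambda>t. F (0 + of_real r * cis t) * of_real r * \<i> * cis t) has_integral I) {0..2*pi}"
    using assms unfolding circlepath_def by (subst (asm) has_contour_integral_part_circlepath_iff) auto
  hence "((\<lambda>t. (1 / \<i>) * (F (0 + of_real r * cis t) * of_real r * \<i> * cis t)) has_integral ((1/\<i>) * I)) {0..2*pi}"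
    by (rule has_integral_mult_right)
  also have "(\<lambda>t. (1 / \<i>) * (F (0 + of_real r * cis t) * of_real r * \<i> * cis t)) =
             (\<lambda>t. of_real r * cis t * F (of_real r * cis t))"
    by (auto simp: field_simps)
  finally have "integral {0..2*pi} (\<lambda>t. of_real r * cis t * F (of_real r * cis t)) = (1/\<i>) * I"
    by (rule integral_unique)
  thus ?thesis unfolding circ_mean_def by (simp add: scaleR_conv_of_real divide_simps mult.assoc[symmetric])
     (simp add: mult.commute)
qed

lemma circ_mean_Cauchy:
  assumes "continuous_on (cball 0 R) g" "g holomorphic_on ball 0 R" "norm z < R"
  shows "circ_mean R (\<lambda>w. w * (g w / (w - z))) = g z"
  by (subst circ_mean_contour[OF Cauchy_integral_circlepath]) (use assms in auto)

lemma circ_mean_value: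
  assumes "continuous_on (cball 0 R) g" "g holomorphic_on ball 0 R" "R > 0"
  shows "circ_mean R g = g 0"
proof -
  have "circ_mean R g = circ_mean R (\<lambda>w. w * (g w / (w - 0)))"
    using assms by (intro circ_mean_cong) auto
  thus ?thesis using circ_mean_Cauchy[of R g 0] assms by simp
qed

lemma circ_mean_Cauchy_deriv:
  assumes "continuous_on (cball 0 R) g" "g holomorphic_on ball 0 R" "norm z < R"
  shows "circ_mean R (\<lambda>w. w * (g w / (w - z)^2)) = deriv g z"
proof -
  have "((\<lambda>u. g u / (u - z) ^ Suc 1) has_contour_integral
         (2 * pi * \<i>) / fact 1 * (deriv ^^ 1) g z) (circlepath 0 R)"
    by (rule Cauchy_has_contour_integral_higher_derivative_circlepath) (use assms in auto)
  from circ_mean_contour[OF this] show ?thesis by (simp add: power2_eq_square)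
qed

section \<open>The Poisson formula and a derivative bound by the real part\<close>

definition poisson_kernel :: "real \<Rightarrow> complex \<Rightarrow> complex \<Rightarrow> real" where
  "poisson_kernel R z w = (R^2 - (norm z)^2) / (norm (w - z))^2"

lemma complex_norm_lt_sq:
  assumes "norm z < R" "norm w \<le> R"
  shows "of_real (R^2) - cnj z * w \<noteq> 0"
proof
  assume "of_real (R^2) - cnj z * w = 0"
  hence "of_real (R^2) = cnj z * w" by simp
  hence "norm (of_real (R^2) :: complex) = norm z * norm w"
    by (metis norm_mult complex_mod_cnj)
  moreover have "norm (of_real (R^2) :: complex) = R^2"
    by (metis norm_of_real abs_power2)
  moreover have "norm z * norm w < R * R"
    using assms by (smt (verit) mult_less_cancel_right norm_ge_zero mult_mono' mult_strict_mono)
  ultimately show False by (simp add: power2_eq_square)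
qed

text \<open>Cauchy's formula at z for g times (R^2 - |z|^2) / (R^2 - cnj z * w), a factor
  holomorphic in w that equals 1 at w = z. On |w| = R its denominator is w * cnj (w - z), which
  completes w / (w - z) to the kernel.\<close>

lemma Poisson:
  assumes g: "continuous_on (cball 0 R) g" "g holomorphic_on ball 0 R" and z: "norm z < R"
  shows "circ_mean R (\<lambda>w. of_real (poisson_kernel R z w) * g w) = g z"
proof -
  have R: "R > 0" using z norm_ge_zero[of z] by linarith
  define G where "G = (\<lambda>w. g w * (of_real (R^2 - norm z^2) / (of_real (R^2) - cnj z * w)))"
  have nz: "of_real (R^2) - cnj z * w \<noteq> 0" if "norm w \<le> R" for w
    using complex_norm_lt_sq[OF z that] .
  have "circ_mean R (\<lambda>w. of_real (poisson_kernel R z w) * g w) = circ_mean R (\<lambda>w. w * (G w / (w - z)))"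
  proof (intro circ_mean_cong)
    fix w :: complex assume w: "norm w = R"
    have eq: "of_real (R^2) - cnj z * w = w * cnj (w - z)"
      using complex_norm_square[of w] w by (simp add: algebra_simps)
    have "w - z \<noteq> 0" "w \<noteq> 0" using w z R by auto
    moreover have "of_real (norm (w - z)^2) = (w - z) * cnj (w - z)"
      using complex_norm_square[of "w - z"] by simp
    ultimately show "of_real (poisson_kernel R z w) * g w = w * (G w / (w - z))"
      unfolding G_def eq poisson_kernel_def of_real_divide
      by (simp del: complex_cnj_diff of_real_power of_real_diff of_real_minus add: mult_ac)
  qed (use R in auto)
  also have "\<dots> = G z"
    using nz by (intro circ_mean_Cauchy z)
      (auto simp: G_def intro!: continuous_intros holomorphic_intros g less_imp_le)
  also have "G z = g z"
  proof -
    have "cnj z * z = of_real (norm z ^ 2)"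
      by (subst complex_norm_square) (simp add: mult.commute)
    moreover have "of_real (R^2) - cnj z * z \<noteq> 0" using nz[of z] z by simp
    ultimately show ?thesis unfolding G_def by simp
  qed
  finally show ?thesis .
qed

text \<open>With 2 Re g = g + cnj g, the first summand is Cauchy's formula for the derivative. The
  second is the conjugate of the mean of a holomorphic function \<open>G\<close> with
  \<open>G 0 = 0\<close>, so it contributes nothing.\<close>

lemma deriv_Poisson:
  assumes g: "continuous_on (cball 0 R) g" "g holomorphic_on ball 0 R" and z: "norm z < R"
  shows "circ_mean R (\<lambda>w. w / (w - z)^2 * of_real (2 * Re (g w))) = deriv g z"
proof -
  have R: "R > 0" using z norm_ge_zero[of z] by linarith
  have nz: "of_real (R^2) - cnj z * w \<noteq> 0" if "norm w \<le> R" for w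
    using complex_norm_lt_sq[OF z that] .
  define G where "G = (\<lambda>w. w * g w * (of_real (R^2) / (of_real (R^2) - cnj z * w)^2))"
  have contG: "continuous_on (cball 0 R) G"
    using nz by (auto simp: G_def intro!: continuous_intros g)
  have ne: "w - z \<noteq> 0" if "w \<in> sphere 0 R" for w
    using that z by auto
  have cg: "continuous_on (sphere 0 R) g"
    using g(1) by (rule continuous_on_subset) auto
  have "circ_mean R G = G 0"
    using nz by (intro circ_mean_value R contG)
      (auto simp: G_def intro!: holomorphic_intros g less_imp_le)
  hence G0: "circ_mean R (\<lambda>w. cnj (G w)) = 0"
    using circ_mean_cnj[of R G] R continuous_on_subset[OF contG, of "sphere 0 R"]
    by (auto simp: G_def)
  have "circ_mean R (\<lambda>w. w / (w - z)^2 * of_real (2 * Re (g w))) =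
        circ_mean R (\<lambda>w. w * (g w / (w - z)^2) + cnj (G w))"
  proof (intro circ_mean_cong)
    fix w :: complex assume w: "norm w = R"
    have ww: "of_real (R^2) = w * cnj w"
      using complex_norm_square[of w] w by simp
    have eq: "of_real (R^2) - cnj z * w = w * cnj (w - z)"
      unfolding ww by (simp add: algebra_simps)
    have nzz: "w - z \<noteq> 0" "w \<noteq> 0" "cnj w \<noteq> 0" using w z R by auto
    have "cnj (G w) = cnj w * cnj (g w) * (cnj (of_real (R^2)) / (cnj w * (w - z))^2)"
      unfolding G_def eq by simp
    also have "cnj (of_real (R^2)) = w * cnj w" unfolding ww by (simp add: mult.commute)
    also have "cnj w * cnj (g w) * (w * cnj w / (cnj w * (w - z))^2) = w * (cnj (g w) / (w - z)^2)"
      using nzz(3) by (simp add: power_mult_distrib power2_eq_square)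
    finally have "cnj (G w) = w * (cnj (g w) / (w - z)^2)" .
    moreover have "of_real (2 * Re (g w)) = g w + cnj (g w)"
      by (simp add: complex_add_cnj)
    ultimately show "w / (w - z)^2 * of_real (2 * Re (g w)) = w * (g w / (w - z)^2) + cnj (G w)"
      by (simp add: ring_distribs add_divide_distrib)
  qed (use R in auto)
  also have "\<dots> = circ_mean R (\<lambda>w. w * (g w / (w - z)^2)) + circ_mean R (\<lambda>w. cnj (G w))"
    using ne by (intro circ_mean_add continuous_intros cg continuous_on_subset[OF contG]) (use R in auto)
  finally show ?thesis using G0 circ_mean_Cauchy_deriv[OF g z] by simp
qed

text \<open>Only the real part of g enters. It will be applied to logarithms of zero-free functions,
  where Re g is the logarithm of a modulus and its absolute mean is controlled by proximity
  functions.\<close>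

lemma norm_deriv_le_mean:
  assumes g: "continuous_on (cball 0 R) g" "g holomorphic_on ball 0 R" and z: "norm z \<le> r" "r < R"
  shows "norm (deriv g z) \<le> 2 * R / (R - r)^2 * circ_mean R (\<lambda>w. \<bar>Re (g w)\<bar>)"
proof -
  have z': "norm z < R" using z by simp
  have R: "R > 0" using z' norm_ge_zero[of z] by linarith
  have ne: "w - z \<noteq> 0" if "w \<in> sphere 0 R" for w
    using that z' by auto
  have cg: "continuous_on (sphere 0 R) g"
    using g(1) by (rule continuous_on_subset) auto
  have "norm (deriv g z) \<le> circ_mean R (\<lambda>w. norm (w / (w - z)^2 * of_real (2 * Re (g w))))"
    unfolding deriv_Poisson[OF g z', symmetric] using ne R cg
    by (intro circ_mean_norm_le) (auto intro!: continuous_intros)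
  also have "\<dots> \<le> circ_mean R (\<lambda>w. 2 * R / (R - r)^2 * \<bar>Re (g w)\<bar>)"
  proof (rule circ_mean_mono)
    fix w :: complex assume w: "norm w = R"
    have "R - r \<le> norm (w - z)" using w z norm_triangle_ineq2[of w z] by linarith
    hence "(R - r)^2 \<le> norm (w - z)^2" using z by (intro power_mono) auto
    moreover have "(R - r)^2 > 0" using z by simp
    ultimately have "R / norm (w - z)^2 \<le> R / (R - r)^2" using R
      using z by (intro divide_left_mono mult_pos_pos) (auto simp: ne w)
    hence "R / norm (w - z)^2 * (2 * \<bar>Re (g w)\<bar>) \<le> R / (R - r)^2 * (2 * \<bar>Re (g w)\<bar>)"
      by (intro mult_right_mono) auto
    thus "norm (w / (w - z)^2 * of_real (2 * Re (g w))) \<le> 2 * R / (R - r)^2 * \<bar>Re (g w)\<bar>"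
      by (simp add: norm_mult norm_divide norm_power w abs_mult mult_ac)
  qed (use ne R cg z in \<open>auto intro!: continuous_intros\<close>)
  finally show ?thesis by (simp only: circ_mean_cmult)
qed

text \<open>On the circle |z - a| = max \<rho> |a| * |1 - c z| for a c with |c| \<rho> < 1: inside
  the disc c = cnj a / \<rho>^2, outside c = 1/a. Then Ln (1 - c z) is holomorphic in the disc and
  vanishes at 0, so the second factor has logarithmic mean 0.\<close>

lemma circ_mean_ln_dist:
  assumes "\<rho> > 0" "norm a \<noteq> \<rho>"
  shows "circ_mean \<rho> (\<lambda>z. ln (norm (z - a))) = ln (max \<rho> (norm a))"
proof -
  have aux: "circ_mean \<rho> (\<lambda>z. ln (norm (1 - c * z))) = 0" if c: "norm c * \<rho> < 1" for c
  proof -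
    have re: "Re (1 - c * z) > 0" if "norm z \<le> \<rho>" for z
    proof -
      have "Re (c * z) \<le> norm c * norm z" by (metis complex_Re_le_cmod norm_mult)
      also have "\<dots> \<le> norm c * \<rho>" using that by (intro mult_left_mono) auto
      finally show ?thesis using c by simp
    qed
    hence nn: "1 - c * z \<notin> \<real>\<^sub>\<le>\<^sub>0" if "norm z \<le> \<rho>" for z
      using that by (metis complex_nonpos_Reals_iff not_le)
    have ct: "continuous_on (cball 0 \<rho>) (\<lambda>z. Ln (1 - c * z))"
      using nn by (auto intro!: continuous_intros)
    have "circ_mean \<rho> (\<lambda>z. Ln (1 - c * z)) = Ln (1 - c * 0)"
      using nn by (intro circ_mean_value ct assms) (auto intro!: holomorphic_intros)
    hence "Re (circ_mean \<rho> (\<lambda>z. Ln (1 - c * z))) = 0" by simp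
    also have "Re (circ_mean \<rho> (\<lambda>z. Ln (1 - c * z))) = circ_mean \<rho> (\<lambda>z. Re (Ln (1 - c * z)))"
      by (rule circ_mean_Re) (use assms in \<open>auto intro!: continuous_on_subset[OF ct]\<close>)
    also have "\<dots> = circ_mean \<rho> (\<lambda>z. ln (norm (1 - c * z)))"
    proof (rule circ_mean_cong)
      fix z :: complex assume "norm z = \<rho>"
      hence "1 - c * z \<noteq> 0" using re[of z] by (metis order_refl zero_complex.simps(1) less_irrefl)
      thus "Re (Ln (1 - c * z)) = ln (norm (1 - c * z))" by (rule Re_Ln)
    qed (use assms in auto)
    finally show ?thesis .
  qed
  have split: "circ_mean \<rho> (\<lambda>z. ln (norm (z - a))) = ln (max \<rho> (norm a))"
    if c: "norm c * \<rho> < 1"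
      and eq: "\<And>z. norm z = \<rho> \<Longrightarrow> norm (z - a) = max \<rho> (norm a) * norm (1 - c * z)" for c
  proof -
    have nz: "1 - c * z \<noteq> 0" if "norm z = \<rho>" for z
    proof
      assume "1 - c * z = 0"
      hence "norm (c * z) = 1" by (metis eq_iff_diff_eq_0 norm_one)
      thus False using c that by (simp add: norm_mult)
    qed
    have "circ_mean \<rho> (\<lambda>z. ln (norm (z - a))) =
          circ_mean \<rho> (\<lambda>z. ln (max \<rho> (norm a)) + ln (norm (1 - c * z)))"
    proof (rule circ_mean_cong)
      fix z :: complex assume z: "norm z = \<rho>"
      have m: "max \<rho> (norm a) > 0" using assms by auto
      have "norm (1 - c * z) > 0" using nz[OF z] by simp
      with m show "ln (norm (z - a)) = ln (max \<rho> (norm a)) + ln (norm (1 - c * z))"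
        unfolding eq[OF z] by (simp only: ln_mult_pos)
    qed (use assms in auto)
    also have "\<dots> = ln (max \<rho> (norm a)) + circ_mean \<rho> (\<lambda>z. ln (norm (1 - c * z)))"
      using nz assms by (subst circ_mean_add) (auto intro!: continuous_intros)
    finally show ?thesis using aux[OF c] by simp
  qed
  show ?thesis
  proof (cases "norm a < \<rho>")
    case True
    show ?thesis
    proof (rule split[of "cnj a / of_real (\<rho>^2)"])
      show "norm (cnj a / of_real (\<rho>^2)) * \<rho> < 1"
        using True assms by (simp add: norm_divide norm_power power2_eq_square norm_mult)
      fix z :: complex assume z: "norm z = \<rho>"
      have zz: "of_real (\<rho>^2) = z * cnj z" using complex_norm_square[of z] z by simp
      have z0: "z \<noteq> 0" "of_real (\<rho>^2) \<noteq> (0::complex)" using z assms by auto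
      have "1 - cnj a / of_real (\<rho>^2) * z = (of_real (\<rho>^2) - cnj a * z) / of_real (\<rho>^2)"
        using z0 by (simp add: field_simps)
      also have "of_real (\<rho>^2) - cnj a * z = z * cnj (z - a)"
        unfolding zz by (simp add: algebra_simps)
      finally have "norm (1 - cnj a / of_real (\<rho>^2) * z) = \<rho> * norm (z - a) / \<rho>^2"
        by (simp add: norm_divide norm_mult norm_power z complex_mod_cnj flip: complex_cnj_diff)
      thus "norm (z - a) = max \<rho> (norm a) * norm (1 - cnj a / of_real (\<rho>^2) * z)"
        using True assms by (simp add: power2_eq_square)
    qed
  next
    case False
    hence a: "norm a > \<rho>" "a \<noteq> 0" using assms by auto
    show ?thesis
    proof (rule split[of "1 / a"])
      show "norm (1 / a) * \<rho> < 1" using a assms by (simp add: norm_divide field_simps)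
      fix z :: complex
      have "norm a * norm (1 - 1 / a * z) = norm (a * (1 - 1 / a * z))" by (simp add: norm_mult)
      also have "a * (1 - 1 / a * z) = a - z" using a by (simp add: field_simps)
      finally show "norm (z - a) = max \<rho> (norm a) * norm (1 - 1 / a * z)"
        using a by (simp add: norm_minus_commute)
    qed
  qed
qed

section \<open>Zeros and poles of a meromorphic function\<close>

text \<open>Nonvanishing is required in a punctured neighbourhood of every point, which is what
  makes \<open>zorder\<close> additive and which ignores arbitrary values on a sparse set.\<close>

definition nonzero_mero :: "(complex \<Rightarrow> complex) \<Rightarrow> bool" where
  "nonzero_mero f \<longleftrightarrow> f meromorphic_on UNIV \<and> (\<forall>z. \<forall>\<^sub>F w in at z. f w \<noteq> 0)"

text \<open>Besides zeros and poles this contains the points where the function merely has a wrong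
  value. It is therefore in general larger than the support of \<open>zorder\<close>.\<close>

definition sing :: "(complex \<Rightarrow> complex) \<Rightarrow> complex set" where
  "sing f = {z. \<not> (f analytic_on {z} \<and> f z \<noteq> 0)}"

definition good_radius :: "(complex \<Rightarrow> complex) \<Rightarrow> real \<Rightarrow> bool" where
  "good_radius f r \<longleftrightarrow> r > 0 \<and> (\<forall>z. norm z = r \<longrightarrow> z \<notin> sing f)"

lemma nonzero_mero_mero [dest]: "nonzero_mero f \<Longrightarrow> f meromorphic_on A"
  unfolding nonzero_mero_def by (meson meromorphic_on_subset subset_UNIV)

lemma nonzero_mero_ev: "nonzero_mero f \<Longrightarrow> \<forall>\<^sub>F w in at z. f w \<noteq> 0"
  unfolding nonzero_mero_def by blast

lemma nonzero_mero_freq: "nonzero_mero f \<Longrightarrow> \<exists>\<^sub>F w in at z. f w \<noteq> 0"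
  using nonzero_mero_ev eventually_frequently at_neq_bot by blast

lemma cosparse_eventually_at: "(\<forall>\<^sub>\<approx>z. P z) \<Longrightarrow> \<forall>\<^sub>F z in at a. P z"
  by (rule eventually_cosparse_imp_eventually_at) auto

lemma cosparse_ex:
  assumes "\<forall>\<^sub>\<approx>z::complex. P z" shows "\<exists>z. P z"
  using eventually_happens[OF assms] by (simp add: cosparse_eq_bot_iff')

lemma nonzero_mero_cosparse_iff:
  "nonzero_mero f \<longleftrightarrow> f meromorphic_on UNIV \<and> (\<forall>\<^sub>\<approx>z. f z \<noteq> 0)"
  unfolding nonzero_mero_def by (auto simp: eventually_cosparse_open_eq)

lemma zero_or_nonzero_mero:
  assumes "f meromorphic_on UNIV"
  shows "(\<forall>\<^sub>\<approx>z. f z = 0) \<or> nonzero_mero f"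
  using meromorphic_imp_constant_or_avoid[OF assms, of 0] assms
  by (auto simp: nonzero_mero_cosparse_iff)

lemma not_nonzero_mero_zero: "\<forall>\<^sub>\<approx>z. f z = 0 \<Longrightarrow> \<not> nonzero_mero f"
proof
  assume z: "\<forall>\<^sub>\<approx>z. f z = 0" and "nonzero_mero f"
  hence "\<forall>\<^sub>\<approx>z. f z \<noteq> 0" by (simp add: nonzero_mero_cosparse_iff)
  with z have "\<forall>\<^sub>\<approx>z::complex. False" by eventually_elim auto
  thus False using cosparse_ex by blast
qed

lemma nonzero_mero_mult [intro]:
  "nonzero_mero f \<Longrightarrow> nonzero_mero g \<Longrightarrow> nonzero_mero (\<lambda>z. f z * g z)"
  unfolding nonzero_mero_def by (auto intro!: meromorphic_intros eventually_conj)

lemma nonzero_mero_divide [intro]: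
  "nonzero_mero f \<Longrightarrow> nonzero_mero g \<Longrightarrow> nonzero_mero (\<lambda>z. f z / g z)"
  unfolding nonzero_mero_def by (auto intro!: meromorphic_intros eventually_conj)

lemma nonzero_mero_const [intro]: "c \<noteq> 0 \<Longrightarrow> nonzero_mero (\<lambda>z. c)"
  unfolding nonzero_mero_def by auto

lemma nonzero_mero_power [intro]: "nonzero_mero f \<Longrightarrow> nonzero_mero (\<lambda>z. f z ^ k)"
  by (induction k) auto

lemma nonzero_mero_analytic:
  "f holomorphic_on UNIV \<Longrightarrow> (\<And>z. f z \<noteq> 0) \<Longrightarrow> nonzero_mero f"
  unfolding nonzero_mero_def by (auto intro!: analytic_on_imp_meromorphic_on simp: analytic_on_open)

lemma nonzero_mero_exp [intro]: "nonzero_mero (\<lambda>z. exp (c * z))"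
  by (intro nonzero_mero_analytic holomorphic_intros) auto

lemma sing_cosparse:
  assumes "nonzero_mero f" shows "\<forall>\<^sub>\<approx>z. z \<notin> sing f"
proof -
  have "\<forall>\<^sub>\<approx>z. f analytic_on {z}" "\<forall>\<^sub>\<approx>z. f z \<noteq> 0"
    using assms meromorphic_on_imp_analytic_cosparse by (auto simp: nonzero_mero_cosparse_iff)
  thus ?thesis by eventually_elim (auto simp: sing_def)
qed

lemma finite_cosparse_compl:
  assumes "\<forall>\<^sub>\<approx>z. P z" shows "finite {z::complex. norm z \<le> R \<and> \<not> P z}"
proof -
  have "{z. \<not> P z} sparse_in UNIV" using assms by (simp add: eventually_cosparse)
  hence "{z. \<not> P z} sparse_in cball 0 R" by (rule sparse_in_subset) auto
  hence "finite (cball 0 R \<inter> {z. \<not> P z})" by (intro sparse_in_compact_finite) auto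
  also have "cball 0 R \<inter> {z. \<not> P z} = {z. norm z \<le> R \<and> \<not> P z}" by auto
  finally show ?thesis .
qed

lemma finite_sing: "nonzero_mero f \<Longrightarrow> finite {z. norm z \<le> R \<and> z \<in> sing f}"
  using finite_cosparse_compl[OF sing_cosparse[of f]] by simp

lemma zorder_nz_imp_sing: "zorder f z \<noteq> 0 \<Longrightarrow> z \<in> sing f"
  unfolding sing_def using zorder_eq_0I by blast

lemma finite_zorder:
  assumes "nonzero_mero f"
  shows "finite {z. norm z \<le> R \<and> zorder f z \<noteq> 0}"
  by (rule finite_subset[OF _ finite_sing[OF assms, of R]]) (auto dest: zorder_nz_imp_sing)

lemma nonzero_mero_is_pole_iff:
  assumes "nonzero_mero f" shows "is_pole f z \<longleftrightarrow> zorder f z < 0"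
  using isolated_pole_imp_neg_zorder[of f z] zorder_neg_imp_is_pole[of f z]
    nonzero_mero_ev[OF assms] nonzero_mero_mero[OF assms, of "{z}"]
  by (auto simp: meromorphic_at_iff)

lemma nonzero_mero_isolated_zero_iff:
  assumes "nonzero_mero f" shows "isolated_zero f z \<longleftrightarrow> zorder f z > 0"
  using zorder_isolated_zero_pos'[of f z] zorder_pos_imp_isolated_zero[of f z]
    nonzero_mero_ev[OF assms] nonzero_mero_mero[OF assms, of "{z}"]
  by (auto simp: meromorphic_at_iff)

lemma zorder_mult':
  "nonzero_mero f \<Longrightarrow> nonzero_mero g \<Longrightarrow> zorder (\<lambda>z. f z * g z) z = zorder f z + zorder g z"
  by (intro zorder_mult nonzero_mero_freq nonzero_mero_mero)

lemma zorder_divide':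
  "nonzero_mero f \<Longrightarrow> nonzero_mero g \<Longrightarrow> zorder (\<lambda>z. f z / g z) z = zorder f z - zorder g z"
  by (intro zorder_divide nonzero_mero_freq nonzero_mero_mero)

lemma zorder_power':
  "nonzero_mero f \<Longrightarrow> zorder (\<lambda>z. f z ^ k) z = int k * zorder f z"
  by (intro zorder_power nonzero_mero_freq nonzero_mero_mero)

lemma zorder_inverse':
  "nonzero_mero f \<Longrightarrow> zorder (\<lambda>z. 1 / f z) z = - zorder f z"
  by (subst zorder_divide') auto

lemma nonzero_mero_remove_sings:
  assumes "nonzero_mero f"
  shows "nonzero_mero (remove_sings f)"
  using eventually_remove_sings_eq[OF nonzero_mero_mero[OF assms, of UNIV]] assms
  unfolding nonzero_mero_cosparse_iff by (auto intro!: meromorphic_intros elim: eventually_elim2)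

lemma remove_sings_zorder_0:
  assumes "nonzero_mero f" "zorder f z = 0"
  shows "remove_sings f analytic_on {z}" "remove_sings f z \<noteq> 0"
proof -
  have iso: "isolated_singularity_at f z" "not_essential f z"
    using assms(1) by (auto simp: meromorphic_at_iff dest: nonzero_mero_mero[of _ "{z}"])
  have "\<not> is_pole f z" using assms nonzero_mero_is_pole_iff by auto
  then obtain c where "f \<midarrow>z\<rightarrow> c" using iso(2) by (auto simp: not_essential_def)
  thus ana: "remove_sings f analytic_on {z}" using iso(1) by (intro remove_sings_analytic_at)
  show "remove_sings f z \<noteq> 0"
    using zorder_eq_0_iff[OF ana nonzero_mero_freq[OF nonzero_mero_remove_sings[OF assms(1)]]]
      assms(2) iso by simp
qed

section \<open>Divisors and the factorization on a disc\<close>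

lemma zorder_linear: "zorder (\<lambda>z. z - a) z = (if z = a then 1 else 0)"
proof (cases "z = a")
  case True
  have "zorder (\<lambda>z. z - a) a = 1"
    by (rule zorder_eqI[of UNIV _ "\<lambda>_. 1"]) auto
  thus ?thesis using True by simp
next
  case False thus ?thesis by (auto intro!: zorder_eq_0I analytic_intros)
qed

lemma nonzero_mero_linear [intro]: "nonzero_mero (\<lambda>z. z - a)"
  unfolding nonzero_mero_def
proof (intro conjI allI)
  show "\<forall>\<^sub>F w in at z. w - a \<noteq> 0" for z
    using eventually_neq_at_within[of a z UNIV] by (auto elim: eventually_mono)
qed (auto intro!: meromorphic_intros)

lemma nonzero_mero_powi [intro]:
  assumes "nonzero_mero f" shows "nonzero_mero (\<lambda>z. f z powi k)"
proof -
  have "\<forall>\<^sub>F w in at z. f w powi k \<noteq> 0" for z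
    using nonzero_mero_ev[OF assms, of z] by eventually_elim simp
  thus ?thesis using assms unfolding nonzero_mero_def by (blast intro: meromorphic_on_powi)
qed

lemma nonzero_mero_prod [intro]:
  "(\<And>i. i \<in> I \<Longrightarrow> nonzero_mero (f i)) \<Longrightarrow> nonzero_mero (\<lambda>z. \<Prod>i\<in>I. f i z)"
proof (induction I rule: infinite_finite_induct)
  case (insert i I)
  have "nonzero_mero (\<lambda>z. f i z * (\<Prod>i\<in>I. f i z))"
    using insert by (intro nonzero_mero_mult) auto
  thus ?case using insert by simp
qed (auto intro!: nonzero_mero_const)

lemma zorder_divisor_product:
  assumes "finite A"
  shows "zorder (\<lambda>z. \<Prod>a\<in>A. (z - a) powi m a) z = (if z \<in> A then m z else 0)"
proof -
  have "nonzero_mero (\<lambda>z. \<Prod>a\<in>A. (z - a) powi m a)"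
    by (intro nonzero_mero_prod nonzero_mero_powi nonzero_mero_linear)
  hence "zorder (\<lambda>z. \<Prod>a\<in>A. (z - a) powi m a) z = (\<Sum>a\<in>A. zorder (\<lambda>z. (z - a) powi m a) z)"
    by (intro zorder_prod nonzero_mero_mero nonzero_mero_powi) (auto dest: nonzero_mero_ev)
  also have "\<dots> = (\<Sum>a\<in>A. if z = a then m a else 0)"
  proof (rule sum.cong[OF refl])
    fix a assume "a \<in> A"
    have "zorder (\<lambda>z. (z - a) powi m a) z = m a * zorder (\<lambda>z. z - a) z"
      by (intro zorder_power_int nonzero_mero_freq nonzero_mero_mero nonzero_mero_linear)
    thus "zorder (\<lambda>z. (z - a) powi m a) z = (if z = a then m a else 0)"
      by (simp add: zorder_linear)
  qed
  also have "\<dots> = (if z \<in> A then m z else 0)" using assms by simp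
  finally show ?thesis .
qed

text \<open>Only finitely many singular points have modulus at most R + 1, so those beyond R keep a
  positive distance from the closed disc. The open disc of radius \<open>R'\<close> gives room for a
  holomorphic logarithm up to |z| = R.\<close>

lemma ex_clear_radius:
  assumes "nonzero_mero f"
  obtains R' where "R' > R" "\<And>z. norm z < R' \<Longrightarrow> z \<in> sing f \<Longrightarrow> norm z \<le> R"
proof -
  define S where "S = norm ` {z. norm z \<le> R + 1 \<and> z \<in> sing f} \<inter> {R<..}"
  have fin: "finite S" unfolding S_def using finite_sing[OF assms] by auto
  define R' where "R' = Min (insert (R + 1) S)"
  have "R' > R" unfolding R'_def using fin by (subst Min_gr_iff) (auto simp: S_def)
  moreover have "norm z \<le> R" if z: "norm z < R'" "z \<in> sing f" for z
  proof (rule ccontr)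
    assume "\<not> norm z \<le> R"
    moreover have "R' \<le> R + 1" unfolding R'_def using fin by (intro Min_le) auto
    ultimately have "norm z \<in> S" unfolding S_def using z by auto
    hence "R' \<le> norm z" unfolding R'_def using fin by (intro Min_le) auto
    thus False using z by simp
  qed
  ultimately show ?thesis using that by blast
qed

text \<open>Dividing by the divisor in the closed disc leaves a function of order 0 throughout the
  slightly larger disc. With its removable singularities removed it is holomorphic and zero-free on
  a simply connected set, hence an exponential.\<close>

lemma factorization:
  assumes f: "nonzero_mero f" and A: "A = {a. norm a \<le> R \<and> zorder f a \<noteq> 0}" and "R > 0"
  obtains R' h where "R' > R" "h holomorphic_on ball 0 R'"
    "\<And>z. norm z < R' \<Longrightarrow> z \<in> sing f \<Longrightarrow> norm z \<le> R"
    "\<And>z. norm z < R' \<Longrightarrow> z \<notin> sing f \<Longrightarrow> f z = (\<Prod>a\<in>A. (z - a) powi zorder f a) * exp (h z)"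
proof -
  obtain R' where R': "R' > R" "\<And>z. norm z < R' \<Longrightarrow> z \<in> sing f \<Longrightarrow> norm z \<le> R"
    using ex_clear_radius[OF f] by blast
  have fin: "finite A" unfolding A using finite_zorder[OF f] .
  define G where "G = (\<lambda>z. f z * (\<Prod>a\<in>A. (z - a) powi (- zorder f a)))"
  have P: "nonzero_mero (\<lambda>z. \<Prod>a\<in>A. (z - a) powi (- zorder f a))"
    by (intro nonzero_mero_prod nonzero_mero_powi nonzero_mero_linear)
  have G: "nonzero_mero G" unfolding G_def by (intro nonzero_mero_mult f P)
  have zG: "zorder G z = 0" if "norm z < R'" for z
  proof -
    have "zorder G z = zorder f z + (if z \<in> A then - zorder f z else 0)"
      unfolding G_def by (subst zorder_mult'[OF f P]) (simp only: zorder_divisor_product[OF fin])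
    thus ?thesis using R'(2)[OF that zorder_nz_imp_sing[of f]] by (auto simp: A)
  qed
  have hol: "remove_sings G holomorphic_on ball 0 R'"
    by (intro analytic_imp_holomorphic) (use remove_sings_zorder_0(1)[OF G zG] in
        \<open>subst analytic_on_analytic_at, auto\<close>)
  obtain h where h: "h holomorphic_on ball 0 R'"
      "\<And>z. z \<in> ball 0 R' \<Longrightarrow> exp (h z) = remove_sings G z"
    using holomorphic_logarithm_exists[of "ball 0 R'" "remove_sings G" 0] hol
      remove_sings_zorder_0(2)[OF G zG] R' \<open>R > 0\<close> by auto
  show ?thesis
  proof (rule that[OF R'(1) h(1) R'(2)])
    fix z assume z: "norm z < R'" "z \<notin> sing f"
    have zA: "z \<noteq> a" if "a \<in> A" for a using that z zorder_nz_imp_sing unfolding A by blast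
    have "G analytic_on {z}"
      unfolding G_def using z zA
      by (intro analytic_on_mult analytic_on_prod analytic_on_power_int analytic_intros) (auto simp: sing_def)
    hence "exp (h z) = f z * (\<Prod>a\<in>A. (z - a) powi (- zorder f a))"
      using h(2)[of z] z by (simp add: G_def)
    moreover have "(\<Prod>a\<in>A. (z - a) powi zorder f a) * (\<Prod>a\<in>A. (z - a) powi (- zorder f a)) = 1"
      unfolding prod.distrib[symmetric] using zA by (intro prod.neutral) (auto simp: power_int_minus)
    ultimately show "f z = (\<Prod>a\<in>A. (z - a) powi zorder f a) * exp (h z)"
      by (simp only: mult.left_commute[of _ "f z"] mult_1_right)
  qed
qed

text \<open>Each factor z - a contributes ln (max r |a|), and the harmonic remainder Re h
  contributes its value at 0. The constant depends on the bound R but not on r.\<close>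

lemma circ_mean_ln_norm:
  assumes f: "nonzero_mero f" and "R > 0"
  shows "\<exists>K. \<forall>r\<le>R. good_radius f r \<longrightarrow>
    circ_mean r (\<lambda>z. ln (norm (f z))) =
      (\<Sum>a | norm a \<le> R \<and> zorder f a \<noteq> 0. of_int (zorder f a) * ln (max r (norm a))) + K"
proof -
  define A where "A = {a. norm a \<le> R \<and> zorder f a \<noteq> 0}"
  have fin: "finite A" unfolding A_def using finite_zorder[OF f] .
  obtain R' h where h: "R' > R" "h holomorphic_on ball 0 R'"
    "\<And>z. norm z < R' \<Longrightarrow> z \<notin> sing f \<Longrightarrow> f z = (\<Prod>a\<in>A. (z - a) powi zorder f a) * exp (h z)"
    using factorization[OF f A_def \<open>R > 0\<close>] by metis
  have "circ_mean r (\<lambda>z. ln (norm (f z))) =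
      (\<Sum>a\<in>A. of_int (zorder f a) * ln (max r (norm a))) + Re (h 0)" if r: "r \<le> R" "good_radius f r" for r
  proof -
    have r0: "r > 0" and ns: "\<And>z. norm z = r \<Longrightarrow> z \<notin> sing f" using r by (auto simp: good_radius_def)
    have na: "norm a \<noteq> r" if "a \<in> A" for a
      using that ns zorder_nz_imp_sing unfolding A_def by blast
    have ch: "continuous_on (cball 0 r) h"
      by (rule holomorphic_on_imp_continuous_on[THEN continuous_on_subset, OF h(2)]) (use r h(1) in auto)
    have "circ_mean r (\<lambda>z. ln (norm (f z))) =
          circ_mean r (\<lambda>z. (\<Sum>a\<in>A. of_int (zorder f a) * ln (norm (z - a))) + Re (h z))"
    proof (rule circ_mean_cong)
      fix z :: complex assume z: "norm z = r"
      have nz: "norm (z - a) > 0" if "a \<in> A" for a using na[OF that] z by auto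
      have "norm (f z) = (\<Prod>a\<in>A. norm (z - a) powi zorder f a) * exp (Re (h z))"
        using h(3)[of z] ns[OF z] z r h(1) by (simp add: norm_mult norm_power_int flip: prod_norm)
      also have "ln \<dots> = ln (\<Prod>a\<in>A. norm (z - a) powi zorder f a) + Re (h z)"
        using nz by (subst ln_mult_pos) (auto intro!: prod_pos)
      also have "ln (\<Prod>a\<in>A. norm (z - a) powi zorder f a) = (\<Sum>a\<in>A. ln (norm (z - a) powi zorder f a))"
        using nz fin by (intro ln_prod) auto
      also have "\<dots> = (\<Sum>a\<in>A. of_int (zorder f a) * ln (norm (z - a)))"
        using nz by (intro sum.cong refl) (simp add: ln_powr flip: powr_real_of_int')
      finally show "ln (norm (f z)) = (\<Sum>a\<in>A. of_int (zorder f a) * ln (norm (z - a))) + Re (h z)" .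
    qed (use r0 in auto)
    also have "\<dots> = circ_mean r (\<lambda>z. \<Sum>a\<in>A. of_int (zorder f a) * ln (norm (z - a))) + circ_mean r (\<lambda>z. Re (h z))"
      using na r0 by (intro circ_mean_add continuous_intros continuous_on_subset[OF ch]) auto
    also have "circ_mean r (\<lambda>z. Re (h z)) = Re (circ_mean r h)"
      using r0 by (subst circ_mean_Re) (auto intro!: continuous_on_subset[OF ch])
    also have "circ_mean r h = h 0"
      using r0 r h(1) by (intro circ_mean_value ch holomorphic_on_subset[OF h(2)]) auto
    also have "circ_mean r (\<lambda>z. \<Sum>a\<in>A. of_int (zorder f a) * ln (norm (z - a))) =
        (\<Sum>a\<in>A. circ_mean r (\<lambda>z. of_int (zorder f a) * ln (norm (z - a))))"
      using na r0 fin by (intro circ_mean_sum continuous_intros) auto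
    also have "\<dots> = (\<Sum>a\<in>A. of_int (zorder f a) * ln (max r (norm a)))"
      using na r0 by (intro sum.cong refl) (simp add: circ_mean_ln_dist)
    finally show ?thesis .
  qed
  thus ?thesis unfolding A_def by blast
qed

section \<open>Counting functions and Jensen's formula\<close>

definition count_weight :: "real \<Rightarrow> complex \<Rightarrow> real" where
  "count_weight r a = (if a = 0 then ln r else ln (r / norm a))"

text \<open>The integrated counting function as a finite sum over points: integrating 1/t from |a|
  to r gives ln (r / |a|), and the origin contributes ln r. Additivity and comparison of counting
  functions become termwise statements about multiplicities.\<close>

definition countN :: "(complex \<Rightarrow> real) \<Rightarrow> real \<Rightarrow> real" where
  "countN \<mu> r = (\<Sum>a | norm a \<le> r \<and> \<mu> a \<noteq> 0. \<mu> a * count_weight r a)"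

definition loc_fin :: "(complex \<Rightarrow> real) \<Rightarrow> bool" where
  "loc_fin \<mu> \<longleftrightarrow> (\<forall>R. finite {a. norm a \<le> R \<and> \<mu> a \<noteq> 0})"

lemma loc_fin_add:
  assumes "loc_fin \<mu>" "loc_fin \<nu>" shows "loc_fin (\<lambda>a. \<mu> a + \<nu> a)"
  unfolding loc_fin_def
proof
  fix R
  have "finite ({a. norm a \<le> R \<and> \<mu> a \<noteq> 0} \<union> {a. norm a \<le> R \<and> \<nu> a \<noteq> 0})"
    using assms by (simp add: loc_fin_def)
  thus "finite {a. norm a \<le> R \<and> \<mu> a + \<nu> a \<noteq> 0}"
    by (rule rev_finite_subset) auto
qed

lemma loc_fin_subset:
  assumes "loc_fin \<nu>" "\<And>a. \<nu> a = 0 \<Longrightarrow> \<mu> a = 0" shows "loc_fin \<mu>"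
  unfolding loc_fin_def
proof
  fix R
  have "finite {a. norm a \<le> R \<and> \<nu> a \<noteq> 0}" using assms(1) by (simp add: loc_fin_def)
  thus "finite {a. norm a \<le> R \<and> \<mu> a \<noteq> 0}"
    by (rule rev_finite_subset) (use assms(2) in blast)
qed

lemma loc_fin_cmult: "loc_fin \<mu> \<Longrightarrow> loc_fin (\<lambda>a. c * \<mu> a)"
  by (erule loc_fin_subset) auto

lemma countN_superset:
  assumes "finite S" "S \<subseteq> cball 0 r" "\<And>a. norm a \<le> r \<Longrightarrow> \<mu> a \<noteq> 0 \<Longrightarrow> a \<in> S"
  shows "countN \<mu> r = (\<Sum>a\<in>S. \<mu> a * count_weight r a)"
  unfolding countN_def using assms by (intro sum.mono_neutral_left) auto

lemma count_weight_nonneg: "r \<ge> 1 \<Longrightarrow> norm a \<le> r \<Longrightarrow> count_weight r a \<ge> 0"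
  unfolding count_weight_def by (auto intro!: ln_ge_zero simp: divide_simps)

lemma countN_mono:
  assumes "loc_fin \<nu>" "\<And>a. 0 \<le> \<mu> a" "\<And>a. \<mu> a \<le> \<nu> a" "r \<ge> 1"
  shows "countN \<mu> r \<le> countN \<nu> r"
proof -
  have "countN \<mu> r = (\<Sum>a | norm a \<le> r \<and> \<nu> a \<noteq> 0. \<mu> a * count_weight r a)"
  proof (intro countN_superset)
    show "a \<in> {a. norm a \<le> r \<and> \<nu> a \<noteq> 0}" if "norm a \<le> r" "\<mu> a \<noteq> 0" for a
      using that assms(2,3)[of a] by auto
  qed (use assms(1) in \<open>auto simp: loc_fin_def\<close>)
  also have "\<dots> \<le> countN \<nu> r" unfolding countN_def using assms
    by (intro sum_mono mult_right_mono count_weight_nonneg) auto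
  finally show ?thesis .
qed

lemma countN_nonneg: "(\<And>a. 0 \<le> \<mu> a) \<Longrightarrow> r \<ge> 1 \<Longrightarrow> 0 \<le> countN \<mu> r"
  unfolding countN_def by (intro sum_nonneg mult_nonneg_nonneg count_weight_nonneg) auto

lemma countN_zero [simp]: "countN (\<lambda>_. 0) r = 0"
  unfolding countN_def by simp

lemma countN_add:
  assumes "loc_fin \<nu>" "loc_fin \<mu>"
  shows "countN (\<lambda>a. \<mu> a + \<nu> a) r = countN \<mu> r + countN \<nu> r"
proof -
  define S where "S = {a. norm a \<le> r \<and> \<mu> a \<noteq> 0} \<union> {a. norm a \<le> r \<and> \<nu> a \<noteq> 0}"
  have S: "finite S" "S \<subseteq> cball 0 r" using assms by (auto simp: S_def loc_fin_def)
  show ?thesis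
    by (subst (1 2 3) countN_superset[OF S]) (auto simp: S_def sum.distrib[symmetric] ring_distribs)
qed

lemma countN_cmult:
  assumes "loc_fin \<mu>"
  shows "countN (\<lambda>a. c * \<mu> a) r = c * countN \<mu> r"
proof -
  define S where "S = {a. norm a \<le> r \<and> \<mu> a \<noteq> 0}"
  have S: "finite S" "S \<subseteq> cball 0 r" using assms by (auto simp: S_def loc_fin_def)
  show ?thesis
    by (subst (1 2) countN_superset[OF S]) (auto simp: S_def sum_distrib_left mult_ac)
qed

lemma count_weight_mono: "0 < r \<Longrightarrow> r \<le> R \<Longrightarrow> count_weight r a \<le> count_weight R a"
  unfolding count_weight_def by (auto simp: divide_right_mono)

lemma countN_mono_radius:
  assumes "loc_fin \<mu>" "\<And>a. 0 \<le> \<mu> a" "1 \<le> r" "r \<le> R"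
  shows "countN \<mu> r \<le> countN \<mu> R"
proof -
  have "countN \<mu> r \<le> (\<Sum>a | norm a \<le> r \<and> \<mu> a \<noteq> 0. \<mu> a * count_weight R a)"
    unfolding countN_def using assms by (intro sum_mono mult_left_mono count_weight_mono) auto
  also have "\<dots> \<le> countN \<mu> R"
    unfolding countN_def using assms
    by (intro sum_mono2 mult_nonneg_nonneg count_weight_nonneg) (auto simp: loc_fin_def)
  finally show ?thesis .
qed

text \<open>Every point of the disc of radius \<rho> has weight at least ln (R / \<rho>) at radius
  R; for the origin, whose weight is ln R, this uses 1 \<le> \<rho>. It converts an integrated count
  into a plain number of points.\<close>

lemma sum_le_countN:
  assumes "loc_fin \<mu>" "\<And>a. 0 \<le> \<mu> a" "1 \<le> \<rho>" "\<rho> < R"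
  shows "(\<Sum>a | norm a \<le> \<rho> \<and> \<mu> a \<noteq> 0. \<mu> a) * ln (R / \<rho>) \<le> countN \<mu> R"
proof -
  have "(\<Sum>a | norm a \<le> \<rho> \<and> \<mu> a \<noteq> 0. \<mu> a) * ln (R / \<rho>)
        = (\<Sum>a | norm a \<le> \<rho> \<and> \<mu> a \<noteq> 0. \<mu> a * ln (R / \<rho>))"
    by (rule sum_distrib_right)
  also have "\<dots> \<le> (\<Sum>a | norm a \<le> \<rho> \<and> \<mu> a \<noteq> 0. \<mu> a * count_weight R a)"
  proof (intro sum_mono mult_left_mono)
    fix a assume "a \<in> {a. norm a \<le> \<rho> \<and> \<mu> a \<noteq> 0}"
    thus "ln (R / \<rho>) \<le> count_weight R a"
      using assms(3,4) unfolding count_weight_def by (auto intro!: divide_left_mono simp: divide_simps)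
  qed (use assms in auto)
  also have "\<dots> \<le> countN \<mu> R"
    unfolding countN_def using assms
    by (intro sum_mono2 mult_nonneg_nonneg count_weight_nonneg) (auto simp: loc_fin_def)
  finally show ?thesis .
qed

lemma integrated_count_eq_countN:
  assumes fin: "loc_fin \<mu>" and r: "r > 0"
    and \<nu>: "\<And>t. \<nu> t = (\<Sum>a | norm a \<le> t \<and> \<mu> a \<noteq> 0. \<mu> a)"
  shows "integrated_count \<nu> r = countN \<mu> r"
proof -
  define S where "S = {a. norm a \<le> r \<and> \<mu> a \<noteq> 0}"
  have fS: "finite S" using fin by (simp add: S_def loc_fin_def)
  have \<nu>0: "\<nu> 0 = \<mu> 0"
  proof -
    have "\<nu> 0 = (\<Sum>a\<in>{0}. \<mu> a)" unfolding \<nu> by (rule sum.mono_neutral_left) auto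
    thus ?thesis by simp
  qed
  have diff: "\<nu> t - \<nu> 0 = (\<Sum>a\<in>S - {0}. if norm a \<le> t then \<mu> a else 0)" if "0 \<le> t" "t \<le> r" for t
  proof -
    have "\<nu> t = (\<Sum>a\<in>insert 0 S. if norm a \<le> t then \<mu> a else 0)"
      unfolding \<nu> using fS that by (intro sum.mono_neutral_cong_left) (auto simp: S_def)
    also have "\<dots> = (\<Sum>a\<in>insert 0 (S - {0}). if norm a \<le> t then \<mu> a else 0)" by simp
    also have "\<dots> = \<mu> 0 + (\<Sum>a\<in>S - {0}. if norm a \<le> t then \<mu> a else 0)"
      using fS that by (subst sum.insert) auto
    finally show ?thesis using \<nu>0 by simp
  qed
  have "((\<lambda>t. \<Sum>a\<in>S - {0}. if norm a \<le> t then \<mu> a / t else 0) has_integral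
         (\<Sum>a\<in>S - {0}. \<mu> a * ln (r / norm a))) {0..r}"
  proof (intro has_integral_sum)
    fix a assume a: "a \<in> S - {0}"
    hence na: "0 < norm a" "norm a \<le> r" by (auto simp: S_def)
    have "((\<lambda>t. \<mu> a / t) has_integral (\<mu> a * ln r - \<mu> a * ln (norm a))) {norm a..r}"
    proof (rule fundamental_theorem_of_calculus[OF na(2)])
      fix x assume "x \<in> {norm a..r}"
      hence "x > 0" using na by (auto simp del: zero_less_norm_iff)
      thus "((\<lambda>x. \<mu> a * ln x) has_vector_derivative \<mu> a / x) (at x within {norm a..r})"
        by (auto intro!: derivative_eq_intros simp flip: has_real_derivative_iff_has_vector_derivative)
    qed
    also have "\<mu> a * ln r - \<mu> a * ln (norm a) = \<mu> a * ln (r / norm a)"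
      using na r by (simp add: ln_div algebra_simps)
    finally have "((\<lambda>t. if t \<in> {norm a..r} then \<mu> a / t else 0) has_integral (\<mu> a * ln (r / norm a))) {0..r}"
      using na by (subst has_integral_restrict) auto
    thus "((\<lambda>t. if norm a \<le> t then \<mu> a / t else 0) has_integral \<mu> a * ln (r / norm a)) {0..r}"
      by (rule has_integral_eq[rotated]) auto
  qed (use fS in auto)
  hence "((\<lambda>t. (\<nu> t - \<nu> 0) / t) has_integral (\<Sum>a\<in>S - {0}. \<mu> a * ln (r / norm a))) {0..r}"
    by (rule has_integral_eq[rotated]) (simp add: diff sum_divide_distrib if_distrib[of "\<lambda>x. x / _"] cong: if_cong)
  hence "integrated_count \<nu> r = (\<Sum>a\<in>S - {0}. \<mu> a * ln (r / norm a)) + \<mu> 0 * ln r"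
    unfolding integrated_count_def by (simp add: integral_unique \<nu>0)
  also have "\<dots> = (\<Sum>a\<in>insert 0 (S - {0}). \<mu> a * count_weight r a)"
    using fS by (subst sum.insert) (auto simp: count_weight_def)
  also have "\<dots> = countN \<mu> r"
    using fS r by (intro countN_superset[symmetric]) (auto simp: S_def)
  finally show ?thesis .
qed

definition zero_div :: "(complex \<Rightarrow> complex) \<Rightarrow> complex \<Rightarrow> real" where
  "zero_div f a = of_int (max 0 (zorder f a))"

definition pole_div :: "(complex \<Rightarrow> complex) \<Rightarrow> complex \<Rightarrow> real" where
  "pole_div f a = of_int (max 0 (- zorder f a))"

lemma zero_div_nonneg [simp]: "0 \<le> zero_div f a" and pole_div_nonneg [simp]: "0 \<le> pole_div f a"
  by (auto simp: zero_div_def pole_div_def)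

lemma loc_fin_zorder: "nonzero_mero f \<Longrightarrow> loc_fin (\<lambda>a. of_int (zorder f a))"
  unfolding loc_fin_def using finite_zorder[of f] by simp

lemma loc_fin_zero_div [simp]: "nonzero_mero f \<Longrightarrow> loc_fin (zero_div f)"
  by (rule loc_fin_subset[OF loc_fin_zorder[of f]]) (auto simp: zero_div_def)

lemma loc_fin_pole_div [simp]: "nonzero_mero f \<Longrightarrow> loc_fin (pole_div f)"
  by (rule loc_fin_subset[OF loc_fin_zorder[of f]]) (auto simp: pole_div_def)

lemma counting_N_eq:
  assumes "nonzero_mero f" "r > 0"
  shows "counting_N r f = countN (pole_div f) r"
  unfolding counting_N_def
proof (rule integrated_count_eq_countN)
  fix t
  have "{z. norm z \<le> t \<and> is_pole f z} = {a. norm a \<le> t \<and> pole_div f a \<noteq> 0}"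
    by (auto simp: nonzero_mero_is_pole_iff[OF assms(1)] pole_div_def)
  thus "pole_count f t = (\<Sum>a | norm a \<le> t \<and> pole_div f a \<noteq> 0. pole_div f a)"
    unfolding pole_count_def by (auto intro!: sum.cong simp: pole_div_def)
qed (use assms in auto)

lemma pole_div_inverse: "nonzero_mero f \<Longrightarrow> pole_div (\<lambda>z. 1 / f z) = zero_div f"
  by (auto simp: fun_eq_iff pole_div_def zero_div_def zorder_inverse')

lemma nonzero_mero_inverse [intro]: "nonzero_mero f \<Longrightarrow> nonzero_mero (\<lambda>z. 1 / f z)"
  by (intro nonzero_mero_divide nonzero_mero_const) auto

lemma counting_N_inverse_eq:
  assumes "nonzero_mero f" "r > 0"
  shows "counting_N r (\<lambda>z. 1 / f z) = countN (zero_div f) r"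
  using counting_N_eq[OF nonzero_mero_inverse[OF assms(1)] assms(2)] pole_div_inverse[OF assms(1)] by simp

lemma counting_N_simple_zeros_eq:
  assumes "nonzero_mero f" "r > 0"
  shows "counting_N_simple_zeros r f = countN (\<lambda>a. of_bool (zorder f a = 1)) r"
  unfolding counting_N_simple_zeros_def
proof (rule integrated_count_eq_countN)
  show "loc_fin (\<lambda>a. of_bool (zorder f a = 1))"
    by (rule loc_fin_subset[OF loc_fin_zorder[OF assms(1)]]) auto
  fix t
  have "{z. norm z \<le> t \<and> isolated_zero f z \<and> zorder f z = 1} =
        {a. norm a \<le> t \<and> of_bool (zorder f a = 1) \<noteq> (0::real)}"
    by (auto simp: nonzero_mero_isolated_zero_iff[OF assms(1)])
  thus "simple_zero_count f t = (\<Sum>a | norm a \<le> t \<and> of_bool (zorder f a = 1) \<noteq> (0::real). of_bool (zorder f a = 1))"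
    unfolding simple_zero_count_def by simp
qed (use assms in auto)

lemma good_radius_pos: "good_radius f r \<Longrightarrow> r > 0"
  by (simp add: good_radius_def)

lemma countable_sing:
  assumes "nonzero_mero f" shows "countable (sing f)"
proof -
  have "sing f = (\<Union>n. {z. norm z \<le> real n \<and> z \<in> sing f})"
    using real_arch_simple by auto
  also have "countable \<dots>" using finite_sing[OF assms] by (intro countable_UN) (auto intro: countable_finite)
  finally show ?thesis .
qed

lemma ex_good_radius:
  assumes "nonzero_mero f" "0 \<le> x" "x < y"
  obtains r where "x < r" "r < y" "good_radius f r"
proof -
  have "countable (norm ` sing f)" using countable_sing[OF assms(1)] by auto
  hence "\<not> {x<..<y} \<subseteq> norm ` sing f"
    using assms(3) countable_subset uncountable_open_interval by blast
  then obtain r where "r \<in> {x<..<y}" "r \<notin> norm ` sing f" by blast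
  thus ?thesis using assms that by (auto simp: good_radius_def)
qed

text \<open>For |a| \<le> r the difference between ln (max r |a|) and the counting weight is ln |a|,
  or 0 at the origin; for |a| > r it is ln |a| as well. So the r-dependence cancels on every bounded
  range of radii, and since any two good radii lie in a common range the constant is global.\<close>

theorem Jensen:
  assumes f: "nonzero_mero f"
  shows "\<exists>K. \<forall>r. good_radius f r \<longrightarrow>
    circ_mean r (\<lambda>z. ln (norm (f z))) = countN (zero_div f) r - countN (pole_div f) r + K"
proof -
  define J where "J = (\<lambda>r. circ_mean r (\<lambda>z. ln (norm (f z))) - (countN (zero_div f) r - countN (pole_div f) r))"
  have cz: "countN (zero_div f) r - countN (pole_div f) r = countN (\<lambda>a. of_int (zorder f a)) r" for r
  proof -
    have "zero_div f = (\<lambda>a. of_int (zorder f a) + pole_div f a)"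
      by (auto simp: fun_eq_iff zero_div_def pole_div_def max_def)
    thus ?thesis using countN_add[OF loc_fin_pole_div[OF f] loc_fin_zorder[OF f], of r] by simp
  qed
  have "\<exists>K. \<forall>r\<le>R. good_radius f r \<longrightarrow> J r = K" if "R > 0" for R
  proof -
    define A where "A = {a. norm a \<le> R \<and> zorder f a \<noteq> 0}"
    have fin: "finite A" unfolding A_def using finite_zorder[OF f] .
    obtain K where K: "\<And>r. r \<le> R \<Longrightarrow> good_radius f r \<Longrightarrow> circ_mean r (\<lambda>z. ln (norm (f z))) =
      (\<Sum>a\<in>A. of_int (zorder f a) * ln (max r (norm a))) + K"
      using circ_mean_ln_norm[OF f \<open>R > 0\<close>] unfolding A_def by blast
    have "J r = (\<Sum>a\<in>A. of_int (zorder f a) * (if a = 0 then 0 else ln (norm a))) + K"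
      if r: "r \<le> R" "good_radius f r" for r
    proof -
      have r0: "r > 0" using r by (simp add: good_radius_def)
      have "countN (\<lambda>a. of_int (zorder f a)) r =
            (\<Sum>a\<in>A. if norm a \<le> r then of_int (zorder f a) * count_weight r a else 0)"
        unfolding countN_def using r fin by (intro sum.mono_neutral_cong_left) (auto simp: A_def)
      also have "(\<Sum>a\<in>A. of_int (zorder f a) * ln (max r (norm a))) - \<dots> =
            (\<Sum>a\<in>A. of_int (zorder f a) * (if a = 0 then 0 else ln (norm a)))"
        unfolding sum_subtractf[symmetric]
        by (intro sum.cong refl) (use r0 in \<open>auto simp: count_weight_def ln_div algebra_simps max_def\<close>)
      finally show ?thesis unfolding J_def cz using K[OF r] by simp
    qed
    thus ?thesis by blast
  qed note * = this
  obtain r1 where r1: "good_radius f r1" using ex_good_radius[OF f, of 0 1] by auto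
  have "J r = J r1" if "good_radius f r" for r
    using *[of "max r r1"] that r1 good_radius_pos[OF r1] by (metis max.cobounded1 max.cobounded2 max.strict_coboundedI2)
  thus ?thesis unfolding J_def by (intro exI[of _ "J r1"]) (auto simp: J_def algebra_simps)
qed

subsection \<open>Proximity function and characteristic\<close>

lemma log_plus_nonneg [simp]: "log_plus x \<ge> 0"
  unfolding log_plus_def by auto

lemma log_plus_mono: "x \<le> y \<Longrightarrow> log_plus x \<le> log_plus y"
  unfolding log_plus_def by auto

lemma ln_le_log_plus: "x > 0 \<Longrightarrow> ln x \<le> log_plus x"
  unfolding log_plus_def by auto

lemma log_plus_mult: "x \<ge> 0 \<Longrightarrow> y \<ge> 0 \<Longrightarrow> log_plus (x * y) \<le> log_plus x + log_plus y"
proof -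
  assume a: "x \<ge> 0" "y \<ge> 0"
  have "x * y \<le> max 1 x * max 1 y" using a by (intro mult_mono) auto
  moreover have "1 * 1 \<le> max 1 x * max 1 y" by (intro mult_mono) auto
  ultimately have "log_plus (x * y) \<le> ln (max 1 x * max 1 y)" unfolding log_plus_def by auto
  thus ?thesis unfolding log_plus_def by (subst (asm) ln_mult_pos) auto
qed

lemma log_plus_power: "x \<ge> 0 \<Longrightarrow> log_plus (x ^ k) = of_nat k * log_plus x"
proof -
  assume a: "x \<ge> 0"
  have "max 1 (x ^ k) = max 1 x ^ k"
    using a by (cases "x \<ge> 1") (auto simp: max_def power_le_one not_le intro: order_antisym one_le_power)
  thus ?thesis unfolding log_plus_def by (simp add: ln_realpow)
qed

lemma log_plus_le_ln: "x \<le> y \<Longrightarrow> 1 \<le> y \<Longrightarrow> log_plus x \<le> ln y"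
  unfolding log_plus_def by auto

lemma continuous_log_plus: "continuous_on A log_plus"
  unfolding log_plus_def by (auto intro!: continuous_intros)

lemma proximity_eq_mean: "proximity_m r f = circ_mean r (\<lambda>z. log_plus (norm (f z)))"
  unfolding proximity_m_def circ_mean_def by simp

lemma proximity_nonneg: "proximity_m r f \<ge> 0"
  unfolding proximity_m_def
  by (cases "(\<lambda>\<theta>. log_plus (norm (f (of_real r * cis \<theta>)))) integrable_on {0..2*pi}")
     (auto intro!: integral_nonneg divide_nonneg_pos simp: not_integrable_integral)

text \<open>No regularity of f on the circle is assumed: a non-integrable integrand has integral 0
  by convention, and the majorant u is nonnegative because \<open>log_plus\<close> is.\<close>

lemma proximity_le_mean:
  assumes "continuous_on (sphere 0 r) u" "r \<ge> 0" "\<And>z. norm z = r \<Longrightarrow> log_plus (norm (f z)) \<le> u z"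
  shows "proximity_m r f \<le> circ_mean r u"
proof (cases "(\<lambda>\<theta>. log_plus (norm (f (of_real r * cis \<theta>)))) integrable_on {0..2*pi}")
  case True
  have "integral {0..2*pi} (\<lambda>\<theta>. log_plus (norm (f (of_real r * cis \<theta>))))
        \<le> integral {0..2*pi} (\<lambda>\<theta>. u (of_real r * cis \<theta>))"
    using assms by (intro integral_le True integrable_on_circle) (auto simp: norm_mult)
  thus ?thesis unfolding proximity_m_def circ_mean_def real_scaleR_def
    by (intro mult_left_mono) auto
next
  case False
  have u: "u z \<ge> 0" if "norm z = r" for z using assms(3)[OF that] log_plus_nonneg order_trans by blast
  have "integral {0..2*pi} (\<lambda>\<theta>. u (of_real r * cis \<theta>)) \<ge> 0"
    using assms(2) by (intro integral_nonneg integrable_on_circle assms(1,2)) (auto simp: norm_mult u)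
  thus ?thesis unfolding proximity_m_def circ_mean_def using False
    by (simp add: not_integrable_integral)
qed

lemma proximity_le_const:
  "r \<ge> 0 \<Longrightarrow> (\<And>z. norm z = r \<Longrightarrow> log_plus (norm (f z)) \<le> B) \<Longrightarrow> proximity_m r f \<le> B"
  using proximity_le_mean[of r "\<lambda>_. B" f] by simp

lemma good_radius_continuous:
  assumes "good_radius f r" shows "continuous_on (sphere 0 r) f"
  using assms unfolding good_radius_def sing_def
  by (intro continuous_at_imp_continuous_on) (auto intro: analytic_at_imp_isCont)

lemma good_radius_continuous_log_plus:
  assumes "good_radius f r" shows "continuous_on (sphere 0 r) (\<lambda>z. log_plus (norm (f z)))"
  by (intro continuous_on_compose2[OF continuous_log_plus[of UNIV]] continuous_intros
      good_radius_continuous assms) auto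

lemma good_radius_inverse: "good_radius f r \<Longrightarrow> good_radius (\<lambda>z. 1 / f z) r"
  unfolding good_radius_def sing_def by (auto intro!: analytic_intros)

lemma mean_ln_eq_proximity:
  assumes "good_radius f r"
  shows "circ_mean r (\<lambda>z. ln (norm (f z))) = proximity_m r f - proximity_m r (\<lambda>z. 1 / f z)"
    and "circ_mean r (\<lambda>z. \<bar>ln (norm (f z))\<bar>) = proximity_m r f + proximity_m r (\<lambda>z. 1 / f z)"
proof -
  have r: "r \<ge> 0" using good_radius_pos[OF assms] by simp
  have nz: "norm (f z) > 0" if "norm z = r" for z
    using assms that by (auto simp: good_radius_def sing_def)
  note c = good_radius_continuous_log_plus[OF assms]
    good_radius_continuous_log_plus[OF good_radius_inverse[OF assms]]
  have "circ_mean r (\<lambda>z. ln (norm (f z))) =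
     circ_mean r (\<lambda>z. log_plus (norm (f z)) - log_plus (norm (1 / f z)))"
    by (intro circ_mean_cong r) (use nz in \<open>auto simp: log_plus_def max_def norm_divide ln_div divide_simps\<close>)
  thus "circ_mean r (\<lambda>z. ln (norm (f z))) = proximity_m r f - proximity_m r (\<lambda>z. 1 / f z)"
    unfolding proximity_eq_mean using c r by (simp add: circ_mean_diff)
  have "circ_mean r (\<lambda>z. \<bar>ln (norm (f z))\<bar>) =
     circ_mean r (\<lambda>z. log_plus (norm (f z)) + log_plus (norm (1 / f z)))"
    by (intro circ_mean_cong r) (use nz in \<open>auto simp: log_plus_def max_def norm_divide ln_div divide_simps\<close>)
  thus "circ_mean r (\<lambda>z. \<bar>ln (norm (f z))\<bar>) = proximity_m r f + proximity_m r (\<lambda>z. 1 / f z)"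
    unfolding proximity_eq_mean using c r by (simp add: circ_mean_add)
qed

theorem first_main_theorem:
  assumes f: "nonzero_mero f"
  shows "\<exists>K. \<forall>r. good_radius f r \<longrightarrow>
    proximity_m r f + countN (pole_div f) r = proximity_m r (\<lambda>z. 1 / f z) + countN (zero_div f) r + K"
  using Jensen[OF f] mean_ln_eq_proximity(1)[of f] by (auto simp: algebra_simps)

lemma characteristic_eq:
  "nonzero_mero f \<Longrightarrow> r > 0 \<Longrightarrow> characteristic_T r f = proximity_m r f + countN (pole_div f) r"
  unfolding characteristic_T_def by (simp add: counting_N_eq)

lemma characteristic_nonneg: "nonzero_mero f \<Longrightarrow> r \<ge> 1 \<Longrightarrow> characteristic_T r f \<ge> 0"
  by (simp add: characteristic_eq proximity_nonneg countN_nonneg)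

section \<open>The Poisson--Jensen formula\<close>

definition blaschke :: "real \<Rightarrow> complex \<Rightarrow> complex \<Rightarrow> complex" where
  "blaschke R a z = of_real R * (z - a) / (of_real (R^2) - cnj a * z)"

lemma Re_blaschke_denom_pos:
  assumes "norm a < R" "norm z \<le> R"
  shows "Re ((of_real (R^2) - cnj a * z) / of_real R) > 0"
proof -
  have R: "R > 0" using assms(1) norm_ge_zero[of a] by linarith
  have "Re (cnj a * z) \<le> norm a * norm z" by (metis complex_Re_le_cmod norm_mult complex_mod_cnj)
  also have "\<dots> \<le> norm a * R" using assms by (intro mult_left_mono) auto
  also have "\<dots> < R * R" using assms R by (intro mult_strict_right_mono) auto
  finally have "Re (of_real (R^2) - cnj a * z) > 0" by (simp add: power2_eq_square)
  thus ?thesis using R by (simp add: Re_divide_of_real zero_less_divide_iff del: minus_complex.sel)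
qed

lemma norm_blaschke_circle:
  assumes "norm a < R" "norm z = R" shows "norm (blaschke R a z) = 1"
proof -
  have zz: "of_real (R^2) = z * cnj z" using complex_norm_square[of z] assms by simp
  have "of_real (R^2) - cnj a * z = z * cnj (z - a)" unfolding zz by (simp add: algebra_simps)
  hence "norm (blaschke R a z) = R * norm (z - a) / (R * norm (z - a))"
    using assms norm_ge_zero[of z] unfolding blaschke_def
    by (simp add: norm_divide norm_mult complex_mod_cnj del: complex_cnj_diff norm_ge_zero)
  moreover have "z - a \<noteq> 0" "R \<noteq> 0" using assms norm_ge_zero[of a] by auto
  ultimately show ?thesis by simp
qed

lemma norm_blaschke_le_1:
  assumes "norm a < R" "norm z \<le> R" shows "norm (blaschke R a z) \<le> 1"
proof -
  have R: "R > 0" using assms(1) norm_ge_zero[of a] by linarith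
  have "norm (of_real (R^2) - cnj a * z)^2 - norm (of_real R * (z - a))^2
        = (R^2 - norm a ^2) * (R^2 - norm z ^ 2)"
    unfolding cmod_power2 by (simp add: power2_eq_square algebra_simps)
  moreover have "norm a ^ 2 \<le> R^2" "norm z ^ 2 \<le> R^2" using assms by (auto intro: power_mono)
  ultimately have "norm (of_real R * (z - a))^2 \<le> norm (of_real (R^2) - cnj a * z)^2"
    by (smt (verit) mult_nonneg_nonneg)
  hence "norm (of_real R * (z - a)) \<le> norm (of_real (R^2) - cnj a * z)"
    by (rule power2_le_imp_le) auto
  thus ?thesis unfolding blaschke_def norm_divide
    by (intro divide_le_eq_1[THEN iffD2]) (metis norm_ge_zero order_le_less)
qed

lemma blaschke_eq_0_iff:
  assumes "norm a < R" "norm z \<le> R" shows "blaschke R a z = 0 \<longleftrightarrow> z = a"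
  using complex_norm_lt_sq[OF assms] assms norm_ge_zero[of a] unfolding blaschke_def
  by (auto simp del: of_real_power)

lemma powi_mult_exp:
  assumes "exp L = (v::complex)" shows "(x * v) powi m = x powi m * exp (of_int m * L)"
proof -
  have "v powi m = exp (of_int m * L)" unfolding assms[symmetric]
    by (cases m rule: int_cases2) (auto simp: power_int_minus exp_minus simp flip: exp_of_nat_mult)
  thus ?thesis by (simp add: power_int_mult_distrib)
qed

text \<open>Each z - a splits into a Blaschke factor times (R^2 - cnj a * z) / R, which has positive
  real part on the closed disc and so a holomorphic logarithm that is absorbed into g. Since
  Blaschke factors have modulus 1 on |z| = R, there Re g = ln |f|.\<close>

lemma blaschke_factorization:
  assumes f: "nonzero_mero f" and A: "A = {a. norm a \<le> R \<and> zorder f a \<noteq> 0}" and R: "good_radius f R"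
  obtains g where "continuous_on (cball 0 R) g" "g holomorphic_on ball 0 R"
    "\<And>z. norm z \<le> R \<Longrightarrow> z \<notin> sing f \<Longrightarrow> f z = (\<Prod>a\<in>A. blaschke R a z powi zorder f a) * exp (g z)"
proof -
  have R0: "R > 0" using R by (simp add: good_radius_def)
  have fin: "finite A" unfolding A using finite_zorder[OF f] .
  have na: "norm a < R" if "a \<in> A" for a
    using that R zorder_nz_imp_sing[of f a] unfolding A good_radius_def by force
  obtain R' h where h: "R' > R" "h holomorphic_on ball 0 R'"
    "\<And>z. norm z < R' \<Longrightarrow> z \<notin> sing f \<Longrightarrow> f z = (\<Prod>a\<in>A. (z - a) powi zorder f a) * exp (h z)"
    using factorization[OF f A R0] by metis
  define v where "v = (\<lambda>a z. (of_real (R^2) - cnj a * z) / of_real R)"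
  have vpos: "Re (v a z) > 0" if "a \<in> A" "norm z \<le> R" for a z
    unfolding v_def by (rule Re_blaschke_denom_pos[OF na[OF that(1)] that(2)])
  hence v0: "v a z \<noteq> 0" "v a z \<notin> \<real>\<^sub>\<le>\<^sub>0" if "a \<in> A" "norm z \<le> R" for a z
    using that by (metis less_irrefl zero_complex.sel(1), metis complex_nonpos_Reals_iff not_le)
  define g where "g = (\<lambda>z. h z + (\<Sum>a\<in>A. of_int (zorder f a) * Ln (v a z)))"
  have vh: "v a holomorphic_on S" "continuous_on S (v a)" for a S
    unfolding v_def using R0 by (auto intro!: holomorphic_intros continuous_intros)
  show ?thesis
  proof (rule that[of g])
    show "continuous_on (cball 0 R) g"
      unfolding g_def using v0(2) h(1)
      by (intro continuous_intros vh holomorphic_on_imp_continuous_on[OF holomorphic_on_subset[OF h(2)]]) auto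
    show "g holomorphic_on ball 0 R"
      unfolding g_def using v0(2) h(1)
      by (intro holomorphic_intros holomorphic_on_Ln' vh holomorphic_on_subset[OF h(2)]) auto
    fix z assume z: "norm z \<le> R" "z \<notin> sing f"
    have "(z - a) powi zorder f a = blaschke R a z powi zorder f a * exp (of_int (zorder f a) * Ln (v a z))"
      if "a \<in> A" for a
    proof -
      have "z - a = blaschke R a z * v a z"
        using v0(1)[OF that z(1)] R0 unfolding blaschke_def v_def by (simp add: field_simps)
      thus ?thesis using powi_mult_exp[of "Ln (v a z)" "v a z"] v0(1)[OF that z(1)] by simp
    qed
    hence "f z = (\<Prod>a\<in>A. blaschke R a z powi zorder f a * exp (of_int (zorder f a) * Ln (v a z))) * exp (h z)"
      using h(3)[of z] z h(1) by simp
    thus "f z = (\<Prod>a\<in>A. blaschke R a z powi zorder f a) * exp (g z)"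
      unfolding g_def prod.distrib exp_add exp_sum[OF fin] by (simp add: mult_ac)
  qed
qed

section \<open>Harmonic majorants and monotonicity of the characteristic\<close>

lemma poisson_kernel_nonneg: "norm z \<le> R \<Longrightarrow> poisson_kernel R z w \<ge> 0"
  unfolding poisson_kernel_def by (auto intro!: divide_nonneg_nonneg power_mono)

lemma poisson_kernel_eq_Re:
  assumes "norm w = R" shows "poisson_kernel R z w = Re ((w + z) / (w - z))"
  unfolding poisson_kernel_def Re_divide assms[symmetric] cmod_power2
  by (simp add: power2_eq_square algebra_simps add_divide_distrib diff_divide_distrib)

text \<open>The mean is taken in the inner variable z, in which the kernel is the real part of a
  holomorphic function with value 1 at 0.\<close>

lemma mean_poisson_kernel:
  assumes "0 < r" "r < R" "norm w = R"
  shows "circ_mean r (\<lambda>z. poisson_kernel R z w) = 1"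
proof -
  have nz: "w - z \<noteq> 0" if "norm z \<le> r" for z using that assms by auto
  have c: "continuous_on (cball 0 r) (\<lambda>z. (w + z) / (w - z))"
    using nz by (auto intro!: continuous_intros)
  have "circ_mean r (\<lambda>z. poisson_kernel R z w) = circ_mean r (\<lambda>z. Re ((w + z) / (w - z)))"
    unfolding poisson_kernel_eq_Re[OF assms(3)] ..
  also have "\<dots> = Re (circ_mean r (\<lambda>z. (w + z) / (w - z)))"
    by (subst circ_mean_Re) (use assms in \<open>auto intro!: continuous_on_subset[OF c]\<close>)
  also have "circ_mean r (\<lambda>z. (w + z) / (w - z)) = (w + 0) / (w - 0)"
    using nz assms by (intro circ_mean_value c) (auto intro!: holomorphic_intros)
  also have "Re \<dots> = 1" using assms by auto
  finally show ?thesis .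
qed

text \<open>Fubini reduces the first claim to the mean of the kernel in z: the Poisson extension of
  u has the same mean on every inner circle as u has on the outer one.\<close>

lemma mean_mean_poisson:
  fixes u :: "complex \<Rightarrow> real"
  assumes "0 < r" "r < R" "continuous_on (sphere 0 R) u"
  shows "circ_mean r (\<lambda>z. circ_mean R (\<lambda>w. poisson_kernel R z w * u w)) = circ_mean R u"
    and "continuous_on (sphere 0 r) (\<lambda>z. circ_mean R (\<lambda>w. poisson_kernel R z w * u w))"
proof -
  define k where "k = (\<lambda>s t. poisson_kernel R (of_real r * cis s) (of_real R * cis t) * u (of_real R * cis t))"
  have nz: "of_real R * cis t - of_real r * cis s \<noteq> 0" for s t
  proof
    assume "of_real R * cis t - of_real r * cis s = 0"
    hence "norm (of_real R * cis t) = norm (of_real r * cis s)" by simp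
    thus False using assms by (simp add: norm_mult)
  qed
  have cu: "continuous_on A (\<lambda>x. u (of_real R * cis (t x)))" if "continuous_on A t" for A :: "(real \<times> real) set" and t
    by (rule continuous_on_compose2[OF assms(3)]) (use assms that in \<open>auto intro!: continuous_intros simp: norm_mult\<close>)
  have ck: "continuous_on (cbox (0, 0) (2 * pi, 2 * pi)) (\<lambda>(s, t). k s t)"
    unfolding k_def poisson_kernel_def case_prod_beta using nz
    by (intro continuous_intros cu) auto
  have "integral {0..2*pi} (\<lambda>s. integral {0..2*pi} (\<lambda>t. k s t)) =
        integral {0..2*pi} (\<lambda>t. integral {0..2*pi} (\<lambda>s. k s t))"
    using integral_swap_continuous[OF ck] by simp
  hence "circ_mean r (\<lambda>z. circ_mean R (\<lambda>w. poisson_kernel R z w * u w)) =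
        circ_mean R (\<lambda>w. circ_mean r (\<lambda>z. poisson_kernel R z w * u w))"
    unfolding circ_mean_def k_def by (simp only: integral_cmul real_scaleR_def integral_mult_right)
  also have "\<dots> = circ_mean R u"
  proof (rule circ_mean_cong)
    fix w :: complex assume w: "norm w = R"
    have "circ_mean r (\<lambda>z. poisson_kernel R z w * u w) = u w * circ_mean r (\<lambda>z. poisson_kernel R z w)"
      by (subst circ_mean_cmult[symmetric]) (simp only: mult.commute)
    thus "circ_mean r (\<lambda>z. poisson_kernel R z w * u w) = u w"
      by (simp add: mean_poisson_kernel[OF assms(1,2) w])
  qed (use assms in auto)
  finally show "circ_mean r (\<lambda>z. circ_mean R (\<lambda>w. poisson_kernel R z w * u w)) = circ_mean R u" .
  have nz': "of_real R * cis t - z \<noteq> 0" if "norm z = r" for t z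
  proof
    assume "of_real R * cis t - z = 0"
    hence "norm (of_real R * cis t) = norm z" by simp
    thus False using assms that by (simp add: norm_mult)
  qed
  have "continuous_on (sphere 0 r \<times> cbox 0 (2*pi))
     (\<lambda>(z, t). poisson_kernel R z (of_real R * cis t) * u (of_real R * cis t))"
    unfolding poisson_kernel_def case_prod_beta using nz'
    by (intro continuous_intros continuous_on_compose2[OF assms(3), of _ "\<lambda>x. of_real R * cis (snd x)"])
       (use assms in \<open>auto simp: norm_mult\<close>)
  hence "continuous_on (sphere 0 r) (\<lambda>z. integral (cbox 0 (2*pi))
          (\<lambda>t. poisson_kernel R z (of_real R * cis t) * u (of_real R * cis t)))"
    by (rule integral_continuous_on_param)
  thus "continuous_on (sphere 0 r) (\<lambda>z. circ_mean R (\<lambda>w. poisson_kernel R z w * u w))"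
    unfolding circ_mean_def by (auto intro!: continuous_intros)
qed

lemma mean_ln_blaschke:
  assumes "norm b < R" "norm b \<noteq> r" "0 < r" "r < R"
  shows "circ_mean r (\<lambda>z. - ln (norm (blaschke R b z))) = ln R - ln (max r (norm b))"
    and "continuous_on (sphere 0 r) (\<lambda>z. - ln (norm (blaschke R b z)))"
proof -
  have den: "of_real (R^2) - cnj b * z \<noteq> 0" if "norm z \<le> R" for z
    using complex_norm_lt_sq[OF assms(1) that] .
  have nz: "blaschke R b z \<noteq> 0" if "norm z = r" for z
    using blaschke_eq_0_iff[of b R z] assms that by auto
  show "continuous_on (sphere 0 r) (\<lambda>z. - ln (norm (blaschke R b z)))"
    using nz den assms(3,4) unfolding blaschke_def by (intro continuous_intros) auto
  have cd: "continuous_on (cball 0 r) (\<lambda>z. Ln ((of_real (R^2) - cnj b * z) / of_real R))"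
    using Re_blaschke_denom_pos[OF assms(1)] assms
    by (intro continuous_intros) (auto simp: complex_nonpos_Reals_iff simp del: Re_divide_of_real,
        metis less_imp_le not_le order_trans)
  have "circ_mean r (\<lambda>z. - ln (norm (blaschke R b z))) =
        circ_mean r (\<lambda>z. Re (Ln ((of_real (R^2) - cnj b * z) / of_real R)) - ln (norm (z - b)))"
  proof (rule circ_mean_cong)
    fix z :: complex assume z: "norm z = r"
    have zb: "norm (z - b) > 0" using z assms by auto
    have d: "norm ((of_real (R^2) - cnj b * z) / of_real R) > 0" "(of_real (R^2) - cnj b * z) / of_real R \<noteq> 0"
      using den[of z] z assms by auto
    have "norm (blaschke R b z) = norm (z - b) / norm ((of_real (R^2) - cnj b * z) / of_real R)"
      using assms unfolding blaschke_def by (simp add: norm_divide norm_mult)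
    thus "- ln (norm (blaschke R b z)) = Re (Ln ((of_real (R^2) - cnj b * z) / of_real R)) - ln (norm (z - b))"
      unfolding Re_Ln[OF d(2)] using zb d by (simp only: ln_div) simp
  qed (use assms in auto)
  also have "\<dots> = circ_mean r (\<lambda>z. Re (Ln ((of_real (R^2) - cnj b * z) / of_real R))) - circ_mean r (\<lambda>z. ln (norm (z - b)))"
    using assms by (intro circ_mean_diff continuous_intros continuous_on_subset[OF cd]) auto
  also have "circ_mean r (\<lambda>z. Re (Ln ((of_real (R^2) - cnj b * z) / of_real R))) =
        Re (circ_mean r (\<lambda>z. Ln ((of_real (R^2) - cnj b * z) / of_real R)))"
    by (rule circ_mean_Re[symmetric], rule continuous_on_subset[OF cd]) (use assms in auto)
  also have "circ_mean r (\<lambda>z. Ln ((of_real (R^2) - cnj b * z) / of_real R)) = Ln ((of_real (R^2) - cnj b * 0) / of_real R)"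
  proof (rule circ_mean_value[OF cd])
    have "(of_real (R^2) - cnj b * z) / of_real R \<notin> \<real>\<^sub>\<le>\<^sub>0" if "norm z < r" for z
      using Re_blaschke_denom_pos[OF assms(1), of z] that assms(4)
      by (auto simp: complex_nonpos_Reals_iff simp del: Re_divide_of_real)
    thus "(\<lambda>z. Ln ((of_real (R^2) - cnj b * z) / of_real R)) holomorphic_on ball 0 r"
      using assms by (auto intro!: holomorphic_intros)
  qed (use assms in auto)
  also have "(of_real (R^2) - cnj b * 0) / of_real R = (of_real R :: complex)"
    using assms by (simp add: power2_eq_square)
  also have "Re (Ln (of_real R)) = ln R" using assms by (subst Re_Ln) auto
  also have "circ_mean r (\<lambda>z. ln (norm (z - b))) = ln (max r (norm b))"
    using assms by (intro circ_mean_ln_dist) auto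
  finally show "circ_mean r (\<lambda>z. - ln (norm (blaschke R b z))) = ln R - ln (max r (norm b))" .
qed

text \<open>\<open>U\<close> is a majorant of log+ |f| on the inner circle: the Poisson integral of
  log+ |f| from the outer circle plus a potential for each pole. Zeros may be dropped because ln
  |Blaschke| \<le> 0. The inner mean of the Poisson part is m(R, f), and that of the potentials is
  exactly N(R, f) - N(r, f).\<close>

theorem characteristic_mono:
  assumes f: "nonzero_mero f" and r: "good_radius f r" and R: "good_radius f R" and "r < R"
  shows "characteristic_T r f \<le> characteristic_T R f"
proof -
  have r0: "r > 0" "R > 0" using r R good_radius_pos by auto
  define A where "A = {a. norm a \<le> R \<and> zorder f a \<noteq> 0}"
  define B where "B = {a. norm a \<le> R \<and> pole_div f a \<noteq> 0}"
  have fin: "finite A" "finite B"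
    using finite_zorder[OF f] loc_fin_pole_div[OF f] by (auto simp: A_def B_def loc_fin_def)
  have BA: "B \<subseteq> A" by (auto simp: A_def B_def pole_div_def)
  have na: "norm a < R" "norm a \<noteq> r" if "a \<in> A" for a
    using that r R zorder_nz_imp_sing[of f a] unfolding A_def good_radius_def by force+
  obtain g where g: "continuous_on (cball 0 R) g" "g holomorphic_on ball 0 R"
    "\<And>z. norm z \<le> R \<Longrightarrow> z \<notin> sing f \<Longrightarrow> f z = (\<Prod>a\<in>A. blaschke R a z powi zorder f a) * exp (g z)"
    using blaschke_factorization[OF f A_def R] by metis
  define u where "u = (\<lambda>w. log_plus (norm (f w)))"
  define V where "V = (\<lambda>z. circ_mean R (\<lambda>w. poisson_kernel R z w * u w))"
  define U where "U = (\<lambda>z. (\<Sum>b\<in>B. pole_div f b * (- ln (norm (blaschke R b z)))) + V z)"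
  have cu: "continuous_on (sphere 0 R) u" unfolding u_def by (rule good_radius_continuous_log_plus[OF R])
  note mm = mean_mean_poisson[OF r0(1) \<open>r < R\<close> cu, folded V_def]
  have cP: "continuous_on (sphere 0 R) (poisson_kernel R z)" if "norm z = r" for z
    unfolding poisson_kernel_def using that \<open>r < R\<close> by (intro continuous_intros) auto
  have cg: "continuous_on (sphere 0 R) g" using g(1) by (rule continuous_on_subset) auto
  have le: "log_plus (norm (f z)) \<le> U z" if z: "norm z = r" for z
  proof -
    have ns: "z \<notin> sing f" using z r by (auto simp: good_radius_def)
    hence nz: "norm (f z) > 0" by (auto simp: sing_def)
    have bl: "norm (blaschke R a z) > 0" "norm (blaschke R a z) \<le> 1" if "a \<in> A" for a
      using blaschke_eq_0_iff[OF na(1)[OF that], of z] na(2)[OF that] norm_blaschke_le_1[OF na(1)[OF that], of z]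
        z \<open>r < R\<close> by auto
    have "circ_mean R (\<lambda>_. 0) \<le> V z" unfolding V_def
      using z r0 \<open>r < R\<close> poisson_kernel_nonneg[of z R]
      by (intro circ_mean_mono continuous_on_mult cP cu continuous_on_const) (auto simp: u_def)
    hence Vpos: "V z \<ge> 0" by simp
    have Upos: "U z \<ge> 0"
      unfolding U_def using bl BA by (intro add_nonneg_nonneg Vpos sum_nonneg mult_nonneg_nonneg) (auto simp: ln_le_zero_iff)
    have "norm (f z) = (\<Prod>a\<in>A. norm (blaschke R a z) powi zorder f a) * exp (Re (g z))"
      using g(3)[of z] ns z \<open>r < R\<close> by (simp add: norm_mult norm_power_int flip: prod_norm)
    also have "ln \<dots> = ln (\<Prod>a\<in>A. norm (blaschke R a z) powi zorder f a) + Re (g z)"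
      using bl by (subst ln_mult_pos) (auto intro!: prod_pos)
    also have "ln (\<Prod>a\<in>A. norm (blaschke R a z) powi zorder f a) = (\<Sum>a\<in>A. ln (norm (blaschke R a z) powi zorder f a))"
      using bl fin by (intro ln_prod) auto
    also have "\<dots> = (\<Sum>a\<in>A. of_int (zorder f a) * ln (norm (blaschke R a z)))"
      using bl by (intro sum.cong refl) (simp add: ln_powr flip: powr_real_of_int')
    also have "\<dots> \<le> (\<Sum>a\<in>A. pole_div f a * (- ln (norm (blaschke R a z))))"
    proof (rule sum_mono)
      fix a assume a: "a \<in> A"
      have "(of_int (zorder f a) + pole_div f a) * ln (norm (blaschke R a z)) \<le> 0"
        using bl[OF a] by (intro mult_nonneg_nonpos) (auto simp: pole_div_def ln_le_zero_iff)
      thus "of_int (zorder f a) * ln (norm (blaschke R a z)) \<le> pole_div f a * (- ln (norm (blaschke R a z)))"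
        by (simp add: algebra_simps)
    qed
    also have "\<dots> = (\<Sum>b\<in>B. pole_div f b * (- ln (norm (blaschke R b z))))"
      using fin BA by (intro sum.mono_neutral_right) (auto simp: A_def B_def)
    also have "Re (g z) \<le> V z"
    proof -
      have "g z = circ_mean R (\<lambda>w. of_real (poisson_kernel R z w) * g w)"
        using z \<open>r < R\<close> by (intro Poisson[symmetric] g) auto
      hence "Re (g z) = circ_mean R (\<lambda>w. poisson_kernel R z w * Re (g w))"
        using r0 by (simp add: circ_mean_Re[OF continuous_on_mult[OF continuous_on_of_real[OF cP[OF z]] cg]])
      also have "\<dots> \<le> V z"
        unfolding V_def
      proof (intro circ_mean_mono continuous_intros cP z cg cu)
        fix w :: complex assume w: "norm w = R"
        have nsw: "w \<notin> sing f" using w R by (auto simp: good_radius_def)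
        have "norm (f w) = (\<Prod>a\<in>A. norm (blaschke R a w) powi zorder f a) * exp (Re (g w))"
          using g(3)[of w] nsw w by (simp add: norm_mult norm_power_int flip: prod_norm)
        also have "(\<Prod>a\<in>A. norm (blaschke R a w) powi zorder f a) = 1"
          by (intro prod.neutral) (simp add: norm_blaschke_circle[OF na(1) w])
        finally have "Re (g w) \<le> u w" unfolding u_def using ln_le_log_plus[of "norm (f w)"] by simp
        thus "poisson_kernel R z w * Re (g w) \<le> poisson_kernel R z w * u w"
          using z \<open>r < R\<close> by (intro mult_left_mono poisson_kernel_nonneg) auto
      qed (use r0 in auto)
      finally show ?thesis .
    qed
    finally have "ln (norm (f z)) \<le> U z" unfolding U_def by simp
    thus ?thesis using Upos nz unfolding log_plus_def by (auto simp: max_def)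
  qed
  have cb: "continuous_on (sphere 0 r) (\<lambda>z. - ln (norm (blaschke R b z)))" if "b \<in> B" for b
    using BA na that r0 \<open>r < R\<close> by (intro mean_ln_blaschke) auto
  have "proximity_m r f \<le> circ_mean r U"
    unfolding U_def
    by (intro proximity_le_mean le[unfolded U_def] continuous_on_add continuous_on_sum
        continuous_on_mult continuous_on_const cb mm) (use r0 in auto)
  also have "\<dots> = circ_mean r (\<lambda>z. \<Sum>b\<in>B. pole_div f b * (- ln (norm (blaschke R b z)))) + circ_mean r V"
    unfolding U_def using r0 by (intro circ_mean_add continuous_on_sum continuous_on_mult continuous_on_const cb mm) auto
  also have "circ_mean r (\<lambda>z. \<Sum>b\<in>B. pole_div f b * (- ln (norm (blaschke R b z)))) =
       (\<Sum>b\<in>B. circ_mean r (\<lambda>z. pole_div f b * (- ln (norm (blaschke R b z)))))"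
    using r0 fin by (intro circ_mean_sum continuous_on_mult continuous_on_const cb) auto
  also have "\<dots> = (\<Sum>b\<in>B. pole_div f b * (ln R - ln (max r (norm b))))"
  proof (rule sum.cong[OF refl])
    fix b assume "b \<in> B"
    hence b: "norm b < R" "norm b \<noteq> r" using BA na by auto
    show "circ_mean r (\<lambda>z. pole_div f b * (- ln (norm (blaschke R b z)))) = pole_div f b * (ln R - ln (max r (norm b)))"
      unfolding circ_mean_cmult mean_ln_blaschke(1)[OF b r0(1) \<open>r < R\<close>] ..
  qed
  also have "circ_mean r V = proximity_m R f" using mm(1) by (simp add: proximity_eq_mean u_def)
  also have "(\<Sum>b\<in>B. pole_div f b * (ln R - ln (max r (norm b)))) = countN (pole_div f) R - countN (pole_div f) r"
  proof -
    have "countN (pole_div f) r = (\<Sum>b\<in>B. if norm b \<le> r then pole_div f b * count_weight r b else 0)"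
      unfolding countN_def using \<open>r < R\<close> fin by (intro sum.mono_neutral_cong_left) (auto simp: B_def)
    moreover have "countN (pole_div f) R = (\<Sum>b\<in>B. pole_div f b * count_weight R b)"
      unfolding countN_def B_def ..
    ultimately have "countN (pole_div f) R - countN (pole_div f) r =
        (\<Sum>b\<in>B. pole_div f b * count_weight R b - (if norm b \<le> r then pole_div f b * count_weight r b else 0))"
      by (simp add: sum_subtractf)
    also have "\<dots> = (\<Sum>b\<in>B. pole_div f b * (ln R - ln (max r (norm b))))"
      using r0 by (intro sum.cong refl) (auto simp: count_weight_def ln_div algebra_simps max_def)
    finally show ?thesis by simp
  qed
  finally show ?thesis using f r0 by (simp add: characteristic_eq)
qed

section \<open>A pointwise logarithmic derivative estimate\<close>

lemma sing_nicely:
  assumes "nonzero_mero f" "f nicely_meromorphic_on UNIV"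
  shows "sing f = {a. zorder f a \<noteq> 0}"
proof (intro equalityI subsetI)
  fix a assume "a \<in> sing f"
  show "a \<in> {a. zorder f a \<noteq> 0}"
  proof (cases "is_pole f a")
    case True thus ?thesis using nonzero_mero_is_pole_iff[OF assms(1)] by auto
  next
    case False
    hence "f analytic_on {a}" using nicely_meromorphic_on_imp_analytic_at[OF assms(2)] by auto
    thus ?thesis using \<open>a \<in> sing f\<close> zorder_eq_0_iff[of f a] nonzero_mero_freq[OF assms(1)]
      by (auto simp: sing_def)
  qed
qed (auto dest: zorder_nz_imp_sing)

lemma closed_sing: assumes "nonzero_mero f" shows "closed (sing f)"
proof (rule sparse_in_UNIV_imp_closed)
  show "sing f sparse_in UNIV"
    using sing_cosparse[OF assms] by (simp add: eventually_cosparse)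
qed

text \<open>Discarding a neighbourhood of radius $1/k^2$ of the $k$-th modulus costs finite measure, while
  the distances that remain are polynomially large in the number of singular points.\<close>

lemma exceptional_radii:
  assumes f: "nonzero_mero f"
  obtains E where "E \<in> lmeasurable"
    "\<And>r a. r \<notin> E \<Longrightarrow> a \<in> sing f \<Longrightarrow>
      1 / (real (card (norm ` {b \<in> sing f. norm b \<le> norm a})))^2 \<le> \<bar>r - norm a\<bar>"
proof -
  define D where "D = norm ` sing f"
  \<comment> \<open>\<open>idx\<close> numbers the distinct moduli of singular points in increasing
    order. On \<open>D\<close> the numbering starts at 1, whence the index \<open>Suc k\<close>
    below, and it is injective, so each \<open>U k\<close> is one interval or empty.\<close>
  define idx where "idx = (\<lambda>x. card {y \<in> D. y \<le> x})"
  have fin: "finite {y \<in> D. y \<le> x}" for x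
  proof -
    have "{y \<in> D. y \<le> x} \<subseteq> norm ` {z. norm z \<le> x \<and> z \<in> sing f}" by (auto simp: D_def)
    thus ?thesis using finite_sing[OF f] finite_subset by blast
  qed
  have idx_less: "idx x < idx y" if "x < y" "y \<in> D" for x y
    unfolding idx_def
  proof (intro psubset_card_mono fin psubsetI)
    have "y \<in> {z \<in> D. z \<le> y}" "y \<notin> {z \<in> D. z \<le> x}" using that by auto
    thus "{z \<in> D. z \<le> x} \<noteq> {z \<in> D. z \<le> y}" by metis
  qed (use that in auto)
  hence inj: "x = y" if "idx x = idx y" "x \<in> D" "y \<in> D" for x y
    using that by (metis linorder_neq_iff)
  define U where "U = (\<lambda>k. \<Union>x\<in>{x \<in> D. idx x = Suc k}. ball x (1 / (real (Suc k))^2))"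
  have U: "emeasure lebesgue (U k) \<le> ennreal (2 / (real (Suc k))^2) \<and> U k \<in> sets lebesgue" for k
  proof (cases "\<exists>x\<in>D. idx x = Suc k")
    case True
    then obtain x where x: "x \<in> D" "idx x = Suc k" by blast
    hence "{x \<in> D. idx x = Suc k} = {x}" using inj by auto
    hence "U k = {x - 1 / (real (Suc k))^2 <..< x + 1 / (real (Suc k))^2}"
      unfolding U_def by (simp add: ball_eq_greaterThanLessThan)
    thus ?thesis by simp
  next
    case False
    hence "U k = {}" unfolding U_def by auto
    thus ?thesis by simp
  qed
  have sm: "summable (\<lambda>k. 2 / (real (Suc k))^2)"
  proof -
    have "summable (\<lambda>k. inverse ((real (Suc k))^2))"
      using inverse_power_summable[of 2, where 'a = real] by (subst summable_Suc_iff) simp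
    from summable_mult[OF this, of 2] show ?thesis by (simp add: divide_inverse)
  qed
  define E where "E = (\<Union>k. U k)"
  have "emeasure lebesgue E \<le> suminf (\<lambda>k. emeasure lebesgue (U k))"
    unfolding E_def using U by (intro emeasure_subadditive_countably) auto
  also have "\<dots> \<le> suminf (\<lambda>k. ennreal (2 / (real (Suc k))^2))"
    by (intro suminf_le summableI conjunct1[OF U])
  also have "\<dots> < \<infinity>"
    using sm by (subst suminf_ennreal2) auto
  finally have "E \<in> lmeasurable" unfolding E_def using U by (intro fmeasurableI) auto
  moreover have "1 / (real (card (norm ` {b \<in> sing f. norm b \<le> norm a})))^2 \<le> \<bar>r - norm a\<bar>"
    if "r \<notin> E" "a \<in> sing f" for r a
  proof -
    have aD: "norm a \<in> D" using that by (auto simp: D_def)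
    have eq: "norm ` {b \<in> sing f. norm b \<le> norm a} = {y \<in> D. y \<le> norm a}" by (auto simp: D_def)
    have "idx (norm a) > 0" unfolding idx_def using aD fin by (subst card_gt_0_iff) auto
    then obtain k where k: "idx (norm a) = Suc k" using gr0_implies_Suc by blast
    have "r \<notin> U k" using that by (auto simp: E_def)
    hence "r \<notin> ball (norm a) (1 / (real (Suc k))^2)" using aD k unfolding U_def by blast
    hence "1 / (real (idx (norm a)))^2 \<le> \<bar>r - norm a\<bar>" unfolding k by (simp add: dist_real_def abs_minus_commute)
    thus ?thesis unfolding eq idx_def .
  qed
  ultimately show ?thesis using that by blast
qed

lemma has_field_derivative_prod_log:
  fixes u :: "'i \<Rightarrow> 'a::real_normed_field \<Rightarrow> 'a"
  assumes "finite A" "\<And>a. a \<in> A \<Longrightarrow> (u a has_field_derivative u' a * u a z) (at z)"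
  shows "((\<lambda>z. \<Prod>a\<in>A. u a z) has_field_derivative (\<Sum>a\<in>A. u' a) * (\<Prod>a\<in>A. u a z)) (at z)"
  using assms
proof (induction A rule: finite_induct)
  case (insert a A)
  have "((\<lambda>z. u a z * (\<Prod>a\<in>A. u a z)) has_field_derivative
      u' a * u a z * (\<Prod>a\<in>A. u a z) + (\<Sum>a\<in>A. u' a) * (\<Prod>a\<in>A. u a z) * u a z) (at z)"
    using insert by (intro DERIV_mult) auto
  thus ?case using insert by (simp add: algebra_simps)
qed simp

lemma blaschke_powi_deriv:
  assumes "norm a < R" "norm z \<le> R" "z \<noteq> a"
  shows "((\<lambda>z. blaschke R a z powi m) has_field_derivative
    (of_int m * (1 / (z - a) + cnj a / (of_real (R^2) - cnj a * z))) * blaschke R a z powi m) (at z)"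
proof -
  have d: "of_real (R^2) - cnj a * z \<noteq> 0" using complex_norm_lt_sq[OF assms(1,2)] .
  have b: "blaschke R a z \<noteq> 0" using blaschke_eq_0_iff[OF assms(1,2)] assms(3) by simp
  have R: "R > 0" using assms(1) norm_ge_zero[of a] by linarith
  have alg: "(r * D - r * x * (- c)) / (D * D) = (1 / x + c / D) * (r * x / D)"
    if "D \<noteq> 0" "x \<noteq> 0" for r D x c :: complex
  proof -
    have "1 / x * (r * x / D) = r / D" "r * D / (D * D) = r / D" using that by simp_all
    moreover have "r * x * (- c) / (D * D) = - (c / D * (r * x / D))" by simp
    ultimately show ?thesis by (simp only: distrib_right diff_divide_distrib) simp
  qed
  have "((\<lambda>z. blaschke R a z) has_field_derivative
    (of_real R * (of_real (R^2) - cnj a * z) - of_real R * (z - a) * (- cnj a)) /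
      ((of_real (R^2) - cnj a * z) * (of_real (R^2) - cnj a * z))) (at z)"
    unfolding blaschke_def by (intro DERIV_divide d) (auto intro!: derivative_eq_intros)
  hence "((\<lambda>z. blaschke R a z) has_field_derivative
    (1 / (z - a) + cnj a / (of_real (R^2) - cnj a * z)) * blaschke R a z) (at z)"
    using alg[OF d, of "z - a" "of_real R" "cnj a"] assms(3) unfolding blaschke_def
    by (simp del: of_real_power)
  hence "((\<lambda>z. blaschke R a z powi m) has_field_derivative of_int m * blaschke R a z powi (m - 1) *
    ((1 / (z - a) + cnj a / (of_real (R^2) - cnj a * z)) * blaschke R a z)) (at z)"
    by (rule DERIV_power_int) (use b in simp)
  moreover have bm: "blaschke R a z powi (m - 1) * blaschke R a z = blaschke R a z powi m"
    using b by (simp add: power_int_diff)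
  have "of_int m * blaschke R a z powi (m - 1) * (x * blaschke R a z) = of_int m * x * blaschke R a z powi m" for x
    unfolding bm[symmetric] by (simp only: mult_ac)
  ultimately show ?thesis by (simp only:)
qed

text \<open>Differentiate the logarithm of the Blaschke factorization. A divisor point contributes
  its order times 1/(z - a) + cnj a / (\<rho>^2 - cnj a * z), bounded through \<delta> and \<rho> -
  s; the exponent g is handled by its real part, which is ln |f| on the circle.\<close>

lemma log_deriv_le:
  assumes f: "nonzero_mero f" and \<rho>: "good_radius f \<rho>" and z: "norm z \<le> s" "s < \<rho>" "z \<notin> sing f"
    and \<delta>: "\<delta> > 0" "\<And>a. norm a \<le> \<rho> \<Longrightarrow> zorder f a \<noteq> 0 \<Longrightarrow> \<delta> \<le> norm (z - a)"
  shows "norm (deriv f z / f z) \<le> 2 * \<rho> / (\<rho> - s)^2 * circ_mean \<rho> (\<lambda>w. \<bar>ln (norm (f w))\<bar>) +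
    (\<Sum>a | norm a \<le> \<rho> \<and> zorder f a \<noteq> 0. \<bar>of_int (zorder f a)\<bar>) * (1 / \<delta> + 1 / (\<rho> - s))"
proof -
  define A where "A = {a. norm a \<le> \<rho> \<and> zorder f a \<noteq> 0}"
  have \<rho>0: "\<rho> > 0" using good_radius_pos[OF \<rho>] .
  have fin: "finite A" unfolding A_def using finite_zorder[OF f] .
  have na: "norm a < \<rho>" if "a \<in> A" for a
    using that \<rho> zorder_nz_imp_sing[of f a] unfolding A_def good_radius_def by force
  have za: "z \<noteq> a" if "a \<in> A" for a using that z zorder_nz_imp_sing unfolding A_def by blast
  obtain g where g: "continuous_on (cball 0 \<rho>) g" "g holomorphic_on ball 0 \<rho>"
    "\<And>z. norm z \<le> \<rho> \<Longrightarrow> z \<notin> sing f \<Longrightarrow> f z = (\<Prod>a\<in>A. blaschke \<rho> a z powi zorder f a) * exp (g z)"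
    using blaschke_factorization[OF f A_def \<rho>] by metis
  define h where "h = (\<lambda>a. of_int (zorder f a) * (1 / (z - a) + cnj a / (of_real (\<rho>^2) - cnj a * z)))"
  have gz: "(g has_field_derivative deriv g z) (at z)"
    using g(2) z by (intro holomorphic_derivI[of _ "ball 0 \<rho>"]) auto
  have "((\<lambda>z. (\<Prod>a\<in>A. blaschke \<rho> a z powi zorder f a) * exp (g z)) has_field_derivative
     ((\<Sum>a\<in>A. h a) + deriv g z) * ((\<Prod>a\<in>A. blaschke \<rho> a z powi zorder f a) * exp (g z))) (at z)"
    (is "(?F has_field_derivative _) _")
  proof -
    have "((\<lambda>z. \<Prod>a\<in>A. blaschke \<rho> a z powi zorder f a) has_field_derivative
       (\<Sum>a\<in>A. h a) * (\<Prod>a\<in>A. blaschke \<rho> a z powi zorder f a)) (at z)"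
    proof (rule has_field_derivative_prod_log[OF fin])
      fix a assume "a \<in> A"
      thus "((\<lambda>z. blaschke \<rho> a z powi zorder f a) has_field_derivative h a * blaschke \<rho> a z powi zorder f a) (at z)"
        unfolding h_def using na za z by (intro blaschke_powi_deriv) auto
    qed
    from DERIV_mult[OF this DERIV_exp[THEN DERIV_chain2, OF gz]] show ?thesis
      by (simp add: algebra_simps)
  qed
  moreover have "\<forall>\<^sub>F w in nhds z. ?F w = f w"
  proof -
    have "open (ball 0 \<rho> - sing f)" using closed_sing[OF f] by auto
    hence "\<forall>\<^sub>F w in nhds z. w \<in> ball 0 \<rho> - sing f" using z by (intro eventually_nhds_in_open) auto
    thus ?thesis by eventually_elim (use g(3) in auto)
  qed
  ultimately have "(f has_field_derivative ((\<Sum>a\<in>A. h a) + deriv g z) * f z) (at z)"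
    using g(3)[of z] z by (subst DERIV_cong_ev[OF refl _ refl, of _ ?F]) (auto elim: eventually_mono)
  moreover have "f z \<noteq> 0" using z by (auto simp: sing_def)
  ultimately have eq: "deriv f z / f z = (\<Sum>a\<in>A. h a) + deriv g z"
    by (simp add: DERIV_imp_deriv)
  have "norm (\<Sum>a\<in>A. h a) \<le> (\<Sum>a\<in>A. \<bar>of_int (zorder f a)\<bar> * (1 / \<delta> + 1 / (\<rho> - s)))"
  proof (rule sum_norm_le)
    fix a assume a: "a \<in> A"
    have "norm (1 / (z - a)) \<le> 1 / \<delta>"
      using \<delta>(1) \<delta>(2)[of a] a unfolding norm_divide A_def by (auto intro!: divide_left_mono mult_pos_pos)
    moreover have "norm (cnj a / (of_real (\<rho>^2) - cnj a * z)) \<le> 1 / (\<rho> - s)"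
    proof -
      have "norm (of_real (\<rho>^2) :: complex) = \<rho>^2" using \<rho>0 by (metis norm_of_real abs_power2)
      hence "\<rho>^2 - norm a * norm z \<le> norm (of_real (\<rho>^2) - cnj a * z)"
        using norm_triangle_ineq2[of "of_real (\<rho>^2)" "cnj a * z"] by (simp add: norm_mult complex_mod_cnj)
      moreover have "norm a * norm z \<le> \<rho> * s" using na[OF a] z \<rho>0 by (intro mult_mono) auto
      ultimately have "\<rho> * (\<rho> - s) \<le> norm (of_real (\<rho>^2) - cnj a * z)"
        by (simp add: power2_eq_square algebra_simps)
      hence "norm (cnj a / (of_real (\<rho>^2) - cnj a * z)) \<le> \<rho> / (\<rho> * (\<rho> - s))"
        using na[OF a] \<rho>0 z unfolding norm_divide complex_mod_cnj by (intro frac_le mult_pos_pos) auto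
      thus ?thesis using \<rho>0 by simp
    qed
    ultimately have "norm (1 / (z - a) + cnj a / (of_real (\<rho>^2) - cnj a * z)) \<le> 1 / \<delta> + 1 / (\<rho> - s)"
      by (intro norm_triangle_le add_mono)
    thus "norm (h a) \<le> \<bar>of_int (zorder f a)\<bar> * (1 / \<delta> + 1 / (\<rho> - s))"
      unfolding h_def norm_mult norm_of_int by (intro mult_left_mono) auto
  qed
  also have "\<dots> = (\<Sum>a\<in>A. \<bar>of_int (zorder f a)\<bar>) * (1 / \<delta> + 1 / (\<rho> - s))"
    by (rule sum_distrib_right[symmetric])
  finally have 1: "norm (\<Sum>a\<in>A. h a) \<le> \<dots>" .
  have "norm (deriv g z) \<le> 2 * \<rho> / (\<rho> - s)^2 * circ_mean \<rho> (\<lambda>w. \<bar>Re (g w)\<bar>)"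
    by (rule norm_deriv_le_mean[OF g(1,2) z(1,2)])
  also have "circ_mean \<rho> (\<lambda>w. \<bar>Re (g w)\<bar>) = circ_mean \<rho> (\<lambda>w. \<bar>ln (norm (f w))\<bar>)"
  proof (rule circ_mean_cong)
    fix w :: complex assume w: "norm w = \<rho>"
    have nsw: "w \<notin> sing f" using w \<rho> by (auto simp: good_radius_def)
    have "norm (f w) = (\<Prod>a\<in>A. norm (blaschke \<rho> a w) powi zorder f a) * exp (Re (g w))"
      using g(3)[of w] nsw w by (simp add: norm_mult norm_power_int flip: prod_norm)
    also have "(\<Prod>a\<in>A. norm (blaschke \<rho> a w) powi zorder f a) = 1"
      by (intro prod.neutral) (simp add: norm_blaschke_circle[OF na(1) w])
    finally show "\<bar>Re (g w)\<bar> = \<bar>ln (norm (f w))\<bar>" by simp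
  qed (use \<rho>0 in auto)
  finally show ?thesis using 1 unfolding eq A_def by (intro norm_triangle_le) linarith
qed

text \<open>A single quantity dominating, up to constants, T(R, f), R and 1/(R - r). Its cube will
  bound f'/f: the number of divisor points is of this size, and the distance to each is at least of
  the size of its inverse square.\<close>

definition ld_scale :: "(complex \<Rightarrow> complex) \<Rightarrow> real \<Rightarrow> real \<Rightarrow> real \<Rightarrow> real" where
  "ld_scale f C r R = C * (1 + characteristic_T R f) * R * (1 + 1 / (R - r))"

text \<open>The bound holds in a whole disc about each point of the circle, so that Cauchy's
  estimate can later bound derivatives of f'/f. The exceptional set does not depend on R, which is
  left free for Borel's lemma.\<close>

theorem log_derivative_estimate:
  assumes f: "nonzero_mero f" and nice: "f nicely_meromorphic_on UNIV"
  shows "\<exists>E\<in>lmeasurable. \<exists>C\<ge>1. \<forall>r R z w.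
    1 \<le> r \<and> r < R \<and> r \<notin> E \<and> good_radius f R \<and> norm z = r \<and> norm (w - z) \<le> 1 / ld_scale f C r R ^ 3 \<longrightarrow>
    w \<notin> sing f \<and> norm (deriv f w / f w) \<le> ld_scale f C r R ^ 3"
proof -
  obtain E where E: "E \<in> lmeasurable" "\<And>r a. r \<notin> E \<Longrightarrow> a \<in> sing f \<Longrightarrow>
      1 / (real (card (norm ` {b \<in> sing f. norm b \<le> norm a})))^2 \<le> \<bar>r - norm a\<bar>"
    using exceptional_radii[OF f] by blast
  obtain K where K: "\<And>r. good_radius f r \<Longrightarrow>
    proximity_m r f + countN (pole_div f) r = proximity_m r (\<lambda>z. 1 / f z) + countN (zero_div f) r + K"
    using first_main_theorem[OF f] by blast
  \<comment> \<open>Chosen so that 2 T + |K| \<le> c (1 + T), which covers T(f) + T(1/f) by the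
    first main theorem.\<close>
  define c where "c = 2 + \<bar>K\<bar>"
  have c: "c \<ge> 2" by (simp add: c_def)
  show ?thesis
  \<comment> \<open>The factor 220 is generous: its cube must absorb 32 y^2, 6 y and 90 y^2 + 96 y^3
    in the estimates below.\<close>
  proof (intro bexI[OF _ E(1)] exI[of _ "220 * c"] conjI allI impI)
    show "220 * c \<ge> 1" using c by simp
    fix r R :: real and z w :: complex
    assume *: "1 \<le> r \<and> r < R \<and> r \<notin> E \<and> good_radius f R \<and> norm z = r \<and>
       norm (w - z) \<le> 1 / ld_scale f (220 * c) r R ^ 3"
    define d where "d = R - r"
    have d: "d > 0" using * by (simp add: d_def)
    define T where "T = characteristic_T R f"
    have T0: "T \<ge> 0" unfolding T_def using * by (intro characteristic_nonneg f) auto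
    define y where "y = c * (1 + T) * R * (1 + 1 / d)"
    have R1: "R \<ge> 1" using * by simp
    define \<Lambda> where "\<Lambda> = c * (1 + T)"
    have \<Lambda>: "\<Lambda> \<ge> 1 * 1" unfolding \<Lambda>_def using c T0 by (intro mult_mono) auto
    have y: "y = \<Lambda> * R * (1 + 1 / d)" by (simp add: y_def \<Lambda>_def)
    have LR: "\<Lambda> * R \<ge> 1 * 1" using \<Lambda> R1 by (intro mult_mono) auto
    have y1: "y \<ge> 1" "y \<ge> 1 / d" "y \<ge> \<Lambda> * R / d"
    proof -
      have "1 * (1 + 1 / d) \<le> y" unfolding y using LR d by (intro mult_right_mono) auto
      hence yd: "1 + 1 / d \<le> y" by simp
      have d1: "1 / d > 0" using d by simp
      show "y \<ge> 1" using yd d1 by linarith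
      show "y \<ge> 1 / d" using yd d1 by linarith
      have "\<Lambda> * R * (1 / d) \<le> y" unfolding y using LR d by (intro mult_left_mono) auto
      thus "y \<ge> \<Lambda> * R / d" by simp
    qed
    have sc: "ld_scale f (220 * c) r R = 220 * y" by (simp add: ld_scale_def y_def T_def d_def)
    \<comment> \<open>A good radius in the middle third of the gap. Both R - \<rho> and the later
      \<rho> - s are then comparable to \<open>d\<close>.\<close>
    obtain \<rho> where \<rho>: "r + d / 3 < \<rho>" "\<rho> < r + 2 * d / 3" "good_radius f \<rho>"
      using ex_good_radius[OF f, of "r + d / 3" "r + 2 * d / 3"] d * by auto
    have \<rho>R: "\<rho> < R" "1 \<le> \<rho>" "r < \<rho>" using \<rho> d * by (auto simp: d_def field_simps)
    define A where "A = {a. norm a \<le> \<rho> \<and> zorder f a \<noteq> 0}"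
    have fin: "finite A" unfolding A_def using finite_zorder[OF f] .
    define n where "n = (\<Sum>a\<in>A. \<bar>of_int (zorder f a)\<bar> :: real)"
    have n0: "n \<ge> 0" unfolding n_def by (intro sum_nonneg) auto
    have TR: "proximity_m R f + countN (pole_div f) R = T" "proximity_m \<rho> f + countN (pole_div f) \<rho> \<le> T"
      using characteristic_mono[OF f \<rho>(3) _ \<rho>R(1)] * characteristic_eq[OF f] \<rho>R by (auto simp: T_def)
    have pos: "proximity_m R f \<ge> 0" "proximity_m R (\<lambda>z. 1 / f z) \<ge> 0" "proximity_m \<rho> f \<ge> 0"
      "proximity_m \<rho> (\<lambda>z. 1 / f z) \<ge> 0" "countN (pole_div f) R \<ge> 0" "countN (zero_div f) R \<ge> 0"
      "countN (pole_div f) \<rho> \<ge> 0" "countN (zero_div f) \<rho> \<ge> 0"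
      using \<rho>R by (auto intro: proximity_nonneg countN_nonneg)
    have cT: "2 * T + \<bar>K\<bar> \<le> \<Lambda>" unfolding \<Lambda>_def c_def using T0 by (simp add: algebra_simps)
    have n_le: "n \<le> 3 * y"
    proof -
      have "n = (\<Sum>a\<in>A. zero_div f a) + (\<Sum>a\<in>A. pole_div f a)"
        unfolding n_def sum.distrib[symmetric] by (intro sum.cong refl) (auto simp: zero_div_def pole_div_def)
      also have "(\<Sum>a\<in>A. zero_div f a) = (\<Sum>a | norm a \<le> \<rho> \<and> zero_div f a \<noteq> 0. zero_div f a)"
        using fin by (intro sum.mono_neutral_right) (auto simp: A_def zero_div_def)
      also have "(\<Sum>a\<in>A. pole_div f a) = (\<Sum>a | norm a \<le> \<rho> \<and> pole_div f a \<noteq> 0. pole_div f a)"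
        using fin by (intro sum.mono_neutral_right) (auto simp: A_def pole_div_def)
      finally have "n * ln (R / \<rho>) \<le> countN (zero_div f) R + countN (pole_div f) R"
        using sum_le_countN[of "zero_div f" \<rho> R] sum_le_countN[of "pole_div f" \<rho> R] f \<rho>R
        by (simp add: ring_distribs)
      also have "\<dots> \<le> \<Lambda>" using K[of R] * TR pos cT by linarith
      finally have nL: "n * ln (R / \<rho>) \<le> \<Lambda>" .
      have "ln (\<rho> / R) \<le> \<rho> / R - 1" using \<rho>R by (intro ln_le_minus_one) auto
      moreover have "ln (R / \<rho>) = - ln (\<rho> / R)" using \<rho>R by (simp add: ln_div)
      moreover have "1 - \<rho> / R \<ge> d / (3 * R)"
      proof -
        have "d / 3 \<le> R - \<rho>" using \<rho>(2) unfolding d_def by (simp add: field_simps)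
        hence "(d / 3) / R \<le> (R - \<rho>) / R" using R1 by (intro divide_right_mono) auto
        thus ?thesis using R1 by (simp add: diff_divide_distrib)
      qed
      ultimately have "d / (3 * R) \<le> ln (R / \<rho>)" by linarith
      hence "n * (d / (3 * R)) \<le> \<Lambda>" using n0 nL by (meson mult_left_mono order_trans)
      hence "n \<le> 3 * (\<Lambda> * R / d)" using d R1 by (simp add: field_simps)
      thus ?thesis using y1 by linarith
    qed
    have mean_le: "circ_mean \<rho> (\<lambda>w. \<bar>ln (norm (f w))\<bar>) \<le> \<Lambda>"
      unfolding mean_ln_eq_proximity(2)[OF \<rho>(3)] using K[OF \<rho>(3)] TR pos cT by linarith
    \<comment> \<open>Half of a lower bound for the excluded distance, since at most n distinct
      moduli are involved. The other half pays for moving from z to w.\<close>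
    define \<delta> where "\<delta> = 1 / (2 * (1 + n)^2)"
    have \<delta>0: "\<delta> > 0" using n0 by (simp add: \<delta>_def)
    have n4: "1 + n \<le> 4 * y" using n_le y1 by linarith
    have yp: "y \<le> y^3" "y^2 \<le> y^3" using y1 power_increasing[of 1 3 y] power_increasing[of 2 3 y] by auto
    have eta: "1 / (220 * y)^3 \<le> \<delta>" "1 / (220 * y)^3 \<le> d / 6"
    proof -
      have "2 * (1 + n)^2 \<le> 2 * (4 * y)^2" using n4 n0 by (intro mult_left_mono power_mono) auto
      also have "\<dots> \<le> (220 * y)^3" using yp y1 by (simp add: power_mult_distrib)
      finally show "1 / (220 * y)^3 \<le> \<delta>" unfolding \<delta>_def using n0 y1
        by (intro divide_left_mono mult_pos_pos zero_less_power) auto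
      have "1 / d \<le> y" by (rule y1)
      hence "6 / d \<le> (220 * y)^3" using yp y1 by (simp add: power_mult_distrib)
      thus "1 / (220 * y)^3 \<le> d / 6" using d y1 by (simp add: field_simps)
    qed
    have wz: "norm (w - z) \<le> \<delta>" "norm (w - z) \<le> d / 6" using * eta unfolding sc by linarith+
    have dist: "\<delta> \<le> norm (w - a)" if a: "norm a \<le> \<rho>" "zorder f a \<noteq> 0" for a
    proof -
      have as: "a \<in> sing f" using a zorder_nz_imp_sing by blast
      \<comment> \<open>Only here does it matter that f is nicely meromorphic: all singular points
        lie in the divisor, so their moduli are counted by \<open>n\<close>.\<close>
      define k where "k = card (norm ` {b \<in> sing f. norm b \<le> norm a})"
      have sub: "{b \<in> sing f. norm b \<le> norm a} \<subseteq> A" using sing_nicely[OF f nice] a by (auto simp: A_def)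
      have "k \<le> card {b \<in> sing f. norm b \<le> norm a}" unfolding k_def
        using finite_subset[OF sub fin] by (rule card_image_le)
      also have "\<dots> \<le> card A" using sub fin by (rule card_mono[rotated])
      finally have "real k \<le> (\<Sum>a\<in>A. 1)" by simp
      also have "\<dots> \<le> n" unfolding n_def by (intro sum_mono) (auto simp: A_def)
      finally have kn: "real k \<le> n" .
      have "k > 0" unfolding k_def using finite_subset[OF sub fin] as by (subst card_gt_0_iff) auto
      hence "2 * \<delta> \<le> 1 / (real k)^2" unfolding \<delta>_def using kn n0
        by (auto intro!: divide_left_mono power_mono mult_pos_pos)
      also have "\<dots> \<le> \<bar>r - norm a\<bar>" unfolding k_def using E(2) as * by blast
      also have "\<dots> \<le> norm (z - a)" using * norm_triangle_ineq3[of z a] by simp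
      also have "\<dots> \<le> norm (w - a) + norm (w - z)"
        using norm_triangle_ineq4[of "w - a" "w - z"] by simp
      finally show ?thesis using wz by linarith
    qed
    define s where "s = r + d / 6"
    have ws: "norm w \<le> s" using wz * norm_triangle_ineq[of z "w - z"] by (simp add: s_def)
    have s\<rho>: "s < \<rho>" "\<rho> - s \<ge> d / 6" using \<rho> d by (auto simp: s_def)
    have nw: "w \<notin> sing f"
    proof
      assume "w \<in> sing f"
      hence "\<delta> \<le> norm (w - w)" using dist[of w] ws s\<rho> sing_nicely[OF f nice] by auto
      thus False using \<delta>0 by simp
    qed
    have "norm (deriv f w / f w) \<le> 2 * \<rho> / (\<rho> - s)^2 * circ_mean \<rho> (\<lambda>w. \<bar>ln (norm (f w))\<bar>) + n * (1 / \<delta> + 1 / (\<rho> - s))"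
      unfolding n_def A_def by (rule log_deriv_le[OF f \<rho>(3) ws s\<rho>(1) nw \<delta>0 dist])
    also have "\<dots> \<le> 2 * R / (d / 6)^2 * \<Lambda> + n * (1 / \<delta> + 1 / (d / 6))"
    proof (intro add_mono mult_mono order_refl)
      show "2 * \<rho> / (\<rho> - s)^2 \<le> 2 * R / (d / 6)^2"
        using \<rho>R s\<rho> d by (intro frac_le power_mono) auto
      show "1 / (\<rho> - s) \<le> 1 / (d / 6)" using s\<rho> d by (intro divide_left_mono) auto
      show "0 \<le> circ_mean \<rho> (\<lambda>w. \<bar>ln (cmod (f w))\<bar>)"
        unfolding mean_ln_eq_proximity(2)[OF \<rho>(3)] using pos by linarith
    qed (use mean_le R1 n0 \<delta>0 s\<rho> in \<open>auto intro!: add_nonneg_nonneg\<close>)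
    also have "\<dots> = 72 * (\<Lambda> * R / d * (1 / d)) + (n * (2 * (1 + n)^2) + 6 * (n * (1 / d)))"
    proof -
      have "1 / \<delta> = 2 * (1 + n)^2" by (simp add: \<delta>_def)
      moreover have "1 / (d / 6) = 6 * (1 / d)" by simp
      moreover have "2 * R / (d / 6)^2 = 72 * (R * (1 / d) * (1 / d))" by (simp add: power2_eq_square)
      moreover have "\<Lambda> * R / d * (1 / d) = R * (1 / d) * (1 / d) * \<Lambda>" by simp
      ultimately show ?thesis by (simp only: distrib_left mult.assoc mult.left_commute[of n 6])
    qed
    also have "\<dots> \<le> 72 * (y * y) + (3 * y * (2 * (4 * y)^2) + 6 * (3 * y * y))"
      using y1 n_le n4 n0 d LR by (intro add_mono mult_left_mono mult_mono power_mono) auto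
    also have "\<dots> = 90 * y^2 + 96 * y^3" by (simp add: power2_eq_square power3_eq_cube)
    also have "\<dots> \<le> (220 * y)^3" using yp y1 by (simp add: power_mult_distrib)
    finally show "norm (deriv f w / f w) \<le> ld_scale f (220 * c) r R ^ 3" unfolding sc .
    show "w \<notin> sing f" by (rule nw)
  qed
qed

section \<open>Exceptional sets of finite measure\<close>

text \<open>"For all large r outside some set of finite measure" as a filter. It is a filter because
  a union of two exceptional sets again has finite measure.\<close>

definition nev :: "real filter" where
  "nev = (INF E\<in>lmeasurable. inf at_top (principal (- E)))"

lemma eventually_at_top_principal:
  "eventually P (inf at_top (principal (- E))) \<longleftrightarrow> (\<exists>r0::real. \<forall>r\<ge>r0. r \<notin> E \<longrightarrow> P r)"
  by (auto simp: eventually_inf_principal eventually_at_top_linorder)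

lemma eventually_nev:
  "eventually P nev \<longleftrightarrow> (\<exists>E\<in>lmeasurable. \<exists>r0. \<forall>r\<ge>r0. r \<notin> E \<longrightarrow> P r)"
  unfolding nev_def
proof (subst eventually_INF_base)
  show "lmeasurable \<noteq> ({} :: real set set)" by auto
  fix E E' :: "real set" assume "E \<in> lmeasurable" "E' \<in> lmeasurable"
  thus "\<exists>x\<in>lmeasurable. inf at_top (principal (- x)) \<le>
      inf (inf at_top (principal (- E))) (inf at_top (principal (- E')))"
    by (intro bexI[of _ "E \<union> E'"])
       (auto simp: fmeasurable.Un intro!: inf_mono intro: le_infI1 le_infI2)
qed (simp add: eventually_at_top_principal)

lemma nev_I: "E \<in> lmeasurable \<Longrightarrow> (\<And>r. r \<ge> r0 \<Longrightarrow> r \<notin> E \<Longrightarrow> P r) \<Longrightarrow> eventually P nev"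
  unfolding eventually_nev by blast

lemma nev_ge: "eventually (\<lambda>r. r \<ge> x) nev"
  by (rule nev_I[of "{}" x]) auto

lemma nev_le_at_top: "nev \<le> at_top"
  by (rule filter_leI) (auto simp: eventually_at_top_linorder intro!: nev_I[of "{}"])

text \<open>An interval longer than the measure of the exceptional set cannot lie inside it.
  Together with monotonicity this extends estimates from unexceptional radii to the others.\<close>

lemma nev_dense:
  assumes "eventually P nev"
  obtains L r0 where "L > 0" "\<And>x. x \<ge> r0 \<Longrightarrow> \<exists>r\<in>{x..x + L}. P r"
proof -
  obtain E r0 where E: "E \<in> lmeasurable" "\<And>r. r \<ge> r0 \<Longrightarrow> r \<notin> E \<Longrightarrow> P r"
    using assms unfolding eventually_nev by blast
  define L where "L = measure lebesgue E + 1"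
  have L: "L > 0" unfolding L_def by (simp add: add_nonneg_pos)
  have "\<exists>r\<in>{x..x + L}. r \<notin> E" for x
  proof (rule ccontr)
    assume "\<not> (\<exists>r\<in>{x..x + L}. r \<notin> E)"
    hence "{x..x + L} \<subseteq> E" by auto
    hence "measure lebesgue {x..x + L} \<le> measure lebesgue E"
      using E(1) by (intro measure_mono_fmeasurable) auto
    thus False using L unfolding L_def by simp
  qed
  thus ?thesis using that[OF L] E(2) by (meson atLeastAtMost_iff order_trans)
qed

lemma nev_frequently_ge:
  assumes "eventually P nev" shows "\<exists>r\<ge>x. P r"
proof -
  obtain L r0 where L: "\<And>x. x \<ge> r0 \<Longrightarrow> \<exists>r\<in>{x..x + L}. P r" using nev_dense[OF assms] by blast
  from L[of "max x r0"] show ?thesis by auto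
qed

lemma nev_neq_bot [simp]: "nev \<noteq> bot"
  using nev_frequently_ge[of "\<lambda>_. False"] by (auto simp: trivial_limit_def)

text \<open>The complement of a cosparse set is countable, so its moduli form a null set and may be
  added to the exceptional radii. This turns identities off a sparse set into identities on whole
  circles.\<close>

lemma cosparse_nev:
  assumes "\<forall>\<^sub>\<approx>z. Q z" shows "\<forall>\<^sub>F r in nev. \<forall>z::complex. norm z = r \<longrightarrow> Q z"
proof -
  have "countable {z. \<not> Q z}"
  proof -
    have "{z. \<not> Q z} = (\<Union>n. {z. norm z \<le> real n \<and> \<not> Q z})" using real_arch_simple by auto
    also have "countable \<dots>" using finite_cosparse_compl[OF assms] by (intro countable_UN) (auto intro: countable_finite)
    finally show ?thesis .
  qed
  hence "negligible (norm ` {z. \<not> Q z})"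
    by (auto simp: negligible_iff_null_sets intro!: null_sets_completionI countable_imp_null_set_lborel)
  thus ?thesis by (intro nev_I[of "norm ` {z. \<not> Q z}" 0]) (auto intro: negligible_imp_measurable)
qed

lemma nev_good_radius: "nonzero_mero f \<Longrightarrow> \<forall>\<^sub>F r in nev. good_radius f r"
  using eventually_conj[OF cosparse_nev[OF sing_cosparse[of f]] nev_ge[of 1]]
  by (auto elim!: eventually_mono simp: good_radius_def)

section \<open>Quantities that are o(r) off an exceptional set\<close>

text \<open>One-sided: \<open>X\<close> need not be bounded below. The exceptional set does not depend on \<open>\<epsilon>\<close>.\<close>

definition sm :: "(real \<Rightarrow> real) \<Rightarrow> bool" where
  "sm X \<longleftrightarrow> (\<exists>E\<in>lmeasurable. \<forall>\<epsilon>>0. \<forall>\<^sub>F r in inf at_top (principal (- E)). X r \<le> \<epsilon> * r)"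

lemma sm_ev:
  assumes "sm X" "\<epsilon> > 0" shows "\<forall>\<^sub>F r in nev. X r \<le> \<epsilon> * r"
  using assms unfolding sm_def eventually_at_top_principal eventually_nev by meson

lemma sm_mono:
  assumes "sm Y" "\<forall>\<^sub>F r in nev. X r \<le> Y r" shows "sm X"
proof -
  obtain E where E: "E \<in> lmeasurable" "\<And>\<epsilon>. \<epsilon> > 0 \<Longrightarrow> \<exists>r0. \<forall>r\<ge>r0. r \<notin> E \<longrightarrow> Y r \<le> \<epsilon> * r"
    using assms(1) unfolding sm_def eventually_at_top_principal by blast
  obtain E' r1 where E': "E' \<in> lmeasurable" "\<And>r. r \<ge> r1 \<Longrightarrow> r \<notin> E' \<Longrightarrow> X r \<le> Y r"
    using assms(2) unfolding eventually_nev by blast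
  show ?thesis unfolding sm_def eventually_at_top_principal
  proof (intro bexI[of _ "E \<union> E'"] allI impI)
    fix \<epsilon> :: real assume "\<epsilon> > 0"
    then obtain r0 where r0: "\<And>r. r \<ge> r0 \<Longrightarrow> r \<notin> E \<Longrightarrow> Y r \<le> \<epsilon> * r" using E(2) by blast
    show "\<exists>r0. \<forall>r\<ge>r0. r \<notin> E \<union> E' \<longrightarrow> X r \<le> \<epsilon> * r"
      by (intro exI[of _ "max r0 r1"] allI impI order_trans[OF E'(2) r0]) auto
  qed (use E E' in \<open>auto intro: fmeasurable.Un\<close>)
qed

lemma sm_add:
  assumes "sm X" "sm Y" shows "sm (\<lambda>r. X r + Y r)"
proof -
  obtain E where E: "E \<in> lmeasurable" "\<And>\<epsilon>. \<epsilon> > 0 \<Longrightarrow> \<exists>r0. \<forall>r\<ge>r0. r \<notin> E \<longrightarrow> X r \<le> \<epsilon> * r"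
    using assms(1) unfolding sm_def eventually_at_top_principal by blast
  obtain E' where E': "E' \<in> lmeasurable" "\<And>\<epsilon>. \<epsilon> > 0 \<Longrightarrow> \<exists>r0. \<forall>r\<ge>r0. r \<notin> E' \<longrightarrow> Y r \<le> \<epsilon> * r"
    using assms(2) unfolding sm_def eventually_at_top_principal by blast
  show ?thesis unfolding sm_def eventually_at_top_principal
  proof (intro bexI[of _ "E \<union> E'"] allI impI)
    fix \<epsilon> :: real assume "\<epsilon> > 0"
    hence e: "\<epsilon> / 2 > 0" by simp
    obtain r0 where r0: "\<And>r. r \<ge> r0 \<Longrightarrow> r \<notin> E \<Longrightarrow> X r \<le> \<epsilon> / 2 * r" using E(2)[OF e] by blast
    obtain r1 where r1: "\<And>r. r \<ge> r1 \<Longrightarrow> r \<notin> E' \<Longrightarrow> Y r \<le> \<epsilon> / 2 * r" using E'(2)[OF e] by blast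
    have "X r + Y r \<le> \<epsilon> * r" if "r \<ge> max r0 r1" "r \<notin> E \<union> E'" for r
      using r0[of r] r1[of r] that by auto
    thus "\<exists>r0. \<forall>r\<ge>r0. r \<notin> E \<union> E' \<longrightarrow> X r + Y r \<le> \<epsilon> * r" by blast
  qed (use E E' in \<open>auto intro: fmeasurable.Un\<close>)
qed

lemma sm_cmult:
  assumes "sm X" "c \<ge> 0" shows "sm (\<lambda>r. c * X r)"
proof -
  obtain E where E: "E \<in> lmeasurable" "\<And>\<epsilon>. \<epsilon> > 0 \<Longrightarrow> \<exists>r0. \<forall>r\<ge>r0. r \<notin> E \<longrightarrow> X r \<le> \<epsilon> * r"
    using assms(1) unfolding sm_def eventually_at_top_principal by blast
  show ?thesis unfolding sm_def eventually_at_top_principal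
  proof (intro bexI[OF _ E(1)] allI impI)
    fix \<epsilon> :: real assume "\<epsilon> > 0"
    hence e: "\<epsilon> / (c + 1) > 0" using assms by simp
    obtain r0 where r0: "\<And>r. r \<ge> r0 \<Longrightarrow> r \<notin> E \<Longrightarrow> X r \<le> \<epsilon> / (c + 1) * r" using E(2)[OF e] by blast
    have "c * X r \<le> \<epsilon> * r" if "r \<ge> max r0 0" "r \<notin> E" for r
    proof -
      have "c * X r \<le> c * (\<epsilon> / (c + 1) * r)" using r0[of r] that assms by (intro mult_left_mono) auto
      also have "\<dots> = c / (c + 1) * (\<epsilon> * r)" by simp
      also have "\<dots> \<le> 1 * (\<epsilon> * r)" using assms \<open>\<epsilon> > 0\<close> that by (intro mult_right_mono) auto
      finally show ?thesis by simp
    qed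
    thus "\<exists>r0. \<forall>r\<ge>r0. r \<notin> E \<longrightarrow> c * X r \<le> \<epsilon> * r" by blast
  qed
qed

lemma sm_ln: "sm (\<lambda>r. c * ln r + d)"
  unfolding sm_def
proof (intro bexI[of _ "{}"] allI impI)
  fix \<epsilon> :: real assume "\<epsilon> > 0"
  have "((\<lambda>r. (c * ln r + d) / r) \<longlongrightarrow> 0) at_top" by real_asymp
  hence "\<forall>\<^sub>F r in at_top. (c * ln r + d) / r < \<epsilon>" using \<open>\<epsilon> > 0\<close> by (rule order_tendstoD)
  hence "\<forall>\<^sub>F r in at_top. c * ln r + d \<le> \<epsilon> * r"
    using eventually_gt_at_top[of 0] by eventually_elim (simp add: field_simps)
  thus "\<forall>\<^sub>F r in inf at_top (principal (- {})). c * ln r + d \<le> \<epsilon> * r" by simp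
qed auto

lemma sm_const: "sm (\<lambda>r. d)"
  using sm_ln[of 0 d] by simp

lemma sm_contradiction:
  assumes "sm X" "c > 0" "\<forall>\<^sub>F r in nev. c * r \<le> X r" shows False
proof -
  have "\<forall>\<^sub>F r in nev. X r \<le> c / 2 * r" using assms by (intro sm_ev) auto
  with assms(3) have "\<forall>\<^sub>F r in nev. False"
    using nev_ge[of 1]
  proof eventually_elim
    case (elim r)
    have "c / 2 * r = c * r / 2" "0 < c * r" using elim(3) assms(2) by auto
    thus False using elim by linarith
  qed
  thus False by simp
qed

section \<open>Functions of moderate growth off the exceptional set\<close>

lemma poly_analytic: "poly p analytic_on (A :: complex set)"
  by (rule analytic_on_subset[of _ UNIV])
     (auto simp: analytic_on_open holomorphic_on_def field_differentiable_def intro: poly_DERIV[THEN DERIV_subset])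

lemma poly_large:
  fixes p :: "complex poly" assumes "p \<noteq> 0"
  obtains c r0 where "c > 0" "\<And>z. norm z \<ge> r0 \<Longrightarrow> norm (poly p z) \<ge> c"
proof (cases "degree p = 0")
  case True
  then obtain a where "p = [:a:]" by (metis degree_eq_zeroE)
  thus ?thesis using assms that[of "norm a" 0] by auto
next
  case False
  hence "filterlim (poly p) at_infinity at_infinity" by (intro filterlim_poly_at_infinity) auto
  hence "\<forall>\<^sub>F z in at_infinity. 1 \<le> norm (poly p z)"
    using filterlim_at_infinity[of 0 "poly p" at_infinity] by auto
  thus ?thesis using that[of 1] unfolding eventually_at_infinity by force
qed

text \<open>The index is abstract so that two situations share one theory: pairs of radii (r, R),
  where \<kappa> contains T(R, f), and single radii with \<kappa> equal to the radius.\<close>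

locale scale =
  fixes Fl :: "'i filter" and \<rho> \<kappa> :: "'i \<Rightarrow> real"
  assumes \<rho>_lim: "filterlim \<rho> nev Fl" and \<kappa>_ge: "\<forall>\<^sub>F i in Fl. \<rho> i \<le> \<kappa> i"
begin

lemma \<rho>_ev: "eventually P nev \<Longrightarrow> \<forall>\<^sub>F i in Fl. P (\<rho> i)"
  using \<rho>_lim by (simp add: filterlim_iff)

lemma \<rho>_ge: "\<forall>\<^sub>F i in Fl. x \<le> \<rho> i"
  using \<rho>_ev[OF nev_ge] .

lemma \<kappa>_ge': "\<forall>\<^sub>F i in Fl. x \<le> \<kappa> i"
  using \<kappa>_ge \<rho>_ge[of x] by eventually_elim simp

text \<open>The bound is required on neighbourhoods of the circles so that Cauchy's estimate makes it stable
  under differentiation. The scale \<open>\<kappa> = \<rho>\<close> is only available once \<open>T(r, f) = O(r)\<close> is known; before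
  that, \<open>\<kappa>\<close> involves the characteristic at a larger radius.\<close>

definition tame :: "(complex \<Rightarrow> complex) \<Rightarrow> bool" where
  "tame u \<longleftrightarrow> u meromorphic_on UNIV \<and> (\<exists>M. \<forall>\<^sub>F i in Fl. \<forall>z w.
     norm z = \<rho> i \<and> norm (w - z) \<le> 1 / \<kappa> i ^ M \<longrightarrow> u analytic_on {w} \<and> norm (u w) \<le> \<kappa> i ^ M)"

lemma tame_mero [dest]: "tame u \<Longrightarrow> u meromorphic_on A"
  unfolding tame_def by (meson meromorphic_on_subset subset_UNIV)

lemma tameE:
  assumes "tame u"
  obtains M0 where "\<And>M. M \<ge> M0 \<Longrightarrow> \<forall>\<^sub>F i in Fl. \<forall>z w.
     norm z = \<rho> i \<and> norm (w - z) \<le> 1 / \<kappa> i ^ M \<longrightarrow> u analytic_on {w} \<and> norm (u w) \<le> \<kappa> i ^ M"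
proof -
  obtain M0 where M0: "\<forall>\<^sub>F i in Fl. \<forall>z w.
     norm z = \<rho> i \<and> norm (w - z) \<le> 1 / \<kappa> i ^ M0 \<longrightarrow> u analytic_on {w} \<and> norm (u w) \<le> \<kappa> i ^ M0"
    using assms unfolding tame_def by blast
  have "\<forall>\<^sub>F i in Fl. \<forall>z w.
     norm z = \<rho> i \<and> norm (w - z) \<le> 1 / \<kappa> i ^ M \<longrightarrow> u analytic_on {w} \<and> norm (u w) \<le> \<kappa> i ^ M"
    if M: "M \<ge> M0" for M
    using M0 \<kappa>_ge'[of 1]
  proof eventually_elim
    case (elim i)
    have "\<kappa> i ^ M0 \<le> \<kappa> i ^ M" using elim(2) M by (intro power_increasing)
    moreover from this have "1 / \<kappa> i ^ M \<le> 1 / \<kappa> i ^ M0" using elim(2) by (intro divide_left_mono) auto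
    ultimately show ?case using elim(1) by (meson order_trans)
  qed
  thus ?thesis using that by blast
qed

lemma tame_bound:
  assumes "tame u"
  shows "\<exists>M. \<forall>\<^sub>F i in Fl. \<forall>z. norm z = \<rho> i \<longrightarrow> norm (u z) \<le> \<kappa> i ^ M"
proof -
  obtain M where "\<forall>\<^sub>F i in Fl. \<forall>z w.
     norm z = \<rho> i \<and> norm (w - z) \<le> 1 / \<kappa> i ^ M \<longrightarrow> u analytic_on {w} \<and> norm (u w) \<le> \<kappa> i ^ M"
    using assms unfolding tame_def by blast
  with \<kappa>_ge'[of 1] have "\<forall>\<^sub>F i in Fl. \<forall>z. norm z = \<rho> i \<longrightarrow> norm (u z) \<le> \<kappa> i ^ M"
  proof eventually_elim
    case (elim i)
    show ?case using elim(1) elim(2)[rule_format, of z z for z] by simp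
  qed
  thus ?thesis by blast
qed

lemma tame_bounded:
  assumes "u meromorphic_on UNIV"
    "\<forall>\<^sub>F i in Fl. \<forall>z w. norm z = \<rho> i \<and> norm (w - z) \<le> 1 \<longrightarrow> u analytic_on {w} \<and> norm (u w) \<le> \<kappa> i ^ M"
  shows "tame u"
  unfolding tame_def
proof (intro conjI assms(1) exI[of _ M])
  show "\<forall>\<^sub>F i in Fl. \<forall>z w. norm z = \<rho> i \<and> norm (w - z) \<le> 1 / \<kappa> i ^ M \<longrightarrow> u analytic_on {w} \<and> norm (u w) \<le> \<kappa> i ^ M"
    using assms(2) \<kappa>_ge'[of 1]
  proof eventually_elim
    case (elim i)
    have "1 / \<kappa> i ^ M \<le> 1" using elim(2) by (simp add: divide_le_eq_1 one_le_power)
    thus ?case using elim(1) by (meson order_trans)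
  qed
qed

lemma tame_const [intro, simp]: "tame (\<lambda>_. c)"
proof (rule tame_bounded[of _ 1])
  show "\<forall>\<^sub>F i in Fl. \<forall>z w. norm z = \<rho> i \<and> norm (w - z) \<le> 1 \<longrightarrow> (\<lambda>_. c) analytic_on {w} \<and> norm c \<le> \<kappa> i ^ 1"
    using \<kappa>_ge'[of "norm c"] by eventually_elim auto
qed auto

lemma tame_id: "tame (\<lambda>z. z)"
proof (rule tame_bounded[of _ 2])
  show "\<forall>\<^sub>F i in Fl. \<forall>z w. norm z = \<rho> i \<and> norm (w - z) \<le> 1 \<longrightarrow> (\<lambda>z. z) analytic_on {w} \<and> norm w \<le> \<kappa> i ^ 2"
    using \<kappa>_ge \<kappa>_ge'[of 2]
  proof eventually_elim
    case (elim i)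
    show ?case
    proof safe
      fix z w :: complex assume zw: "norm z = \<rho> i" "norm (w - z) \<le> 1"
      have "norm w \<le> norm z + norm (w - z)" using norm_triangle_ineq[of z "w - z"] by simp
      also have "\<dots> \<le> \<kappa> i + \<kappa> i" using zw elim by simp
      also have "\<dots> \<le> \<kappa> i ^ 2" using elim(2) by (simp add: power2_eq_square)
      finally show "norm w \<le> \<kappa> i ^ 2" .
    qed auto
  qed
qed auto

lemma tame_add [intro]:
  assumes "tame u" "tame v" shows "tame (\<lambda>z. u z + v z)"
proof -
  obtain M1 where M1: "\<And>M. M \<ge> M1 \<Longrightarrow> \<forall>\<^sub>F i in Fl. \<forall>z w.
     norm z = \<rho> i \<and> norm (w - z) \<le> 1 / \<kappa> i ^ M \<longrightarrow> u analytic_on {w} \<and> norm (u w) \<le> \<kappa> i ^ M"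
    using tameE[OF assms(1)] by blast
  obtain M2 where M2: "\<And>M. M \<ge> M2 \<Longrightarrow> \<forall>\<^sub>F i in Fl. \<forall>z w.
     norm z = \<rho> i \<and> norm (w - z) \<le> 1 / \<kappa> i ^ M \<longrightarrow> v analytic_on {w} \<and> norm (v w) \<le> \<kappa> i ^ M"
    using tameE[OF assms(2)] by blast
  define M where "M = max M1 M2"
  have M12: "M1 \<le> M" "M2 \<le> M" by (auto simp: M_def)
  have "\<forall>\<^sub>F i in Fl. \<forall>z w. norm z = \<rho> i \<and> norm (w - z) \<le> 1 / \<kappa> i ^ Suc M \<longrightarrow>
    (\<lambda>z. u z + v z) analytic_on {w} \<and> norm (u w + v w) \<le> \<kappa> i ^ Suc M"
    using M1[OF M12(1)] M2[OF M12(2)] \<kappa>_ge'[of 2]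
  proof (eventually_elim)
    case (elim i)
    have k: "\<kappa> i ^ M \<le> \<kappa> i ^ Suc M" "2 * \<kappa> i ^ M \<le> \<kappa> i ^ Suc M" "\<kappa> i ^ M > 0"
      using elim by (auto intro!: power_increasing mult_right_mono)
    show ?case
    proof safe
      fix z w :: complex assume zw: "norm z = \<rho> i" "norm (w - z) \<le> 1 / \<kappa> i ^ Suc M"
      have "1 / \<kappa> i ^ Suc M \<le> 1 / \<kappa> i ^ M" using k by (intro divide_left_mono) auto
      hence zw': "norm (w - z) \<le> 1 / \<kappa> i ^ M" using zw by linarith
      hence uv: "u analytic_on {w}" "norm (u w) \<le> \<kappa> i ^ M" "v analytic_on {w}" "norm (v w) \<le> \<kappa> i ^ M"
        using elim zw(1) by blast+
      thus "(\<lambda>z. u z + v z) analytic_on {w}" by (intro analytic_intros)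
      show "norm (u w + v w) \<le> \<kappa> i ^ Suc M" using uv k norm_triangle_ineq[of "u w" "v w"] by linarith
    qed
  qed
  moreover have "(\<lambda>z. u z + v z) meromorphic_on UNIV" using assms by (auto intro!: meromorphic_intros)
  ultimately show ?thesis unfolding tame_def by blast
qed

lemma tame_mult [intro]:
  assumes "tame u" "tame v" shows "tame (\<lambda>z. u z * v z)"
proof -
  obtain M1 where M1: "\<And>M. M \<ge> M1 \<Longrightarrow> \<forall>\<^sub>F i in Fl. \<forall>z w.
     norm z = \<rho> i \<and> norm (w - z) \<le> 1 / \<kappa> i ^ M \<longrightarrow> u analytic_on {w} \<and> norm (u w) \<le> \<kappa> i ^ M"
    using tameE[OF assms(1)] by blast
  obtain M2 where M2: "\<And>M. M \<ge> M2 \<Longrightarrow> \<forall>\<^sub>F i in Fl. \<forall>z w.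
     norm z = \<rho> i \<and> norm (w - z) \<le> 1 / \<kappa> i ^ M \<longrightarrow> v analytic_on {w} \<and> norm (v w) \<le> \<kappa> i ^ M"
    using tameE[OF assms(2)] by blast
  define M where "M = max M1 M2"
  have M12: "M1 \<le> M" "M2 \<le> M" by (auto simp: M_def)
  have "\<forall>\<^sub>F i in Fl. \<forall>z w. norm z = \<rho> i \<and> norm (w - z) \<le> 1 / \<kappa> i ^ (M + M) \<longrightarrow>
    (\<lambda>z. u z * v z) analytic_on {w} \<and> norm (u w * v w) \<le> \<kappa> i ^ (M + M)"
    using M1[OF M12(1)] M2[OF M12(2)] \<kappa>_ge'[of 2]
  proof (eventually_elim)
    case (elim i)
    have k: "\<kappa> i ^ M \<le> \<kappa> i ^ (M + M)" "\<kappa> i ^ M > 0"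
      using elim by (auto intro!: power_increasing)
    show ?case
    proof safe
      fix z w :: complex assume zw: "norm z = \<rho> i" "norm (w - z) \<le> 1 / \<kappa> i ^ (M + M)"
      have "1 / \<kappa> i ^ (M + M) \<le> 1 / \<kappa> i ^ M" using k by (intro divide_left_mono) auto
      hence zw': "norm (w - z) \<le> 1 / \<kappa> i ^ M" using zw by linarith
      hence uv: "u analytic_on {w}" "norm (u w) \<le> \<kappa> i ^ M" "v analytic_on {w}" "norm (v w) \<le> \<kappa> i ^ M"
        using elim zw(1) by blast+
      thus "(\<lambda>z. u z * v z) analytic_on {w}" by (intro analytic_intros)
      show "norm (u w * v w) \<le> \<kappa> i ^ (M + M)"
        unfolding norm_mult power_add using uv k by (intro mult_mono) auto
    qed
  qed
  moreover have "(\<lambda>z. u z * v z) meromorphic_on UNIV" using assms by (auto intro!: meromorphic_intros)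
  ultimately show ?thesis unfolding tame_def by blast
qed

text \<open>Cauchy's estimate on a disc of half the admissible radius about w, which stays inside
  the admissible disc about z. The exponent grows from M to 2M + 1.\<close>

lemma tame_deriv [intro]:
  assumes "tame u" shows "tame (deriv u)"
proof -
  obtain M where M: "\<forall>\<^sub>F i in Fl. \<forall>z w.
     norm z = \<rho> i \<and> norm (w - z) \<le> 1 / \<kappa> i ^ M \<longrightarrow> u analytic_on {w} \<and> norm (u w) \<le> \<kappa> i ^ M"
    using assms unfolding tame_def by blast
  have "\<forall>\<^sub>F i in Fl. \<forall>z w. norm z = \<rho> i \<and> norm (w - z) \<le> 1 / \<kappa> i ^ Suc (M + M) \<longrightarrow>
    deriv u analytic_on {w} \<and> norm (deriv u w) \<le> \<kappa> i ^ Suc (M + M)"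
    using M \<kappa>_ge'[of 2]
  proof eventually_elim
    case (elim i)
    have k: "\<kappa> i ^ M > 0" "\<kappa> i ^ M \<le> \<kappa> i ^ (M + M)"
      using elim by (auto intro!: power_increasing)
    have k2: "2 * \<kappa> i ^ M \<le> \<kappa> i ^ Suc (M + M)" "2 * \<kappa> i ^ (M + M) \<le> \<kappa> i ^ Suc (M + M)"
      using mult_mono[of 2 "\<kappa> i" "\<kappa> i ^ M" "\<kappa> i ^ (M + M)"] k elim by (auto intro!: mult_right_mono)
    define e where "e = 1 / (2 * \<kappa> i ^ M)"
    have e: "e > 0" "1 / \<kappa> i ^ Suc (M + M) \<le> e" "2 * e = 1 / \<kappa> i ^ M"
      unfolding e_def using k k2 by (auto intro!: divide_left_mono mult_pos_pos)
    show ?case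
    proof (intro allI impI)
      fix z w :: complex assume zw: "norm z = \<rho> i \<and> norm (w - z) \<le> 1 / \<kappa> i ^ Suc (M + M)"
      have *: "u analytic_on {x}" "norm (u x) \<le> \<kappa> i ^ M" if "norm (w - x) \<le> e" for x :: complex
      proof -
        have "norm (x - z) \<le> norm (w - z) + norm (w - x)"
          using norm_triangle_ineq4[of "w - z" "w - x"] by simp
        also have "\<dots> \<le> 1 / \<kappa> i ^ M" using that zw e by linarith
        finally show "u analytic_on {x}" "norm (u x) \<le> \<kappa> i ^ M" using elim(1) zw by blast+
      qed
      have an: "u analytic_on cball w e" using * by (subst analytic_on_analytic_at) (auto simp: dist_norm)
      have "norm ((deriv ^^ 1) u w) \<le> fact 1 * \<kappa> i ^ M / e ^ 1"
        using an * e(1) by (intro Cauchy_inequality analytic_imp_holomorphic holomorphic_on_imp_continuous_on)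
          (auto intro: analytic_on_subset)
      also have "\<dots> = 2 * \<kappa> i ^ (M + M)" unfolding e_def using k by (simp add: power_add)
      also note k2(2)
      finally show "deriv u analytic_on {w} \<and> norm (deriv u w) \<le> \<kappa> i ^ Suc (M + M)"
        using *(1)[of w] e(1) by (auto intro: analytic_deriv)
    qed
  qed
  moreover have "deriv u meromorphic_on UNIV" using assms by (auto intro!: meromorphic_intros)
  ultimately show ?thesis unfolding tame_def by blast
qed

lemma tame_uminus [intro]: "tame u \<Longrightarrow> tame (\<lambda>z. - u z)"
  using tame_mult[OF tame_const[of "-1"]] by simp

lemma tame_diff [intro]: "tame u \<Longrightarrow> tame v \<Longrightarrow> tame (\<lambda>z. u z - v z)"
  using tame_add[OF _ tame_uminus] by simp

lemma tame_power [intro]: "tame u \<Longrightarrow> tame (\<lambda>z. u z ^ k)"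
  by (induction k) auto

lemma tame_sum [intro]: "(\<And>i. i \<in> I \<Longrightarrow> tame (u i)) \<Longrightarrow> tame (\<lambda>z. \<Sum>i\<in>I. u i z)"
  by (induction I rule: infinite_finite_induct) auto

lemma tame_prod [intro]: "(\<And>i. i \<in> I \<Longrightarrow> tame (u i)) \<Longrightarrow> tame (\<lambda>z. \<Prod>i\<in>I. u i z)"
  by (induction I rule: infinite_finite_induct) auto

lemma tame_poly: "tame (\<lambda>z. poly p z)"
proof (induction p)
  case (pCons a p)
  thus ?case using tame_add[OF tame_const[of a] tame_mult[OF tame_id pCons.IH]] by simp
qed simp

lemma tame_inverse_poly:
  assumes "p \<noteq> 0" shows "tame (\<lambda>z. 1 / poly p z)"
proof -
  obtain c r0 where c: "c > 0" "\<And>z. norm z \<ge> r0 \<Longrightarrow> norm (poly p z) \<ge> c"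
    using poly_large[OF assms] by blast
  show ?thesis
  proof (rule tame_bounded[of _ 1])
    show "\<forall>\<^sub>F i in Fl. \<forall>z w. norm z = \<rho> i \<and> norm (w - z) \<le> 1 \<longrightarrow>
      (\<lambda>z. 1 / poly p z) analytic_on {w} \<and> norm (1 / poly p w) \<le> \<kappa> i ^ 1"
      using \<rho>_ge[of "r0 + 1"] \<kappa>_ge'[of "1 / c"]
    proof eventually_elim
      case (elim i)
      show ?case
      proof (intro allI impI)
        fix z w :: complex assume zw: "norm z = \<rho> i \<and> norm (w - z) \<le> 1"
        have "norm z \<le> norm w + norm (w - z)" using norm_triangle_ineq4[of w "w - z"] by simp
        hence "norm w \<ge> r0" using zw elim by linarith
        hence w: "norm (poly p w) \<ge> c" by (rule c)
        hence "norm (1 / poly p w) \<le> 1 / c" using c(1) by (auto simp: norm_divide intro!: divide_left_mono mult_pos_pos)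
        moreover have "poly p w \<noteq> 0" using w c(1) by auto
        ultimately show "(\<lambda>z. 1 / poly p z) analytic_on {w} \<and> norm (1 / poly p w) \<le> \<kappa> i ^ 1"
          using elim by (auto intro!: analytic_intros poly_analytic)
      qed
    qed
  qed (intro meromorphic_intros analytic_on_imp_meromorphic_on[OF poly_analytic])
qed

lemma tame_ratfun: "tame (ratfun_eval q)"
proof -
  have "snd (quot_of_fract q) \<noteq> 0" by simp
  from tame_mult[OF tame_poly[of "fst (quot_of_fract q)"] tame_inverse_poly[OF this]]
  show ?thesis unfolding ratfun_eval_def by (simp add: fun_eq_iff)
qed

end

text \<open>Agreement off a sparse set holds in a punctured neighbourhood of every point, hence in a
  full neighbourhood of each point where the values agree too; there the derivatives
  coincide.\<close>

lemma meromorphic_deriv_cong: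
  assumes "\<forall>\<^sub>\<approx>z. u z = (v z :: complex)" shows "\<forall>\<^sub>\<approx>z. deriv u z = deriv v z"
proof -
  have "\<forall>\<^sub>\<approx>z. \<forall>\<^sub>F w in at z. u w = v w"
    using cosparse_eventually_at[OF assms] by simp
  with assms show ?thesis
  proof eventually_elim
    case (elim z)
    hence "\<forall>\<^sub>F w in nhds z. u w = v w" by (auto simp: eventually_at_filter elim: eventually_mono)
    thus ?case by (rule deriv_cong_ev) simp
  qed
qed

subsection \<open>Differential polynomials at a given scale\<close>

locale log_deriv_scale = scale Fl \<rho> \<kappa> for Fl :: "'i filter" and \<rho> \<kappa> +
  fixes f :: "complex \<Rightarrow> complex"
  assumes f_nz: "nonzero_mero f" and ld: "tame (\<lambda>z. deriv f z / f z)"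
begin

text \<open>\<open>q k\<close> is the quotient of the k-th derivative of f by f, generated from f'/f
  alone. Tameness of f'/f therefore gives tameness of all of them.\<close>

primrec q :: "nat \<Rightarrow> complex \<Rightarrow> complex" where
  "q 0 = (\<lambda>z. 1)"
| "q (Suc k) = (\<lambda>z. deriv (q k) z + q k z * (deriv f z / f z))"

lemma tame_q: "tame (q k)"
proof (induction k)
  case (Suc k)
  thus ?case unfolding q.simps by (intro tame_add tame_deriv tame_mult ld)
qed simp

lemma analytic_ld: "w \<notin> sing f \<Longrightarrow> (\<lambda>z. deriv f z / f z) analytic_on {w}"
  by (auto simp: sing_def intro!: analytic_intros analytic_deriv)

lemma higher_deriv_eq_q:
  "w \<notin> sing f \<Longrightarrow> q k analytic_on {w} \<and> (deriv ^^ k) f w = q k w * f w"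
proof (induction k arbitrary: w)
  case (Suc k)
  have fa: "f analytic_on {w}" "f w \<noteq> 0" using Suc.prems by (auto simp: sing_def)
  have qa: "q k analytic_on {w}" using Suc by blast
  have "\<forall>\<^sub>F x in nhds w. x \<in> - sing f"
    using closed_sing[OF f_nz] Suc.prems by (intro eventually_nhds_in_open) auto
  hence "\<forall>\<^sub>F x in nhds w. (deriv ^^ k) f x = q k x * f x"
    by eventually_elim (use Suc.IH in auto)
  hence "deriv ((deriv ^^ k) f) w = deriv (\<lambda>x. q k x * f x) w" by (rule deriv_cong_ev) simp
  also have "\<dots> = q k w * deriv f w + deriv (q k) w * f w"
    using fa qa by (intro deriv_mult) (auto simp: analytic_on_imp_differentiable_at)
  finally show ?case using fa qa analytic_ld[OF Suc.prems]
    by (auto simp: algebra_simps intro!: analytic_intros analytic_deriv)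
qed simp

text \<open>Polynomials in f itself with tame coefficients. Replacing f' by (f'/f) f keeps this
  class stable under differentiation without raising the degree, so derivatives of f need not be
  tracked.\<close>

definition form :: "nat \<Rightarrow> (complex \<Rightarrow> complex) \<Rightarrow> bool" where
  "form d u \<longleftrightarrow> (\<exists>c. (\<forall>i. tame (c i)) \<and> (\<forall>\<^sub>\<approx>z. u z = (\<Sum>i\<le>d. c i z * f z ^ i)))"

lemma formE:
  assumes "form d u"
  obtains c where "\<And>i. tame (c i)" "\<forall>\<^sub>\<approx>z. u z = (\<Sum>i\<le>d. c i z * f z ^ i)"
  using assms unfolding form_def by blast

lemma form_add: assumes "form d u" "form d v" shows "form d (\<lambda>z. u z + v z)"
proof -
  obtain a where a: "\<And>i. tame (a i)" "\<forall>\<^sub>\<approx>z. u z = (\<Sum>i\<le>d. a i z * f z ^ i)"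
    using formE[OF assms(1)] by blast
  obtain b where b: "\<And>i. tame (b i)" "\<forall>\<^sub>\<approx>z. v z = (\<Sum>i\<le>d. b i z * f z ^ i)"
    using formE[OF assms(2)] by blast
  note * = a b
  have "\<forall>\<^sub>\<approx>z. u z + v z = (\<Sum>i\<le>d. (a i z + b i z) * f z ^ i)"
    using *(2,4) by eventually_elim (simp add: distrib_right sum.distrib)
  moreover have "tame (\<lambda>z. a i z + b i z)" for i using * by auto
  ultimately show ?thesis unfolding form_def by (intro exI[of _ "\<lambda>i z. a i z + b i z"]) auto
qed

lemma form_mult: assumes "form d u" "tame t" shows "form d (\<lambda>z. t z * u z)"
proof -
  obtain a where *: "\<And>i. tame (a i)" "\<forall>\<^sub>\<approx>z. u z = (\<Sum>i\<le>d. a i z * f z ^ i)"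
    using formE[OF assms(1)] by blast
  have "\<forall>\<^sub>\<approx>z. t z * u z = (\<Sum>i\<le>d. (t z * a i z) * f z ^ i)"
    using *(2) by eventually_elim (simp add: sum_distrib_left mult_ac)
  moreover have "tame (\<lambda>z. t z * a i z)" for i using * assms by auto
  ultimately show ?thesis unfolding form_def by (intro exI[of _ "\<lambda>i z. t z * a i z"]) auto
qed

lemma form_deriv: assumes "form d u" shows "form d (deriv u)"
proof -
  obtain a where *: "\<And>i. tame (a i)" "\<forall>\<^sub>\<approx>z. u z = (\<Sum>i\<le>d. a i z * f z ^ i)"
    using formE[OF assms(1)] by blast
  have "\<forall>\<^sub>\<approx>z. \<forall>i\<in>{..d}. a i analytic_on {z}"
    using *(1) by (intro eventually_ball_finite ballI meromorphic_on_imp_analytic_cosparse) auto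
  with sing_cosparse[OF f_nz] meromorphic_deriv_cong[OF *(2)]
  have "\<forall>\<^sub>\<approx>z. deriv u z = (\<Sum>i\<le>d. (deriv (a i) z + of_nat i * a i z * (deriv f z / f z)) * f z ^ i)"
  proof eventually_elim
    case (elim z)
    have fz: "f analytic_on {z}" "f z \<noteq> 0" using elim by (auto simp: sing_def)
    have df: "(f has_field_derivative deriv f z) (at z)"
      using fz by (simp add: analytic_on_imp_differentiable_at DERIV_deriv_iff_field_differentiable)
    have "((\<lambda>z. \<Sum>i\<le>d. a i z * f z ^ i) has_field_derivative
      (\<Sum>i\<le>d. (deriv (a i) z + of_nat i * a i z * (deriv f z / f z)) * f z ^ i)) (at z)"
    proof (rule DERIV_sum)
      fix i assume "i \<in> {..d}"
      hence "(a i has_field_derivative deriv (a i) z) (at z)"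
        using elim unfolding DERIV_deriv_iff_field_differentiable
        by (auto intro: analytic_on_imp_differentiable_at[of _ "{z}"])
      from DERIV_mult[OF this DERIV_power[OF df, of i]]
      have "((\<lambda>z. a i z * f z ^ i) has_field_derivative
        deriv (a i) z * f z ^ i + of_nat i * (deriv f z * f z ^ (i - Suc 0)) * a i z) (at z)" .
      moreover have "of_nat i * (deriv f z * f z ^ (i - Suc 0)) * a i z =
        of_nat i * a i z * (deriv f z / f z) * f z ^ i"
        using fz(2) by (cases i) auto
      ultimately show "((\<lambda>z. a i z * f z ^ i) has_field_derivative
        (deriv (a i) z + of_nat i * a i z * (deriv f z / f z)) * f z ^ i) (at z)"
        by (simp add: distrib_right)
    qed
    thus ?case using elim by (simp add: DERIV_imp_deriv)
  qed
  moreover have "tame (\<lambda>z. deriv (a i) z + of_nat i * a i z * (deriv f z / f z))" for i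
    using * ld by (intro tame_add tame_mult tame_deriv tame_const) auto
  ultimately show ?thesis unfolding form_def
    by (intro exI[of _ "\<lambda>i z. deriv (a i) z + of_nat i * a i z * (deriv f z / f z)"]) auto
qed

text \<open>A monomial of total degree i in the derivatives of f is a product of the functions
  \<open>q j\<close> times f^i. Monomials are then collected by total degree.\<close>

lemma form_diff_poly:
  assumes "diff_poly_degree P \<le> d" shows "form d (diff_poly_eval P f)"
proof -
  define ord where "ord = (\<lambda>l::nat \<Rightarrow>\<^sub>0 nat. \<Sum>j\<in>Poly_Mapping.keys l. Poly_Mapping.lookup l j)"
  define b where "b = (\<lambda>l z. ratfun_eval (Poly_Mapping.lookup P l) z *
        (\<Prod>j\<in>Poly_Mapping.keys l. q j z ^ Poly_Mapping.lookup l j))"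
  define c where "c = (\<lambda>i z. \<Sum>l | l \<in> Poly_Mapping.keys P \<and> ord l = i. b l z)"
  have "tame (c i)" for i
    unfolding c_def b_def by (intro tame_sum tame_mult tame_ratfun tame_prod tame_power tame_q)
  moreover have ordle: "ord l \<le> d" if "l \<in> Poly_Mapping.keys P" for l
  proof -
    have "ord l \<le> diff_poly_degree P" unfolding diff_poly_degree_def ord_def
      using that by (intro Max_ge) auto
    thus ?thesis using assms by simp
  qed
  have "\<forall>\<^sub>\<approx>z. diff_poly_eval P f z = (\<Sum>i\<le>d. c i z * f z ^ i)"
    using sing_cosparse[OF f_nz]
  proof eventually_elim
    case (elim z)
    have "(\<Prod>j\<in>Poly_Mapping.keys l. (deriv ^^ j) f z ^ Poly_Mapping.lookup l j) =
      (\<Prod>j\<in>Poly_Mapping.keys l. q j z ^ Poly_Mapping.lookup l j) * f z ^ ord l" for l :: "nat \<Rightarrow>\<^sub>0 nat"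
      unfolding ord_def power_sum prod.distrib[symmetric]
      using higher_deriv_eq_q[OF elim] by (intro prod.cong refl) (simp add: power_mult_distrib)
    hence "diff_poly_eval P f z = (\<Sum>l\<in>Poly_Mapping.keys P. b l z * f z ^ ord l)"
      unfolding diff_poly_eval_def b_def by (simp add: mult_ac)
    also have "\<dots> = (\<Sum>i\<le>d. \<Sum>l | l \<in> Poly_Mapping.keys P \<and> ord l = i. b l z * f z ^ ord l)"
      by (rule sum.group[symmetric]) (use ordle in auto)
    also have "\<dots> = (\<Sum>i\<le>d. c i z * f z ^ i)"
      unfolding c_def by (intro sum.cong refl) (auto simp: sum_distrib_right intro!: sum.cong)
    finally show ?case .
  qed
  ultimately show ?thesis unfolding form_def by blast
qed

lemma form_mono: assumes "form d u" "d \<le> e" shows "form e u"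
proof -
  obtain a where a: "\<And>i. tame (a i)" "\<forall>\<^sub>\<approx>z. u z = (\<Sum>i\<le>d. a i z * f z ^ i)"
    using formE[OF assms(1)] by blast
  have "(\<Sum>i\<le>d. a i z * f z ^ i) = (\<Sum>i\<le>e. (if i \<le> d then a i z else 0) * f z ^ i)" for z
    using assms(2) by (intro sum.mono_neutral_cong_left) auto
  hence "\<forall>\<^sub>\<approx>z. u z = (\<Sum>i\<le>e. (if i \<le> d then a i z else 0) * f z ^ i)" using a(2) by simp
  moreover have "tame (\<lambda>z. if i \<le> d then a i z else 0)" for i using a(1)[of i] by (cases "i \<le> d") auto
  ultimately show ?thesis unfolding form_def by (intro exI[of _ "\<lambda>i z. if i \<le> d then a i z else 0"]) auto
qed

lemma form_power: "form d (\<lambda>z. f z ^ d)"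
proof -
  have "f z ^ d = (\<Sum>i\<le>d. (if i = d then 1 else 0) * f z ^ i)" for z
    by (simp add: if_distrib[of "\<lambda>x. x * _"] cong: if_cong)
  moreover have "tame (\<lambda>z. if i = d then 1 else 0)" for i by simp
  ultimately show ?thesis unfolding form_def by (intro exI[of _ "\<lambda>i z. if i = d then 1 else 0"]) auto
qed

lemma form_cong:
  assumes "form d u" "\<forall>\<^sub>\<approx>z. u z = v z" shows "form d v"
proof -
  obtain a where a: "\<And>i. tame (a i)" "\<forall>\<^sub>\<approx>z. u z = (\<Sum>i\<le>d. a i z * f z ^ i)"
    using formE[OF assms(1)] by blast
  have "\<forall>\<^sub>\<approx>z. v z = (\<Sum>i\<le>d. a i z * f z ^ i)" using a(2) assms(2) by eventually_elim simp
  thus ?thesis using a(1) unfolding form_def by blast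
qed

lemma form_bound:
  assumes "form d u"
  shows "\<exists>M. \<forall>\<^sub>F i in Fl. \<forall>z. norm z = \<rho> i \<longrightarrow> norm (u z) \<le> \<kappa> i ^ M * max 1 (norm (f z)) ^ d"
proof -
  obtain c where *: "\<And>i. tame (c i)" "\<forall>\<^sub>\<approx>z. u z = (\<Sum>i\<le>d. c i z * f z ^ i)"
    using formE[OF assms(1)] by blast
  have "\<forall>j. \<exists>M. \<forall>\<^sub>F i in Fl. \<forall>z. norm z = \<rho> i \<longrightarrow> norm (c j z) \<le> \<kappa> i ^ M"
    using tame_bound[OF *(1)] by blast
  from choice[OF this] obtain M where M: "\<forall>j. \<forall>\<^sub>F i in Fl. \<forall>z. norm z = \<rho> i \<longrightarrow> norm (c j z) \<le> \<kappa> i ^ M j"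
    by blast
  define M' where "M' = Max (M ` {..d})"
  have "\<forall>\<^sub>F i in Fl. \<forall>j\<in>{..d}. \<forall>z. norm z = \<rho> i \<longrightarrow> norm (c j z) \<le> \<kappa> i ^ M j"
    using M by (intro eventually_ball_finite ballI) (simp, blast)
  with \<rho>_ev[OF cosparse_nev[OF *(2)]] \<kappa>_ge'[of 1] \<kappa>_ge'[of "real (Suc d)"]
  have "\<forall>\<^sub>F i in Fl. \<forall>z. norm z = \<rho> i \<longrightarrow> norm (u z) \<le> \<kappa> i ^ Suc M' * max 1 (norm (f z)) ^ d"
  proof eventually_elim
    case (elim i)
    show ?case
    proof (intro allI impI)
      fix z :: complex assume z: "norm z = \<rho> i"
      have "norm (u z) \<le> (\<Sum>j\<le>d. \<kappa> i ^ M' * max 1 (norm (f z)) ^ d)"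
        unfolding elim(1)[rule_format, OF z]
      proof (rule sum_norm_le)
        fix j assume j: "j \<in> {..d}"
        have "norm (c j z) \<le> \<kappa> i ^ M j" using elim(4) j z by blast
        also have "\<dots> \<le> \<kappa> i ^ M'" using elim(2) j unfolding M'_def by (intro power_increasing) auto
        finally have 1: "norm (c j z) \<le> \<kappa> i ^ M'" .
        have "norm (f z) ^ j \<le> max 1 (norm (f z)) ^ j" by (intro power_mono) auto
        also have "\<dots> \<le> max 1 (norm (f z)) ^ d" using j by (intro power_increasing) auto
        finally show "norm (c j z * f z ^ j) \<le> \<kappa> i ^ M' * max 1 (norm (f z)) ^ d"
          unfolding norm_mult norm_power using 1 elim(2) by (intro mult_mono) auto
      qed
      also have "\<dots> = real (Suc d) * (\<kappa> i ^ M' * max 1 (norm (f z)) ^ d)" by simp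
      also have "\<dots> \<le> \<kappa> i * (\<kappa> i ^ M' * max 1 (norm (f z)) ^ d)"
        using elim(2,3) by (intro mult_right_mono) auto
      finally show "norm (u z) \<le> \<kappa> i ^ Suc M' * max 1 (norm (f z)) ^ d" by (simp add: mult_ac)
    qed
  qed
  thus ?thesis by blast
qed

text \<open>Where |f| > 1, the equation and |u| \<le> \<kappa>^M |f|^(n-1) allow division by
  |f|^(n-1), which leaves |f| \<le> |h| + \<kappa>^M. This is where the gap between the degrees n
  and n - 1 is used.\<close>

lemma power_plus_form_bound:
  assumes "n \<ge> 1" "form (n - 1) u" "\<forall>\<^sub>\<approx>z. f z ^ n + u z = h z"
  shows "\<exists>M. \<forall>\<^sub>F i in Fl. \<forall>z. norm z = \<rho> i \<longrightarrow> norm (f z) \<le> 1 + norm (h z) + \<kappa> i ^ M"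
proof -
  obtain M where M: "\<forall>\<^sub>F i in Fl. \<forall>z. norm z = \<rho> i \<longrightarrow> norm (u z) \<le> \<kappa> i ^ M * max 1 (norm (f z)) ^ (n - 1)"
    using form_bound[OF assms(2)] by blast
  have "\<forall>\<^sub>F i in Fl. \<forall>z. norm z = \<rho> i \<longrightarrow> norm (f z) \<le> 1 + norm (h z) + \<kappa> i ^ M"
    using M \<rho>_ev[OF cosparse_nev[OF assms(3)]] \<kappa>_ge'[of 1]
  proof eventually_elim
    case (elim i)
    show ?case
    proof (intro allI impI)
      fix z :: complex assume z: "norm z = \<rho> i"
      show "norm (f z) \<le> 1 + norm (h z) + \<kappa> i ^ M"
      proof (cases "norm (f z) \<le> 1")
        case True
        have "\<kappa> i ^ M \<ge> 0" using elim(3) by auto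
        thus ?thesis using True norm_ge_zero[of "h z"] by linarith
      next
        case False
        define x where "x = norm (f z) ^ (n - 1)"
        have x: "x \<ge> 1" unfolding x_def using False by (intro one_le_power) auto
        have "f z ^ n = h z - u z" using elim(2) z by (auto simp: algebra_simps)
        hence "norm (f z) ^ n \<le> norm (h z) + norm (u z)"
          using norm_triangle_ineq4[of "h z" "u z"] by (simp flip: norm_power)
        also have "norm (u z) \<le> \<kappa> i ^ M * x" using elim(1) z False by (auto simp: x_def max_def)
        also have "norm (h z) \<le> norm (h z) * x" using x mult_left_mono[of 1 x "norm (h z)"] by simp
        also have "norm (f z) ^ n = norm (f z) * x" unfolding x_def using assms(1)
          by (cases n) auto
        finally have "norm (f z) * x \<le> (norm (h z) + \<kappa> i ^ M) * x" by (simp add: distrib_right)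
        hence "norm (f z) \<le> norm (h z) + \<kappa> i ^ M" using x by (simp add: mult_le_cancel_right)
        thus ?thesis by simp
      qed
    qed
  qed
  thus ?thesis by blast
qed

end

section \<open>Linear growth of the characteristic\<close>

text \<open>Cut [x, \<infinity>) into cells of length \<epsilon>. The cells before the first one not
  contained in E lie in E, so the distance skipped is charged to the measure of the part of E that
  was passed.\<close>

lemma ex_outside_small_skip:
  fixes E :: "real set"
  assumes E: "E \<in> lmeasurable" and "\<epsilon> > 0"
  obtains s where "s \<ge> x" "s \<notin> E" "s - x \<le> measure lebesgue (E \<inter> {x..<s}) + \<epsilon>"
proof -
  define Q where "Q = (\<lambda>j::nat. \<not> {x + real j * \<epsilon>..<x + real (Suc j) * \<epsilon>} \<subseteq> E)"
  have sub: "{x..<x + real j * \<epsilon>} \<subseteq> E" if "\<And>i. i < j \<Longrightarrow> \<not> Q i" for j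
    using that
  proof (induction j)
    case (Suc j)
    have "{x..<x + real (Suc j) * \<epsilon>} \<subseteq> {x..<x + real j * \<epsilon>} \<union> {x + real j * \<epsilon>..<x + real (Suc j) * \<epsilon>}"
      by auto
    moreover have "{x..<x + real j * \<epsilon>} \<subseteq> E" using Suc.IH Suc.prems by (meson less_SucI)
    moreover have "{x + real j * \<epsilon>..<x + real (Suc j) * \<epsilon>} \<subseteq> E"
      using Suc.prems[of j] unfolding Q_def by simp
    ultimately show ?case by (meson Un_least subset_trans)
  qed simp
  have "\<exists>j. Q j"
  proof (rule ccontr)
    assume "\<not> (\<exists>j. Q j)"
    hence all: "{x..<x + real j * \<epsilon>} \<subseteq> E" for j using sub by blast
    obtain j :: nat where j: "real j * \<epsilon> > measure lebesgue E"
      using reals_Archimedean3[OF assms(2)] by blast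
    have "measure lebesgue {x..<x + real j * \<epsilon>} \<le> measure lebesgue E"
      using all[of j] E by (intro measure_mono_fmeasurable) auto
    thus False using j assms(2) by simp
  qed
  then obtain j where j: "Q j" "\<And>i. i < j \<Longrightarrow> \<not> Q i" using exists_least_iff[of Q] by blast
  then obtain s where s: "s \<in> {x + real j * \<epsilon>..<x + real (Suc j) * \<epsilon>}" "s \<notin> E" unfolding Q_def by blast
  have j0: "real j * \<epsilon> \<ge> 0" using assms(2) by simp
  have "measure lebesgue {x..<x + real j * \<epsilon>} \<le> measure lebesgue (E \<inter> {x..<s})"
    using sub[OF j(2)] s E by (intro measure_mono_fmeasurable) (auto intro!: fmeasurable_Int_fmeasurable)
  hence "real j * \<epsilon> \<le> measure lebesgue (E \<inter> {x..<s})" using j0 by simp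
  moreover have "s - x \<le> real j * \<epsilon> + \<epsilon>" using s by (simp add: algebra_simps)
  ultimately have "s - x \<le> measure lebesgue (E \<inter> {x..<s}) + \<epsilon>" by linarith
  moreover have "s \<ge> x" using s(1) j0 by simp
  ultimately show ?thesis using that[of s] s(2) by blast
qed

text \<open>Borel's growth lemma: a point where \<open>T\<close> is large would start a bounded sequence of points
  along which \<open>T\<close> doubles forever.\<close>

lemma Borel_growth:
  fixes T :: "real \<Rightarrow> real" and G :: "real \<Rightarrow> bool"
  assumes mono: "\<And>r R. G r \<Longrightarrow> G R \<Longrightarrow> r < R \<Longrightarrow> T r \<le> T R"
    and dense: "\<And>x y. 0 \<le> x \<Longrightarrow> x < y \<Longrightarrow> \<exists>r. x < r \<and> r < y \<and> G r"
    and E: "E \<in> lmeasurable" and A: "A \<ge> 1"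
    and outside: "\<And>r. r \<ge> r0 \<Longrightarrow> r \<notin> E \<Longrightarrow> G r"
    and bound: "\<And>r R. r \<ge> r0 \<Longrightarrow> r \<notin> E \<Longrightarrow> r < R \<Longrightarrow> R \<le> r + 1 \<Longrightarrow> G R \<Longrightarrow>
      T r \<le> A * (r + ln (1 + T R) + ln (1 + 1 / (R - r)))"
  shows "\<exists>K. \<forall>r\<ge>max r0 1. G r \<longrightarrow> T r \<le> K * r"
proof -
  define m where "m = measure lebesgue E"
  \<comment> \<open>From ln y \<le> y - 1 at y = (1 + 8X)/(64A): the bound ln (1 + 8X) \<le> X/(8A)
    + c makes the two logarithms, after multiplication by A, cost only X/4 plus a constant.\<close>
  define c where "c = ln (64 * A)"
  define K where "K = 2 * A * (1 + (1 + m) + 2 * c) + 1"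
  have m0: "m \<ge> 0" by (simp add: m_def)
  have c0: "c \<ge> 0" unfolding c_def using A by simp
  have K1: "K \<ge> 1" unfolding K_def using A m0 c0 by (auto intro!: mult_nonneg_nonneg add_nonneg_nonneg)
  have ln_bd: "ln (1 + 8 * X) \<le> X / (8 * A) + c" if "X \<ge> 0" for X
  proof -
    have "ln ((1 + 8 * X) / (64 * A)) \<le> (1 + 8 * X) / (64 * A) - 1"
      using that A by (intro ln_le_minus_one) auto
    moreover have "ln ((1 + 8 * X) / (64 * A)) = ln (1 + 8 * X) - c"
      unfolding c_def using that A by (subst ln_div) auto
    moreover have "(1 + 8 * X) / (64 * A) = 1 / (64 * A) + X / (8 * A)" using A by (simp add: add_divide_distrib)
    moreover have "1 / (64 * A) \<le> 1" using A by simp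
    ultimately show ?thesis by linarith
  qed
  have "T r \<le> K * r" if r: "r \<ge> max r0 1" "G r" for r
  proof (rule ccontr)
    assume "\<not> T r \<le> K * r"
    hence big: "T r > K * r" by simp
    define t where "t = T r"
    have "1 * 1 \<le> K * r" using K1 r by (intro mult_mono) auto
    hence t1: "t \<ge> 1" using big unfolding t_def by linarith
    \<comment> \<open>The geometric sum accounts for the steps taken and the measure term for the
      stretches of E jumped over. All points stay within 1 + m of r, although T doubles at
      each.\<close>
    have seq: "\<exists>x\<ge>r. G x \<and> 2 ^ k * t \<le> T x \<and> x - r \<le> 1 - (1 / 2) ^ k + measure lebesgue (E \<inter> {r..<x})" for k
    proof (induction k)
      case 0
      show ?case using r by (intro exI[of _ r]) (auto simp: t_def)
    next
      case (Suc k)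
      then obtain x where x: "x \<ge> r" "G x" "2 ^ k * t \<le> T x"
        "x - r \<le> 1 - (1 / 2) ^ k + measure lebesgue (E \<inter> {r..<x})" by blast
      define e where "e = (1 / 2 :: real) ^ Suc k"
      have e: "e > 0" "e \<le> 1 / 2" unfolding e_def by (auto simp: power_le_one)
      obtain s where s: "s \<ge> x" "s \<notin> E" "s - x \<le> measure lebesgue (E \<inter> {x..<s}) + e / 2"
        using ex_outside_small_skip[OF E, of "e / 2" x] e by auto
      have Gs: "G s" using outside[of s] s x r by auto
      have Ts: "2 ^ k * t \<le> T s" using mono[OF x(2) Gs] x s by (cases "s = x") auto
      obtain y where y: "s + e / 4 < y" "y < s + e / 2" "G y"
        using dense[of "s + e / 4" "s + e / 2"] s x r e by auto
      have split: "measure lebesgue (E \<inter> {r..<b}) = measure lebesgue (E \<inter> {r..<a}) + measure lebesgue (E \<inter> {a..<b})"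
        if "r \<le> a" "a \<le> b" for a b
      proof -
        have "E \<inter> {r..<b} = (E \<inter> {r..<a}) \<union> (E \<inter> {a..<b})" using that by auto
        moreover have fm: "E \<inter> {x..<y} \<in> lmeasurable" for x y
          using E by (intro fmeasurable_Int_fmeasurable) auto
        have ne: "emeasure lebesgue (E \<inter> {x..<y}) \<noteq> \<infinity>" for x y
          using fmeasurableD2[OF fm] unfolding infinity_ennreal_def .
        have "measure lebesgue ((E \<inter> {r..<a}) \<union> (E \<inter> {a..<b})) =
            measure lebesgue (E \<inter> {r..<a}) + measure lebesgue (E \<inter> {a..<b})"
          by (rule measure_Union[OF ne ne fmeasurableD[OF fm] fmeasurableD[OF fm]]) auto
        ultimately show ?thesis by (simp only:)
      qed
      have sub: "measure lebesgue (E \<inter> {r..<b}) \<le> m" for b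
        unfolding m_def using E by (intro measure_mono_fmeasurable) (auto dest: fmeasurableD)
      have pos: "measure lebesgue (E \<inter> {s..<y}) \<ge> 0" by simp
      have sr: "s - r \<le> 1 - (1 / 2) ^ k + e / 2 + measure lebesgue (E \<inter> {r..<s})"
        using split[of x s] x s by linarith
      have pk: "(1 / 2 :: real) ^ k = 2 * e" by (simp add: e_def)
      have yr: "y - r \<le> 1 - (1 / 2) ^ Suc k + measure lebesgue (E \<inter> {r..<y})"
        using sr split[of s y] s x y pos pk e unfolding e_def[symmetric] by linarith
      have sL: "s \<le> r + (1 + m)" using sr sub[of s] pk e by linarith
      \<comment> \<open>Without doubling, the growth hypothesis between s and y would bound X = 2^k
        t by a constant times r plus X/4. By the choice of \<open>K\<close> this gives X < K r,
        contrary to K r < t \<le> X.\<close>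
      have Ty: "2 ^ Suc k * t \<le> T y"
      proof (rule ccontr)
        assume "\<not> 2 ^ Suc k * t \<le> T y"
        define X where "X = 2 ^ k * t"
        have X2: "T y \<le> 2 * X" using \<open>\<not> 2 ^ Suc k * t \<le> T y\<close> unfolding X_def by simp
        have Xt: "t \<le> X" unfolding X_def using t1 mult_right_mono[of 1 "2 ^ k" t] by simp
        have Xk: "2 ^ k \<le> X" unfolding X_def using t1 mult_left_mono[of 1 t "2 ^ k"] by simp
        have Typ: "T y \<ge> 0" using mono[OF Gs y(3)] y e Ts Xt t1 unfolding X_def by linarith
        have inv: "1 / (y - s) \<le> 8 * 2 ^ k"
        proof -
          have "1 / (y - s) \<le> 1 / (e / 4)" using y e by (intro divide_left_mono) auto
          also have "\<dots> = 8 * 2 ^ k" unfolding e_def by (simp add: power_divide)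
          finally show ?thesis .
        qed
        have "1 / (y - s) > 0" using y e by simp
        have "ln (1 + T y) \<le> ln (1 + 8 * X)" using Typ X2 Xt t1 by (intro ln_mono) auto
        moreover have "ln (1 + 1 / (y - s)) \<le> ln (1 + 8 * X)"
        proof (rule ln_mono)
          show "0 < 1 + 1 / (y - s)" using \<open>1 / (y - s) > 0\<close> by linarith
          show "1 + 1 / (y - s) \<le> 1 + 8 * X" using inv Xk by linarith
        qed
        moreover have "T s \<le> A * (s + ln (1 + T y) + ln (1 + 1 / (y - s)))"
          using s x r y e by (intro bound) auto
        ultimately have "T s \<le> A * (r + (1 + m) + 2 * ln (1 + 8 * X))"
          using sL A by (elim order_trans) (intro mult_left_mono, auto)
        also have "\<dots> \<le> A * (r + (1 + m) + 2 * (X / (8 * A) + c))"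
          using ln_bd[of X] Xt t1 A by (intro mult_left_mono add_left_mono) auto
        also have "\<dots> = A * (r + (1 + m) + 2 * c) + X / 4" using A by (simp add: algebra_simps)
        also have "A * (r + (1 + m) + 2 * c) \<le> A * (r * 1 + r * (1 + m) + r * (2 * c))"
        proof -
          have 1: "1 * (1 + m) \<le> r * (1 + m)" using r m0 by (intro mult_right_mono) auto
          have 2: "1 * (2 * c) \<le> r * (2 * c)" using r c0 by (intro mult_right_mono) auto
          have 3: "r \<le> r * 1" by simp
          have "0 \<le> A" using A by simp
          from mult_left_mono[OF add_mono[OF add_mono[OF 3 1] 2] this] show ?thesis by (simp only: mult_1)
        qed
        also have "\<dots> = A * (1 + (1 + m) + 2 * c) * r" by (simp add: algebra_simps)
        finally have "X \<le> A * (1 + (1 + m) + 2 * c) * r + X / 4" using Ts unfolding X_def by linarith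
        hence "X \<le> 2 * (A * (1 + (1 + m) + 2 * c) * r)" using Xt t1 by linarith
        also have "\<dots> = (K - 1) * r" unfolding K_def by simp
        also have "\<dots> < K * r" using r by simp
        finally show False using big Xt unfolding t_def by linarith
      qed
      show ?case using y yr Ty s x e by (intro exI[of _ y]) auto
    qed
    obtain R where R: "r + 2 + m < R" "G R" using dense[of "r + 2 + m" "r + 3 + m"] r m0 by auto
    have "2 ^ k * t \<le> T R" for k
    proof -
      obtain x where x: "x \<ge> r" "G x" "2 ^ k * t \<le> T x"
        "x - r \<le> 1 - (1 / 2) ^ k + measure lebesgue (E \<inter> {r..<x})" using seq by blast
      have "measure lebesgue (E \<inter> {r..<x}) \<le> m"
        unfolding m_def using E by (intro measure_mono_fmeasurable) (auto dest: fmeasurableD)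
      moreover have "(1 / 2 :: real) ^ k \<ge> 0" by simp
      ultimately have "x < R" using x R by linarith
      thus ?thesis using mono[OF x(2) R(2)] x by linarith
    qed
    moreover have "(2::real) ^ k \<le> 2 ^ k * t" for k using t1 mult_left_mono[of 1 t "2 ^ k"] by simp
    ultimately have "(2::real) ^ k \<le> T R" for k by (meson order_trans)
    moreover obtain k where "T R < 2 ^ k" using real_arch_pow[of 2 "T R"] by auto
    ultimately show False by (meson not_le)
  qed
  thus ?thesis by blast
qed

lemma is_S_ev:
  assumes "is_S f X" "c > 0" shows "\<forall>\<^sub>F r in nev. \<bar>X r\<bar> \<le> c * \<bar>characteristic_T r f\<bar>"
proof -
  obtain E where E: "E \<in> lmeasurable" "X \<in> o[inf at_top (principal (- E))](\<lambda>r. characteristic_T r f)"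
    using assms(1) unfolding is_S_def by blast
  from landau_o.smallD[OF E(2) assms(2)] show ?thesis
    using E(1) unfolding eventually_at_top_principal eventually_nev by auto
qed

lemma ld_scale_ge:
  assumes "nonzero_mero f" "C \<ge> 1" "1 \<le> r" "r < R"
  shows "r \<le> ld_scale f C r R"
proof -
  have T: "1 \<le> 1 + characteristic_T R f" using characteristic_nonneg[OF assms(1), of R] assms by simp
  have "1 * 1 * r * 1 \<le> ld_scale f C r R"
    unfolding ld_scale_def using assms T by (intro mult_mono mult_nonneg_nonneg) auto
  thus ?thesis by simp
qed

text \<open>At this stage f'/f at radius r is only controlled through T(R, f) with R > r, hence the
  index pairs (r, R). The equation gives m(r, f) \<le> a r + O(ln \<kappa>), the pole count is
  absorbed as T/2, and \<open>Borel_growth\<close> removes T(R, f) from the right-hand side.\<close>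

theorem characteristic_linear_good:
  assumes f: "nonzero_mero f" "f nicely_meromorphic_on UNIV" and n: "n \<ge> 1"
    and P: "diff_poly_degree P \<le> n - 1"
    and eq: "\<forall>\<^sub>\<approx>z. f z ^ n + diff_poly_eval P f z = h z"
    and h: "\<And>z. norm (h z) \<le> H * exp (a * norm z)" "H \<ge> 1" "a \<ge> 0"
    and N: "is_S f (\<lambda>r. counting_N r f)"
  shows "\<exists>K r1. \<forall>r\<ge>r1. good_radius f r \<longrightarrow> characteristic_T r f \<le> K * r"
proof -
  obtain E C where EC: "E \<in> lmeasurable" "C \<ge> 1" "\<And>r R (z::complex) w.
    1 \<le> r \<and> r < R \<and> r \<notin> E \<and> good_radius f R \<and> norm z = r \<and> norm (w - z) \<le> 1 / ld_scale f C r R ^ 3 \<Longrightarrow>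
    w \<notin> sing f \<and> norm (deriv f w / f w) \<le> ld_scale f C r R ^ 3"
    using log_derivative_estimate[OF f] by meson
  define S where "S = {(r, R). r < R \<and> R \<le> r + 1 \<and> good_radius f R}"
  define Fl where "Fl = inf (filtercomap fst nev) (principal S)"
  define \<kappa> where "\<kappa> = (\<lambda>x. ld_scale f C (fst x) (snd x))"
  have lim: "filterlim fst nev Fl" unfolding Fl_def
    by (rule filterlim_mono[OF filterlim_filtercomap order_refl inf_le1])
  have inS: "\<forall>\<^sub>F x in Fl. x \<in> S" unfolding Fl_def eventually_inf_principal by simp
  have ev: "eventually Q nev \<Longrightarrow> \<forall>\<^sub>F x in Fl. Q (fst x)" for Q using lim by (simp add: filterlim_iff)
  interpret log_deriv_scale Fl fst \<kappa> f
  proof (intro log_deriv_scale.intro log_deriv_scale_axioms.intro f(1))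
    show sc: "scale Fl fst \<kappa>"
    proof
      show "\<forall>\<^sub>F i in Fl. fst i \<le> \<kappa> i" using ev[OF nev_ge[of 1]] inS
        by eventually_elim (auto simp: \<kappa>_def S_def intro!: ld_scale_ge f EC)
    qed (rule lim)
    have "\<forall>\<^sub>F r in nev. r \<notin> E" by (rule nev_I[OF EC(1), of 0])
    from ev[OF this] ev[OF nev_ge[of 1]] inS
    have "\<forall>\<^sub>F i in Fl. \<forall>z w. norm z = fst i \<and> norm (w - z) \<le> 1 / \<kappa> i ^ 3 \<longrightarrow>
      (\<lambda>z. deriv f z / f z) analytic_on {w} \<and> norm (deriv f w / f w) \<le> \<kappa> i ^ 3"
    proof eventually_elim
      case (elim i)
      show ?case
      proof (intro allI impI)
        fix z w :: complex assume zw: "norm z = fst i \<and> norm (w - z) \<le> 1 / \<kappa> i ^ 3"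
        have "w \<notin> sing f \<and> norm (deriv f w / f w) \<le> \<kappa> i ^ 3" unfolding \<kappa>_def
          by (rule EC(3)[of _ _ z]) (use elim zw in \<open>auto simp: S_def \<kappa>_def\<close>)
        thus "(\<lambda>z. deriv f z / f z) analytic_on {w} \<and> norm (deriv f w / f w) \<le> \<kappa> i ^ 3"
          by (auto simp: sing_def intro!: analytic_intros analytic_deriv)
      qed
    qed
    moreover have "(\<lambda>z. deriv f z / f z) meromorphic_on UNIV"
      using f by (auto intro!: meromorphic_intros)
    ultimately show "scale.tame Fl fst \<kappa> (\<lambda>z. deriv f z / f z)"
      unfolding scale.tame_def[OF sc] by blast
  qed
  obtain M where M: "\<forall>\<^sub>F i in Fl. \<forall>z. norm z = fst i \<longrightarrow> norm (f z) \<le> 1 + norm (h z) + \<kappa> i ^ M"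
    using power_plus_form_bound[OF n form_diff_poly[OF P] eq] by blast
  then obtain Q where Q: "eventually Q nev"
    "\<And>r R z. Q r \<Longrightarrow> r < R \<Longrightarrow> R \<le> r + 1 \<Longrightarrow> good_radius f R \<Longrightarrow> norm z = r \<Longrightarrow>
      norm (f z) \<le> 1 + norm (h z) + ld_scale f C r R ^ M"
    unfolding Fl_def eventually_inf_principal eventually_filtercomap \<kappa>_def S_def by force
  \<comment> \<open>The part of the bound that is independent of r. The constant \<open>A\<close>
    then dominates, for r \<ge> 1, both the terms linear in r and the coefficients of the two
    remaining logarithms.\<close>
  define c0 where "c0 = ln 3 + ln H + M * ln C + M"
  define A where "A = 2 * (c0 + (a + M)) + 2 * M + 1"
  have c00: "c0 \<ge> 0" unfolding c0_def using h EC by (intro add_nonneg_nonneg) auto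
  have "\<forall>\<^sub>F r in nev. counting_N r f \<le> 1 / 2 * characteristic_T r f \<and> r \<ge> 1 \<and> good_radius f r \<and> Q r"
    using is_S_ev[OF N, of "1/2", simplified] Q(1) nev_ge[of 1] nev_good_radius[OF f(1)]
  proof eventually_elim
    case (elim r)
    thus ?case using characteristic_nonneg[OF f(1) elim(3)] by auto
  qed
  then obtain E' r0 where E': "E' \<in> lmeasurable" "\<And>r. r \<ge> r0 \<Longrightarrow> r \<notin> E' \<Longrightarrow>
     counting_N r f \<le> 1 / 2 * characteristic_T r f \<and> r \<ge> 1 \<and> good_radius f r \<and> Q r"
    unfolding eventually_nev by blast
  have "\<exists>K. \<forall>r\<ge>max r0 1. good_radius f r \<longrightarrow> characteristic_T r f \<le> K * r"
  proof (rule Borel_growth[where E = E' and A = A])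
    fix r R assume r: "r \<ge> r0" "r \<notin> E'" "r < R" "R \<le> r + 1" "good_radius f R"
    note r' = E'(2)[OF r(1,2)]
    define T where "T = characteristic_T R f"
    have T0: "T \<ge> 0" unfolding T_def using r r' by (intro characteristic_nonneg f) auto
    define k where "k = ld_scale f C r R"
    have k1: "k \<ge> 1" using ld_scale_ge[OF f(1) EC(2) _ r(3)] r' by (simp add: k_def)
    have i0: "1 / (R - r) > 0" using r by simp
    have lnk: "ln k \<le> ln C + ln (1 + T) + (r + 1) + ln (1 + 1 / (R - r))"
    proof -
      have "ln k = ln C + ln (1 + T) + ln R + ln (1 + 1 / (R - r))"
        unfolding k_def ld_scale_def T_def[symmetric] using EC(2) T0 r r' i0
        by (simp add: ln_mult_pos add_pos_pos del: zero_less_divide_1_iff)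
      moreover have "ln R \<le> r + 1" using ln_le_minus_one[of R] r r' by linarith
      ultimately show ?thesis by linarith
    qed
    have "proximity_m r f \<le> ln 3 + ln H + a * r + M * ln k"
    proof (rule proximity_le_const)
      fix z :: complex assume z: "norm z = r"
      define B where "B = H * exp (a * r) * k ^ M"
      have kM: "k ^ M \<ge> 1" using k1 by (rule one_le_power)
      have "exp (a * r) \<ge> 1" using h r' by auto
      hence He: "1 * 1 \<le> H * exp (a * r)" using h by (intro mult_mono) auto
      have "1 \<le> B" "H * exp (a * r) \<le> B" "k ^ M \<le> B"
        unfolding B_def using He kM mult_mono[of 1 "H * exp (a * r)" 1 "k ^ M"]
          mult_left_mono[of 1 "k ^ M" "H * exp (a * r)"] mult_right_mono[of 1 "H * exp (a * r)" "k ^ M"] by auto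
      moreover have "norm (f z) \<le> 1 + norm (h z) + k ^ M" unfolding k_def using r r' z by (intro Q) auto
      moreover have "norm (h z) \<le> H * exp (a * r)" using h(1)[of z] z by simp
      ultimately have "norm (f z) \<le> 3 * B" "1 \<le> 3 * B" by linarith+
      hence "log_plus (norm (f z)) \<le> ln (3 * B)" by (rule log_plus_le_ln)
      also have "\<dots> = ln 3 + ln H + a * r + M * ln k"
        unfolding B_def using h(2) k1 by (simp add: ln_mult_pos ln_realpow)
      finally show "log_plus (norm (f z)) \<le> ln 3 + ln H + a * r + M * ln k" .
    qed (use r' in auto)
    moreover have "characteristic_T r f = proximity_m r f + counting_N r f" by (simp add: characteristic_T_def)
    moreover have "counting_N r f \<le> characteristic_T r f / 2" using r' by simp
    ultimately have "characteristic_T r f \<le> 2 * (ln 3 + ln H + a * r + M * ln k)" by argo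
    also have "\<dots> \<le> 2 * (ln 3 + ln H + a * r + M * (ln C + ln (1 + T) + (r + 1) + ln (1 + 1 / (R - r))))"
      using lnk by (intro mult_left_mono add_left_mono) auto
    also have "\<dots> = 2 * c0 + 2 * (a + M) * r + 2 * M * (ln (1 + T) + ln (1 + 1 / (R - r)))"
      unfolding c0_def by (simp add: algebra_simps)
    also have "\<dots> \<le> A * r + A * (ln (1 + T) + ln (1 + 1 / (R - r)))"
    proof (rule add_mono)
      have "2 * c0 + 2 * (a + M) * r \<le> 2 * c0 * r + 2 * (a + M) * r"
        using r' c00 mult_left_mono[of 1 r "2 * c0"] by simp
      also have "\<dots> = (2 * (c0 + (a + M))) * r" by (simp add: algebra_simps)
      also have "\<dots> \<le> A * r" unfolding A_def using r' by (intro mult_right_mono) auto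
      finally show "2 * c0 + 2 * (a + M) * r \<le> A * r" .
      have "ln (1 + T) \<ge> 0" "ln (1 + 1 / (R - r)) \<ge> 0" using T0 i0 by (auto intro!: ln_ge_zero)
      thus "2 * M * (ln (1 + T) + ln (1 + 1 / (R - r))) \<le> A * (ln (1 + T) + ln (1 + 1 / (R - r)))"
        unfolding A_def using c00 h by (intro mult_right_mono) auto
    qed
    finally show "characteristic_T r f \<le> A * (r + ln (1 + characteristic_T R f) + ln (1 + 1 / (R - r)))"
      unfolding T_def by (simp add: distrib_left)
  next
    show "A \<ge> 1" unfolding A_def using c00 h by auto
    show "E' \<in> lmeasurable" by fact
    show "good_radius f r" if "r \<ge> r0" "r \<notin> E'" for r using E'(2) that by blast
    show "\<exists>r>x. r < y \<and> good_radius f r" if "0 \<le> x" "x < y" for x y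
      using ex_good_radius[OF f(1) that] by blast
  qed (rule characteristic_mono[OF f(1)])
  thus ?thesis by blast
qed

interpretation nv: scale nev "\<lambda>r. r" "\<lambda>r. r"
  by unfold_locales (auto simp: filterlim_ident)

text \<open>With linear growth R can be taken between 2r and 3r, so 1/(R - r) \<le> 1 and T(R, f) =
  O(r). The scale is then at most B r^2 \<le> r^3 once r \<ge> B, and its cube is at most r^9: a
  power of r replaces the characteristic.\<close>

lemma log_deriv_scale_nev:
  assumes f: "nonzero_mero f" "f nicely_meromorphic_on UNIV"
    and T: "\<And>r. r \<ge> r1 \<Longrightarrow> good_radius f r \<Longrightarrow> characteristic_T r f \<le> K * r"
  shows "log_deriv_scale nev (\<lambda>r. r) (\<lambda>r. r) f"
proof (intro log_deriv_scale.intro log_deriv_scale_axioms.intro f(1) nv.scale_axioms)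
  obtain E C where EC: "E \<in> lmeasurable" "C \<ge> 1" "\<And>r R (z::complex) w.
    1 \<le> r \<and> r < R \<and> r \<notin> E \<and> good_radius f R \<and> norm z = r \<and> norm (w - z) \<le> 1 / ld_scale f C r R ^ 3 \<Longrightarrow>
    w \<notin> sing f \<and> norm (deriv f w / f w) \<le> ld_scale f C r R ^ 3"
    using log_derivative_estimate[OF f] by meson
  define K' where "K' = max K 0"
  define B where "B = C * (1 + 3 * K') * 6"
  have "\<forall>\<^sub>F r in nev. \<forall>z w. norm z = r \<and> norm (w - z) \<le> 1 / r ^ 9 \<longrightarrow>
      (\<lambda>z. deriv f z / f z) analytic_on {w} \<and> norm (deriv f w / f w) \<le> r ^ 9"
  proof (rule nev_I[OF EC(1), of "max (max r1 1) B"])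
    fix r assume r: "r \<ge> max (max r1 1) B" "r \<notin> E"
    obtain R where R: "2 * r < R" "R < 3 * r" "good_radius f R"
      using ex_good_radius[OF f(1), of "2 * r" "3 * r"] r by auto
    have r1: "r \<ge> 1" "r < R" using r R by auto
    have TR: "characteristic_T R f \<le> K' * (3 * r)"
    proof -
      have "characteristic_T R f \<le> K * R" using r R by (intro T) auto
      also have "\<dots> \<le> K' * (3 * r)" using R r by (intro mult_mono) (auto simp: K'_def)
      finally show ?thesis .
    qed
    have T0: "characteristic_T R f \<ge> 0" using r1 by (intro characteristic_nonneg f) auto
    have "ld_scale f C r R \<le> C * (1 + K' * (3 * r)) * (3 * r) * (1 + 1)"
      unfolding ld_scale_def using EC(2) TR T0 R r1
      by (intro mult_mono add_mono mult_nonneg_nonneg add_nonneg_nonneg) (auto simp: K'_def divide_le_eq_1)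
    also have "\<dots> \<le> C * (r + K' * (3 * r)) * (3 * r) * (1 + 1)"
      using EC(2) r1 by (intro mult_mono mult_nonneg_nonneg add_mono) (auto simp: K'_def)
    also have "\<dots> = B * r ^ 2" unfolding B_def by (simp add: power2_eq_square algebra_simps)
    also have "\<dots> \<le> r * r ^ 2" using r by (intro mult_right_mono) auto
    finally have le: "ld_scale f C r R \<le> r ^ 3" by (simp add: power2_eq_square power3_eq_cube mult_ac)
    have pos: "ld_scale f C r R \<ge> 1" using ld_scale_ge[OF f(1) EC(2) r1] r1 by simp
    have le9: "ld_scale f C r R ^ 3 \<le> r ^ 9"
      using power_mono[OF le, of 3] pos by (simp flip: power_mult)
    show "\<forall>z w. norm z = r \<and> norm (w - z) \<le> 1 / r ^ 9 \<longrightarrow>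
      (\<lambda>z. deriv f z / f z) analytic_on {w} \<and> norm (deriv f w / f w) \<le> r ^ 9"
    proof (intro allI impI)
      fix z w :: complex assume zw: "norm z = r \<and> norm (w - z) \<le> 1 / r ^ 9"
      have "1 / r ^ 9 \<le> 1 / ld_scale f C r R ^ 3"
        using le9 pos r1 by (intro divide_left_mono mult_pos_pos zero_less_power) auto
      hence "w \<notin> sing f \<and> norm (deriv f w / f w) \<le> ld_scale f C r R ^ 3"
        using zw r r1 R by (intro EC(3)[of _ _ z]) auto
      thus "(\<lambda>z. deriv f z / f z) analytic_on {w} \<and> norm (deriv f w / f w) \<le> r ^ 9"
        using le9 by (auto simp: sing_def intro!: analytic_intros analytic_deriv)
    qed
  qed
  thus "nv.tame (\<lambda>z. deriv f z / f z)"
    unfolding nv.tame_def using f by (auto intro!: meromorphic_intros)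
qed

text \<open>|Re Q| = 2 log+ |exp Q| - Re Q, and the mean of Re Q is Re (Q 0). So m(R, exp Q) bounds
  Q'; this gives a lower bound for m(r, exp (\<alpha> z)) and later limits the degree of an
  exponent.\<close>

lemma norm_deriv_le_proximity_exp:
  assumes Q: "Q holomorphic_on UNIV" and R: "R > 0" and z: "norm z \<le> R / 2"
  shows "norm (deriv Q z) \<le> 8 / R * (2 * proximity_m R (\<lambda>z. exp (Q z)) - Re (Q 0))"
proof -
  have hol: "Q holomorphic_on A" for A using Q holomorphic_on_subset by blast
  have c: "continuous_on A Q" for A using hol holomorphic_on_imp_continuous_on by blast
  have "norm (deriv Q z) \<le> 2 * R / (R - R / 2)^2 * circ_mean R (\<lambda>w. \<bar>Re (Q w)\<bar>)"
    using R z by (intro norm_deriv_le_mean c hol) auto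
  also have "2 * R / (R - R / 2)^2 = 8 / R" using R by (simp add: power2_eq_square field_simps)
  also have "circ_mean R (\<lambda>w. \<bar>Re (Q w)\<bar>) = circ_mean R (\<lambda>w. 2 * log_plus (norm (exp (Q w))) - Re (Q w))"
    using R by (intro circ_mean_cong) (auto simp: log_plus_def max_def)
  also have "\<dots> = 2 * circ_mean R (\<lambda>w. log_plus (norm (exp (Q w)))) - circ_mean R (\<lambda>w. Re (Q w))"
    using R by (subst circ_mean_diff)
      (auto intro!: continuous_intros c continuous_on_compose2[OF continuous_log_plus[of UNIV]])
  also have "circ_mean R (\<lambda>w. Re (Q w)) = Re (circ_mean R Q)"
    using R c by (subst circ_mean_Re) auto
  also have "circ_mean R Q = Q 0" using R by (intro circ_mean_value c hol)
  finally show ?thesis by (simp add: proximity_eq_mean)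
qed

lemma proximity_exp_ge:
  assumes "R > 0" shows "norm \<alpha> / 16 * R \<le> proximity_m R (\<lambda>z. exp (\<alpha> * z))"
proof -
  have "norm (deriv (\<lambda>z. \<alpha> * z) 0) \<le> 8 / R * (2 * proximity_m R (\<lambda>z. exp (\<alpha> * z)) - Re (\<alpha> * 0))"
    using assms by (intro norm_deriv_le_proximity_exp holomorphic_intros) auto
  moreover have "deriv (\<lambda>z. \<alpha> * z) 0 = \<alpha>" by simp
  ultimately show ?thesis using assms by (simp add: field_simps)
qed

text \<open>Fatou's lemma along good radii decreasing to r. At a pole on the circle the integrand is
  0, because a nicely meromorphic function has value 0 there, so the liminf inequality holds at
  every angle; a non-integrable integrand gives m = 0 by convention. Counting functions are monotone
  in the radius anyway.\<close>

theorem characteristic_linear: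
  assumes f: "nonzero_mero f" "f nicely_meromorphic_on UNIV"
    and T: "\<And>r. r \<ge> r1 \<Longrightarrow> good_radius f r \<Longrightarrow> characteristic_T r f \<le> K * r"
  shows "\<exists>K'. \<forall>\<^sub>F r in at_top. characteristic_T r f \<le> K' * r"
proof -
  define K' where "K' = 4 * max K 0"
  have "characteristic_T r f \<le> K' * r" if r: "r \<ge> max r1 1" for r
  proof -
    have TK: "characteristic_T R f \<le> 2 * max K 0 * r" if "r < R" "R \<le> r + 1" "good_radius f R" for R
    proof -
      have "characteristic_T R f \<le> K * R" using r that by (intro T) auto
      also have "\<dots> \<le> max K 0 * (2 * r)" using that r by (intro mult_mono) auto
      finally show ?thesis by simp
    qed
    obtain R where R: "r < R" "R < r + 1" "good_radius f R"
      using ex_good_radius[OF f(1), of r "r + 1"] r by auto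
    have "countN (pole_div f) r \<le> countN (pole_div f) R"
      using R r f by (intro countN_mono_radius) auto
    also have "\<dots> \<le> characteristic_T R f" using R r f by (simp add: characteristic_eq proximity_nonneg)
    also have "\<dots> \<le> 2 * max K 0 * r" using R by (intro TK) auto
    finally have N: "countN (pole_div f) r \<le> 2 * max K 0 * r" .
    define g where "g = (\<lambda>\<rho> \<theta>. log_plus (norm (f (of_real \<rho> * cis \<theta>))))"
    have m: "proximity_m r f \<le> 2 * max K 0 * r"
    proof (cases "g r integrable_on {0..2*pi}")
      case False
      hence "proximity_m r f = 0" unfolding proximity_m_def g_def by (simp add: not_integrable_integral)
      thus ?thesis using r by simp
    next
      case int: True
      have "\<exists>R. r < R \<and> R < r + 1 / real (Suc k) \<and> good_radius f R" for k
        using ex_good_radius[OF f(1), of r "r + 1 / real (Suc k)"] r by auto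
      then obtain R where R: "\<And>k. r < R k" "\<And>k. R k < r + 1 / real (Suc k)" "\<And>k. good_radius f (R k)" by metis
      have Rlim: "R \<longlonglongrightarrow> r"
      proof (rule real_tendsto_sandwich[of "\<lambda>_. r" _ _ "\<lambda>k. r + 1 / real (Suc k)"])
        show "(\<lambda>k. r + 1 / real (Suc k)) \<longlonglongrightarrow> r"
          using tendsto_add[OF tendsto_const[of r] LIMSEQ_inverse_real_of_nat] by (simp add: divide_inverse)
      qed (use R in \<open>auto intro: always_eventually less_imp_le\<close>)
      define I where "I = 2 * pi * (2 * max K 0 * r)"
      define G where "G = (\<lambda>\<rho> \<theta>. ennreal (indicator {0..2*pi} \<theta> * g \<rho> \<theta>))"
      have gint: "g (R k) integrable_on {0..2*pi}" for k
        unfolding g_def using R(3)[of k] good_radius_pos[OF R(3)[of k]]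
        by (intro integrable_on_circle[where u = "\<lambda>z. log_plus (norm (f z))"] good_radius_continuous_log_plus) auto
      have nn: "(\<integral>\<^sup>+\<theta>. G \<rho> \<theta> \<partial>lebesgue) = ennreal (integral {0..2*pi} (g \<rho>))"
        if "g \<rho> integrable_on {0..2*pi}" for \<rho>
        unfolding G_def using nn_integral_has_integral_lebesgue[of "{0..2*pi}" "g \<rho>" "integral {0..2*pi} (g \<rho>)"] that
        by (simp add: g_def has_integral_integral[symmetric] nn_integral_completion)
      have meas: "G \<rho> \<in> borel_measurable lebesgue" if "g \<rho> integrable_on {0..2*pi}" for \<rho>
      proof -
        have "g \<rho> \<in> borel_measurable (lebesgue_on {0..2*pi})" using that by (rule integrable_imp_measurable)
        hence "(\<lambda>\<theta>. indicator {0..2*pi} \<theta> *\<^sub>R g \<rho> \<theta>) \<in> borel_measurable lebesgue"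
          by (subst (asm) borel_measurable_restrict_space_iff) (auto simp: mult.commute)
        thus ?thesis unfolding G_def by simp
      qed
      have "(\<integral>\<^sup>+\<theta>. G r \<theta> \<partial>lebesgue) \<le> (\<integral>\<^sup>+\<theta>. liminf (\<lambda>k. G (R k) \<theta>) \<partial>lebesgue)"
      proof (rule nn_integral_mono)
        fix \<theta>
        show "G r \<theta> \<le> liminf (\<lambda>k. G (R k) \<theta>)"
        proof (cases "is_pole f (of_real r * cis \<theta>)")
          case True
          hence "f (of_real r * cis \<theta>) = 0" using is_pole_zero_at_nicely_mero[OF f(2)] by auto
          hence "G r \<theta> = 0" by (simp add: G_def g_def log_plus_def)
          thus ?thesis by simp
        next
          case False
          hence "isCont f (of_real r * cis \<theta>)"
            using nicely_meromorphic_on_imp_analytic_at[OF f(2)] by (auto intro: analytic_at_imp_isCont)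
          hence "(\<lambda>k. f (of_real (R k) * cis \<theta>)) \<longlonglongrightarrow> f (of_real r * cis \<theta>)"
            by (rule isCont_tendsto_compose) (auto intro!: tendsto_intros Rlim)
          hence "(\<lambda>k. g (R k) \<theta>) \<longlonglongrightarrow> g r \<theta>" unfolding g_def
            by (intro continuous_on_tendsto_compose[OF continuous_log_plus[of UNIV]] tendsto_norm) auto
          hence "(\<lambda>k. G (R k) \<theta>) \<longlonglongrightarrow> G r \<theta>" unfolding G_def
            by (intro tendsto_ennrealI tendsto_mult tendsto_const)
          thus ?thesis by (simp add: lim_imp_Liminf)
        qed
      qed
      also have "\<dots> \<le> liminf (\<lambda>k. \<integral>\<^sup>+\<theta>. G (R k) \<theta> \<partial>lebesgue)"
        using meas[OF gint] by (intro nn_integral_liminf) auto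
      also have "\<dots> \<le> liminf (\<lambda>k. ennreal I)"
      proof (intro Liminf_mono always_eventually allI)
        fix k
        have "1 / real (Suc k) \<le> 1" by simp
        hence Rk: "R k \<le> r + 1" using R(2)[of k] by linarith
        have "proximity_m (R k) f \<le> characteristic_T (R k) f"
          using R[of k] r f by (auto simp: characteristic_eq intro!: countN_nonneg)
        also have "\<dots> \<le> 2 * max K 0 * r" using R Rk by (intro TK) auto
        finally have "integral {0..2*pi} (g (R k)) \<le> I"
          unfolding I_def proximity_m_def g_def by (simp add: field_simps)
        thus "(\<integral>\<^sup>+\<theta>. G (R k) \<theta> \<partial>lebesgue) \<le> ennreal I" unfolding nn[OF gint] by (rule ennreal_leI)
      qed
      also have "\<dots> = ennreal I" by (simp add: Liminf_const)
      finally have "ennreal (integral {0..2*pi} (g r)) \<le> ennreal I" unfolding nn[OF int] .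
      hence "integral {0..2*pi} (g r) \<le> I" using r by (subst (asm) ennreal_le_iff) (auto simp: I_def)
      thus ?thesis unfolding I_def proximity_m_def g_def by (simp add: field_simps)
    qed
    show ?thesis using N m r f(1) by (simp add: characteristic_eq K'_def)
  qed
  thus ?thesis unfolding eventually_at_top_linorder by blast
qed

text \<open>The upper bound needs an estimate at all large radii. For the lower bound the
  exceptional radii are harmless, since a limsup along the finer filter \<open>nev\<close> is at
  most the one along \<open>at_top\<close>.\<close>

lemma growth_order_eq_1:
  assumes "\<forall>\<^sub>F r in at_top. characteristic_T r f \<le> K * r"
    and "c > 0" "\<forall>\<^sub>F r in nev. c * r \<le> characteristic_T r f"
  shows "growth_order f = 1"
proof (rule antisym)
  define K' where "K' = max K 1"
  have "growth_order f \<le> Limsup at_top (\<lambda>r. ereal (ln (K' * r) / ln r))"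
    unfolding growth_order_def
  proof (rule Limsup_mono)
    show "\<forall>\<^sub>F r in at_top. ereal (log_plus (characteristic_T r f) / ln r) \<le> ereal (ln (K' * r) / ln r)"
      using assms(1) eventually_gt_at_top[of 1]
    proof eventually_elim
      case (elim r)
      have "K * r \<le> K' * r" using elim by (intro mult_right_mono) (auto simp: K'_def)
      moreover have "1 * 1 \<le> K' * r" using elim by (intro mult_mono) (auto simp: K'_def)
      ultimately have "characteristic_T r f \<le> K' * r" "1 \<le> K' * r" using elim(1) by linarith+
      hence "log_plus (characteristic_T r f) \<le> ln (K' * r)" by (rule log_plus_le_ln)
      thus ?case using elim by (simp add: divide_right_mono)
    qed
  qed
  also have "\<dots> = 1"
  proof (rule lim_imp_Limsup)
    have "K' > 0" by (simp add: K'_def)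
    hence "((\<lambda>r. ln (K' * r) / ln r) \<longlongrightarrow> 1) at_top" by real_asymp
    thus "((\<lambda>r. ereal (ln (K' * r) / ln r)) \<longlongrightarrow> 1) at_top"
      by (simp add: one_ereal_def)
  qed simp
  finally show "growth_order f \<le> 1" .
  have "((\<lambda>r. ln (c * r) / ln r) \<longlongrightarrow> 1) at_top" using assms(2) by real_asymp
  hence "((\<lambda>r. ln (c * r) / ln r) \<longlongrightarrow> 1) nev" by (rule tendsto_mono[OF nev_le_at_top])
  hence "((\<lambda>r. ereal (ln (c * r) / ln r)) \<longlongrightarrow> 1) nev" by (simp add: one_ereal_def)
  hence "1 = Limsup nev (\<lambda>r. ereal (ln (c * r) / ln r))" by (intro lim_imp_Limsup[symmetric]) auto
  also have "\<dots> \<le> Limsup nev (\<lambda>r. ereal (log_plus (characteristic_T r f) / ln r))"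
  proof (rule Limsup_mono)
    show "\<forall>\<^sub>F r in nev. ereal (ln (c * r) / ln r) \<le> ereal (log_plus (characteristic_T r f) / ln r)"
      using assms(3) nev_ge[of 2]
    proof eventually_elim
      case (elim r)
      have "c * r > 0" using elim assms(2) by simp
      hence "ln (c * r) \<le> ln (characteristic_T r f)" "characteristic_T r f > 0" using elim by auto
      hence "ln (c * r) \<le> log_plus (characteristic_T r f)"
        using ln_le_log_plus[of "characteristic_T r f"] by linarith
      thus ?case using elim by (simp add: divide_right_mono)
    qed
  qed
  also have "\<dots> \<le> growth_order f" unfolding growth_order_def Limsup_def
    using nev_le_at_top by (intro INF_superset_mono) (auto simp: le_filter_def)
  finally show "1 \<le> growth_order f" .
qed

section \<open>Bounding pole orders\<close>

text \<open>For a nonzero meromorphic function \<open>sub_ord\<close> is the order; the zero function has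
  \<open>sub_ord\<close> 0.\<close>

definition sub_ord :: "(complex \<Rightarrow> complex) \<Rightarrow> complex \<Rightarrow> int" where
  "sub_ord u z = fls_subdegree (laurent_expansion u z)"

lemma has_laurent_laurent_expansion:
  "u meromorphic_on UNIV \<Longrightarrow> (\<lambda>w. u (z + w)) has_laurent_expansion laurent_expansion u z"
  by (auto simp: meromorphic_on_def')

lemma nonzero_mero_laurent_nz:
  assumes "nonzero_mero u" shows "laurent_expansion u z \<noteq> 0"
proof -
  have "\<exists>\<^sub>F w in at z. u w \<noteq> 0" using nonzero_mero_freq[OF assms] .
  thus ?thesis using has_laurent_laurent_expansion[OF nonzero_mero_mero[OF assms], of z]
    by (metis has_laurent_expansion_eventually_nonzero_iff nonzero_mero_ev[OF assms])
qed

lemma sub_ord_eq_zorder: "nonzero_mero u \<Longrightarrow> sub_ord u z = zorder u z"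
  unfolding sub_ord_def using nonzero_mero_laurent_nz[of u z]
    has_laurent_expansion_zorder[OF has_laurent_laurent_expansion[of u z]]
    nonzero_mero_mero[of u UNIV] by auto

lemma sub_ord_eqI:
  "u meromorphic_on UNIV \<Longrightarrow> (\<lambda>w. u (z + w)) has_laurent_expansion F \<Longrightarrow> sub_ord u z = fls_subdegree F"
  unfolding sub_ord_def using laurent_expansion_eqI by metis

text \<open>The condition m \<le> 0 covers cancellation: the zero series has subdegree 0, so a
  positive lower bound could fail.\<close>

lemma sub_ord_add:
  assumes "u meromorphic_on UNIV" "v meromorphic_on UNIV" "m \<le> sub_ord u z" "m \<le> sub_ord v z" "m \<le> 0"
  shows "m \<le> sub_ord (\<lambda>z. u z + v z) z"
proof -
  have "sub_ord (\<lambda>z. u z + v z) z = fls_subdegree (laurent_expansion u z + laurent_expansion v z)"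
    using assms by (intro sub_ord_eqI meromorphic_intros has_laurent_expansion_add has_laurent_laurent_expansion)
  thus ?thesis using fls_plus_subdegree[of "laurent_expansion u z" "laurent_expansion v z"] assms(3-)
    unfolding sub_ord_def by (cases "laurent_expansion u z + laurent_expansion v z = 0") auto
qed

lemma sub_ord_mult:
  assumes "u meromorphic_on UNIV" "v meromorphic_on UNIV" "m \<le> sub_ord u z" "m' \<le> sub_ord v z" "m + m' \<le> 0"
  shows "m + m' \<le> sub_ord (\<lambda>z. u z * v z) z"
proof -
  have "sub_ord (\<lambda>z. u z * v z) z = fls_subdegree (laurent_expansion u z * laurent_expansion v z)"
    using assms by (intro sub_ord_eqI meromorphic_intros has_laurent_expansion_mult has_laurent_laurent_expansion)
  thus ?thesis using assms(3-)
    unfolding sub_ord_def by (cases "laurent_expansion u z = 0 \<or> laurent_expansion v z = 0") auto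
qed

lemma has_laurent_expansion_deriv_at:
  assumes "(\<lambda>w. f (z + w)) has_laurent_expansion F"
  shows "(\<lambda>w. deriv f (z + w)) has_laurent_expansion fls_deriv F"
proof -
  have "deriv (\<lambda>w. f (z + w)) has_laurent_expansion fls_deriv F"
    using assms by (rule has_laurent_expansion_deriv)
  also have "deriv (\<lambda>w. f (z + w)) = (\<lambda>w. deriv f (z + w))"
    by (simp add: deriv_shift_0' add_ac o_def fun_eq_iff)
  finally show ?thesis .
qed

lemma fls_subdegree_deriv_ge:
  fixes F :: "complex fls"
  shows "fls_subdegree F \<ge> 0 \<Longrightarrow> fls_subdegree (fls_deriv F) \<ge> 0"
    and "fls_subdegree F < 0 \<Longrightarrow> fls_subdegree (fls_deriv F) = fls_subdegree F - 1"
    and "fls_subdegree F \<noteq> 0 \<Longrightarrow> fls_subdegree (fls_deriv F) = fls_subdegree F - 1"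
  using fls_subdegree_deriv[of F] fls_deriv_subdegree0[of F] by fastforce+

lemma sub_ord_deriv:
  assumes "u meromorphic_on UNIV"
  shows "0 \<le> sub_ord u z \<Longrightarrow> 0 \<le> sub_ord (deriv u) z" "sub_ord u z < 0 \<Longrightarrow> sub_ord (deriv u) z = sub_ord u z - 1"
proof -
  have "sub_ord (deriv u) z = fls_subdegree (fls_deriv (laurent_expansion u z))"
    using assms by (intro sub_ord_eqI meromorphic_intros has_laurent_expansion_deriv_at has_laurent_laurent_expansion)
  thus "0 \<le> sub_ord u z \<Longrightarrow> 0 \<le> sub_ord (deriv u) z" "sub_ord u z < 0 \<Longrightarrow> sub_ord (deriv u) z = sub_ord u z - 1"
    using fls_subdegree_deriv_ge[of "laurent_expansion u z"] unfolding sub_ord_def by auto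
qed

lemma sub_ord_log_deriv:
  assumes "nonzero_mero u"
  shows "-1 \<le> sub_ord (\<lambda>z. deriv u z / u z) z" "zorder u z = 0 \<Longrightarrow> 0 \<le> sub_ord (\<lambda>z. deriv u z / u z) z"
proof -
  have mu: "u meromorphic_on UNIV" using assms by auto
  define F where "F = laurent_expansion u z"
  have F: "F \<noteq> 0" unfolding F_def using nonzero_mero_laurent_nz[OF assms] .
  have zo: "zorder u z = fls_subdegree F" using sub_ord_eq_zorder[OF assms, of z] by (simp add: sub_ord_def F_def)
  have eq: "sub_ord (\<lambda>z. deriv u z / u z) z = fls_subdegree (fls_deriv F / F)"
    using mu unfolding F_def
    by (intro sub_ord_eqI meromorphic_intros has_laurent_expansion_divide has_laurent_expansion_deriv_at has_laurent_laurent_expansion)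
  have *: "fls_subdegree (fls_deriv F / F) = (if fls_deriv F = 0 then 0 else fls_subdegree (fls_deriv F) - fls_subdegree F)"
    using F by (auto simp: fls_divide_subdegree)
  show "-1 \<le> sub_ord (\<lambda>z. deriv u z / u z) z" "zorder u z = 0 \<Longrightarrow> 0 \<le> sub_ord (\<lambda>z. deriv u z / u z) z"
    unfolding eq * zo using fls_subdegree_deriv_ge(1,3)[of F] by (cases "fls_subdegree F = 0"; force)+
qed

lemma sub_ord_const [simp]: "sub_ord (\<lambda>_. c) z = 0"
proof (cases "c = 0")
  case True
  have "sub_ord (\<lambda>_. c) z = fls_subdegree (fls_const c)"
    by (rule sub_ord_eqI) auto
  thus ?thesis by simp
next
  case False thus ?thesis by (simp add: sub_ord_eq_zorder nonzero_mero_const)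
qed

text \<open>The order bound is uniform over the plane, so N(r, u) is at most k times the counting
  function of S. Leaving k existential gives closure under sums, products and derivatives.\<close>

definition poles_in :: "complex set \<Rightarrow> (complex \<Rightarrow> complex) \<Rightarrow> bool" where
  "poles_in S u \<longleftrightarrow> u meromorphic_on UNIV \<and> (\<exists>k. \<forall>z. - int (if z \<in> S then k else 0) \<le> sub_ord u z)"

lemma poles_in_mero [dest]: "poles_in S u \<Longrightarrow> u meromorphic_on A"
  unfolding poles_in_def by (meson meromorphic_on_subset subset_UNIV)

lemma poles_in_const [simp, intro]: "poles_in S (\<lambda>_. c)"
  unfolding poles_in_def by auto

lemma poles_inE:
  assumes "poles_in S u"
  obtains k0 where "\<And>k z. k \<ge> k0 \<Longrightarrow> - int (if z \<in> S then k else 0) \<le> sub_ord u z"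
proof -
  obtain k0 where k0: "\<And>z. - int (if z \<in> S then k0 else 0) \<le> sub_ord u z"
    using assms unfolding poles_in_def by blast
  have "- int (if z \<in> S then k else 0) \<le> sub_ord u z" if "k \<ge> k0" for k z
    using k0[of z] that by (auto split: if_splits)
  thus ?thesis using that by blast
qed

lemma poles_in_add:
  assumes "poles_in S u" "poles_in S v" shows "poles_in S (\<lambda>z. u z + v z)"
proof -
  obtain k1 where k1: "\<And>k z. k \<ge> k1 \<Longrightarrow> - int (if z \<in> S then k else 0) \<le> sub_ord u z" using poles_inE[OF assms(1)] by blast
  obtain k2 where k2: "\<And>k z. k \<ge> k2 \<Longrightarrow> - int (if z \<in> S then k else 0) \<le> sub_ord v z" using poles_inE[OF assms(2)] by blast
  have "- int (if z \<in> S then max k1 k2 else 0) \<le> sub_ord (\<lambda>z. u z + v z) z" for z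
    using assms by (intro sub_ord_add k1 k2) auto
  thus ?thesis unfolding poles_in_def using assms by (blast intro: meromorphic_intros)
qed

lemma poles_in_mult:
  assumes "poles_in S u" "poles_in S v" shows "poles_in S (\<lambda>z. u z * v z)"
proof -
  obtain k1 where k1: "\<And>k z. k \<ge> k1 \<Longrightarrow> - int (if z \<in> S then k else 0) \<le> sub_ord u z" using poles_inE[OF assms(1)] by blast
  obtain k2 where k2: "\<And>k z. k \<ge> k2 \<Longrightarrow> - int (if z \<in> S then k else 0) \<le> sub_ord v z" using poles_inE[OF assms(2)] by blast
  have "- int (if z \<in> S then k1 + k2 else 0) \<le> sub_ord (\<lambda>z. u z * v z) z" for z
    using sub_ord_mult[of u v "- int (if z \<in> S then k1 else 0)" z "- int (if z \<in> S then k2 else 0)"]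
      k1[of k1 z] k2[of k2 z] poles_in_mero[OF assms(1), of UNIV] poles_in_mero[OF assms(2), of UNIV]
    by (auto split: if_splits)
  thus ?thesis unfolding poles_in_def using assms by (blast intro: meromorphic_intros)
qed

lemma poles_in_deriv:
  assumes "poles_in S u" shows "poles_in S (deriv u)"
proof -
  obtain k where k: "\<And>z. - int (if z \<in> S then k else 0) \<le> sub_ord u z"
    using assms unfolding poles_in_def by blast
  have "- int (if z \<in> S then Suc k else 0) \<le> sub_ord (deriv u) z" for z
    using k[of z] sub_ord_deriv[OF poles_in_mero[OF assms], of z]
    by (cases "sub_ord u z < 0") (auto split: if_splits)
  thus ?thesis unfolding poles_in_def using assms by (blast intro: meromorphic_intros)
qed

lemma poles_in_log_deriv:
  assumes "nonzero_mero u" "{z. zorder u z \<noteq> 0} \<subseteq> S" shows "poles_in S (\<lambda>z. deriv u z / u z)"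
  unfolding poles_in_def
proof (intro conjI exI[of _ 1] allI)
  show "(\<lambda>z. deriv u z / u z) meromorphic_on UNIV" using assms by (auto intro!: meromorphic_intros)
  show "- int (if z \<in> S then 1 else 0) \<le> sub_ord (\<lambda>z. deriv u z / u z) z" for z
    using sub_ord_log_deriv[OF assms(1), of z] assms(2) by (cases "zorder u z = 0") auto
qed

text \<open>Separates two arguments: a crude uniform order bound everywhere, and regularity off S by
  a finer local analysis.\<close>

lemma poles_in_restrict:
  assumes "poles_in UNIV u" "\<And>z. z \<notin> S \<Longrightarrow> 0 \<le> sub_ord u z" shows "poles_in S u"
proof -
  obtain k where "\<And>z. - int k \<le> sub_ord u z" using assms(1) unfolding poles_in_def by auto
  thus ?thesis using assms poles_in_mero[OF assms(1), of UNIV] unfolding poles_in_def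
    by (intro conjI exI[of _ k]) auto
qed

section \<open>The ring of small functions\<close>

text \<open>The functions that play the role of \<open>S(r, f)\<close>-small coefficients.\<close>

locale small_setup =
  fixes S :: "complex set" and \<nu> :: "complex \<Rightarrow> real"
  assumes \<nu>_fin: "loc_fin \<nu>" and \<nu>_nonneg: "\<And>z. 0 \<le> \<nu> z" and \<nu>_ge: "\<And>z. z \<in> S \<Longrightarrow> 1 \<le> \<nu> z"
    and \<nu>_sm: "sm (countN \<nu>)"
begin

definition small :: "(complex \<Rightarrow> complex) \<Rightarrow> bool" where
  "small u \<longleftrightarrow> nv.tame u \<and> poles_in S u"

lemma small_mero [dest]: "small u \<Longrightarrow> u meromorphic_on A"
  unfolding small_def by auto

lemma small_const [simp, intro]: "small (\<lambda>_. c)"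
  unfolding small_def by auto

lemma small_add [intro]: "small u \<Longrightarrow> small v \<Longrightarrow> small (\<lambda>z. u z + v z)"
  unfolding small_def using poles_in_add nv.tame_add by blast

lemma small_mult [intro]: "small u \<Longrightarrow> small v \<Longrightarrow> small (\<lambda>z. u z * v z)"
  unfolding small_def using poles_in_mult nv.tame_mult by blast

lemma small_deriv [intro]: "small u \<Longrightarrow> small (deriv u)"
  unfolding small_def using poles_in_deriv nv.tame_deriv by blast

lemma small_uminus [intro]: "small u \<Longrightarrow> small (\<lambda>z. - u z)"
  using small_mult[OF small_const[of "-1"]] by simp

lemma small_diff [intro]: "small u \<Longrightarrow> small v \<Longrightarrow> small (\<lambda>z. u z - v z)"
  using small_add[OF _ small_uminus] by simp

lemma small_power [intro]: "small u \<Longrightarrow> small (\<lambda>z. u z ^ k)"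
  by (induction k) auto

lemma small_divide_const [intro]: "small u \<Longrightarrow> small (\<lambda>z. u z / c)"
  using small_mult[OF _ small_const[of "1 / c"]] by simp

lemma proximity_tame_sm:
  assumes "\<forall>\<^sub>F r in nev. \<forall>z. norm z = r \<longrightarrow> norm (u z) \<le> r ^ M"
  shows "sm (\<lambda>r. proximity_m r u)"
proof (rule sm_mono[OF sm_ln[of "real M" 0]])
  show "\<forall>\<^sub>F r in nev. proximity_m r u \<le> real M * ln r + 0"
    using assms nev_ge[of 1]
  proof eventually_elim
    case (elim r)
    show ?case
    proof (rule proximity_le_const)
      fix z :: complex assume "norm z = r"
      hence "log_plus (norm (u z)) \<le> ln (r ^ M)" using elim by (intro log_plus_le_ln one_le_power) auto
      thus "log_plus (norm (u z)) \<le> real M * ln r + 0" using elim by (simp add: ln_realpow)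
    qed (use elim in auto)
  qed
qed

text \<open>A polynomial bound on circles makes m(r, u) logarithmic, bounded pole orders in S make
  N(r, u) at most k times an o(r) quantity, and the first main theorem transfers both to
  1/u.\<close>

lemma small_sm:
  assumes "small u" "nonzero_mero u"
  shows "sm (\<lambda>r. proximity_m r u)" "sm (countN (pole_div u))"
    "sm (\<lambda>r. proximity_m r (\<lambda>z. 1 / u z))" "sm (countN (zero_div u))"
proof -
  obtain M where "\<forall>\<^sub>F r in nev. \<forall>z. norm z = r \<longrightarrow> norm (u z) \<le> r ^ M"
    using nv.tame_bound assms(1) unfolding small_def by blast
  thus m: "sm (\<lambda>r. proximity_m r u)" by (rule proximity_tame_sm)
  obtain k where k: "\<And>z. - int (if z \<in> S then k else 0) \<le> sub_ord u z"
    using assms unfolding small_def poles_in_def by blast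
  have le: "pole_div u z \<le> real k * \<nu> z" for z
  proof (cases "z \<in> S")
    case True
    have "max 0 (- zorder u z) \<le> int k" using k[of z] True sub_ord_eq_zorder[OF assms(2), of z] by simp
    hence "real_of_int (max 0 (- zorder u z)) \<le> real_of_int (int k)" by (simp only: of_int_le_iff)
    hence "pole_div u z \<le> real k * 1" by (simp add: pole_div_def del: of_int_max)
    also have "\<dots> \<le> real k * \<nu> z" using \<nu>_ge[OF True] by (intro mult_left_mono) auto
    finally show ?thesis .
  next
    case False
    hence "pole_div u z = 0" using k[of z] by (simp add: pole_div_def sub_ord_eq_zorder[OF assms(2)])
    thus ?thesis using \<nu>_nonneg[of z] by simp
  qed
  have "sm (\<lambda>r. real k * countN \<nu> r)" by (intro sm_cmult \<nu>_sm) auto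
  moreover have "\<forall>\<^sub>F r in nev. countN (pole_div u) r \<le> real k * countN \<nu> r"
    using nev_ge[of 1]
    by eventually_elim (subst countN_cmult[OF \<nu>_fin, symmetric], intro countN_mono loc_fin_cmult \<nu>_fin le, auto)
  ultimately show N: "sm (countN (pole_div u))" by (rule sm_mono)
  obtain K where K: "\<And>r. good_radius u r \<Longrightarrow>
    proximity_m r u + countN (pole_div u) r = proximity_m r (\<lambda>z. 1 / u z) + countN (zero_div u) r + K"
    using first_main_theorem[OF assms(2)] by blast
  have s: "sm (\<lambda>r. proximity_m r u + countN (pole_div u) r + \<bar>K\<bar>)"
    by (intro sm_add m N sm_const)
  show "sm (\<lambda>r. proximity_m r (\<lambda>z. 1 / u z))"
  proof (rule sm_mono[OF s])
    show "\<forall>\<^sub>F r in nev. proximity_m r (\<lambda>z. 1 / u z) \<le> proximity_m r u + countN (pole_div u) r + \<bar>K\<bar>"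
      using nev_good_radius[OF assms(2)] nev_ge[of 1]
    proof eventually_elim
      case (elim r)
      show ?case using K[OF elim(1)] countN_nonneg[of "zero_div u" r] elim(2) by force
    qed
  qed
  show "sm (countN (zero_div u))"
  proof (rule sm_mono[OF s])
    show "\<forall>\<^sub>F r in nev. countN (zero_div u) r \<le> proximity_m r u + countN (pole_div u) r + \<bar>K\<bar>"
      using nev_good_radius[OF assms(2)]
    proof eventually_elim
      case (elim r)
      show ?case using K[OF elim] proximity_nonneg[of r "\<lambda>z. 1 / u z"] by force
    qed
  qed
qed

end

lemma proximity_exp_not_sm:
  assumes "sm X" "\<forall>\<^sub>F r in nev. proximity_m r (\<lambda>z. exp (\<alpha> * z)) \<le> X r" shows "\<alpha> = 0"
proof (rule ccontr)
  assume "\<alpha> \<noteq> 0"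
  have "\<forall>\<^sub>F r in nev. norm \<alpha> / 16 * r \<le> X r"
    using assms(2) nev_ge[of 1]
  proof eventually_elim
    case (elim r)
    have "norm \<alpha> / 16 * r \<le> proximity_m r (\<lambda>z. exp (\<alpha> * z))"
      by (rule proximity_exp_ge) (use elim in simp)
    thus ?case using elim(1) by (rule order_trans)
  qed
  thus False using sm_contradiction[OF assms(1), of "norm \<alpha> / 16"] \<open>\<alpha> \<noteq> 0\<close> by auto
qed

lemma proximity_mult_le:
  assumes "good_radius u r" "good_radius v r" "\<And>z. norm z = r \<Longrightarrow> norm (w z) \<le> norm (u z) * norm (v z)"
  shows "proximity_m r w \<le> proximity_m r u + proximity_m r v"
proof -
  have "proximity_m r w \<le> circ_mean r (\<lambda>z. log_plus (norm (u z)) + log_plus (norm (v z)))"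
    using assms good_radius_pos[OF assms(1)]
    by (intro proximity_le_mean continuous_intros good_radius_continuous_log_plus
        order_trans[OF log_plus_mono[OF assms(3)] log_plus_mult]) auto
  also have "\<dots> = proximity_m r u + proximity_m r v"
    unfolding proximity_eq_mean using assms good_radius_pos[OF assms(1)]
    by (intro circ_mean_add good_radius_continuous_log_plus) auto
  finally show ?thesis .
qed

lemma proximity_power:
  "proximity_m r (\<lambda>z. u z ^ k) = real k * proximity_m r u"
  unfolding proximity_eq_mean by (simp add: norm_power log_plus_power)

text \<open>Removing a sparse set from the plane leaves an open connected set, on which a vanishing
  derivative forces constancy.\<close>

lemma meromorphic_deriv_0_const:
  assumes "u meromorphic_on UNIV" "\<forall>\<^sub>\<approx>z. deriv u z = 0"
  shows "\<exists>c. \<forall>\<^sub>\<approx>z. u z = c"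
proof -
  define A where "A = {z. \<not> (u analytic_on {z} \<and> deriv u z = 0)}"
  have "\<forall>\<^sub>\<approx>z. u analytic_on {z} \<and> deriv u z = 0"
    using assms(2) meromorphic_on_imp_analytic_cosparse[OF assms(1)] by eventually_elim auto
  hence sp: "A sparse_in UNIV" unfolding A_def by (simp add: eventually_cosparse)
  have op: "open (UNIV - A)" and con: "connected (UNIV - A)"
    using open_diff_sparse_pts[OF open_UNIV sp] sparse_imp_connected[OF _ connected_UNIV open_UNIV sp] by auto
  have "\<exists>c. \<forall>z\<in>UNIV - A. u z = c"
  proof -
    have "(u has_field_derivative 0) (at z)" if "z \<in> UNIV - A" for z
    proof -
      have "u field_differentiable at z" using that analytic_on_imp_differentiable_at[of u "{z}" z] by (auto simp: A_def)
      thus ?thesis using that by (auto simp: A_def dest!: DERIV_deriv_iff_field_differentiable[THEN iffD2])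
    qed
    hence "\<exists>c. \<forall>z\<in>UNIV - A. u z = c"
      using DERIV_zero_connected_constant[OF con op, of "{}" u]
      by (metis (no_types, lifting) Diff_empty at_within_open continuous_on_eq_continuous_at
          DERIV_isCont finite.emptyI op)
    thus ?thesis .
  qed
  then obtain c where c: "\<And>z. z \<notin> A \<Longrightarrow> u z = c" by auto
  have "\<forall>\<^sub>\<approx>z. z \<notin> A" using sp by (simp add: eventually_cosparse)
  thus ?thesis using c by (intro exI[of _ c]) (auto elim: eventually_mono)
qed

text \<open>Upgrades identities off a sparse set to equality of functions: g supplies a finite limit
  of f at every point, and a nicely meromorphic function takes its limit as value where it has no
  pole.\<close>

lemma nicely_eq_entire:
  assumes "f nicely_meromorphic_on UNIV" "g holomorphic_on UNIV" "\<forall>\<^sub>\<approx>z. f z = g z"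
  shows "f = g"
proof
  fix z
  have gc: "g \<midarrow>z\<rightarrow> g z" using assms(2)
    by (meson UNIV_I continuous_on_eq_continuous_at holomorphic_on_imp_continuous_on isContD open_UNIV)
  have ev: "\<forall>\<^sub>F w in at z. g w = f w" using cosparse_eventually_at[OF assms(3), of z] by (auto elim: eventually_mono)
  have "f \<midarrow>z\<rightarrow> g z" using Lim_transform_eventually[OF gc ev] .
  moreover from this have "\<not> is_pole f z"
    unfolding is_pole_def using not_tendsto_and_filterlim_at_infinity[of "at z"] by auto
  hence "f \<midarrow>z\<rightarrow> f z" using assms(1) unfolding nicely_meromorphic_on_def by blast
  ultimately show "f z = g z" using LIM_unique by blast
qed

section \<open>The differential equation\<close>

text \<open>The assumptions are symmetric under exchanging (\<alpha>1, p1) with (\<alpha>2, p2).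
  Statements proved for \<alpha>1 are carried over to \<alpha>2 by \<open>swapped\<close>.\<close>

locale tumura_clunie =
  fixes n :: nat and P :: diff_poly and \<alpha>1 \<alpha>2 p1 p2 :: complex and f :: "complex \<Rightarrow> complex"
  assumes n2: "n \<ge> 2" and deg: "diff_poly_degree P \<le> n - 1"
    and \<alpha>0: "\<alpha>1 \<noteq> 0" "\<alpha>2 \<noteq> 0" and p0: "p1 \<noteq> 0" "p2 \<noteq> 0"
    and \<alpha>s: "\<alpha>1 + \<alpha>2 \<noteq> 0" and \<alpha>d: "\<alpha>1 \<noteq> \<alpha>2"
    and f_trans: "transcendental_meromorphic f"
    and f_eq: "\<forall>\<^sub>\<approx>z. f z ^ n + diff_poly_eval P f z = p1 * exp (\<alpha>1 * z) + p2 * exp (\<alpha>2 * z)"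
    and N_small: "is_S f (\<lambda>r. counting_N r f)"
begin

abbreviation "h \<equiv> \<lambda>z. p1 * exp (\<alpha>1 * z) + p2 * exp (\<alpha>2 * z)"
abbreviation "\<phi> \<equiv> phi_aux n \<alpha>1 \<alpha>2 f"
abbreviation "W \<equiv> \<lambda>z. f z ^ n + diff_poly_eval P f z"

definition s where "s = \<alpha>1 + \<alpha>2"

definition gf where "gf z = deriv f z / f z"

definition L where
  "L z = \<alpha>1 * \<alpha>2 - of_nat n * s * gf z + of_nat n * (of_nat n - 1) * gf z ^ 2 +
    of_nat n * (deriv gf z + gf z ^ 2)"

lemma f_nice: "f nicely_meromorphic_on UNIV"
  using f_trans by (simp add: transcendental_meromorphic_def)

lemma f_mero: "f meromorphic_on A"
  using f_nice meromorphic_on_subset[of f UNIV A] by (simp add: nicely_meromorphic_on_def)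

lemma f_nz: "nonzero_mero f"
proof -
  have "\<not> (\<forall>\<^sub>\<approx>z. f z = 0)"
  proof
    assume "\<forall>\<^sub>\<approx>z. f z = 0"
    hence "\<forall>\<^sub>\<approx>z. f z = ratfun_eval 0 z" by (simp add: ratfun_eval_def)
    thus False using f_trans unfolding transcendental_meromorphic_def by blast
  qed
  thus ?thesis using zero_or_nonzero_mero[OF f_mero] by blast
qed

lemma \<phi>_mero: "\<phi> meromorphic_on UNIV"
  unfolding phi_aux_def by (intro meromorphic_intros f_mero)

lemma gf_mero: "gf meromorphic_on UNIV"
  unfolding gf_def by (intro meromorphic_intros f_mero)

lemma L_mero: "L meromorphic_on UNIV"
  unfolding L_def by (intro meromorphic_intros gf_mero)

lemma sing_analytic: "z \<notin> sing f \<Longrightarrow> f analytic_on {z} \<and> f z \<noteq> 0"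
  by (simp add: sing_def)

lemma f_deriv: "f analytic_on {z} \<Longrightarrow> (f has_field_derivative deriv f z) (at z)"
  unfolding DERIV_deriv_iff_field_differentiable by (rule analytic_on_imp_differentiable_at) auto

lemma f_deriv2: "f analytic_on {z} \<Longrightarrow> (deriv f has_field_derivative deriv (deriv f) z) (at z)"
  unfolding DERIV_deriv_iff_field_differentiable
  by (rule analytic_on_imp_differentiable_at) (auto intro: analytic_deriv)

lemma deriv_gf:
  assumes "z \<notin> sing f" shows "deriv gf z = deriv (deriv f) z / f z - gf z ^ 2"
proof -
  have "(gf has_field_derivative (deriv (deriv f) z * f z - deriv f z * deriv f z) / (f z * f z)) (at z)"
    unfolding gf_def using sing_analytic[OF assms]
    by (intro DERIV_divide f_deriv f_deriv2) auto
  hence "deriv gf z = (deriv (deriv f) z * f z - deriv f z * deriv f z) / (f z * f z)" by (rule DERIV_imp_deriv)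
  thus ?thesis using sing_analytic[OF assms] by (simp add: gf_def diff_divide_distrib power2_eq_square)
qed

lemma \<phi>_eq: assumes "z \<notin> sing f" shows "\<phi> z = f z ^ 2 * L z"
proof -
  have nz: "f z \<noteq> 0" using sing_analytic[OF assms] by simp
  have 1: "deriv f z = f z * gf z" using nz by (simp add: gf_def)
  have 2: "deriv (deriv f) z = f z * (deriv gf z + gf z ^ 2)" using nz by (simp add: deriv_gf[OF assms])
  show ?thesis unfolding phi_aux_def L_def s_def 1 2 by (simp add: power2_eq_square algebra_simps)
qed

lemma \<phi>_eq_cosparse: "\<forall>\<^sub>\<approx>z. \<phi> z = f z ^ 2 * L z"
  using sing_cosparse[OF f_nz] by eventually_elim (rule \<phi>_eq)

lemma \<phi>_nz_iff: "nonzero_mero \<phi> \<longleftrightarrow> nonzero_mero L"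
proof -
  have "(\<forall>\<^sub>\<approx>z. \<phi> z \<noteq> 0) \<longleftrightarrow> (\<forall>\<^sub>\<approx>z. L z \<noteq> 0)"
  proof
    assume "\<forall>\<^sub>\<approx>z. \<phi> z \<noteq> 0"
    thus "\<forall>\<^sub>\<approx>z. L z \<noteq> 0" using \<phi>_eq_cosparse by eventually_elim auto
  next
    assume "\<forall>\<^sub>\<approx>z. L z \<noteq> 0"
    thus "\<forall>\<^sub>\<approx>z. \<phi> z \<noteq> 0" using \<phi>_eq_cosparse sing_cosparse[OF f_nz]
      by eventually_elim (auto simp: sing_def)
  qed
  thus ?thesis using \<phi>_mero L_mero by (simp add: nonzero_mero_cosparse_iff)
qed

lemma sub_ord_L: "-2 \<le> sub_ord L z"
proof -
  note [intro] = gf_mero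
  have g: "-1 \<le> sub_ord gf z"
    using sub_ord_log_deriv(1)[OF f_nz, of z] by (simp add: gf_def[abs_def])
  have m: "-2 \<le> sub_ord (\<lambda>z. c * u z) z" if "-2 \<le> sub_ord u z" "u meromorphic_on UNIV" for c u
    using sub_ord_mult[OF meromorphic_on_const[of c] that(2), of 0 z "-2"] that(1) by simp
  have g2: "-2 \<le> sub_ord (\<lambda>z. gf z ^ 2) z"
    using sub_ord_mult[of gf gf "-1" z "-1"] g by (simp add: power2_eq_square gf_mero)
  have g': "-2 \<le> sub_ord (deriv gf) z"
    using sub_ord_deriv[OF gf_mero, of z] g by (cases "sub_ord gf z < 0") auto
  have "-2 \<le> sub_ord (\<lambda>z. (\<alpha>1 * \<alpha>2 + (- (of_nat n * s)) * gf z) +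
     (of_nat n * (of_nat n - 1) * gf z ^ 2 + of_nat n * (deriv gf z + gf z ^ 2))) z"
    using g by (intro sub_ord_add m g2 g' meromorphic_intros gf_mero) auto
  thus ?thesis by (simp add: L_def[abs_def] algebra_simps)
qed

text \<open>\<phi> = f^2 L, and L has at most double poles because f'/f has at most simple
  ones.\<close>

lemma zorder_\<phi>:
  assumes "nonzero_mero \<phi>" shows "zorder \<phi> z \<ge> 2 * zorder f z - 2"
proof -
  have L: "nonzero_mero L" using assms \<phi>_nz_iff by simp
  have "zorder \<phi> z = zorder (\<lambda>z. f z ^ 2 * L z) z"
    by (rule zorder_cong) (use cosparse_eventually_at[OF \<phi>_eq_cosparse] in auto)
  also have "\<dots> = 2 * zorder f z + zorder L z"
    using zorder_mult'[OF nonzero_mero_power[OF f_nz, of 2] L, of z] zorder_power'[OF f_nz, of 2 z] by simp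
  finally show ?thesis using sub_ord_L[of z] sub_ord_eq_zorder[OF L, of z] by simp
qed

lemma \<phi>_analytic: "f analytic_on {z} \<Longrightarrow> \<phi> analytic_on {z}"
  unfolding phi_aux_def by (intro analytic_intros analytic_deriv)

text \<open>At a pole of f of order m the order bound gives a pole of \<phi> of order at most 2m + 2
  \<le> 4m. Elsewhere f is analytic and so is \<phi>.\<close>

lemma pole_div_\<phi>:
  assumes "nonzero_mero \<phi>" shows "pole_div \<phi> z \<le> 4 * pole_div f z"
proof (cases "is_pole f z")
  case True
  hence "zorder f z \<le> -1" using nonzero_mero_is_pole_iff[OF f_nz, of z] by simp
  thus ?thesis using zorder_\<phi>[OF assms, of z] by (simp add: pole_div_def)
next
  case False
  hence "f analytic_on {z}" using nicely_meromorphic_on_imp_analytic_at[OF f_nice] by auto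
  hence "zorder \<phi> z \<ge> 0"
    using zorder_ge_0[OF \<phi>_analytic nonzero_mero_freq[OF assms]] by blast
  thus ?thesis by (simp add: pole_div_def)
qed

text \<open>For a zero of order m \<ge> 2 of f, \<phi> vanishes to order at least 2m - 2 \<ge> m;
  simple zeros are counted separately.\<close>

lemma zero_div_f_le:
  assumes "nonzero_mero \<phi>" shows "zero_div f z \<le> of_bool (zorder f z = 1) + zero_div \<phi> z"
  using zorder_\<phi>[OF assms, of z] by (auto simp: zero_div_def)

lemma h_bound: "norm (h z) \<le> (norm p1 + norm p2 + 1) * exp (max (norm \<alpha>1) (norm \<alpha>2) * norm z)"
proof -
  have *: "norm (exp (\<alpha> * z)) \<le> exp (max (norm \<alpha>1) (norm \<alpha>2) * norm z)" if "\<alpha> \<in> {\<alpha>1, \<alpha>2}" for \<alpha>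
  proof -
    have "Re (\<alpha> * z) \<le> norm \<alpha> * norm z" by (metis complex_Re_le_cmod norm_mult)
    also have "\<dots> \<le> max (norm \<alpha>1) (norm \<alpha>2) * norm z" using that by (intro mult_right_mono) auto
    finally show ?thesis by simp
  qed
  have "norm (h z) \<le> norm p1 * exp (max (norm \<alpha>1) (norm \<alpha>2) * norm z) + norm p2 * exp (max (norm \<alpha>1) (norm \<alpha>2) * norm z)"
    using * by (intro norm_triangle_le add_mono) (auto simp: norm_mult intro!: mult_left_mono)
  also have "\<dots> \<le> (norm p1 + norm p2 + 1) * exp (max (norm \<alpha>1) (norm \<alpha>2) * norm z)"
    by (simp add: distrib_right)
  finally show ?thesis .
qed

lemma T_good: "\<exists>K r1. \<forall>r\<ge>r1. good_radius f r \<longrightarrow> characteristic_T r f \<le> K * r"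
  by (rule characteristic_linear_good[OF f_nz f_nice _ deg f_eq h_bound _ _ N_small])
     (use n2 in \<open>auto simp: le_max_iff_disj\<close>)

lemma T_upper: "\<exists>K. \<forall>\<^sub>F r in at_top. characteristic_T r f \<le> K * r"
  using T_good characteristic_linear[OF f_nz f_nice] by blast

sublocale ld: log_deriv_scale nev "\<lambda>r. r" "\<lambda>r. r" f
  using T_good log_deriv_scale_nev[OF f_nz f_nice] by blast

section \<open>The second-order operator and Clunie's argument\<close>

lemma W_analytic: "\<forall>\<^sub>\<approx>z. diff_poly_eval P f analytic_on {z}"
proof -
  have r: "ratfun_eval q meromorphic_on UNIV" for q by (rule nv.tame_mero[OF nv.tame_ratfun])
  have "diff_poly_eval P f meromorphic_on UNIV"
    unfolding diff_poly_eval_def by (intro meromorphic_intros r f_mero)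
  thus ?thesis by (rule meromorphic_on_imp_analytic_cosparse)
qed

definition D2 :: "(complex \<Rightarrow> complex) \<Rightarrow> complex \<Rightarrow> complex" where
  "D2 u z = deriv (deriv u) z - s * deriv u z + \<alpha>1 * \<alpha>2 * u z"

lemma D2_power: assumes "z \<notin> sing f" shows "D2 (\<lambda>z. f z ^ n) z = f z ^ (n - 2) * \<phi> z"
proof -
  have d1: "deriv (\<lambda>z. f z ^ n) w = of_nat n * f w ^ (n - 1) * deriv f w" if "w \<notin> sing f" for w
    using DERIV_power[OF f_deriv, of w n] sing_analytic[OF that] by (auto dest!: DERIV_imp_deriv)
  have fa: "f analytic_on {z}" using sing_analytic[OF assms] by simp
  have "\<forall>\<^sub>F w in nhds z. w \<in> - sing f"
    using closed_sing[OF f_nz] assms by (intro eventually_nhds_in_open) auto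
  hence "\<forall>\<^sub>F w in nhds z. deriv (\<lambda>z. f z ^ n) w = of_nat n * f w ^ (n - 1) * deriv f w"
    by eventually_elim (use d1 in auto)
  hence "deriv (deriv (\<lambda>z. f z ^ n)) z = deriv (\<lambda>w. of_nat n * f w ^ (n - 1) * deriv f w) z"
    by (rule deriv_cong_ev) simp
  also have "\<dots> = of_nat n * (of_nat (n - 1) * f z ^ (n - 2) * deriv f z) * deriv f z +
      of_nat n * f z ^ (n - 1) * deriv (deriv f) z"
  proof (rule DERIV_imp_deriv)
    have "((\<lambda>w. f w ^ (n - 1)) has_field_derivative of_nat (n - 1) * (deriv f z * f z ^ (n - 1 - Suc 0))) (at z)"
      by (rule DERIV_power[OF f_deriv[OF fa]])
    from DERIV_mult[OF DERIV_cmult[OF this, of "of_nat n"] f_deriv2[OF fa]]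
    show "((\<lambda>w. of_nat n * f w ^ (n - 1) * deriv f w) has_field_derivative
       of_nat n * (of_nat (n - 1) * f z ^ (n - 2) * deriv f z) * deriv f z +
      of_nat n * f z ^ (n - 1) * deriv (deriv f) z) (at z)"
      by (simp add: numeral_2_eq_2 mult_ac)
  qed
  finally have d2: "deriv (deriv (\<lambda>z. f z ^ n)) z = \<dots>" .
  obtain m where m: "n = Suc (Suc m)" using n2 by (metis Suc_le_D numeral_2_eq_2 Suc_le_mono)
  show ?thesis unfolding D2_def d2 d1[OF assms] phi_aux_def s_def unfolding m
    by (simp add: algebra_simps power2_eq_square)
qed

lemma D2_cong: assumes "\<forall>\<^sub>\<approx>z. u z = v z" shows "\<forall>\<^sub>\<approx>z. D2 u z = D2 v z"
  using assms meromorphic_deriv_cong[OF assms] meromorphic_deriv_cong[OF meromorphic_deriv_cong[OF assms]]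
  by eventually_elim (simp add: D2_def)

lemma D2_exp: "D2 (\<lambda>z. a * exp (\<alpha>1 * z) + b * exp (\<alpha>2 * z)) z = 0"
proof -
  have *: "deriv (\<lambda>z. a * exp (\<alpha>1 * z) + b * exp (\<alpha>2 * z)) = (\<lambda>z. a * \<alpha>1 * exp (\<alpha>1 * z) + b * \<alpha>2 * exp (\<alpha>2 * z))" for a b
    by (rule ext, rule DERIV_imp_deriv) (auto intro!: derivative_eq_intros)
  show ?thesis unfolding D2_def * s_def by (simp add: algebra_simps)
qed

lemma D2_add:
  assumes "u analytic_on {z}" "v analytic_on {z}" shows "D2 (\<lambda>z. u z + v z) z = D2 u z + D2 v z"
proof -
  have ev: "\<forall>\<^sub>F w in nhds z. u analytic_on {w} \<and> v analytic_on {w}"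
  proof -
    obtain A B where "open A" "z \<in> A" "u holomorphic_on A" "open B" "z \<in> B" "v holomorphic_on B"
      using assms by (auto simp: analytic_at)
    moreover from this have "\<forall>\<^sub>F w in nhds z. w \<in> A \<inter> B" by (intro eventually_nhds_in_open) auto
    ultimately have "\<forall>\<^sub>F w in nhds z. w \<in> A \<inter> B" "u analytic_on A" "v analytic_on B"
      by (auto simp: analytic_on_open)
    thus ?thesis by (auto elim!: eventually_mono intro: analytic_on_subset)
  qed
  have diff: "u field_differentiable at w" if "u analytic_on {w}" for u w
    by (rule analytic_on_imp_differentiable_at[OF that]) auto
  have d: "deriv (\<lambda>z. u z + v z) w = deriv u w + deriv v w" if "u analytic_on {w} \<and> v analytic_on {w}" for w
    using that by (intro deriv_add diff) auto
  have "\<forall>\<^sub>F w in nhds z. deriv (\<lambda>z. u z + v z) w = deriv u w + deriv v w"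
    using ev by eventually_elim (rule d)
  hence "deriv (deriv (\<lambda>z. u z + v z)) z = deriv (\<lambda>w. deriv u w + deriv v w) z" by (rule deriv_cong_ev) simp
  also have "\<dots> = deriv (deriv u) z + deriv (deriv v) z"
    using assms by (intro deriv_add diff analytic_deriv)
  finally show ?thesis using d[of z] assms by (simp add: D2_def algebra_simps)
qed

lemma power_\<phi>_eq: "\<forall>\<^sub>\<approx>z. f z ^ (n - 2) * \<phi> z = - D2 (diff_poly_eval P f) z"
  using D2_cong[OF f_eq] W_analytic sing_cosparse[OF f_nz]
proof eventually_elim
  case (elim z)
  have "D2 W z = D2 (\<lambda>z. f z ^ n) z + D2 (diff_poly_eval P f) z"
    using elim sing_analytic by (intro D2_add analytic_intros) auto
  thus ?case using elim(1) D2_exp D2_power[OF elim(3)] by (simp add: eq_neg_iff_add_eq_0)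
qed

lemma form_P: "ld.form (n - 1) (diff_poly_eval P f)"
  by (rule ld.form_diff_poly[OF deg])

lemma form_D2: "ld.form d u \<Longrightarrow> ld.form d (\<lambda>z. D2 u z)"
proof -
  assume u: "ld.form d u"
  have "ld.form d (\<lambda>z. (deriv (deriv u) z + (- s) * deriv u z) + (\<alpha>1 * \<alpha>2) * u z)"
    by (intro ld.form_add ld.form_deriv ld.form_mult u nv.tame_const)
  thus ?thesis by (simp add: D2_def)
qed

lemma tame_gf: "nv.tame gf"
  using ld.ld by (simp add: gf_def[abs_def])

lemma tame_L: "nv.tame L"
  unfolding L_def using tame_gf
  by (intro nv.tame_add nv.tame_diff nv.tame_mult nv.tame_const nv.tame_power nv.tame_deriv)

text \<open>Where \<open>f\<close> is small this is \<open>\<phi> = f\<^sup>2 L\<close>; elsewhere it is Clunie's argument,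
  since \<open>f\<^sup>n\<^sup>-\<^sup>2 \<phi>\<close> is a differential polynomial of degree \<open>n - 1\<close>.\<close>

lemma \<phi>_le: "\<exists>M. \<forall>\<^sub>F r in nev. \<forall>z. norm z = r \<longrightarrow> norm (\<phi> z) \<le> r ^ M * norm (f z)"
proof -
  obtain M1 where M1: "\<forall>\<^sub>F r in nev. \<forall>z. norm z = r \<longrightarrow>
      norm (D2 (diff_poly_eval P f) z) \<le> r ^ M1 * max 1 (norm (f z)) ^ (n - 1)"
    using ld.form_bound[OF form_D2[OF form_P]] by blast
  obtain M2 where M2: "\<forall>\<^sub>F r in nev. \<forall>z. norm z = r \<longrightarrow> norm (L z) \<le> r ^ M2"
    using nv.tame_bound[OF tame_L] by blast
  have "\<forall>\<^sub>F r in nev. \<forall>z. norm z = r \<longrightarrow> norm (\<phi> z) \<le> r ^ (M1 + M2) * norm (f z)"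
    using M1 M2 cosparse_nev[OF power_\<phi>_eq] cosparse_nev[OF sing_cosparse[OF f_nz]] nev_ge[of 1]
  proof eventually_elim
    case (elim r)
    have rM: "r ^ M1 \<le> r ^ (M1 + M2)" "r ^ M2 \<le> r ^ (M1 + M2)" using elim(5) by (auto intro!: power_increasing)
    show ?case
    proof (intro allI impI)
      fix z :: complex assume z: "norm z = r"
      have nz: "f z \<noteq> 0" using elim(4) z sing_analytic by blast
      show "norm (\<phi> z) \<le> r ^ (M1 + M2) * norm (f z)"
      proof (cases "norm (f z) \<le> 1")
        case True
        have "norm (\<phi> z) = norm (f z) * norm (f z) * norm (L z)"
          using \<phi>_eq[of z] elim(4) z by (simp add: norm_mult norm_power power2_eq_square)
        also have "\<dots> \<le> 1 * norm (f z) * r ^ M2"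
          using True elim(2) z by (intro mult_mono) auto
        also have "\<dots> \<le> r ^ (M1 + M2) * norm (f z)"
          using rM mult_right_mono[OF rM(2), of "norm (f z)"] by (simp add: mult.commute)
        finally show ?thesis .
      next
        case False
        have pos: "norm (f z) ^ (n - 2) > 0" using nz by simp
        have "norm (f z) ^ (n - 2) * norm (\<phi> z) = norm (D2 (diff_poly_eval P f) z)"
          using elim(3) z by (metis norm_minus_cancel norm_mult norm_power)
        also have "\<dots> \<le> r ^ M1 * norm (f z) ^ (n - 1)" using elim(1) z False by (auto simp: max_def)
        also have "norm (f z) ^ (n - 1) = norm (f z) ^ (n - 2) * norm (f z)"
          using n2 by (metis Suc_diff_le Suc_1 diff_Suc_Suc mult.commute power_Suc)
        finally have "norm (f z) ^ (n - 2) * norm (\<phi> z) \<le> norm (f z) ^ (n - 2) * (r ^ M1 * norm (f z))"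
          by (simp add: mult_ac)
        hence "norm (\<phi> z) \<le> r ^ M1 * norm (f z)" using pos by (simp only: mult_le_cancel_left_pos)
        also have "\<dots> \<le> r ^ (M1 + M2) * norm (f z)" using rM by (intro mult_right_mono) auto
        finally show ?thesis .
      qed
    qed
  qed
  thus ?thesis by blast
qed

text \<open>The operator d/dz - \<alpha>2 removes the second exponential, so (\<alpha>1 - \<alpha>2)
  p1 exp (\<alpha>1 z) is a polynomial of degree n in f with tame coefficients. Hence |exp
  (\<alpha>1 z)| is at most a power of r times max(1, |f|)^n, and linear growth of m(r, exp
  (\<alpha>1 z)) passes to m(r, f).\<close>

lemma m_lower: "\<exists>c>0. \<forall>\<^sub>F r in nev. c * r \<le> proximity_m r f"
proof -
  define \<beta> where "\<beta> = (\<alpha>1 - \<alpha>2) * p1"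
  have \<beta>: "\<beta> \<noteq> 0" using \<alpha>d p0 by (simp add: \<beta>_def)
  have fW: "ld.form n W"
    by (intro ld.form_add ld.form_power ld.form_mono[OF form_P]) auto
  have "ld.form n (\<lambda>z. deriv W z + (- \<alpha>2) * W z)"
    by (intro ld.form_add[OF ld.form_deriv[OF fW] ld.form_mult[OF fW]] nv.tame_const)
  moreover have "\<forall>\<^sub>\<approx>z. deriv W z + (- \<alpha>2) * W z = \<beta> * exp (\<alpha>1 * z)"
    using f_eq meromorphic_deriv_cong[OF f_eq]
  proof eventually_elim
    case (elim z)
    have "deriv h z = p1 * \<alpha>1 * exp (\<alpha>1 * z) + p2 * \<alpha>2 * exp (\<alpha>2 * z)"
      by (rule DERIV_imp_deriv) (auto intro!: derivative_eq_intros)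
    thus ?case using elim by (simp add: \<beta>_def algebra_simps)
  qed
  ultimately have "ld.form n (\<lambda>z. \<beta> * exp (\<alpha>1 * z))" by (rule ld.form_cong)
  then obtain M where M: "\<forall>\<^sub>F r in nev. \<forall>z. norm z = r \<longrightarrow>
      norm (\<beta> * exp (\<alpha>1 * z)) \<le> r ^ M * max 1 (norm (f z)) ^ n"
    using ld.form_bound by blast
  define c where "c = norm \<alpha>1 / 16"
  have c: "c > 0" using \<alpha>0 by (simp add: c_def)
  have ev: "\<forall>\<^sub>F r in nev. c * r \<le> real n * proximity_m r f + (real (Suc M) * ln r + 0)"
    using M nev_ge[of 1] nev_ge[of "1 / norm \<beta>"] nev_good_radius[OF f_nz]
  proof eventually_elim
    case (elim r)
    have cc: "continuous_on (sphere 0 r) (\<lambda>z. log_plus (norm (f z)))"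
      by (rule good_radius_continuous_log_plus[OF elim(4)])
    have "c * r \<le> proximity_m r (\<lambda>z. exp (\<alpha>1 * z))"
      using proximity_exp_ge[of r \<alpha>1] elim by (simp add: c_def)
    also have "\<dots> \<le> circ_mean r (\<lambda>z. real n * log_plus (norm (f z)) + (real (Suc M) * ln r + 0))"
    proof (rule proximity_le_mean)
      fix z :: complex assume z: "norm z = r"
      have "norm \<beta> * norm (exp (\<alpha>1 * z)) \<le> r ^ M * max 1 (norm (f z)) ^ n"
        using elim(1) z by (simp add: norm_mult)
      hence "norm (exp (\<alpha>1 * z)) \<le> 1 / norm \<beta> * (r ^ M * max 1 (norm (f z)) ^ n)"
        using \<beta> by (simp add: field_simps)
      also have "\<dots> \<le> r * (r ^ M * max 1 (norm (f z)) ^ n)"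
        using elim by (intro mult_right_mono) auto
      also have "\<dots> = r ^ Suc M * max 1 (norm (f z)) ^ n" by simp
      finally have "log_plus (norm (exp (\<alpha>1 * z))) \<le> log_plus (r ^ Suc M * max 1 (norm (f z)) ^ n)"
        by (rule log_plus_mono)
      also have "\<dots> \<le> log_plus (r ^ Suc M) + log_plus (max 1 (norm (f z)) ^ n)"
        using elim by (intro log_plus_mult) auto
      also have "log_plus (max 1 (norm (f z)) ^ n) = real n * log_plus (norm (f z))"
        by (subst log_plus_power) (auto simp: log_plus_def)
      also have "log_plus (r ^ Suc M) = real (Suc M) * ln r"
        using elim by (subst log_plus_power) (auto simp: log_plus_def)
      finally show "log_plus (norm (exp (\<alpha>1 * z))) \<le> real n * log_plus (norm (f z)) + (real (Suc M) * ln r + 0)"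
        by simp
    qed (use elim in \<open>auto intro!: continuous_intros cc\<close>)
    also have "\<dots> = real n * proximity_m r f + (real (Suc M) * ln r + 0)"
      using elim cc by (subst circ_mean_add) (auto intro!: continuous_intros simp: proximity_eq_mean)
    finally show ?case .
  qed
  have "\<forall>\<^sub>F r in nev. real (Suc M) * ln r + 0 \<le> c / 2 * r" by (rule sm_ev[OF sm_ln]) (use c in auto)
  with ev have "\<forall>\<^sub>F r in nev. c / (2 * real n) * r \<le> proximity_m r f"
  proof eventually_elim
    case (elim r)
    hence "c / 2 * r \<le> real n * proximity_m r f" by (simp add: field_simps)
    thus ?case using n2 by (simp add: field_simps)
  qed
  thus ?thesis using c n2 by (intro exI[of _ "c / (2 * real n)"]) auto
qed

section \<open>Order one and the identification of S(r, f) with o(r)\<close>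

lemma T_lower: "\<exists>c>0. \<forall>\<^sub>F r in nev. c * r \<le> characteristic_T r f"
proof -
  obtain c where c: "c > 0" "\<forall>\<^sub>F r in nev. c * r \<le> proximity_m r f" using m_lower by blast
  from c(2) nev_ge[of 1] have "\<forall>\<^sub>F r in nev. c * r \<le> characteristic_T r f"
    by eventually_elim (use countN_nonneg[of "pole_div f"] in \<open>force simp: characteristic_eq[OF f_nz]\<close>)
  thus ?thesis using c by blast
qed

lemma order_1: "growth_order f = 1"
  using T_upper T_lower growth_order_eq_1 by blast

text \<open>T(r, f) is at most a multiple of r for all large r, so o(T) implies o(r) with the same
  exceptional set.\<close>

lemma is_S_sm: assumes "is_S f X" shows "sm (\<lambda>r. \<bar>X r\<bar>)"
proof -
  obtain E where E: "E \<in> lmeasurable" "X \<in> o[inf at_top (principal (- E))](\<lambda>r. characteristic_T r f)"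
    using assms unfolding is_S_def by blast
  obtain K where K: "\<forall>\<^sub>F r in at_top. characteristic_T r f \<le> K * r" using T_upper by blast
  define K' where "K' = max K 1"
  have K': "K' > 0" by (simp add: K'_def)
  show ?thesis unfolding sm_def
  proof (intro bexI[OF _ E(1)] allI impI)
    fix \<epsilon> :: real assume \<epsilon>: "\<epsilon> > 0"
    have "\<forall>\<^sub>F r in inf at_top (principal (- E)). norm (X r) \<le> \<epsilon> / K' * norm (characteristic_T r f)"
      using \<epsilon> K' by (intro landau_o.smallD[OF E(2)]) auto
    moreover have "\<forall>\<^sub>F r in inf at_top (principal (- E)). characteristic_T r f \<le> K * r \<and> r \<ge> 1"
      by (rule filter_leD[OF inf_le1]) (use K eventually_ge_at_top[of 1] in eventually_elim, simp)
    ultimately show "\<forall>\<^sub>F r in inf at_top (principal (- E)). \<bar>X r\<bar> \<le> \<epsilon> * r"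
    proof eventually_elim
      case (elim r)
      have "characteristic_T r f \<ge> 0" using elim by (intro characteristic_nonneg f_nz) auto
      moreover have "K * r \<le> K' * r" using elim by (intro mult_right_mono) (auto simp: K'_def)
      moreover have "characteristic_T r f \<le> K * r" using elim by simp
      ultimately have "norm (characteristic_T r f) \<le> K' * r" unfolding real_norm_def by linarith
      hence "\<epsilon> / K' * norm (characteristic_T r f) \<le> \<epsilon> / K' * (K' * r)" using \<epsilon> K' by (intro mult_left_mono) auto
      also have "\<dots> = \<epsilon> * r" using K' by simp
      finally show ?case using elim by simp
    qed
  qed
qed

text \<open>The converse uses the linear lower bound on T, which is only known off an exceptional
  set; that set is joined to the given one.\<close>

lemma sm_is_S: assumes "sm (\<lambda>r. \<bar>X r\<bar>)" shows "is_S f X"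
proof -
  obtain E where E: "E \<in> lmeasurable" "\<And>\<epsilon>. \<epsilon> > 0 \<Longrightarrow> \<exists>r0. \<forall>r\<ge>r0. r \<notin> E \<longrightarrow> \<bar>X r\<bar> \<le> \<epsilon> * r"
    using assms unfolding sm_def eventually_at_top_principal by blast
  obtain c where c: "c > 0" "\<forall>\<^sub>F r in nev. c * r \<le> characteristic_T r f" using T_lower by blast
  obtain E' r1 where E': "E' \<in> lmeasurable" "\<And>r. r \<ge> r1 \<Longrightarrow> r \<notin> E' \<Longrightarrow> c * r \<le> characteristic_T r f"
    using c(2) unfolding eventually_nev by blast
  show ?thesis unfolding is_S_def
  proof (intro bexI[of _ "E \<union> E'"] landau_o.smallI)
    fix \<epsilon> :: real assume \<epsilon>: "\<epsilon> > 0"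
    obtain r0 where r0: "\<And>r. r \<ge> r0 \<Longrightarrow> r \<notin> E \<Longrightarrow> \<bar>X r\<bar> \<le> \<epsilon> * c * r" using E(2)[of "\<epsilon> * c"] \<epsilon> c by auto
    have "norm (X r) \<le> \<epsilon> * norm (characteristic_T r f)" if "r \<ge> max r0 r1" "r \<notin> E \<union> E'" for r
    proof -
      have "\<bar>X r\<bar> \<le> \<epsilon> * (c * r)" using r0[of r] that by (simp add: mult.assoc)
      also have "\<dots> \<le> \<epsilon> * norm (characteristic_T r f)" using E'(2)[of r] that \<epsilon> by (intro mult_left_mono) auto
      finally show ?thesis by simp
    qed
    thus "\<forall>\<^sub>F r in inf at_top (principal (- (E \<union> E'))). norm (X r) \<le> \<epsilon> * norm (characteristic_T r f)"
      unfolding eventually_at_top_principal by blast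
  qed (use E E' in \<open>auto intro: fmeasurable.Un\<close>)
qed

lemma sm_pole_f: "sm (countN (pole_div f))"
proof (rule sm_mono[OF is_S_sm[OF N_small]])
  show "\<forall>\<^sub>F r in nev. countN (pole_div f) r \<le> \<bar>counting_N r f\<bar>"
    using nev_ge[of 1] by eventually_elim (auto simp: counting_N_eq[OF f_nz])
qed

lemma is_S_zero_iff: "is_S f (\<lambda>r. counting_N r (\<lambda>z. 1 / f z)) \<longleftrightarrow> sm (countN (zero_div f))"
proof
  assume "is_S f (\<lambda>r. counting_N r (\<lambda>z. 1 / f z))"
  note s = is_S_sm[OF this]
  show "sm (countN (zero_div f))"
    by (rule sm_mono[OF s])
       (use nev_ge[of 1] in eventually_elim, auto simp: counting_N_inverse_eq[OF f_nz])
next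
  assume s: "sm (countN (zero_div f))"
  show "is_S f (\<lambda>r. counting_N r (\<lambda>z. 1 / f z))"
    by (rule sm_is_S, rule sm_mono[OF s])
       (use nev_ge[of 1] in eventually_elim, auto simp: counting_N_inverse_eq[OF f_nz] countN_nonneg)
qed

text \<open>Taking the positive part of the difference as the error makes the inequality hold at
  every r > 0, so the content is that this error is small. From (1/f)^2 = L/\<phi>, m(r, 1/f) is at
  most half of m(r, 1/\<phi>) up to O(ln r), while N(r, 1/f) is at most the simple-zero count plus
  N(r, 1/\<phi>). Half of N(r, 1/\<phi>) is contained in half of T(r, \<phi>), which leaves the
  other half as a separate term.\<close>

lemma case_II_inequality:
  assumes \<phi>: "nonzero_mero \<phi>"
  shows "\<exists>S. is_S f S \<and> (\<forall>r>0. characteristic_T r f \<le> counting_N_simple_zeros r f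
              + 1 / 2 * characteristic_T r \<phi> + 1 / 2 * counting_N r (\<lambda>z. 1 / \<phi> z) + S r)"
proof -
  define B where "B = (\<lambda>r. counting_N_simple_zeros r f
              + 1 / 2 * characteristic_T r \<phi> + 1 / 2 * counting_N r (\<lambda>z. 1 / \<phi> z))"
  define S where "S = (\<lambda>r. max 0 (characteristic_T r f - B r))"
  obtain M where M: "\<forall>\<^sub>F r in nev. \<forall>z. norm z = r \<longrightarrow> norm (L z) \<le> r ^ M"
    using nv.tame_bound[OF tame_L] by blast
  obtain K1 where K1: "\<And>r. good_radius f r \<Longrightarrow>
    proximity_m r f + countN (pole_div f) r = proximity_m r (\<lambda>z. 1 / f z) + countN (zero_div f) r + K1"
    using first_main_theorem[OF f_nz] by blast
  obtain K2 where K2: "\<And>r. good_radius \<phi> r \<Longrightarrow>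
    proximity_m r \<phi> + countN (pole_div \<phi>) r = proximity_m r (\<lambda>z. 1 / \<phi> z) + countN (zero_div \<phi>) r + K2"
    using first_main_theorem[OF \<phi>] by blast
  have "sm (\<lambda>r. \<bar>S r\<bar>)"
  proof (rule sm_mono[OF sm_ln[of "M" "\<bar>K1\<bar> + \<bar>K2\<bar>"]])
    show "\<forall>\<^sub>F r in nev. \<bar>S r\<bar> \<le> real M * ln r + (\<bar>K1\<bar> + \<bar>K2\<bar>)"
      using M nev_ge[of 1] nev_good_radius[OF f_nz] nev_good_radius[OF \<phi>]
    proof eventually_elim
      case (elim r)
      note gi = good_radius_inverse[OF elim(4)]
      have "2 * proximity_m r (\<lambda>z. 1 / f z) = proximity_m r (\<lambda>z. (1 / f z) ^ 2)"
        by (subst proximity_power) simp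
      also have "\<dots> \<le> circ_mean r (\<lambda>z. real M * ln r + log_plus (norm (1 / \<phi> z)))"
      proof (rule proximity_le_mean)
        fix z :: complex assume z: "norm z = r"
        have ns: "z \<notin> sing f" "\<phi> z \<noteq> 0" using z elim by (auto simp: good_radius_def sing_def)
        have "(1 / f z) ^ 2 = L z * (1 / \<phi> z)"
          using \<phi>_eq[OF ns(1)] ns(2) by (auto simp: field_simps)
        hence "norm ((1 / f z) ^ 2) \<le> r ^ M * norm (1 / \<phi> z)"
          using elim(1) z unfolding norm_mult[symmetric]
          by (simp only: norm_mult) (intro mult_right_mono, auto)
        hence "log_plus (norm ((1 / f z) ^ 2)) \<le> log_plus (r ^ M) + log_plus (norm (1 / \<phi> z))"
          using elim by (intro order_trans[OF log_plus_mono log_plus_mult]) auto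
        also have "log_plus (r ^ M) = real M * ln r"
          using elim by (subst log_plus_power) (auto simp: log_plus_def)
        finally show "log_plus (norm ((1 / f z) ^ 2)) \<le> real M * ln r + log_plus (norm (1 / \<phi> z))" .
      qed (use elim gi in \<open>auto intro!: continuous_intros good_radius_continuous_log_plus\<close>)
      also have "\<dots> = real M * ln r + proximity_m r (\<lambda>z. 1 / \<phi> z)"
        using elim good_radius_continuous_log_plus[OF gi]
        by (subst circ_mean_add) (auto intro!: continuous_intros simp: proximity_eq_mean)
      finally have 1: "2 * proximity_m r (\<lambda>z. 1 / f z) \<le> real M * ln r + proximity_m r (\<lambda>z. 1 / \<phi> z)" .
      have lf: "loc_fin (\<lambda>a. of_bool (zorder f a = 1))"
        by (rule loc_fin_subset[OF loc_fin_zorder[OF f_nz]]) auto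
      have "countN (zero_div f) r \<le> countN (\<lambda>a. of_bool (zorder f a = 1) + zero_div \<phi> a) r"
        using elim \<phi> by (intro countN_mono loc_fin_add lf zero_div_f_le) auto
      also have "\<dots> = countN (\<lambda>a. of_bool (zorder f a = 1)) r + countN (zero_div \<phi>) r"
        using \<phi> by (intro countN_add lf) auto
      finally have 2: "countN (zero_div f) r \<le> counting_N_simple_zeros r f + countN (zero_div \<phi>) r"
        using elim counting_N_simple_zeros_eq[OF f_nz, of r] by simp
      have "characteristic_T r f = proximity_m r (\<lambda>z. 1 / f z) + countN (zero_div f) r + K1"
        using K1[OF elim(3)] elim by (simp add: characteristic_eq[OF f_nz])
      moreover have "characteristic_T r \<phi> = proximity_m r (\<lambda>z. 1 / \<phi> z) + countN (zero_div \<phi>) r + K2"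
        using K2[OF elim(4)] elim by (simp add: characteristic_eq[OF \<phi>])
      moreover have "counting_N r (\<lambda>z. 1 / \<phi> z) = countN (zero_div \<phi>) r"
        using elim by (simp add: counting_N_inverse_eq[OF \<phi>])
      moreover have "real M * ln r \<ge> 0" using elim by simp
      ultimately have "characteristic_T r f - B r \<le> real M * ln r + (\<bar>K1\<bar> + \<bar>K2\<bar>)"
        using 1 2 unfolding B_def by linarith
      thus ?case using elim unfolding S_def by auto
    qed
  qed
  hence "is_S f S" by (rule sm_is_S)
  moreover have "characteristic_T r f \<le> B r + S r" for r unfolding S_def by simp
  ultimately show ?thesis unfolding B_def by blast
qed

end

section \<open>Linear independence of exponentials\<close>

text \<open>Induction on the sum of degree + 1 over the nonzero coefficients. Multiplying by exp (-l
  z) and differentiating lowers the degree of the chosen coefficient and preserves the others, so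
  all new coefficients vanish. Hence the original ones other than p l are zero, and a single
  exponential term remains.\<close>

lemma exp_poly_independent:
  fixes p :: "complex \<Rightarrow> complex poly"
  assumes "finite \<Lambda>" "\<And>z. (\<Sum>l\<in>\<Lambda>. poly (p l) z * exp (l * z)) = 0" "l \<in> \<Lambda>"
  shows "p l = 0"
  using assms(2,3)
proof (induction "\<Sum>l\<in>\<Lambda>. if p l = 0 then 0 else Suc (degree (p l))" arbitrary: p l rule: less_induct)
  case less
  show ?case
  proof (rule ccontr)
    assume nz: "p l \<noteq> 0"
    define p' where "p' = (\<lambda>m. pderiv (p m) + smult (m - l) (p m))"
    define \<mu> where "\<mu> = (\<lambda>p :: complex poly. if p = 0 then 0 else Suc (degree p))"
    have pd: "\<mu> (pderiv q) < \<mu> q" if "q \<noteq> 0" for q :: "complex poly"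
      using that pderiv_eq_0_iff[of q] by (auto simp: \<mu>_def degree_pderiv)
    have deg: "degree (p' m) = degree (p m) \<and> p' m \<noteq> 0" if "p m \<noteq> 0" "m \<noteq> l" for m
    proof (cases "degree (p m) = 0")
      case True
      hence "pderiv (p m) = 0" by (simp add: pderiv_eq_0_iff)
      thus ?thesis using that by (simp add: p'_def)
    next
      case False
      have "degree (pderiv (p m)) < degree (smult (m - l) (p m))"
        using that False by (simp add: degree_pderiv)
      hence d: "degree (p' m) = degree (p m)" unfolding p'_def using that by (simp add: degree_add_eq_right)
      hence "p' m \<noteq> 0" using False by auto
      with d show ?thesis by simp
    qed
    have le: "\<mu> (p' m) \<le> \<mu> (p m)" if "m \<in> \<Lambda>" for m
    proof (cases "p m = 0 \<or> m = l")
      case True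
      thus ?thesis using pd[of "p m"] by (cases "p m = 0") (auto simp: p'_def)
    next
      case False thus ?thesis using deg[of m] by (simp add: \<mu>_def)
    qed
    have "\<mu> (p' l) < \<mu> (p l)" using pd[OF nz] by (simp add: p'_def)
    hence lt: "(\<Sum>m\<in>\<Lambda>. \<mu> (p' m)) < (\<Sum>m\<in>\<Lambda>. \<mu> (p m))"
      using le less.prems(2) assms(1) by (intro sum_strict_mono_ex1) auto
    have eq: "(\<Sum>m\<in>\<Lambda>. poly (p' m) z * exp (m * z)) = 0" for z
    proof -
      have "(\<lambda>z. exp (- l * z) * (\<Sum>m\<in>\<Lambda>. poly (p m) z * exp (m * z))) = (\<lambda>z. 0)"
        using less.prems(1) by simp
      moreover have "(\<lambda>z. exp (- l * z) * (\<Sum>m\<in>\<Lambda>. poly (p m) z * exp (m * z))) =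
         (\<lambda>z. \<Sum>m\<in>\<Lambda>. poly (p m) z * exp ((m - l) * z))"
        by (simp add: sum_distrib_left mult_ac fun_eq_iff mult_exp_exp algebra_simps)
      ultimately have 0: "(\<lambda>z. \<Sum>m\<in>\<Lambda>. poly (p m) z * exp ((m - l) * z)) = (\<lambda>z. 0)" by simp
      have "((\<lambda>z. \<Sum>m\<in>\<Lambda>. poly (p m) z * exp ((m - l) * z)) has_field_derivative
        (\<Sum>m\<in>\<Lambda>. poly (p' m) z * exp ((m - l) * z))) (at z)"
        unfolding p'_def
        by (rule DERIV_sum) (auto intro!: derivative_eq_intros simp: algebra_simps)
      hence "(\<Sum>m\<in>\<Lambda>. poly (p' m) z * exp ((m - l) * z)) = 0"
        unfolding 0 using DERIV_unique DERIV_const by blast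
      hence "exp (l * z) * (\<Sum>m\<in>\<Lambda>. poly (p' m) z * exp ((m - l) * z)) = 0" by simp
      thus ?thesis by (simp add: sum_distrib_left mult_ac mult_exp_exp algebra_simps)
    qed
    have p'0: "p' m = 0" if "m \<in> \<Lambda>" for m
      using less.hyps[of p' m] lt eq that unfolding \<mu>_def by blast
    have "p m = 0" if "m \<in> \<Lambda>" "m \<noteq> l" for m using p'0[OF that(1)] deg[of m] that(2) by blast
    hence "(\<Sum>m\<in>\<Lambda>. poly (p m) z * exp (m * z)) = (\<Sum>m\<in>{l}. poly (p m) z * exp (m * z))" for z
      using less.prems(2) assms(1) by (intro sum.mono_neutral_right) auto
    hence "poly (p l) z = 0" for z using less.prems(1)[of z] by simp
    thus False using nz poly_all_0_iff_0[of "p l"] by simp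
  qed
qed

lemma higher_deriv_exp:
  "(deriv ^^ j) (\<lambda>z. c * exp (a * z) + d :: complex) = (\<lambda>z. poly (if j = 0 then [:d, c:] else [:0, c * a ^ j:]) (exp (a * z)))"
proof (induction j)
  case (Suc j)
  have "deriv (\<lambda>z. poly (if j = 0 then [:d, c:] else [:0, c * a ^ j:]) (exp (a * z))) =
     (\<lambda>z. poly [:0, c * a ^ Suc j:] (exp (a * z)))"
    by (rule ext, rule DERIV_imp_deriv) (auto intro!: derivative_eq_intros simp: mult_ac)
  thus ?case using Suc by simp
qed (auto simp: mult.commute)

lemma poly_cosparse: assumes "p \<noteq> 0" shows "\<forall>\<^sub>\<approx>z. poly p z \<noteq> (0::complex)"
proof -
  have "finite {z. poly p z = 0}" using assms by (rule poly_roots_finite)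
  thus ?thesis unfolding eventually_cosparse by (auto intro: finite_imp_sparse)
qed

text \<open>Each derivative of c exp (a z) + d is a polynomial of degree at most 1 in exp (a z), so
  a monomial of total degree i becomes one of degree at most i. \<open>D\<close> clears the
  denominators of the rational coefficients.\<close>

lemma diff_poly_exp:
  fixes a c d :: complex
  assumes "diff_poly_degree P \<le> m"
  shows "\<exists>D B. D \<noteq> 0 \<and> (\<forall>\<^sub>\<approx>z. poly D z * diff_poly_eval P (\<lambda>z. c * exp (a * z) + d) z =
     (\<Sum>k\<le>m. poly (B k) z * exp (of_nat k * a * z)))"
proof -
  define K where "K = Poly_Mapping.keys P"
  define e where "e = (\<lambda>j::nat. if j = 0 then [:d, c:] else [:0, c * a ^ j:])"
  define g where "g = (\<lambda>l::nat \<Rightarrow>\<^sub>0 nat. \<Prod>j\<in>Poly_Mapping.keys l. e j ^ Poly_Mapping.lookup l j)"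
  define num where "num = (\<lambda>l. fst (quot_of_fract (Poly_Mapping.lookup P l)))"
  define den where "den = (\<lambda>l. snd (quot_of_fract (Poly_Mapping.lookup P l)))"
  have den: "den l \<noteq> 0" for l by (simp add: den_def)
  have fin: "finite K" by (simp add: K_def)
  define D where "D = (\<Prod>l\<in>K. den l)"
  define b where "b = (\<lambda>l. num l * (\<Prod>l'\<in>K - {l}. den l'))"
  define B where "B = (\<lambda>k. \<Sum>l\<in>K. smult (coeff (g l) k) (b l))"
  have D0: "D \<noteq> 0" using den fin by (simp add: D_def)
  have dg: "degree (g l) \<le> m" if "l \<in> K" for l
  proof -
    have "degree (g l) \<le> (\<Sum>j\<in>Poly_Mapping.keys l. degree (e j ^ Poly_Mapping.lookup l j))"
      unfolding g_def by (rule degree_prod_sum_le[OF finite_keys, unfolded o_def])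
    also have "\<dots> \<le> (\<Sum>j\<in>Poly_Mapping.keys l. Poly_Mapping.lookup l j)"
    proof (rule sum_mono)
      fix j
      have "degree (e j) \<le> 1" by (auto simp: e_def)
      hence "degree (e j) * Poly_Mapping.lookup l j \<le> 1 * Poly_Mapping.lookup l j" by (intro mult_right_mono) auto
      thus "degree (e j ^ Poly_Mapping.lookup l j) \<le> Poly_Mapping.lookup l j"
        using degree_power_le[of "e j" "Poly_Mapping.lookup l j"] by linarith
    qed
    also have "\<dots> \<le> diff_poly_degree P" unfolding diff_poly_degree_def
      using that by (intro Max_ge) (auto simp: K_def)
    finally show ?thesis using assms by simp
  qed
  have "\<forall>\<^sub>\<approx>z. poly D z * diff_poly_eval P (\<lambda>z. c * exp (a * z) + d) z =
     (\<Sum>k\<le>m. poly (B k) z * exp (of_nat k * a * z))"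
    using poly_cosparse[OF D0]
  proof eventually_elim
    case (elim z)
    have dz: "poly (den l) z \<noteq> 0" if "l \<in> K" for l
      using elim that fin unfolding D_def by (auto simp: poly_prod)
    have "poly D z * diff_poly_eval P (\<lambda>z. c * exp (a * z) + d) z =
      (\<Sum>l\<in>K. poly D z * (poly (num l) z / poly (den l) z) * poly (g l) (exp (a * z)))"
      unfolding diff_poly_eval_def higher_deriv_exp K_def[symmetric] sum_distrib_left
      by (simp add: ratfun_eval_def num_def den_def g_def e_def poly_prod poly_power mult_ac)
    also have "\<dots> = (\<Sum>l\<in>K. poly (b l) z * (\<Sum>k\<le>m. coeff (g l) k * exp (a * z) ^ k))"
    proof (rule sum.cong[OF refl])
      fix l assume l: "l \<in> K"
      have "D = den l * (\<Prod>l'\<in>K - {l}. den l')" unfolding D_def using fin l by (rule prod.remove)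
      hence "poly D z * (poly (num l) z / poly (den l) z) = poly (b l) z"
        using dz[OF l] by (simp add: b_def)
      moreover have "poly (g l) (exp (a * z)) = (\<Sum>k\<le>m. coeff (g l) k * exp (a * z) ^ k)"
        unfolding poly_altdef using dg[OF l] by (intro sum.mono_neutral_left) (auto simp: coeff_eq_0)
      ultimately show "poly D z * (poly (num l) z / poly (den l) z) * poly (g l) (exp (a * z)) =
        poly (b l) z * (\<Sum>k\<le>m. coeff (g l) k * exp (a * z) ^ k)" by simp
    qed
    also have "\<dots> = (\<Sum>l\<in>K. \<Sum>k\<le>m. poly (b l) z * coeff (g l) k * exp (a * z) ^ k)"
      by (simp add: sum_distrib_left mult_ac)
    also have "\<dots> = (\<Sum>k\<le>m. \<Sum>l\<in>K. poly (b l) z * coeff (g l) k * exp (a * z) ^ k)" by (rule sum.swap)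
    also have "\<dots> = (\<Sum>k\<le>m. poly (B k) z * exp (of_nat k * a * z))"
    proof (rule sum.cong[OF refl])
      fix k
      have "exp (a * z) ^ k = exp (of_nat k * a * z)" by (simp add: exp_of_nat_mult[symmetric] mult_ac)
      thus "(\<Sum>l\<in>K. poly (b l) z * coeff (g l) k * exp (a * z) ^ k) = poly (B k) z * exp (of_nat k * a * z)"
        unfolding B_def poly_sum sum_distrib_right by (intro sum.cong refl) simp
    qed
    finally show ?case .
  qed
  thus ?thesis using D0 by blast
qed

section \<open>Solutions that are affine in an exponential\<close>

context tumura_clunie
begin

text \<open>With a = \<alpha>1/n, the differential polynomial and the lower binomial terms only
  produce exponents k a with k \<le> n - 1. Hence \<alpha>1 = n a arises on the left only from f^n,
  which gives c^n = p1, and \<alpha>2 must be one of the k a. The case d = 0 serves the zero-poor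
  solutions and d \<noteq> 0 those with constant \<phi>.\<close>

lemma exp_solution:
  assumes f: "f = (\<lambda>z. c * exp (\<alpha>1 * z / of_nat n) + d)"
  shows "c ^ n = p1 \<and> (\<exists>k. 1 \<le> k \<and> k \<le> n - 1 \<and> of_nat k * \<alpha>1 = of_nat n * \<alpha>2)"
proof -
  define a where "a = \<alpha>1 / of_nat n"
  have n0: "of_nat n \<noteq> (0::complex)" using n2 by simp
  have a0: "a \<noteq> 0" "of_nat n * a = \<alpha>1" using \<alpha>0 n0 by (auto simp: a_def)
  have f': "f = (\<lambda>z. c * exp (a * z) + d)" unfolding f a_def by simp
  obtain D B where D: "D \<noteq> 0" and B: "\<forall>\<^sub>\<approx>z. poly D z * diff_poly_eval P f z =
     (\<Sum>k\<le>n-1. poly (B k) z * exp (of_nat k * a * z))"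
    using diff_poly_exp[OF deg, of c a d] unfolding f' by blast
  define C where "C = (\<lambda>k. B k + smult (of_nat (n choose k) * c ^ k * d ^ (n - k)) D)"
  define \<Lambda> where "\<Lambda> = insert \<alpha>1 (insert \<alpha>2 ((\<lambda>k. of_nat k * a) ` {..n-1}))"
  \<comment> \<open>Terms are grouped by exponent because \<alpha>2 coincides with some k a;
    independence applies only to distinct exponents. The last two summands move the right-hand side
    over.\<close>
  define q where "q = (\<lambda>l. (\<Sum>k | k \<le> n - 1 \<and> of_nat k * a = l. C k) +
     (if l = \<alpha>1 then smult (c ^ n - p1) D else 0) - (if l = \<alpha>2 then smult p2 D else 0))"
  have fin: "finite \<Lambda>" by (simp add: \<Lambda>_def)
  have grp: "(\<Sum>l\<in>\<Lambda>. poly (q l) z * exp (l * z)) = (\<Sum>k\<le>n-1. poly (C k) z * exp (of_nat k * a * z)) +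
     (c ^ n - p1) * poly D z * exp (\<alpha>1 * z) - p2 * poly D z * exp (\<alpha>2 * z)" for z
  proof -
    have "(\<Sum>l\<in>\<Lambda>. \<Sum>k | k \<in> {..n-1} \<and> of_nat k * a = l. poly (C k) z * exp (of_nat k * a * z)) =
       (\<Sum>k\<le>n-1. poly (C k) z * exp (of_nat k * a * z))"
      using fin by (intro sum.group) (auto simp: \<Lambda>_def)
    moreover have "(\<Sum>l\<in>\<Lambda>. \<Sum>k | k \<in> {..n-1} \<and> of_nat k * a = l. poly (C k) z * exp (of_nat k * a * z)) =
       (\<Sum>l\<in>\<Lambda>. poly (\<Sum>k | k \<le> n - 1 \<and> of_nat k * a = l. C k) z * exp (l * z))"
      by (intro sum.cong refl) (auto simp: poly_sum sum_distrib_right intro!: sum.cong)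
    moreover have "(\<Sum>l\<in>\<Lambda>. poly (if l = \<alpha>1 then smult (c ^ n - p1) D else 0) z * exp (l * z)) =
       (\<Sum>l\<in>\<Lambda>. if l = \<alpha>1 then (c ^ n - p1) * poly D z * exp (\<alpha>1 * z) else 0)"
      by (intro sum.cong refl) auto
    moreover have "\<dots> = (c ^ n - p1) * poly D z * exp (\<alpha>1 * z)" using fin by (simp add: \<Lambda>_def)
    moreover have "(\<Sum>l\<in>\<Lambda>. poly (if l = \<alpha>2 then smult p2 D else 0) z * exp (l * z)) =
       (\<Sum>l\<in>\<Lambda>. if l = \<alpha>2 then p2 * poly D z * exp (\<alpha>2 * z) else 0)"
      by (intro sum.cong refl) auto
    moreover have "\<dots> = p2 * poly D z * exp (\<alpha>2 * z)" using fin by (simp add: \<Lambda>_def)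
    ultimately show ?thesis unfolding q_def poly_add poly_diff ring_distribs sum.distrib sum_subtractf by simp
  qed
  have binom: "(c * exp (a * z) + d) ^ n =
     (\<Sum>k\<le>n-1. of_nat (n choose k) * c ^ k * d ^ (n - k) * exp (of_nat k * a * z)) + c ^ n * exp (\<alpha>1 * z)" for z
  proof -
    have "(c * exp (a * z) + d) ^ n = (\<Sum>k\<le>n. of_nat (n choose k) * (c * exp (a * z)) ^ k * d ^ (n - k))"
      by (rule binomial_ring)
    also have "{..n} = insert n {..n-1}" using n2 by auto
    also have "(\<Sum>k\<in>insert n {..n-1}. of_nat (n choose k) * (c * exp (a * z)) ^ k * d ^ (n - k)) =
       c ^ n * exp (a * z) ^ n + (\<Sum>k\<le>n-1. of_nat (n choose k) * (c * exp (a * z)) ^ k * d ^ (n - k))"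
      using n2 by (subst sum.insert) (auto simp: power_mult_distrib)
    finally show ?thesis
      using a0 by (simp add: power_mult_distrib exp_of_nat_mult[symmetric] mult_ac flip: a0(2))
  qed
  have "\<forall>\<^sub>\<approx>z. (\<Sum>l\<in>\<Lambda>. poly (q l) z * exp (l * z)) = 0"
    using f_eq B
  proof eventually_elim
    case (elim z)
    have "poly D z * f z ^ n + poly D z * diff_poly_eval P f z = poly D z * (p1 * exp (\<alpha>1 * z) + p2 * exp (\<alpha>2 * z))"
      using elim(1) by (simp flip: distrib_left)
    hence "(\<Sum>k\<le>n-1. poly D z * (of_nat (n choose k) * c ^ k * d ^ (n - k) * exp (of_nat k * a * z))) +
        poly D z * (c ^ n * exp (\<alpha>1 * z)) + (\<Sum>k\<le>n-1. poly (B k) z * exp (of_nat k * a * z)) =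
        poly D z * (p1 * exp (\<alpha>1 * z) + p2 * exp (\<alpha>2 * z))"
      unfolding elim(2) by (simp add: f' binom distrib_left sum_distrib_left)
    moreover have "(\<Sum>k\<le>n-1. poly (C k) z * exp (of_nat k * a * z)) =
      (\<Sum>k\<le>n-1. poly D z * (of_nat (n choose k) * c ^ k * d ^ (n - k) * exp (of_nat k * a * z))) +
      (\<Sum>k\<le>n-1. poly (B k) z * exp (of_nat k * a * z))"
      unfolding C_def sum.distrib[symmetric] by (intro sum.cong refl) (simp add: algebra_simps)
    ultimately show ?case unfolding grp by (simp add: algebra_simps)
  qed
  hence "(\<lambda>z. \<Sum>l\<in>\<Lambda>. poly (q l) z * exp (l * z)) = (\<lambda>z. 0)"
    by (intro nicely_eq_entire analytic_on_imp_nicely_meromorphic_on analytic_intros poly_analytic) auto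
  hence "(\<Sum>l\<in>\<Lambda>. poly (q l) z * exp (l * z)) = 0" for z by (rule fun_cong)
  hence q0: "q l = 0" if "l \<in> \<Lambda>" for l using exp_poly_independent[OF fin _ that] by blast
  have noka: "of_nat k * a \<noteq> \<alpha>1" if "k \<le> n - 1" for k
  proof
    assume "of_nat k * a = \<alpha>1"
    hence "of_nat k = (of_nat n :: complex)" using a0 by (metis mult_right_cancel)
    thus False using that n2 by simp
  qed
  have "{k. k \<le> n - 1 \<and> of_nat k * a = \<alpha>1} = {}" using noka by blast
  hence "q \<alpha>1 = smult (c ^ n - p1) D" unfolding q_def using \<alpha>d by (simp only:) simp
  hence c1: "c ^ n = p1" using q0[of \<alpha>1] D by (simp add: \<Lambda>_def)
  have "\<exists>k\<le>n-1. of_nat k * a = \<alpha>2"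
  proof (rule ccontr)
    assume "\<not> (\<exists>k\<le>n-1. of_nat k * a = \<alpha>2)"
    hence "{k. k \<le> n - 1 \<and> of_nat k * a = \<alpha>2} = {}" by blast
    hence "q \<alpha>2 = - smult p2 D" unfolding q_def using \<alpha>d by (simp only:) simp
    thus False using q0[of \<alpha>2] D p0 by (simp add: \<Lambda>_def)
  qed
  then obtain k where k: "k \<le> n - 1" "of_nat k * a = \<alpha>2" by blast
  have "k \<noteq> 0" using k \<alpha>0 by (intro notI) simp
  moreover have "of_nat k * \<alpha>1 = of_nat n * \<alpha>2" using k n0 by (simp add: a_def field_simps)
  ultimately show ?thesis using c1 k by (intro conjI exI[of _ k]) auto
qed

text \<open>The operator factors, so two first-order equations are solved in succession: first u' -
  \<alpha>2 u is a multiple of exp (\<alpha>1 z), then subtracting b exp (\<alpha>1 z) from u leaves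
  a multiple of exp (\<alpha>2 z).\<close>

lemma D2_zero_solution:
  assumes u: "u meromorphic_on UNIV" and D: "\<forall>\<^sub>\<approx>z. D2 u z = 0"
  shows "\<exists>c1 c2. \<forall>\<^sub>\<approx>z. u z = c1 * exp (\<alpha>1 * z) + c2 * exp (\<alpha>2 * z)"
proof -
  have an: "\<forall>\<^sub>\<approx>z. u analytic_on {z}" using meromorphic_on_imp_analytic_cosparse[OF u] .
  have du: "(u has_field_derivative deriv u z) (at z)"
    "(deriv u has_field_derivative deriv (deriv u) z) (at z)" if "u analytic_on {z}" for z
    unfolding DERIV_deriv_iff_field_differentiable
    using that by (auto intro!: analytic_on_imp_differentiable_at[of _ "{z}"] analytic_deriv)
  have expm: "(\<lambda>z. exp (b * z)) meromorphic_on UNIV" for b using nonzero_mero_exp by auto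
  define v where "v = (\<lambda>z. (deriv u z - \<alpha>2 * u z) * exp (- \<alpha>1 * z))"
  have "\<forall>\<^sub>\<approx>z. deriv v z = 0" using an D
  proof eventually_elim
    case (elim z)
    have "(v has_field_derivative D2 u z * exp (- \<alpha>1 * z)) (at z)" unfolding v_def
      using du[OF elim(1)] by (auto intro!: derivative_eq_intros simp: D2_def s_def algebra_simps)
    thus ?case using elim by (simp add: DERIV_imp_deriv)
  qed
  moreover have "v meromorphic_on UNIV" unfolding v_def using u expm by (intro meromorphic_intros)
  ultimately obtain c where c: "\<forall>\<^sub>\<approx>z. v z = c" using meromorphic_deriv_0_const by blast
  define b where "b = c / (\<alpha>1 - \<alpha>2)"
  define w where "w = (\<lambda>z. (u z - b * exp (\<alpha>1 * z)) * exp (- \<alpha>2 * z))"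
  have "\<forall>\<^sub>\<approx>z. deriv w z = 0" using an c
  proof eventually_elim
    case (elim z)
    have eq: "deriv u z - \<alpha>2 * u z = c * exp (\<alpha>1 * z)"
      using elim(2) unfolding v_def by (simp add: exp_minus field_simps)
    have "c = b * (\<alpha>1 - \<alpha>2)" using \<alpha>d by (simp add: b_def)
    hence "deriv u z - \<alpha>2 * u z = b * (\<alpha>1 - \<alpha>2) * exp (\<alpha>1 * z)" using eq by simp
    hence "deriv u z - b * \<alpha>1 * exp (\<alpha>1 * z) - \<alpha>2 * (u z - b * exp (\<alpha>1 * z)) = 0"
      by (simp add: algebra_simps)
    moreover have "(w has_field_derivative (deriv u z - b * \<alpha>1 * exp (\<alpha>1 * z) - \<alpha>2 * (u z - b * exp (\<alpha>1 * z))) * exp (- \<alpha>2 * z)) (at z)"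
      unfolding w_def using du[OF elim(1)] by (auto intro!: derivative_eq_intros simp: algebra_simps)
    ultimately show ?case by (simp add: DERIV_imp_deriv)
  qed
  moreover have "w meromorphic_on UNIV" unfolding w_def using u expm by (intro meromorphic_intros)
  ultimately obtain c2 where c2: "\<forall>\<^sub>\<approx>z. w z = c2" using meromorphic_deriv_0_const by blast
  from c2 have "\<forall>\<^sub>\<approx>z. u z = b * exp (\<alpha>1 * z) + c2 * exp (\<alpha>2 * z)"
    by eventually_elim (auto simp: w_def exp_minus field_simps)
  thus ?thesis by blast
qed

text \<open>n times the order of f equals the order of g, which is nonnegative, so f has no poles.
  The identity then holds everywhere.\<close>

lemma f_entire_if_power:
  assumes "\<forall>\<^sub>\<approx>z. f z ^ n = g z" "g holomorphic_on UNIV"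
  shows "f holomorphic_on UNIV" "f z ^ n = g z"
proof -
  have fa: "f analytic_on {z}" for z
  proof (rule nicely_meromorphic_on_imp_analytic_at[OF f_nice])
    have ga: "g analytic_on {z}" using assms(2) by (auto simp: analytic_on_open intro: analytic_on_subset[of g UNIV])
    have fn: "nonzero_mero (\<lambda>z. f z ^ n)" using f_nz by auto
    have "\<exists>\<^sub>F w in at z. g w \<noteq> 0"
    proof -
      have "\<forall>\<^sub>F w in at z. g w \<noteq> 0"
        using nonzero_mero_ev[OF fn, of z] cosparse_eventually_at[OF assms(1), of z] by eventually_elim auto
      thus ?thesis by (simp add: eventually_frequently)
    qed
    hence "zorder g z \<ge> 0" using ga by (intro zorder_ge_0)
    also have "zorder g z = zorder (\<lambda>z. f z ^ n) z"
      by (rule zorder_cong) (use cosparse_eventually_at[OF assms(1), of z] in \<open>auto elim: eventually_mono\<close>)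
    also have "\<dots> = int n * zorder f z" by (rule zorder_power'[OF f_nz])
    finally have "zorder f z \<ge> 0" using n2 by (simp add: zero_le_mult_iff)
    thus "\<not> is_pole f z" using nonzero_mero_is_pole_iff[OF f_nz, of z] by simp
  qed auto
  hence "f analytic_on UNIV" using analytic_on_analytic_at by blast
  thus fh: "f holomorphic_on UNIV" by (rule analytic_imp_holomorphic)
  have "(\<lambda>z. f z ^ n) = g"
    by (rule nicely_eq_entire[OF analytic_on_imp_nicely_meromorphic_on assms(2,1)])
       (use fh in \<open>auto simp: analytic_on_open intro!: holomorphic_intros\<close>)
  thus "f z ^ n = g z" by (rule fun_cong)
qed

text \<open>f exp (-\<alpha> z / n) has a constant nonzero n-th power. Differentiating that power
  shows that its own derivative vanishes.\<close>

lemma exp_root: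
  assumes "\<And>z. f z ^ n = c * exp (\<alpha> * z)" "f holomorphic_on UNIV"
  shows "\<exists>s. f = (\<lambda>z. s * exp (\<alpha> * z / of_nat n))"
proof -
  have n0: "of_nat n \<noteq> (0::complex)" using n2 by simp
  define v where "v = (\<lambda>z. f z * exp (- (\<alpha> * z / of_nat n)))"
  have vn: "v z ^ n = c" for z
  proof -
    have "v z ^ n = f z ^ n * exp (- (\<alpha> * z))"
      unfolding v_def power_mult_distrib using n0 by (simp add: exp_of_nat_mult[symmetric])
    thus ?thesis using assms(1) by (simp add: exp_minus)
  qed
  have c0: "c \<noteq> 0"
  proof
    assume "c = 0"
    hence "f z = 0" for z using assms(1)[of z] by simp
    thus False using not_nonzero_mero_zero[of f] f_nz by simp
  qed
  have dv: "(v has_field_derivative deriv v z) (at z)" for z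
    unfolding v_def DERIV_deriv_iff_field_differentiable using assms(2) n0
    by (intro holomorphic_on_imp_differentiable_at[of _ UNIV] holomorphic_intros) auto
  have "deriv v z = 0" for z
  proof -
    have "((\<lambda>z. v z ^ n) has_field_derivative of_nat n * (deriv v z * v z ^ (n - Suc 0))) (at z)"
      by (rule DERIV_power[OF dv])
    hence "of_nat n * (deriv v z * v z ^ (n - Suc 0)) = 0"
      unfolding vn using DERIV_unique DERIV_const by blast
    moreover have "v z \<noteq> 0" using vn[of z] c0 n2 by (cases "v z = 0") (auto simp: power_0_left)
    ultimately show ?thesis using n0 by simp
  qed
  hence "(v has_field_derivative 0) (at z)" for z using dv[of z] by simp
  hence "\<exists>s. \<forall>z\<in>UNIV. v z = s" by (intro has_field_derivative_zero_constant) auto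
  then obtain s where "\<And>z. v z = s" by blast
  hence "f z = s * exp (\<alpha> * z / of_nat n)" for z unfolding v_def by (simp add: exp_minus field_simps)
  thus ?thesis by blast
qed

text \<open>If both coefficients of the exponentials were nonzero, their sum would have a zero, and
  only simple ones as \<alpha>1 \<noteq> \<alpha>2. An n-th power with n \<ge> 2 has no simple
  zeros.\<close>

lemma \<phi>_zero_cases:
  assumes "\<forall>\<^sub>\<approx>z. \<phi> z = 0"
  shows "(\<exists>s. f = (\<lambda>z. s * exp (\<alpha>1 * z / of_nat n))) \<or> (\<exists>s. f = (\<lambda>z. s * exp (\<alpha>2 * z / of_nat n)))"
proof -
  have "\<forall>\<^sub>\<approx>z. D2 (\<lambda>z. f z ^ n) z = 0"
    using assms sing_cosparse[OF f_nz] by eventually_elim (simp add: D2_power)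
  then obtain c1 c2 where c: "\<forall>\<^sub>\<approx>z. f z ^ n = c1 * exp (\<alpha>1 * z) + c2 * exp (\<alpha>2 * z)"
    using D2_zero_solution[of "\<lambda>z. f z ^ n"] f_mero by (blast intro: meromorphic_intros)
  have hol: "(\<lambda>z. c1 * exp (\<alpha>1 * z) + c2 * exp (\<alpha>2 * z)) holomorphic_on UNIV"
    by (intro holomorphic_intros)
  note fh = f_entire_if_power[OF c hol]
  consider "c1 = 0" | "c2 = 0" | "c1 \<noteq> 0" "c2 \<noteq> 0" by blast
  thus ?thesis
  proof cases
    case 1 thus ?thesis using exp_root[of c2 \<alpha>2] fh by simp
  next
    case 2 thus ?thesis using exp_root[of c1 \<alpha>1] fh by simp
  next
    case 3
    have "- c2 / c1 \<noteq> 0" using 3 by simp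
    hence "exp (Ln (- c2 / c1)) = - c2 / c1" by (rule exp_Ln)
    then obtain t where t: "exp t = - c2 / c1" by blast
    define z where "z = t / (\<alpha>1 - \<alpha>2)"
    have "(\<alpha>1 - \<alpha>2) * z = t" using \<alpha>d by (simp add: z_def)
    hence "exp (\<alpha>1 * z) / exp (\<alpha>2 * z) = - c2 / c1" using t by (simp flip: exp_diff left_diff_distrib)
    hence e: "c2 * exp (\<alpha>2 * z) = - c1 * exp (\<alpha>1 * z)" using 3 by (simp add: field_simps)
    hence "f z ^ n = 0" using fh(2)[of z] by simp
    hence fz: "f z = 0" by simp
    have "((\<lambda>z. f z ^ n) has_field_derivative of_nat n * (deriv f z * f z ^ (n - Suc 0))) (at z)"
      using fh(1) by (intro DERIV_power f_deriv) (auto simp: analytic_on_open intro: analytic_on_subset[of f UNIV])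
    moreover have "((\<lambda>z. f z ^ n) has_field_derivative \<alpha>1 * (c1 * exp (\<alpha>1 * z)) + \<alpha>2 * (c2 * exp (\<alpha>2 * z))) (at z)"
      unfolding fh(2) by (auto intro!: derivative_eq_intros)
    ultimately have "\<alpha>1 * (c1 * exp (\<alpha>1 * z)) + \<alpha>2 * (c2 * exp (\<alpha>2 * z)) = of_nat n * (deriv f z * f z ^ (n - Suc 0))"
      using DERIV_unique by blast
    also have "\<dots> = 0" using fz n2 by simp
    finally have "(\<alpha>1 - \<alpha>2) * (c1 * exp (\<alpha>1 * z)) = 0" unfolding e by (simp add: algebra_simps)
    thus ?thesis using \<alpha>d 3 by simp
  qed
qed

lemma exp_zero_div:
  assumes "f = (\<lambda>z. c * exp (\<alpha> * z / of_nat n))" shows "zero_div f = (\<lambda>_. 0)"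
proof -
  have n0: "of_nat n \<noteq> (0::complex)" using n2 by simp
  have "c \<noteq> 0" using not_nonzero_mero_zero[of f] f_nz assms by auto
  hence "zorder f z = 0" for z
    unfolding assms using n0 by (intro zorder_eq_0I analytic_intros) auto
  thus ?thesis by (simp add: zero_div_def fun_eq_iff)
qed

lemma \<phi>_zero_imp_sm:
  assumes "\<forall>\<^sub>\<approx>z. \<phi> z = 0" shows "sm (countN (zero_div f))"
proof -
  have "zero_div f = (\<lambda>_. 0)"
    using \<phi>_zero_cases[OF assms] by (elim disjE exE) (erule exp_zero_div)+
  hence "countN (zero_div f) = (\<lambda>r. 0)" by (simp only:) (simp add: countN_def fun_eq_iff)
  thus ?thesis using sm_const[of 0] by simp
qed

lemma sm_imp_\<phi>_zero:
  assumes sm: "sm (countN (zero_div f))" shows "\<forall>\<^sub>\<approx>z. \<phi> z = 0"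
proof (rule ccontr)
  assume "\<not> (\<forall>\<^sub>\<approx>z. \<phi> z = 0)"
  hence "nonzero_mero \<phi>" using zero_or_nonzero_mero[OF \<phi>_mero] by blast
  hence L: "nonzero_mero L" using \<phi>_nz_iff by simp
  \<comment> \<open>Here zeros and poles of f are both rare, so f'/f is itself a small function. In
    the other case only the poles of f and the divisor of \<phi> are available for this
    purpose.\<close>
  interpret sml: small_setup "{z. zorder f z \<noteq> 0}" "\<lambda>z. zero_div f z + pole_div f z"
  proof
    show "loc_fin (\<lambda>z. zero_div f z + pole_div f z)" using f_nz by (intro loc_fin_add) auto
    have "countN (\<lambda>z. zero_div f z + pole_div f z) = (\<lambda>r. countN (zero_div f) r + countN (pole_div f) r)"
      using f_nz by (intro ext countN_add) auto
    thus "sm (countN (\<lambda>z. zero_div f z + pole_div f z))" using sm_add[OF sm sm_pole_f] by simp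
  qed (auto simp: zero_div_def pole_div_def)
  have gfs: "sml.small gf"
    unfolding sml.small_def using tame_gf poles_in_log_deriv[OF f_nz order_refl] by (simp add: gf_def[abs_def])
  have "sml.small L" unfolding L_def[abs_def]
    by (intro sml.small_add sml.small_diff sml.small_mult sml.small_const sml.small_power sml.small_deriv gfs)
  note Ls = sml.small_sm(3)[OF this L]
  obtain M where M: "\<forall>\<^sub>F r in nev. \<forall>z. norm z = r \<longrightarrow> norm (\<phi> z) \<le> r ^ M * norm (f z)" using \<phi>_le by blast
  have "\<forall>\<^sub>F r in nev. proximity_m r f \<le> (real M * ln r + 0) + proximity_m r (\<lambda>z. 1 / L z)"
    using M nev_ge[of 1] nev_good_radius[OF f_nz] nev_good_radius[OF L]
  proof eventually_elim
    case (elim r)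
    note gi = good_radius_inverse[OF elim(4)]
    have "proximity_m r f \<le> circ_mean r (\<lambda>z. (real M * ln r + 0) + log_plus (norm (1 / L z)))"
    proof (rule proximity_le_mean)
      fix z :: complex assume z: "norm z = r"
      have ns: "z \<notin> sing f" "L z \<noteq> 0" "f z \<noteq> 0" using z elim by (auto simp: good_radius_def sing_def)
      have "norm (\<phi> z) \<le> r ^ M * norm (f z)" using elim(1) z by blast
      hence "norm (f z) * norm (L z) * norm (f z) \<le> r ^ M * norm (f z)"
        unfolding \<phi>_eq[OF ns(1)] by (simp add: norm_mult power2_eq_square mult_ac)
      hence "norm (f z) * norm (L z) \<le> r ^ M" using ns by (simp add: mult_le_cancel_right)
      hence "norm (f z) \<le> r ^ M * norm (1 / L z)" using ns by (simp add: norm_divide field_simps)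
      hence "log_plus (norm (f z)) \<le> log_plus (r ^ M) + log_plus (norm (1 / L z))"
        using elim by (intro order_trans[OF log_plus_mono log_plus_mult]) auto
      also have "log_plus (r ^ M) = real M * ln r"
        using elim by (subst log_plus_power) (auto simp: log_plus_def)
      finally show "log_plus (norm (f z)) \<le> (real M * ln r + 0) + log_plus (norm (1 / L z))" by simp
    qed (use elim gi in \<open>auto intro!: continuous_intros good_radius_continuous_log_plus\<close>)
    also have "\<dots> = (real M * ln r + 0) + proximity_m r (\<lambda>z. 1 / L z)"
      using elim good_radius_continuous_log_plus[OF gi]
      by (subst circ_mean_add) (auto intro!: continuous_intros simp: proximity_eq_mean)
    finally show ?case .
  qed
  hence "sm (\<lambda>r. proximity_m r f)" by (rule sm_mono[OF sm_add[OF sm_ln Ls]])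
  thus False using m_lower sm_contradiction by blast
qed

lemma swapped: "tumura_clunie n P \<alpha>2 \<alpha>1 p2 p1 f"
  by unfold_locales
     (use n2 deg \<alpha>0 p0 \<alpha>s \<alpha>d f_trans f_eq N_small in \<open>auto simp: add.commute\<close>)

lemma case_I:
  assumes "is_S f (\<lambda>r. counting_N r (\<lambda>z. 1 / f z))"
  shows "(\<exists>k1 s1. 1 \<le> k1 \<and> k1 \<le> int n - 1 \<and> of_int k1 * \<alpha>1 = of_nat n * \<alpha>2 \<and> s1 ^ n = p1
           \<and> f = (\<lambda>z. s1 * exp (\<alpha>1 * z / of_nat n)))
      \<or> (\<exists>k2 s2. 1 \<le> k2 \<and> k2 \<le> int n - 1 \<and> of_int k2 * \<alpha>2 = of_nat n * \<alpha>1 \<and> s2 ^ n = p2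
           \<and> f = (\<lambda>z. s2 * exp (\<alpha>2 * z / of_nat n)))"
proof -
  interpret sw: tumura_clunie n P \<alpha>2 \<alpha>1 p2 p1 f by (rule swapped)
  have "\<forall>\<^sub>\<approx>z. \<phi> z = 0" using assms is_S_zero_iff sm_imp_\<phi>_zero by blast
  from \<phi>_zero_cases[OF this] show ?thesis
  proof
    assume "\<exists>s. f = (\<lambda>z. s * exp (\<alpha>1 * z / of_nat n))"
    then obtain s where s: "f = (\<lambda>z. s * exp (\<alpha>1 * z / of_nat n))" by blast
    obtain k where "s ^ n = p1" "1 \<le> k" "k \<le> n - 1" "of_nat k * \<alpha>1 = of_nat n * \<alpha>2"
      using exp_solution[of s 0] s by auto
    thus ?thesis using s n2 by (intro disjI1 exI[of _ "int k"] exI[of _ s]) auto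
  next
    assume "\<exists>s. f = (\<lambda>z. s * exp (\<alpha>2 * z / of_nat n))"
    then obtain s where s: "f = (\<lambda>z. s * exp (\<alpha>2 * z / of_nat n))" by blast
    obtain k where "s ^ n = p2" "1 \<le> k" "k \<le> n - 1" "of_nat k * \<alpha>2 = of_nat n * \<alpha>1"
      using sw.exp_solution[of s 0] s by auto
    thus ?thesis using s n2 by (intro disjI2 exI[of _ "int k"] exI[of _ s]) auto
  qed
qed

end

section \<open>Small auxiliary functions\<close>

lemma sub_ord_cong:
  assumes "u meromorphic_on UNIV" "v meromorphic_on UNIV" "\<forall>\<^sub>\<approx>z. u z = v z"
  shows "sub_ord u z = sub_ord v z"
proof -
  have "\<forall>\<^sub>F w in at 0. u (z + w) = v (z + w)"
    using cosparse_eventually_at[OF assms(3), of z]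
    by (simp add: eventually_at_to_0[of _ z] add.commute)
  hence "(\<lambda>w. u (z + w)) has_laurent_expansion laurent_expansion v z"
    using has_laurent_laurent_expansion[OF assms(2), of z] by (subst has_laurent_expansion_cong) auto
  thus ?thesis using sub_ord_eqI[OF assms(1)] unfolding sub_ord_def[of v] by blast
qed

lemma sub_ord_log_deriv_nz:
  assumes "nonzero_mero u" "zorder u z \<noteq> 0" shows "sub_ord (\<lambda>z. deriv u z / u z) z = -1"
proof -
  have mu: "u meromorphic_on UNIV" using assms by auto
  define F where "F = laurent_expansion u z"
  have F: "F \<noteq> 0" unfolding F_def using nonzero_mero_laurent_nz[OF assms(1)] .
  have zo: "fls_subdegree F \<noteq> 0"
    using sub_ord_eq_zorder[OF assms(1), of z] assms(2) by (simp add: sub_ord_def F_def)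
  have eq: "sub_ord (\<lambda>z. deriv u z / u z) z = fls_subdegree (fls_deriv F / F)"
    using mu unfolding F_def
    by (intro sub_ord_eqI meromorphic_intros has_laurent_expansion_divide has_laurent_expansion_deriv_at has_laurent_laurent_expansion)
  have "fls_deriv F \<noteq> 0" using zo by (metis fls_deriv_eq_0_iff fls_const_subdegree)
  thus ?thesis unfolding eq using F fls_subdegree_deriv_ge(3)[OF zo] by (simp add: fls_divide_subdegree)
qed

lemma poles_in_mono:
  assumes "poles_in S u" "S \<subseteq> S'" shows "poles_in S' u"
proof -
  obtain k where k: "\<And>z. - int (if z \<in> S then k else 0) \<le> sub_ord u z"
    using assms(1) unfolding poles_in_def by blast
  have "- int (if z \<in> S' then k else 0) \<le> sub_ord u z" for z
    using k[of z] assms(2) by (auto split: if_splits)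
  thus ?thesis using assms(1) unfolding poles_in_def by blast
qed

lemma meromorphic_linear_ode:
  assumes "u meromorphic_on UNIV" "\<forall>\<^sub>\<approx>z. deriv u z = \<kappa> * u z"
  shows "\<exists>c. \<forall>\<^sub>\<approx>z. u z = c * exp (\<kappa> * z)"
proof -
  have expm: "(\<lambda>z. exp (b * z)) meromorphic_on UNIV" for b using nonzero_mero_exp by auto
  define v where "v = (\<lambda>z. u z * exp (- \<kappa> * z))"
  have "\<forall>\<^sub>\<approx>z. deriv v z = 0" using meromorphic_on_imp_analytic_cosparse[OF assms(1)] assms(2)
  proof eventually_elim
    case (elim z)
    have "(u has_field_derivative deriv u z) (at z)"
      unfolding DERIV_deriv_iff_field_differentiable using elim(1)
      by (auto intro!: analytic_on_imp_differentiable_at[of _ "{z}"])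
    hence "(v has_field_derivative deriv u z * exp (- \<kappa> * z) + exp (- \<kappa> * z) * (- \<kappa>) * u z) (at z)"
      unfolding v_def by (auto intro!: derivative_eq_intros)
    thus ?case using elim(2) by (simp add: DERIV_imp_deriv)
  qed
  moreover have "v meromorphic_on UNIV" unfolding v_def using assms(1) expm by (intro meromorphic_intros)
  ultimately obtain c where c: "\<forall>\<^sub>\<approx>z. v z = c" using meromorphic_deriv_0_const by blast
  from c have "\<forall>\<^sub>\<approx>z. u z = c * exp (\<kappa> * z)"
    by eventually_elim (auto simp: v_def exp_minus field_simps)
  thus ?thesis by blast
qed

lemma sm_proximity_mult:
  assumes "nonzero_mero u" "nonzero_mero v" "sm (\<lambda>r. proximity_m r u)" "sm (\<lambda>r. proximity_m r v)"
  shows "sm (\<lambda>r. proximity_m r (\<lambda>z. u z * v z))"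
proof (rule sm_mono[OF sm_add[OF assms(3,4)]])
  show "\<forall>\<^sub>F r in nev. proximity_m r (\<lambda>z. u z * v z) \<le> proximity_m r u + proximity_m r v"
    using nev_good_radius[OF assms(1)] nev_good_radius[OF assms(2)]
    by eventually_elim (rule proximity_mult_le, auto simp: norm_mult)
qed

lemma sm_proximity_power:
  "sm (\<lambda>r. proximity_m r u) \<Longrightarrow> sm (\<lambda>r. proximity_m r (\<lambda>z. u z ^ k))"
  unfolding proximity_power by (intro sm_cmult) auto

text \<open>A solution is c exp (\<kappa> z), whose proximity function grows linearly unless
  \<kappa> = 0. The same contradiction is used for the discriminant, for the Riccati equation and
  for \<phi> itself.\<close>

lemma sm_linear_ode_0:
  assumes u: "nonzero_mero u" and "\<forall>\<^sub>\<approx>z. deriv u z = \<kappa> * u z" "sm (\<lambda>r. proximity_m r u)"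
  shows "\<kappa> = 0"
proof -
  obtain c where c: "\<forall>\<^sub>\<approx>z. u z = c * exp (\<kappa> * z)"
    using meromorphic_linear_ode[OF nonzero_mero_mero[OF u] assms(2)] by blast
  have c0: "c \<noteq> 0"
  proof
    assume "c = 0" thus False using c not_nonzero_mero_zero[of u] u by simp
  qed
  have m1: "sm (\<lambda>r. proximity_m r (\<lambda>z. 1 / c))"
  proof (rule sm_mono[OF sm_const[of "log_plus (norm (1 / c))"]])
    show "\<forall>\<^sub>F r in nev. proximity_m r (\<lambda>z. 1 / c) \<le> log_plus (norm (1 / c))"
      using nev_ge[of 1] by eventually_elim (rule proximity_le_const, auto)
  qed
  have s: "sm (\<lambda>r. proximity_m r (\<lambda>z. 1 / c * u z))"
    using c0 by (intro sm_proximity_mult nonzero_mero_const u m1 assms(3)) auto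
  have "\<forall>\<^sub>F r in nev. proximity_m r (\<lambda>z. exp (\<kappa> * z)) \<le> proximity_m r (\<lambda>z. 1 / c * u z)"
    using cosparse_nev[OF c] nev_ge[of 1]
  proof eventually_elim
    case (elim r)
    have "proximity_m r (\<lambda>z. exp (\<kappa> * z)) = proximity_m r (\<lambda>z. 1 / c * u z)"
      unfolding proximity_eq_mean using elim c0 by (intro circ_mean_cong) auto
    thus ?case by simp
  qed
  thus ?thesis by (rule proximity_exp_not_sm[OF s])
qed

lemma analytic_has_deriv:
  assumes "u analytic_on {z}" shows "(u has_field_derivative deriv u z) (at z)"
  unfolding DERIV_deriv_iff_field_differentiable using assms
  by (auto intro!: analytic_on_imp_differentiable_at[of _ "{z}"])

locale tumura_clunie_small = tumura_clunie +
  assumes \<phi>_nz: "nonzero_mero \<phi>" and T_\<phi>: "sm (\<lambda>r. characteristic_T r \<phi>)"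
    and N_large: "\<not> sm (countN (zero_div f))"
begin

section \<open>Coefficients attached to a small \<phi>\<close>

abbreviation "N \<equiv> of_nat n :: complex"

text \<open>The nicely meromorphic representative of \<phi>, whose own values on a sparse set are
  arbitrary. The logarithmic derivative estimate requires such a representative.\<close>

definition F where "F = remove_sings \<phi>"

definition g where "g z = deriv F z / F z"

definition t where "t z = (s + (N - 1) * g z) / (2 * N - 1)"

text \<open>Since gf' + gf^2 = f''/f, this is the coefficient for which f'' = t f' - w f.\<close>

definition w where "w z = t z * gf z - (deriv gf z + gf z ^ 2)"

text \<open>The zeros of f are deliberately left out, although \<open>gf\<close> has poles there:
  they are not rare, and \<open>w\<close> is shown to be regular at those outside S.\<close>

definition S where "S = {z. zorder f z < 0 \<or> zorder F z \<noteq> 0}"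

text \<open>With \<open>cB\<close> and \<open>cC\<close>, the coefficients of \<phi> as a quadratic
  form in f and f', after f'' has been eliminated.\<close>

definition cA where "cA z = \<alpha>1 * \<alpha>2 - N * w z"

definition cB where "cB z = N * (t z - s)"

definition cC where "cC = N * (N - 1)"

text \<open>With \<open>Y\<close>, the coefficients in (\<phi>' - g \<phi>) / f = f X + f' Y. The
  quadratic form \<phi>' - g \<phi> is divisible by f because its f'^2 coefficient is N((2N - 1) t -
  s - (N - 1) g), which vanishes by the choice of t.\<close>

definition X where "X z = deriv cA z - cB z * w z - g z * cA z"

definition Y where "Y z = 2 * cA z + deriv cB z + cB z * t z - 2 * cC * w z - g z * cB z"

definition Dis where "Dis z = cB z ^ 2 - 4 * cC * cA z"

lemma N_facts: "N \<noteq> 0" "N - 1 \<noteq> 0" "2 * N - 1 \<noteq> 0" "cC \<noteq> 0"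
proof -
  have "2 * n - 1 \<noteq> 0" "n - 1 \<noteq> 0" using n2 by auto
  hence "of_nat (2 * n - 1) \<noteq> (0 :: complex)" "of_nat (n - 1) \<noteq> (0 :: complex)" unfolding of_nat_eq_0_iff .
  thus "N \<noteq> 0" "N - 1 \<noteq> 0" "2 * N - 1 \<noteq> 0" "cC \<noteq> 0" using n2 by (auto simp: of_nat_diff cC_def)
qed

lemma F_nz: "nonzero_mero F" unfolding F_def using \<phi>_nz by (rule nonzero_mero_remove_sings)

lemma F_eq: "\<forall>\<^sub>\<approx>z. F z = \<phi> z"
  unfolding F_def using meromorphic_on_imp_analytic_cosparse[OF \<phi>_mero] by eventually_elim simp

lemma zorder_F: "zorder F z = zorder \<phi> z"
  by (rule zorder_cong) (use cosparse_eventually_at[OF F_eq, of z] in \<open>auto elim: eventually_mono\<close>)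

lemma T_F: "\<forall>\<^sub>F r in nev. characteristic_T r F = characteristic_T r \<phi>"
  using cosparse_nev[OF F_eq] nev_ge[of 1]
proof eventually_elim
  case (elim r)
  have "proximity_m r F = proximity_m r \<phi>"
    unfolding proximity_eq_mean using elim by (intro circ_mean_cong) auto
  moreover have "pole_div F = pole_div \<phi>" by (simp add: fun_eq_iff pole_div_def zorder_F)
  ultimately show ?case using elim by (simp add: characteristic_eq[OF F_nz] characteristic_eq[OF \<phi>_nz])
qed

lemma sm_T_F: "sm (\<lambda>r. characteristic_T r F)"
  by (rule sm_mono[OF T_\<phi>]) (use T_F in eventually_elim, simp)

lemma sm_F: "sm (\<lambda>r. proximity_m r F)" "sm (\<lambda>r. proximity_m r (\<lambda>z. 1 / F z))" "sm (countN (zero_div F))"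
proof -
  obtain K where K: "\<And>r. good_radius F r \<Longrightarrow>
    proximity_m r F + countN (pole_div F) r = proximity_m r (\<lambda>z. 1 / F z) + countN (zero_div F) r + K"
    using first_main_theorem[OF F_nz] by blast
  note s = sm_add[OF sm_T_F sm_const[of "\<bar>K\<bar>"]]
  have ev: "\<forall>\<^sub>F r in nev. proximity_m r F \<le> characteristic_T r F + \<bar>K\<bar> \<and>
    proximity_m r (\<lambda>z. 1 / F z) \<le> characteristic_T r F + \<bar>K\<bar> \<and> countN (zero_div F) r \<le> characteristic_T r F + \<bar>K\<bar>"
    using nev_good_radius[OF F_nz] nev_ge[of 1]
  proof eventually_elim
    case (elim r)
    have "countN (zero_div F) r \<ge> 0" "countN (pole_div F) r \<ge> 0" using elim by (auto intro: countN_nonneg)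
    moreover have "proximity_m r F \<ge> 0" "proximity_m r (\<lambda>z. 1 / F z) \<ge> 0" by (rule proximity_nonneg)+
    moreover have "characteristic_T r F = proximity_m r F + countN (pole_div F) r"
      using elim by (intro characteristic_eq[OF F_nz]) auto
    ultimately show ?case using K[OF elim(1)] by linarith
  qed
  show "sm (\<lambda>r. proximity_m r F)" by (rule sm_mono[OF s]) (use ev in eventually_elim, simp)
  show "sm (\<lambda>r. proximity_m r (\<lambda>z. 1 / F z))" by (rule sm_mono[OF s]) (use ev in eventually_elim, simp)
  show "sm (countN (zero_div F))" by (rule sm_mono[OF s]) (use ev in eventually_elim, simp)
qed

text \<open>Smallness bounds T(r, F) by r only off an exceptional set, whereas linear growth is
  required at every good radius. An unexceptional R within bounded distance above r exists, and
  monotonicity carries the bound down to r.\<close>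

lemma tame_g: "nv.tame g"
proof -
  have ev: "\<forall>\<^sub>F r in nev. characteristic_T r F \<le> 1 * r \<and> good_radius F r"
    using sm_ev[OF sm_T_F, of 1] nev_good_radius[OF F_nz] by (auto elim: eventually_elim2)
  obtain L r0 where L: "L > 0" and r0: "\<And>x. x \<ge> r0 \<Longrightarrow> \<exists>R\<in>{x..x + L}. characteristic_T R F \<le> 1 * R \<and> good_radius F R"
    using nev_dense[OF ev] by metis
  have "log_deriv_scale nev (\<lambda>r. r) (\<lambda>r. r) F"
  proof (rule log_deriv_scale_nev[OF F_nz])
    show "F nicely_meromorphic_on UNIV" unfolding F_def using \<phi>_mero by (rule remove_sings_nicely_meromorphic)
    fix r assume r: "r \<ge> max r0 1" "good_radius F r"
    obtain R where R: "r + 1 \<le> R" "R \<le> r + 1 + L" "characteristic_T R F \<le> R" "good_radius F R"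
      using r0[of "r + 1"] r by auto
    have "characteristic_T r F \<le> characteristic_T R F" using R r by (intro characteristic_mono F_nz) auto
    also have "\<dots> \<le> r + (1 + L) * 1" using R by simp
    also have "\<dots> \<le> r + (1 + L) * r" using r L by (intro add_left_mono mult_left_mono) auto
    finally show "characteristic_T r F \<le> (2 + L) * r" by (simp add: algebra_simps)
  qed
  from log_deriv_scale.ld[OF this] show ?thesis by (simp add: g_def[abs_def])
qed

sublocale sml: small_setup S "\<lambda>z. pole_div f z + zero_div F z"
proof
  show "loc_fin (\<lambda>z. pole_div f z + zero_div F z)" using f_nz F_nz by (intro loc_fin_add) auto
  have "countN (\<lambda>z. pole_div f z + zero_div F z) = (\<lambda>r. countN (pole_div f) r + countN (zero_div F) r)"
    using f_nz F_nz by (intro ext countN_add) auto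
  thus "sm (countN (\<lambda>z. pole_div f z + zero_div F z))" using sm_add[OF sm_pole_f sm_F(3)] by simp
  show "0 \<le> pole_div f z + zero_div F z" for z by simp
  show "1 \<le> pole_div f z + zero_div F z" if "z \<in> S" for z
  proof (cases "zorder f z < 0")
    case True
    hence "1 \<le> pole_div f z" by (simp add: pole_div_def)
    thus ?thesis by (simp add: add_increasing2)
  next
    case False
    hence "pole_div f z = 0" by (simp add: pole_div_def)
    \<comment> \<open>Poles of \<phi> occur only at poles of f. So a point of S that is not a pole
      of f is a zero of \<open>F\<close>, and zeros of \<open>F\<close> are rare.\<close>
    hence "pole_div \<phi> z = 0" using pole_div_\<phi>[OF \<phi>_nz, of z] pole_div_nonneg[of \<phi> z] by simp
    hence "zorder F z \<ge> 0" by (simp add: pole_div_def zorder_F max_def split: if_splits)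
    hence "1 \<le> zero_div F z" using that False by (auto simp: S_def zero_div_def)
    thus ?thesis by (simp add: add_increasing)
  qed
qed

lemma small_g: "sml.small g"
  unfolding sml.small_def using tame_g poles_in_log_deriv[OF F_nz, of S]
  by (auto simp: S_def g_def[abs_def])

lemma small_t: "sml.small t"
  unfolding t_def[abs_def]
  by (intro sml.small_divide_const sml.small_add sml.small_mult sml.small_const small_g)

lemma tg: "(2 * N - 1) * t z = s + (N - 1) * g z"
  using N_facts by (simp add: t_def)

lemma w_eq: assumes "z \<notin> sing f" shows "deriv (deriv f) z = t z * deriv f z - w z * f z"
proof -
  have fz: "f z \<noteq> 0" using sing_analytic[OF assms] by simp
  have "w z = t z * (deriv f z / f z) - deriv (deriv f) z / f z"
    unfolding w_def deriv_gf[OF assms] by (simp add: gf_def)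
  hence "w z * f z = t z * deriv f z - deriv (deriv f) z" using fz by (simp add: field_simps)
  thus ?thesis by simp
qed

lemma \<phi>_quad: assumes "z \<notin> sing f"
  shows "\<phi> z = cA z * f z ^ 2 + cB z * f z * deriv f z + cC * deriv f z ^ 2"
  unfolding phi_aux_def w_eq[OF assms] cA_def cB_def cC_def s_def
  by (simp add: algebra_simps power2_eq_square)

text \<open>At a simple zero of \<open>f\<close> outside \<open>S\<close>, \<open>\<phi>' = g \<phi>\<close> gives \<open>f'' = t f'\<close>, so
  \<open>t f' - f''\<close> vanishes there.\<close>

lemma simple_zero_t:
  assumes z: "z \<notin> S" "zorder f z = 1"
  shows "f analytic_on {z}" "t analytic_on {z}" "deriv (deriv f) z = t z * deriv f z"
proof -
  have "\<not> is_pole f z" using z nonzero_mero_is_pole_iff[OF f_nz, of z] by simp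
  thus fa: "f analytic_on {z}" using nicely_meromorphic_on_imp_analytic_at[OF f_nice] by auto
  have f0: "f z = 0" using zorder_pos_iff'[OF fa nonzero_mero_freq[OF f_nz]] z by simp
  have \<phi>a: "\<phi> analytic_on {z}" by (rule \<phi>_analytic[OF fa])
  have Fz: "F z = \<phi> z" unfolding F_def using \<phi>a by simp
  have FF: "\<forall>\<^sub>F x in nhds z. F x = \<phi> x"
  proof -
    have "\<forall>\<^sub>F x in at z. F x = \<phi> x" by (rule cosparse_eventually_at[OF F_eq])
    thus ?thesis using Fz by (simp add: eventually_nhds_conv_at)
  qed
  hence dF: "deriv F z = deriv \<phi> z" by (rule deriv_cong_ev) simp
  have Fa: "F analytic_on {z}" using \<phi>a analytic_at_cong[OF FF] by simp
  have F0: "F z \<noteq> 0" using zorder_pos_iff'[OF Fa nonzero_mero_freq[OF F_nz]] z by (auto simp: S_def)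
  show "t analytic_on {z}" unfolding t_def g_def using Fa F0 N_facts
    by (intro analytic_intros analytic_deriv) auto
  have f3: "(deriv (deriv f) has_field_derivative deriv (deriv (deriv f)) z) (at z)"
    using fa by (intro analytic_has_deriv analytic_deriv)
  have "(\<phi> has_field_derivative N * (2 * N - 1) * deriv f z * deriv (deriv f) z - N * s * deriv f z ^ 2) (at z)"
    unfolding phi_aux_def
    by (auto intro!: derivative_eq_intros f_deriv[OF fa] f_deriv2[OF fa] f3
        simp: f0 s_def algebra_simps power2_eq_square)
  hence "deriv \<phi> z = N * (2 * N - 1) * deriv f z * deriv (deriv f) z - N * s * deriv f z ^ 2"
    by (rule DERIV_imp_deriv)
  moreover have \<phi>z: "\<phi> z = N * (N - 1) * deriv f z ^ 2" using f0 by (simp add: phi_aux_def)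
  moreover have "deriv \<phi> z = g z * \<phi> z" using F0 dF Fz by (simp add: g_def)
  ultimately have "N * deriv f z * ((2 * N - 1) * deriv (deriv f) z - s * deriv f z - (N - 1) * g z * deriv f z) = 0"
    by (simp add: algebra_simps power2_eq_square)
  moreover have "deriv f z \<noteq> 0" using F0 Fz \<phi>z by auto
  ultimately have "(2 * N - 1) * deriv (deriv f) z - s * deriv f z - (N - 1) * g z * deriv f z = 0"
    using N_facts(1) by (simp only: mult_eq_0_iff) simp
  hence "(2 * N - 1) * deriv (deriv f) z = (s + (N - 1) * g z) * deriv f z" by (simp add: algebra_simps)
  also have "\<dots> = (2 * N - 1) * (t z * deriv f z)" unfolding tg[symmetric] by simp
  finally show "deriv (deriv f) z = t z * deriv f z" using N_facts by simp
qed

lemma tame_t: "nv.tame t" using small_t by (simp add: sml.small_def)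

lemma w_mero: "w meromorphic_on UNIV"
  unfolding w_def using sml.small_mero[OF small_t] by (intro meromorphic_intros gf_mero)

lemma w_alt: "w = (\<lambda>z. t z * gf z + (- 1) * (deriv gf z + gf z * gf z))"
  by (rule ext) (simp add: w_def power2_eq_square)

text \<open>Off S, \<open>F\<close> has order 0, so 2 ord f - 2 \<le> 0 and f has order 0 or 1. At
  order 0 all ingredients of w are regular; at a simple zero w = (t f' - f'')/f, whose numerator
  vanishes by the choice of t.\<close>

lemma sub_ord_w: assumes z: "z \<notin> S" shows "0 \<le> sub_ord w z"
proof -
  have z0: "zorder F z = 0" "zorder f z \<ge> 0" using z by (auto simp: S_def)
  hence "zorder f z \<le> 1" using zorder_\<phi>[OF \<phi>_nz, of z] by (simp add: zorder_F)
  with z0 consider "zorder f z = 0" | "zorder f z = 1" by linarith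
  thus ?thesis
  proof cases
    case 1
    have gf: "0 \<le> sub_ord gf z" using sub_ord_log_deriv(2)[OF f_nz 1] by (simp add: gf_def[abs_def])
    have tz: "0 \<le> sub_ord t z" using small_t z unfolding sml.small_def poles_in_def by (metis if_False minus_zero of_nat_0)
    have tm: "t meromorphic_on UNIV" using small_t by auto
    have m: "0 \<le> sub_ord (\<lambda>z. u z * v z) z"
      if "0 \<le> sub_ord u z" "0 \<le> sub_ord v z" "u meromorphic_on UNIV" "v meromorphic_on UNIV" for u v
      using sub_ord_mult[OF that(3,4,1,2)] by simp
    have "0 \<le> sub_ord (\<lambda>z. t z * gf z + (- 1) * (deriv gf z + gf z * gf z)) z"
      by (intro sub_ord_add m gf tz tm gf_mero meromorphic_intros sub_ord_deriv(1)) auto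
    thus ?thesis unfolding w_alt .
  next
    case 2
    note st = simple_zero_t[OF z 2]
    define u where "u = (\<lambda>z. t z * deriv f z - deriv (deriv f) z)"
    have um: "u meromorphic_on UNIV" unfolding u_def using sml.small_mero[OF small_t]
      by (intro meromorphic_intros f_mero)
    have uf: "(\<lambda>z. u z / f z) meromorphic_on UNIV" by (intro meromorphic_intros um f_mero)
    have wu: "\<forall>\<^sub>\<approx>z. w z = u z / f z" using sing_cosparse[OF f_nz]
      by eventually_elim (use w_eq sing_analytic in \<open>auto simp: u_def field_simps\<close>)
    show ?thesis using zero_or_nonzero_mero[OF um]
    proof
      assume "\<forall>\<^sub>\<approx>z. u z = 0"
      with wu have "\<forall>\<^sub>\<approx>z. w z = 0" by eventually_elim simp
      thus ?thesis using sub_ord_cong[OF w_mero meromorphic_on_const, of 0 z] by simp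
    next
      assume u: "nonzero_mero u"
      have "u analytic_on {z}" unfolding u_def using st by (intro analytic_intros analytic_deriv)
      moreover have "u z = 0" using st by (simp add: u_def)
      ultimately have "zorder u z > 0" using zorder_pos_iff'[OF _ nonzero_mero_freq[OF u]] by blast
      moreover have "sub_ord w z = zorder (\<lambda>z. u z / f z) z"
        using sub_ord_cong[OF w_mero uf wu, of z] sub_ord_eq_zorder[OF nonzero_mero_divide[OF u f_nz]] by simp
      ultimately show ?thesis using zorder_divide'[OF u f_nz, of z] 2 by simp
    qed
  qed
qed

lemma small_w: "sml.small w"
proof -
  have gf: "poles_in UNIV gf" using poles_in_log_deriv[OF f_nz, of UNIV] by (simp add: gf_def[abs_def])
  have t: "poles_in UNIV t" using small_t poles_in_mono unfolding sml.small_def by blast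
  have "poles_in UNIV (\<lambda>z. t z * gf z + (- 1) * (deriv gf z + gf z * gf z))"
    by (intro poles_in_add poles_in_mult poles_in_deriv poles_in_const gf t)
  hence "poles_in UNIV w" unfolding w_alt .
  hence "poles_in S w" using sub_ord_w by (rule poles_in_restrict)
  moreover have "nv.tame w" unfolding w_def[abs_def]
    by (intro nv.tame_diff nv.tame_add nv.tame_mult nv.tame_deriv nv.tame_power tame_t tame_gf)
  ultimately show ?thesis unfolding sml.small_def by simp
qed

section \<open>Vanishing of the compatibility coefficients and of the discriminant\<close>

lemma small_cA: "sml.small cA" unfolding cA_def[abs_def]
  by (intro sml.small_diff sml.small_mult sml.small_const small_w)

lemma small_cB: "sml.small cB" unfolding cB_def[abs_def]
  by (intro sml.small_diff sml.small_mult sml.small_const small_t)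

lemma small_X: "sml.small X" unfolding X_def[abs_def]
  by (intro sml.small_diff sml.small_mult sml.small_deriv small_w small_cA small_cB small_g)

lemma small_Y: "sml.small Y" unfolding Y_def[abs_def]
  by (intro sml.small_diff sml.small_add sml.small_mult sml.small_deriv sml.small_const small_w small_cA small_cB small_g small_t)

lemma small_Dis: "sml.small Dis" unfolding Dis_def[abs_def]
  by (intro sml.small_diff sml.small_power sml.small_mult sml.small_const small_cA small_cB)

lemma analytic_cosparse:
  "\<forall>\<^sub>\<approx>z. cA analytic_on {z} \<and> cB analytic_on {z}"
  using meromorphic_on_imp_analytic_cosparse[OF sml.small_mero[OF small_cA]]
    meromorphic_on_imp_analytic_cosparse[OF sml.small_mero[OF small_cB]] by eventually_elim auto

lemma XY: "\<forall>\<^sub>\<approx>z. f z * X z + deriv f z * Y z = 0"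
proof -
  define u where "u = (\<lambda>z. cA z * f z ^ 2 + cB z * f z * deriv f z + cC * deriv f z ^ 2)"
  have "\<forall>\<^sub>\<approx>z. F z = u z" using F_eq sing_cosparse[OF f_nz]
    by eventually_elim (auto simp: u_def \<phi>_quad)
  note this meromorphic_deriv_cong[OF this]
  thus ?thesis using analytic_cosparse sing_cosparse[OF f_nz] sing_cosparse[OF F_nz]
  proof eventually_elim
    case (elim z)
    have fa: "f analytic_on {z}" "f z \<noteq> 0" using sing_analytic[OF elim(4)] by auto
    have "(u has_field_derivative deriv cA z * f z ^ 2 + 2 * cA z * f z * deriv f z + deriv cB z * f z * deriv f z
       + cB z * (deriv f z ^ 2 + f z * deriv (deriv f) z) + 2 * cC * deriv f z * deriv (deriv f) z) (at z)"
      unfolding u_def using elim(3)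
      by (auto intro!: derivative_eq_intros f_deriv[OF fa(1)] f_deriv2[OF fa(1)] analytic_has_deriv[of cA] analytic_has_deriv[of cB]
          simp: algebra_simps power2_eq_square)
    hence du: "deriv u z = deriv cA z * f z ^ 2 + 2 * cA z * f z * deriv f z + deriv cB z * f z * deriv f z
       + cB z * (deriv f z ^ 2 + f z * deriv (deriv f) z) + 2 * cC * deriv f z * deriv (deriv f) z"
      by (rule DERIV_imp_deriv)
    have "F z \<noteq> 0" using elim(5) by (auto simp: sing_def)
    hence "deriv u z - g z * u z = 0" using elim(1,2) by (simp add: g_def)
    moreover have "f z * (f z * X z + deriv f z * Y z) = deriv u z - g z * u z
       - deriv f z ^ 2 * N * ((2 * N - 1) * t z - (s + (N - 1) * g z))"
      unfolding du w_eq[OF elim(4)] unfolding u_def X_def Y_def cB_def cC_def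
      by (simp add: algebra_simps power2_eq_square)
    ultimately have "f z * (f z * X z + deriv f z * Y z) = 0" using tg[of z] by simp
    thus ?case using fa by simp
  qed
qed

text \<open>Otherwise f'/f = -X/Y. At a simple zero of f off S the left side has a pole while X is
  regular, so Y vanishes; the remaining zeros are charged to \<open>F\<close>. Then N(r, 1/f) is at
  most N(r, 1/Y) + N(r, 1/F), which is small, against \<open>N_large\<close>.\<close>

lemma Y_zero: "\<forall>\<^sub>\<approx>z. Y z = 0"
proof (rule ccontr)
  assume "\<not> (\<forall>\<^sub>\<approx>z. Y z = 0)"
  hence Y: "nonzero_mero Y" using zero_or_nonzero_mero[of Y] small_Y by blast
  have X: "X meromorphic_on UNIV" using small_X by blast
  have eq: "\<forall>\<^sub>\<approx>z. gf z = (- X z) * (1 / Y z)"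
    using XY nonzero_mero_cosparse_iff[THEN iffD1, OF Y, THEN conjunct2] sing_cosparse[OF f_nz]
  proof eventually_elim
    case (elim z)
    have "f z \<noteq> 0" using sing_analytic[OF elim(3)] by simp
    moreover have "deriv f z * Y z = - X z * f z" using elim(1) by (simp add: algebra_simps eq_neg_iff_add_eq_0)
    ultimately show ?case using elim(2) by (simp add: gf_def field_simps)
  qed
  have "zero_div f z \<le> zero_div Y z + zero_div F z" for z
  proof (cases "zorder f z > 0 \<and> zorder F z \<le> 0")
    case False
    thus ?thesis using zorder_\<phi>[OF \<phi>_nz, of z] unfolding zorder_F[symmetric]
      by (cases "zorder f z > 0") (auto simp: zero_div_def simp flip: of_int_add)
  next
    case True
    hence "pole_div f z = 0" by (simp add: pole_div_def)
    hence "pole_div \<phi> z = 0" using pole_div_\<phi>[OF \<phi>_nz, of z] pole_div_nonneg[of \<phi> z] by simp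
    hence "zorder F z \<ge> 0" by (simp add: pole_div_def zorder_F max_def split: if_splits)
    with True have z: "z \<notin> S" by (simp add: S_def)
    have "zorder f z \<le> 1" using True zorder_\<phi>[OF \<phi>_nz, of z] by (simp add: zorder_F)
    moreover have "zorder Y z > 0"
    proof (rule ccontr)
      assume Yz: "\<not> zorder Y z > 0"
      have "0 \<le> sub_ord X z" using small_X z unfolding sml.small_def poles_in_def by (metis if_False minus_zero of_nat_0)
      hence "0 \<le> sub_ord (\<lambda>z. (- 1) * X z) z" using sub_ord_mult[OF meromorphic_on_const X, of 0 "-1" z 0] by simp
      hence "0 + 0 \<le> sub_ord (\<lambda>z. (- 1) * X z * (1 / Y z)) z"
        using Yz Y sub_ord_eq_zorder[OF nonzero_mero_inverse[OF Y], of z] zorder_inverse'[OF Y, of z]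
        by (intro sub_ord_mult meromorphic_intros X) auto
      moreover have "sub_ord gf z = sub_ord (\<lambda>z. (- 1) * X z * (1 / Y z)) z"
        using eq Y by (intro sub_ord_cong gf_mero meromorphic_intros X) auto
      moreover have "sub_ord gf z = -1" unfolding gf_def[abs_def] using True by (intro sub_ord_log_deriv_nz f_nz) auto
      ultimately show False by simp
    qed
    hence "1 \<le> zero_div Y z" by (simp add: zero_div_def)
    moreover have "zero_div f z \<le> 1" using \<open>zorder f z \<le> 1\<close> by (simp add: zero_div_def)
    ultimately show ?thesis using zero_div_nonneg[of F z] by linarith
  qed
  hence "countN (zero_div f) r \<le> countN (zero_div Y) r + countN (zero_div F) r" if "r \<ge> 1" for r
    using that Y F_nz by (subst countN_add[symmetric]) (auto intro!: countN_mono loc_fin_add)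
  hence "\<forall>\<^sub>F r in nev. countN (zero_div f) r \<le> countN (zero_div Y) r + countN (zero_div F) r"
    using nev_ge[of 1] by (auto elim: eventually_mono)
  hence "sm (countN (zero_div f))" by (rule sm_mono[OF sm_add[OF sml.small_sm(4)[OF small_Y Y] sm_F(3)]])
  thus False using N_large by contradiction
qed

lemma X_zero: "\<forall>\<^sub>\<approx>z. X z = 0"
  using XY Y_zero sing_cosparse[OF f_nz] by eventually_elim (use sing_analytic in auto)

lemma s_nz: "s \<noteq> 0" using \<alpha>s by (simp add: s_def)

text \<open>If the discriminant did not vanish, \<open>e\<^sup>2\<^sup>s\<^sup>z\<close> would be a constant multiple of \<open>\<phi>\<^sup>2\<^sup>n\<close> over
  a power of it.\<close>

lemma Dis_zero: "\<forall>\<^sub>\<approx>z. Dis z = 0"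
proof (rule ccontr)
  assume "\<not> (\<forall>\<^sub>\<approx>z. Dis z = 0)"
  hence D: "nonzero_mero Dis" using zero_or_nonzero_mero[of Dis] small_Dis by blast
  have D': "\<forall>\<^sub>\<approx>z. deriv Dis z = 2 * (g z - t z) * Dis z"
    using analytic_cosparse X_zero Y_zero
  proof eventually_elim
    case (elim z)
    have "(Dis has_field_derivative 2 * cB z * deriv cB z - 4 * cC * deriv cA z) (at z)"
      unfolding Dis_def[abs_def] using elim(1)
      by (auto intro!: derivative_eq_intros analytic_has_deriv[of cA] analytic_has_deriv[of cB] simp: power2_eq_square)
    hence d: "deriv Dis z = 2 * cB z * deriv cB z - 4 * cC * deriv cA z" by (rule DERIV_imp_deriv)
    have A': "deriv cA z = cB z * w z + g z * cA z" using elim(2) by (simp add: X_def algebra_simps)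
    have B': "deriv cB z = g z * cB z + 2 * cC * w z - 2 * cA z - cB z * t z" using elim(3) by (simp add: Y_def algebra_simps)
    have e: "cB z + 2 * cC * t z - g z * cC = N * ((2 * N - 1) * t z - (s + (N - 1) * g z))"
      by (simp add: cB_def cC_def algebra_simps)
    have "deriv Dis z - 2 * (g z - t z) * Dis z = - 4 * cA z * (cB z + 2 * cC * t z - g z * cC)"
      unfolding d A' B' Dis_def by (simp add: algebra_simps power2_eq_square)
    also have "\<dots> = 0" unfolding e tg by simp
    finally show ?case by simp
  qed
  \<comment> \<open>The exponents 2n - 1 for \<open>Dis\<close> and 2n for 1/F are the ones that
    cancel g: from Dis' = 2 (g - t) Dis and the defining relation of t, the logarithmic derivative
    is 2((2N - 1)(g - t) - N g) = -2s.\<close>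
  define m where "m = 2 * n - 2"
  have Nm: "of_nat (Suc m) = 2 * N - 1" using n2 by (simp add: m_def of_nat_diff)
  define G where "G = (\<lambda>z. Dis z ^ Suc m * (1 / F z) ^ (2 * n))"
  have Gnz: "nonzero_mero G" unfolding G_def using D F_nz by (intro nonzero_mero_mult nonzero_mero_power nonzero_mero_inverse)
  have "sm (\<lambda>r. proximity_m r G)" unfolding G_def
    using D F_nz sml.small_sm(1)[OF small_Dis D] sm_F(2)
    by (intro sm_proximity_mult sm_proximity_power nonzero_mero_power nonzero_mero_inverse) auto
  moreover have "\<forall>\<^sub>\<approx>z. deriv G z = (- 2 * s) * G z"
    using D' sing_cosparse[OF F_nz] sing_cosparse[OF D]
  proof eventually_elim
    case (elim z)
    have Dz: "(Dis has_field_derivative deriv Dis z) (at z)" using elim(3)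
      by (intro analytic_has_deriv) (auto simp: sing_def)
    have F0: "F z \<noteq> 0" and Fz: "(F has_field_derivative g z * F z) (at z)" using elim(2) analytic_has_deriv[of F z]
      by (auto simp: sing_def g_def)
    have i: "((\<lambda>z. 1 / F z) has_field_derivative - g z * (1 / F z)) (at z)"
      using F0 by (auto intro!: derivative_eq_intros Fz simp: power2_eq_square field_simps)
    have "(G has_field_derivative (of_nat (Suc m) * (deriv Dis z * Dis z ^ m)) * (1 / F z) ^ (2 * n) +
        (of_nat (2 * n) * ((- g z * (1 / F z)) * (1 / F z) ^ (2 * n - Suc 0))) * Dis z ^ Suc m) (at z)"
      unfolding G_def using DERIV_mult[OF DERIV_power[OF Dz, of "Suc m"] DERIV_power[OF i, of "2 * n"]] by simp
    hence "deriv G z = (of_nat (Suc m) * (deriv Dis z * Dis z ^ m)) * (1 / F z) ^ (2 * n) +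
        (of_nat (2 * n) * ((- g z * (1 / F z)) * (1 / F z) ^ (2 * n - Suc 0))) * Dis z ^ Suc m" by (rule DERIV_imp_deriv)
    also have "(- g z * (1 / F z)) * (1 / F z) ^ (2 * n - Suc 0) = - g z * (1 / F z) ^ (2 * n)"
      using n2 by (simp only: mult.assoc power_Suc[symmetric]) simp
    also have "of_nat (Suc m) * (deriv Dis z * Dis z ^ m) * (1 / F z) ^ (2 * n) + of_nat (2 * n) * (- g z * (1 / F z) ^ (2 * n)) * Dis z ^ Suc m
       = 2 * ((2 * N - 1) * (g z - t z) - N * g z) * G z"
      unfolding Nm elim(1) G_def by (simp add: algebra_simps)
    also have "(2 * N - 1) * (g z - t z) - N * g z = - s"
      unfolding right_diff_distrib tg by (simp add: algebra_simps)
    finally show ?case by simp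
  qed
  ultimately have "- 2 * s = 0" using sm_linear_ode_0[OF Gnz] by blast
  thus False using s_nz by simp
qed

text \<open>-N times the double root of the quadratic form in f'/f. With it \<phi> = N(N - 1)(f' + v
  f / N)^2.\<close>

definition v where "v z = (t z - s) / (2 * (N - 1)) * N"

lemma small_v: "sml.small v"
  unfolding v_def[abs_def]
  by (intro sml.small_divide_const sml.small_diff sml.small_mult sml.small_const small_t)

lemma t_v: "t z = s + 2 * (N - 1) * v z / N" and g_v: "g z = 2 * s + 2 * (2 * N - 1) * v z / N"
proof -
  show t: "t z = s + 2 * (N - 1) * v z / N" using N_facts by (simp add: v_def)
  have "(N - 1) * g z = (N - 1) * (2 * s + 2 * (2 * N - 1) * v z / N)"
    using tg[of z] unfolding t by (simp add: algebra_simps)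
  thus "g z = 2 * s + 2 * (2 * N - 1) * v z / N" using N_facts by simp
qed

lemma cB_v: "cB z = 2 * (N - 1) * v z"
  using N_facts by (simp add: cB_def t_v)

lemma cA_v: "\<forall>\<^sub>\<approx>z. N * cA z = (N - 1) * v z ^ 2"
  using Dis_zero
proof eventually_elim
  case (elim z)
  hence "4 * (N - 1) * (N * cA z - (N - 1) * v z ^ 2) = 0"
    unfolding Dis_def cB_v cC_def by (simp add: algebra_simps power2_eq_square)
  thus ?case using N_facts by simp
qed

lemma v_Riccati: "\<forall>\<^sub>\<approx>z. deriv v z = (v z + \<alpha>1) * (v z + \<alpha>2)"
  using cA_v Y_zero meromorphic_on_imp_analytic_cosparse[OF sml.small_mero[OF small_v]]
proof eventually_elim
  case (elim z)
  have "cB = (\<lambda>z. 2 * (N - 1) * v z)" by (rule ext) (rule cB_v)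
  hence B': "deriv cB z = 2 * (N - 1) * deriv v z"
    using elim(3) by (auto intro!: deriv_cmult analytic_on_imp_differentiable_at)
  have "N * w z = \<alpha>1 * \<alpha>2 - cA z" by (simp add: cA_def)
  hence Nw: "N * (N * w z) = N * (\<alpha>1 * \<alpha>2) - (N - 1) * v z ^ 2" using elim(1) by (simp add: right_diff_distrib)
  have Nt: "N * t z = N * s + 2 * (N - 1) * v z" and Ng: "N * g z = 2 * N * s + 2 * (2 * N - 1) * v z"
    using N_facts by (simp_all add: t_v g_v field_simps)
  have "0 = N * Y z" using elim(2) by simp
  also have "\<dots> = 2 * (N * cA z) + 2 * N * (N - 1) * deriv v z + 2 * (N - 1) * v z * (N * t z)
      - 2 * (N - 1) * (N * (N * w z)) - (N * g z) * (2 * (N - 1) * v z)"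
    unfolding Y_def B' cB_v cC_def by (simp add: algebra_simps)
  also have "\<dots> = 2 * N * (N - 1) * (deriv v z - (v z + \<alpha>1) * (v z + \<alpha>2))"
    unfolding Nw Nt Ng elim(1) s_def by (simp add: algebra_simps power2_eq_square)
  finally show ?case using N_facts by simp
qed

text \<open>If neither factor vanishes identically, the quotient (v + \<alpha>1)/(v + \<alpha>2)
  satisfies G' = (\<alpha>2 - \<alpha>1) G by the Riccati equation. It has small proximity function,
  which forces \<alpha>1 = \<alpha>2.\<close>

lemma v_const: "(\<forall>\<^sub>\<approx>z. v z + \<alpha>1 = 0) \<or> (\<forall>\<^sub>\<approx>z. v z + \<alpha>2 = 0)"
proof (rule ccontr)
  assume *: "\<not> ?thesis"
  have sv: "sml.small (\<lambda>z. v z + \<alpha>1)" "sml.small (\<lambda>z. v z + \<alpha>2)"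
    by (intro sml.small_add small_v sml.small_const)+
  have nz: "nonzero_mero (\<lambda>z. v z + \<alpha>1)" "nonzero_mero (\<lambda>z. v z + \<alpha>2)"
    using * zero_or_nonzero_mero[OF sml.small_mero[OF sv(1)]] zero_or_nonzero_mero[OF sml.small_mero[OF sv(2)]] by blast+
  define G where "G = (\<lambda>z. (v z + \<alpha>1) * (1 / (v z + \<alpha>2)))"
  have G: "nonzero_mero G" unfolding G_def by (intro nonzero_mero_mult nonzero_mero_inverse nz)
  have "sm (\<lambda>r. proximity_m r G)" unfolding G_def
    by (intro sm_proximity_mult nonzero_mero_inverse nz sml.small_sm(1)[OF sv(1) nz(1)] sml.small_sm(3)[OF sv(2) nz(2)])
  moreover have "\<forall>\<^sub>\<approx>z. deriv G z = (\<alpha>2 - \<alpha>1) * G z"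
    using v_Riccati sing_cosparse[OF nz(2)] meromorphic_on_imp_analytic_cosparse[OF sml.small_mero[OF small_v]]
  proof eventually_elim
    case (elim z)
    have nz: "v z + \<alpha>2 \<noteq> 0" using elim(2) by (auto simp: sing_def)
    note dv = analytic_has_deriv[OF elim(3), unfolded elim(1)]
    have "((\<lambda>z. (v z + \<alpha>1) / (v z + \<alpha>2)) has_field_derivative
      ((v z + \<alpha>1) * (v z + \<alpha>2) * (v z + \<alpha>2) - (v z + \<alpha>1) * ((v z + \<alpha>1) * (v z + \<alpha>2))) / ((v z + \<alpha>2) * (v z + \<alpha>2))) (at z)"
      by (rule DERIV_divide) (use nz in \<open>auto intro!: derivative_eq_intros dv\<close>)
    moreover have "((v z + \<alpha>1) * (v z + \<alpha>2) * (v z + \<alpha>2) - (v z + \<alpha>1) * ((v z + \<alpha>1) * (v z + \<alpha>2))) =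
       (\<alpha>2 - \<alpha>1) * (v z + \<alpha>1) * (v z + \<alpha>2)" by (simp add: algebra_simps)
    ultimately have "(G has_field_derivative (\<alpha>2 - \<alpha>1) * G z) (at z)"
      unfolding G_def using nz by simp
    thus ?case by (rule DERIV_imp_deriv)
  qed
  ultimately have "\<alpha>2 - \<alpha>1 = 0" using sm_linear_ode_0[OF G] by blast
  thus False using \<alpha>d by simp
qed

text \<open>A constant v makes g constant, so \<open>F\<close> solves F' = g F with constant g;
  smallness gives g = 0, which is the stated relation between s and \<alpha>. Then \<phi> is
  constant and equals N(N - 1) times the square of f' - (\<alpha>/N) f, so that expression is
  constant as well.\<close>

lemma \<phi>_const:
  assumes v: "\<forall>\<^sub>\<approx>z. v z + \<alpha> = 0"
  shows "N * s = (2 * N - 1) * \<alpha> \<and> (\<exists>\<beta>. \<beta> \<noteq> 0 \<and> (\<forall>\<^sub>\<approx>z. \<phi> z = N * (N - 1) * \<beta> ^ 2) \<and>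
    (\<forall>\<^sub>\<approx>z. deriv f z - \<alpha> / N * f z = \<beta>))"
proof -
  define g0 where "g0 = 2 * s - 2 * (2 * N - 1) * \<alpha> / N"
  have F': "\<forall>\<^sub>\<approx>z. deriv F z = g0 * F z" using v sing_cosparse[OF F_nz]
  proof eventually_elim
    case (elim z)
    have "v z = - \<alpha>" using elim(1) by (simp add: eq_neg_iff_add_eq_0)
    hence "g z = g0" by (simp add: g_v g0_def)
    thus ?case using elim(2) by (simp add: g_def sing_def field_simps)
  qed
  have g0: "g0 = 0" by (rule sm_linear_ode_0[OF F_nz F' sm_F(1)])
  hence 1: "N * s = (2 * N - 1) * \<alpha>"
  proof -
    have "2 * (N * s) = 2 * ((2 * N - 1) * \<alpha>)" using g0 N_facts(1) by (simp add: g0_def field_simps)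
    thus ?thesis by (simp only: mult_cancel_left) simp
  qed
  obtain c where c: "\<forall>\<^sub>\<approx>z. F z = c"
    using meromorphic_deriv_0_const[of F] F' g0 F_nz by auto
  have c0: "c \<noteq> 0" using c not_nonzero_mero_zero[of F] F_nz by auto
  define \<beta> where "\<beta> = (\<lambda>z. deriv f z - \<alpha> / N * f z)"
  have \<beta>m: "\<beta> meromorphic_on UNIV" unfolding \<beta>_def by (intro meromorphic_intros f_mero)
  have sq: "\<forall>\<^sub>\<approx>z. \<beta> z ^ 2 = c / cC" using c F_eq cA_v v sing_cosparse[OF f_nz]
  proof eventually_elim
    case (elim z)
    have vz: "v z = - \<alpha>" using elim(4) by (simp add: eq_neg_iff_add_eq_0)
    have "N * c = (N * cA z) * f z ^ 2 + N * cB z * f z * deriv f z + N * cC * deriv f z ^ 2"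
      unfolding elim(1)[symmetric] elim(2) \<phi>_quad[OF elim(5)] by (simp add: algebra_simps)
    also have "\<dots> = (N - 1) * (N * deriv f z - \<alpha> * f z) ^ 2"
      unfolding elim(3) cB_v vz cC_def by (simp add: algebra_simps power2_eq_square)
    also have "N * deriv f z - \<alpha> * f z = N * \<beta> z" using N_facts by (simp add: \<beta>_def right_diff_distrib)
    finally have "N * c = N * (cC * \<beta> z ^ 2)" by (simp add: cC_def power2_eq_square mult_ac)
    thus ?case using N_facts by simp
  qed
  have "\<forall>\<^sub>\<approx>z. deriv \<beta> z = 0"
    using sq meromorphic_deriv_cong[OF sq] meromorphic_on_imp_analytic_cosparse[OF \<beta>m]
  proof eventually_elim
    case (elim z)
    have "((\<lambda>z. \<beta> z ^ 2) has_field_derivative 2 * \<beta> z * deriv \<beta> z) (at z)"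
      by (auto intro!: derivative_eq_intros analytic_has_deriv[OF elim(3)] simp: power2_eq_square)
    hence "deriv (\<lambda>z. \<beta> z ^ 2) z = 2 * \<beta> z * deriv \<beta> z" by (rule DERIV_imp_deriv)
    hence "2 * \<beta> z * deriv \<beta> z = 0" using elim(2) by simp
    moreover have "\<beta> z \<noteq> 0" using elim(1) c0 N_facts by auto
    ultimately show ?case by simp
  qed
  then obtain b where b: "\<forall>\<^sub>\<approx>z. \<beta> z = b" using meromorphic_deriv_0_const[OF \<beta>m] by blast
  obtain z where "\<beta> z ^ 2 = c / cC" "\<beta> z = b"
    using cosparse_ex[OF eventually_conj[OF sq b]] by blast
  hence cb: "c = N * (N - 1) * b ^ 2" using N_facts by (simp add: cC_def field_simps)
  have "\<forall>\<^sub>\<approx>z. \<phi> z = N * (N - 1) * b ^ 2" using c F_eq by eventually_elim (simp add: cb)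
  moreover have "b \<noteq> 0" using c0 cb by auto
  ultimately show ?thesis using 1 b unfolding \<beta>_def by blast
qed

end

section \<open>The two cases\<close>

lemma pderiv_surj: "\<exists>R. pderiv R = A \<and> degree R \<le> Suc (degree (A :: complex poly))"
proof -
  have 1: "\<exists>R. \<forall>k. coeff R k = (if k = 0 then 0 else coeff A (k - 1) / of_nat k)"
  proof -
    have "\<forall>\<^sub>\<infinity>k. (if k = 0 then 0 else coeff A (k - 1) / of_nat k) = 0"
      unfolding MOST_nat by (intro exI[of _ "Suc (degree A)"]) (auto simp: coeff_eq_0)
    hence "coeff (Abs_poly (\<lambda>k. if k = 0 then 0 else coeff A (k - 1) / of_nat k)) =
       (\<lambda>k. if k = 0 then 0 else coeff A (k - 1) / of_nat k)" by (intro Abs_poly_inverse) simp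
    thus ?thesis by (intro exI) (rule allI, erule fun_cong)
  qed
  then obtain R where R: "\<And>k. coeff R k = (if k = 0 then 0 else coeff A (k - 1) / of_nat k)" by blast
  have "pderiv R = A" by (rule poly_eqI) (simp add: coeff_pderiv R del: of_nat_Suc)
  moreover have "degree R \<le> Suc (degree A)" by (rule degree_le) (auto simp: R coeff_eq_0)
  ultimately show ?thesis by blast
qed

text \<open>For e \<noteq> 0 the candidate A/e leaves an error involving only A', of lower degree,
  and the recursion keeps the degree at most deg A. For e = 0 integration raises it by one. Two
  applications account for the bound deg P + 2.\<close>

lemma linear_ode_poly: "\<exists>R. pderiv R + smult e R = A \<and> degree R \<le> Suc (degree (A :: complex poly))"
proof (cases "e = 0")
  case True thus ?thesis using pderiv_surj[of A] by auto
next
  case e: False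
  have "\<exists>R. pderiv R + smult e R = A \<and> degree R \<le> degree A" for A :: "complex poly"
  proof (induction "degree A" arbitrary: A rule: less_induct)
    case less
    show ?case
    proof (cases "degree A = 0")
      case True
      hence "pderiv (smult (1 / e) A) = 0" by (simp add: pderiv_eq_0_iff)
      thus ?thesis using e by (intro exI[of _ "smult (1 / e) A"]) simp
    next
      case False
      define B where "B = smult (- 1 / e) (pderiv A)"
      have "degree B < degree A" using False e by (simp add: B_def degree_pderiv)
      then obtain R where R: "pderiv R + smult e R = B" "degree R \<le> degree B" using less by blast
      have "pderiv (smult (1 / e) A + R) + smult e (smult (1 / e) A + R) = smult (1 / e) (pderiv A) + A + (pderiv R + smult e R)"
        using e by (simp add: pderiv_add pderiv_smult smult_add_right)
      also have "\<dots> = A" unfolding R B_def by (simp flip: smult_add_left)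
      finally have "pderiv (smult (1 / e) A + R) + smult e (smult (1 / e) A + R) = A" .
      moreover have "degree (smult (1 / e) A + R) \<le> degree A"
        using R(2) \<open>degree B < degree A\<close> e by (intro degree_add_le) auto
      ultimately show ?thesis by blast
    qed
  qed
  then obtain R where "pderiv R + smult e R = A" "degree R \<le> degree A" by blast
  thus ?thesis by (intro exI[of _ R]) auto
qed

lemma poly_exp_deriv:
  "deriv (\<lambda>z. poly R z * exp (poly Q z)) = (\<lambda>z. poly (pderiv R + pderiv Q * R) z * exp (poly Q z :: complex))"
  by (rule ext, rule DERIV_imp_deriv) (auto intro!: derivative_eq_intros poly_DERIV simp: algebra_simps)

lemma (in tumura_clunie_small) \<phi>_const_cases:
  "\<exists>\<alpha> \<beta>. (\<alpha> = \<alpha>1 \<or> \<alpha> = \<alpha>2) \<and> N * s = (2 * N - 1) * \<alpha> \<and>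
    (\<forall>\<^sub>\<approx>z. \<phi> z = N * (N - 1) * \<beta> ^ 2) \<and> (\<forall>\<^sub>\<approx>z. deriv f z - \<alpha> / N * f z = \<beta>)"
proof -
  have "\<exists>\<alpha>. (\<alpha> = \<alpha>1 \<or> \<alpha> = \<alpha>2) \<and> (\<forall>\<^sub>\<approx>z. v z + \<alpha> = 0)" using v_const by blast
  then obtain \<alpha> where \<alpha>: "\<alpha> = \<alpha>1 \<or> \<alpha> = \<alpha>2" and v: "\<forall>\<^sub>\<approx>z. v z + \<alpha> = 0" by blast
  obtain \<beta> where "\<forall>\<^sub>\<approx>z. \<phi> z = N * (N - 1) * \<beta> ^ 2" "\<forall>\<^sub>\<approx>z. deriv f z - \<alpha> / N * f z = \<beta>"
    using \<phi>_const[OF v] by (elim conjE exE)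
  thus ?thesis using \<alpha> \<phi>_const[OF v, THEN conjunct1] by (intro exI[of _ \<alpha>] exI[of _ \<beta>] conjI)
qed

context tumura_clunie
begin

lemma affine_solution:
  assumes "\<forall>\<^sub>\<approx>z. deriv f z - \<alpha>1 / of_nat n * f z = \<beta>"
  shows "\<exists>c d. f = (\<lambda>z. c * exp (\<alpha>1 * z / of_nat n) + d) \<and> \<alpha>1 * d = - of_nat n * \<beta>"
proof -
  have n0: "of_nat n \<noteq> (0::complex)" using n2 by simp
  define d where "d = - of_nat n * \<beta> / \<alpha>1"
  have d: "\<alpha>1 * d = - of_nat n * \<beta>" using \<alpha>0 by (simp add: d_def)
  hence d': "\<alpha>1 / of_nat n * d = - \<beta>" using n0 by (simp add: field_simps)
  define u where "u = (\<lambda>z. f z - d)"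
  have um: "u meromorphic_on UNIV" unfolding u_def by (intro meromorphic_intros f_mero)
  have "\<forall>\<^sub>\<approx>z. deriv u z = (\<alpha>1 / of_nat n) * u z"
    using assms meromorphic_on_imp_analytic_cosparse[OF f_mero]
  proof eventually_elim
    case (elim z)
    have "(u has_field_derivative deriv f z) (at z)" unfolding u_def
      by (auto intro!: derivative_eq_intros f_deriv elim(2))
    hence "deriv u z = deriv f z" by (rule DERIV_imp_deriv)
    also have "\<dots> = \<alpha>1 / of_nat n * f z + \<beta>" using elim(1) by (simp only: diff_eq_eq add.commute)
    also have "\<beta> = - (\<alpha>1 / of_nat n * d)" unfolding d' by simp
    finally show ?case by (simp add: u_def right_diff_distrib)
  qed
  then obtain c where "\<forall>\<^sub>\<approx>z. u z = c * exp (\<alpha>1 / of_nat n * z)" using meromorphic_linear_ode[OF um] by blast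
  hence "\<forall>\<^sub>\<approx>z. f z = c * exp (\<alpha>1 * z / of_nat n) + d"
    by eventually_elim (simp add: u_def algebra_simps)
  hence "f = (\<lambda>z. c * exp (\<alpha>1 * z / of_nat n) + d)"
    using n0 by (intro nicely_eq_entire[OF f_nice] holomorphic_intros) auto
  thus ?thesis using d by blast
qed

lemma small_\<phi>_const:
  assumes "nonzero_mero \<phi>" "sm (\<lambda>r. characteristic_T r \<phi>)" "\<not> sm (countN (zero_div f))"
  shows "\<exists>\<alpha> \<beta>. (\<alpha> = \<alpha>1 \<or> \<alpha> = \<alpha>2) \<and> of_nat n * s = (2 * of_nat n - 1) * \<alpha> \<and>
    (\<forall>\<^sub>\<approx>z. \<phi> z = of_nat n * (of_nat n - 1) * \<beta> ^ 2) \<and> (\<forall>\<^sub>\<approx>z. deriv f z - \<alpha> / of_nat n * f z = \<beta>)"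
  by (rule tumura_clunie_small.\<phi>_const_cases[OF tumura_clunie_small.intro[OF tumura_clunie_axioms
      tumura_clunie_small_axioms.intro[OF assms]]])

text \<open>The constant term d satisfies (\<alpha>1 d)^2 = n c / (n - 1), so \<alpha>1 d is plus or
  minus the chosen square root: the two signs are the two alternatives. The exponent relation is the
  one for s solved for \<alpha>2.\<close>

lemma const_case_half:
  assumes s: "of_nat n * s = (2 * of_nat n - 1) * \<alpha>1" and c: "c = of_nat n * (of_nat n - 1) * \<beta> ^ 2"
    and f: "\<forall>\<^sub>\<approx>z. deriv f z - \<alpha>1 / of_nat n * f z = \<beta>"
  shows "(of_nat n - 1) * \<alpha>1 = of_nat n * \<alpha>2 \<and>
              ((\<exists>c1. c1 ^ n = p1 \<and> f = (\<lambda>z. c1 * exp (\<alpha>1 * z / of_nat n)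
                  - 1 / \<alpha>1 * csqrt (of_nat n * c / (of_nat n - 1))))
             \<or> (\<exists>c3. c3 ^ n = p1 \<and> f = (\<lambda>z. c3 * exp (\<alpha>1 * z / of_nat n)
                  + 1 / \<alpha>1 * csqrt (of_nat n * c / (of_nat n - 1)))))"
proof -
  have n1: "of_nat n - 1 \<noteq> (0::complex)" using n2 by auto
  obtain a d where f': "f = (\<lambda>z. a * exp (\<alpha>1 * z / of_nat n) + d)" and d: "\<alpha>1 * d = - of_nat n * \<beta>"
    using affine_solution[OF f] by blast
  have ap: "a ^ n = p1" using exp_solution[OF f'] by blast
  define x where "x = csqrt (of_nat n * c / (of_nat n - 1))"
  have "x ^ 2 = of_nat n * c / (of_nat n - 1)" unfolding x_def by simp
  also have "\<dots> = (\<alpha>1 * d) ^ 2" unfolding c d using n1 by (simp add: power2_eq_square field_simps)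
  finally have "x = \<alpha>1 * d \<or> x = - (\<alpha>1 * d)" unfolding power2_eq_iff .
  hence "d = 1 / \<alpha>1 * x \<or> d = - (1 / \<alpha>1 * x)" using \<alpha>0 by auto
  moreover have "(of_nat n - 1) * \<alpha>1 = of_nat n * \<alpha>2" using s by (simp add: s_def algebra_simps)
  ultimately show ?thesis using ap f' unfolding x_def[symmetric] by auto
qed

lemma const_case:
  assumes c: "\<forall>\<^sub>\<approx>z. \<phi> z = c" "c \<noteq> 0" and N: "\<not> sm (countN (zero_div f))"
  shows "((of_nat n - 1) * \<alpha>1 = of_nat n * \<alpha>2 \<and>
              ((\<exists>c1. c1 ^ n = p1 \<and> f = (\<lambda>z. c1 * exp (\<alpha>1 * z / of_nat n)
                  - 1 / \<alpha>1 * csqrt (of_nat n * c / (of_nat n - 1))))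
             \<or> (\<exists>c3. c3 ^ n = p1 \<and> f = (\<lambda>z. c3 * exp (\<alpha>1 * z / of_nat n)
                  + 1 / \<alpha>1 * csqrt (of_nat n * c / (of_nat n - 1))))))
         \<or> ((of_nat n - 1) * \<alpha>2 = of_nat n * \<alpha>1 \<and>
              ((\<exists>c2. c2 ^ n = p2 \<and> f = (\<lambda>z. c2 * exp (\<alpha>2 * z / of_nat n)
                  - 1 / \<alpha>2 * csqrt (of_nat n * c / (of_nat n - 1))))
             \<or> (\<exists>c4. c4 ^ n = p2 \<and> f = (\<lambda>z. c4 * exp (\<alpha>2 * z / of_nat n)
                  + 1 / \<alpha>2 * csqrt (of_nat n * c / (of_nat n - 1))))))"
proof -
  interpret sw: tumura_clunie n P \<alpha>2 \<alpha>1 p2 p1 f by (rule swapped)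
  have nz: "nonzero_mero \<phi>"
    using zero_or_nonzero_mero[OF \<phi>_mero] cosparse_ex[OF eventually_conj[OF _ c(1)]] c(2) by blast
  have sm: "sm (\<lambda>r. characteristic_T r \<phi>)"
  proof (rule sm_mono[OF sm_const[of "log_plus (norm c)"]])
    have zo: "zorder \<phi> z = 0" for z
    proof -
      have "zorder \<phi> z = zorder (\<lambda>_. c) z"
        by (rule zorder_cong) (use cosparse_eventually_at[OF c(1), of z] in auto)
      also have "\<dots> = 0" using c(2) by (intro zorder_eq_0I) auto
      finally show ?thesis .
    qed
    hence 0: "pole_div \<phi> = (\<lambda>_. 0)" by (simp add: pole_div_def fun_eq_iff)
    have "\<forall>\<^sub>F r in nev. proximity_m r \<phi> \<le> log_plus (norm c)"
      using cosparse_nev[OF c(1)] nev_ge[of 1] by eventually_elim (rule proximity_le_const, auto)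
    from this nev_ge[of 1] show "\<forall>\<^sub>F r in nev. characteristic_T r \<phi> \<le> log_plus (norm c)"
      by eventually_elim (simp add: characteristic_eq[OF nz] 0)
  qed
  obtain \<alpha> \<beta> where \<alpha>: "\<alpha> = \<alpha>1 \<or> \<alpha> = \<alpha>2" and s: "of_nat n * s = (2 * of_nat n - 1) * \<alpha>"
    and \<phi>: "\<forall>\<^sub>\<approx>z. \<phi> z = of_nat n * (of_nat n - 1) * \<beta> ^ 2"
    and f: "\<forall>\<^sub>\<approx>z. deriv f z - \<alpha> / of_nat n * f z = \<beta>"
    using small_\<phi>_const[OF nz sm N] by blast
  obtain z where "\<phi> z = c" "\<phi> z = of_nat n * (of_nat n - 1) * \<beta> ^ 2"
    using cosparse_ex[OF eventually_conj[OF c(1) \<phi>]] by blast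
  hence cb: "c = of_nat n * (of_nat n - 1) * \<beta> ^ 2" by simp
  have ss: "sw.s = s" by (simp add: s_def sw.s_def)
  from \<alpha> show ?thesis
  proof
    assume "\<alpha> = \<alpha>1"
    thus ?thesis using const_case_half[OF _ cb] s f by (intro disjI1) blast
  next
    assume "\<alpha> = \<alpha>2"
    thus ?thesis using sw.const_case_half[OF _ cb, unfolded ss] s f by (intro disjI2) blast
  qed
qed

lemma not_const_not_small:
  assumes "\<not> (\<exists>c. \<forall>\<^sub>\<approx>z. \<phi> z = c)" "\<not> sm (countN (zero_div f))"
  shows "\<not> is_S f (\<lambda>r. characteristic_T r \<phi>)"
proof
  assume "is_S f (\<lambda>r. characteristic_T r \<phi>)"
  from is_S_sm[OF this] have "sm (\<lambda>r. characteristic_T r \<phi>)"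
    by (rule sm_mono) (use nev_ge[of 0] in \<open>eventually_elim, simp\<close>)
  moreover have "nonzero_mero \<phi>" using zero_or_nonzero_mero[OF \<phi>_mero] assms(1) by blast
  ultimately show False using small_\<phi>_const assms by blast
qed

text \<open>Clunie's bound gives |exp Q| \<le> r^(M + M') |f| off an exceptional set, so m(r, exp Q)
  = O(r). Then Q' is bounded by \<open>norm_deriv_le_proximity_exp\<close>, hence constant by
  Liouville.\<close>

lemma exp_factor_degree:
  assumes A: "A \<noteq> 0" and \<phi>: "\<forall>\<^sub>\<approx>z. \<phi> z = poly A z * exp (poly Q z)" and "degree Q \<ge> 1"
  shows "degree Q = 1"
proof -
  obtain M where M: "\<forall>\<^sub>F r in nev. \<forall>z. norm z = r \<longrightarrow> norm (\<phi> z) \<le> r ^ M * norm (f z)" using \<phi>_le by blast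
  obtain M' where M': "\<forall>\<^sub>F r in nev. \<forall>z. norm z = r \<longrightarrow> norm (1 / poly A z) \<le> r ^ M'"
    using nv.tame_bound[OF nv.tame_inverse_poly[OF A]] by blast
  obtain K where "\<forall>\<^sub>F r in at_top. characteristic_T r f \<le> K * r" using T_upper by blast
  hence K: "\<forall>\<^sub>F r in nev. characteristic_T r f \<le> K * r" by (rule filter_leD[OF nev_le_at_top])
  define K' where "K' = real (M' + M) + K"
  have mQ: "\<forall>\<^sub>F r in nev. proximity_m r (\<lambda>z. exp (poly Q z)) \<le> K' * r \<and> r \<ge> 1"
    using M M' K cosparse_nev[OF \<phi>] cosparse_nev[OF poly_cosparse[OF A]] nev_ge[of 1] nev_good_radius[OF f_nz]
  proof eventually_elim
    case (elim r)
    have "proximity_m r (\<lambda>z. exp (poly Q z)) \<le> circ_mean r (\<lambda>z. real (M' + M) * ln r + log_plus (norm (f z)))"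
    proof (rule proximity_le_mean)
      fix z :: complex assume z: "norm z = r"
      have "exp (poly Q z) = (1 / poly A z) * \<phi> z" using elim(4,5) z by simp
      hence "norm (exp (poly Q z)) = norm (1 / poly A z) * norm (\<phi> z)" by (simp only: norm_mult)
      also have "\<dots> \<le> r ^ M' * (r ^ M * norm (f z))" using elim z by (intro mult_mono) auto
      also have "\<dots> = r ^ (M' + M) * norm (f z)" by (simp add: power_add)
      finally have "log_plus (norm (exp (poly Q z))) \<le> log_plus (r ^ (M' + M)) + log_plus (norm (f z))"
        using elim by (intro order_trans[OF log_plus_mono log_plus_mult]) auto
      also have "log_plus (r ^ (M' + M)) = real (M' + M) * ln r"
        using elim by (subst log_plus_power) (auto simp: log_plus_def)
      finally show "log_plus (norm (exp (poly Q z))) \<le> real (M' + M) * ln r + log_plus (norm (f z))" .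
    qed (use elim in \<open>auto intro!: continuous_intros good_radius_continuous_log_plus\<close>)
    also have "\<dots> = real (M' + M) * ln r + proximity_m r f"
      using elim good_radius_continuous_log_plus[OF elim(7)]
      by (subst circ_mean_add) (auto intro!: continuous_intros simp: proximity_eq_mean)
    also have "\<dots> \<le> real (M' + M) * r + characteristic_T r f"
      using elim ln_le_minus_one[of r] countN_nonneg[of "pole_div f" r]
      by (intro add_mono mult_left_mono) (auto simp: characteristic_eq[OF f_nz])
    also have "\<dots> \<le> K' * r" using elim(3) by (simp add: K'_def distrib_right)
    finally show ?case using elim by simp
  qed
  have bnd: "norm (poly (pderiv Q) z) \<le> 16 * K' + 8 * norm (poly Q 0)" for z
  proof -
    \<comment> \<open>For fixed z some unexceptional R beyond 2|z| suffices, and the resulting bound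
      does not involve R or z.\<close>
    obtain R where R: "R \<ge> 2 * norm z + 1" "proximity_m R (\<lambda>z. exp (poly Q z)) \<le> K' * R" "R \<ge> 1"
      using nev_frequently_ge[OF mQ] by blast
    have "poly Q holomorphic_on UNIV" using poly_analytic[of Q UNIV] by (rule analytic_imp_holomorphic)
    hence "norm (deriv (poly Q) z) \<le> 8 / R * (2 * proximity_m R (\<lambda>z. exp (poly Q z)) - Re (poly Q 0))"
      using R by (intro norm_deriv_le_proximity_exp) auto
    also have "\<dots> \<le> 8 / R * (2 * (K' * R) + norm (poly Q 0) * R)"
    proof (intro mult_left_mono add_mono)
      have "- Re (poly Q 0) \<le> norm (poly Q 0)" using abs_Re_le_cmod[of "poly Q 0"] by linarith
      moreover have "norm (poly Q 0) * 1 \<le> norm (poly Q 0) * R" using R by (intro mult_left_mono) auto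
      ultimately show "2 * proximity_m R (\<lambda>z. exp (poly Q z)) - Re (poly Q 0) \<le> 2 * (K' * R) + norm (poly Q 0) * R"
        using R(2) by linarith
    qed (use R in auto)
    also have "\<dots> = 16 * K' + 8 * norm (poly Q 0)" using R by (simp add: field_simps)
    finally show ?thesis by (simp add: DERIV_imp_deriv[OF poly_DERIV])
  qed
  have "bounded (range (poly (pderiv Q)))" using bnd unfolding bounded_iff by blast
  moreover have "poly (pderiv Q) holomorphic_on UNIV" using poly_analytic by (rule analytic_imp_holomorphic)
  ultimately obtain q where "\<And>z. poly (pderiv Q) z = q" using Liouville_theorem[of "poly (pderiv Q)"]
    unfolding constant_on_def by blast
  hence "poly (pderiv Q) = poly [:q:]" by (simp add: fun_eq_iff)
  hence "pderiv Q = [:q:]" by (simp only: poly_eq_poly_eq_iff)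
  hence "degree (pderiv Q) = 0" by simp
  thus ?thesis using assms(3) by (simp add: degree_pderiv)
qed

text \<open>For n = 2 the operator gives D2 (f^2) = \<phi> directly. A polynomial R with D2 (R exp
  Q) = -A exp Q is found by solving two first-order equations with constants q - \<alpha>1 and q -
  \<alpha>2, where q = Q'; then f^2 + R exp Q is annihilated by D2. R cannot vanish since A does
  not.\<close>

lemma exp_factor_solution:
  assumes n: "n = 2" and A: "A \<noteq> 0" and \<phi>: "\<forall>\<^sub>\<approx>z. \<phi> z = poly A z * exp (poly Q z)" and Q: "degree Q \<ge> 1"
  shows "degree Q = 1 \<and> (\<exists>d1 d2 R. R \<noteq> 0 \<and> degree R \<le> degree A + 2 \<and>
    (\<forall>z. f z ^ 2 = d1 * exp (\<alpha>1 * z) + d2 * exp (\<alpha>2 * z) - poly R z * exp (poly Q z)))"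
proof -
  have Q1: "degree Q = 1" by (rule exp_factor_degree[OF A \<phi> Q])
  hence "degree (pderiv Q) = 0" by (simp add: degree_pderiv)
  then obtain q where q: "pderiv Q = [:q:]" by (rule degree_eq_zeroE)
  obtain S where S: "pderiv S + smult (q - \<alpha>1) S = - A" "degree S \<le> Suc (degree A)"
    using linear_ode_poly[of "q - \<alpha>1" "- A"] by auto
  obtain R where R: "pderiv R + smult (q - \<alpha>2) R = S" "degree R \<le> Suc (degree S)"
    using linear_ode_poly[of "q - \<alpha>2" S] by auto
  have R0: "R \<noteq> 0" using R S A by auto
  define v where "v = (\<lambda>z. poly R z * exp (poly Q z))"
  have va: "v analytic_on A" for A unfolding v_def by (intro analytic_intros poly_analytic)
  have D2v: "D2 v z = - (poly A z * exp (poly Q z))" for z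
  proof -
    have R': "pderiv R = S - smult (q - \<alpha>2) R" using R(1) by (simp add: algebra_simps)
    have S': "pderiv S = - A - smult (q - \<alpha>1) S" using S(1) by (simp add: algebra_simps)
    have 1: "pderiv R + pderiv Q * R = S + smult \<alpha>2 R"
      unfolding R' q by (simp add: smult_diff_left)
    have 2: "pderiv (S + smult \<alpha>2 R) + pderiv Q * (S + smult \<alpha>2 R) = - A + smult \<alpha>1 S + smult \<alpha>2 S + smult (\<alpha>2 * \<alpha>2) R"
      unfolding pderiv_add pderiv_smult R' S' q by (simp add: smult_diff_left smult_diff_right smult_add_right algebra_simps)
    show ?thesis unfolding D2_def v_def poly_exp_deriv 1 2 s_def by (simp add: algebra_simps)
  qed
  have "\<forall>\<^sub>\<approx>z. D2 (\<lambda>z. f z ^ 2 + v z) z = 0" using \<phi> sing_cosparse[OF f_nz]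
  proof eventually_elim
    case (elim z)
    have "D2 (\<lambda>z. f z ^ 2 + v z) z = D2 (\<lambda>z. f z ^ 2) z + D2 v z"
      using sing_analytic[OF elim(2)] by (intro D2_add analytic_intros va) auto
    also have "D2 (\<lambda>z. f z ^ 2) z = \<phi> z" using D2_power[OF elim(2)] n by simp
    finally show ?case using elim(1) D2v by simp
  qed
  moreover have vm: "v meromorphic_on UNIV" by (rule analytic_on_imp_meromorphic_on[OF va])
  moreover have "(\<lambda>z. f z ^ 2 + v z) meromorphic_on UNIV" by (intro meromorphic_intros f_mero vm)
  ultimately obtain d1 d2 where "\<forall>\<^sub>\<approx>z. f z ^ 2 + v z = d1 * exp (\<alpha>1 * z) + d2 * exp (\<alpha>2 * z)"
    using D2_zero_solution by blast
  hence "\<forall>\<^sub>\<approx>z. f z ^ n = d1 * exp (\<alpha>1 * z) + d2 * exp (\<alpha>2 * z) - poly R z * exp (poly Q z)"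
    by eventually_elim (simp add: n v_def algebra_simps)
  hence "f z ^ n = d1 * exp (\<alpha>1 * z) + d2 * exp (\<alpha>2 * z) - poly R z * exp (poly Q z)" for z
    by (rule f_entire_if_power(2)) (intro holomorphic_intros analytic_imp_holomorphic poly_analytic)
  moreover have "degree R \<le> degree A + 2" using R S by simp
  ultimately show ?thesis using Q1 R0 unfolding n by blast
qed

end

theorem theorem1p4:
  fixes n :: nat and P :: diff_poly and \<alpha>1 \<alpha>2 p1 p2 :: complex
    and f \<phi> :: "complex \<Rightarrow> complex"
  assumes "n \<ge> 2"
    and "diff_poly_degree P = n - 1"
    and "\<alpha>1 \<noteq> 0" and "\<alpha>2 \<noteq> 0" and "p1 \<noteq> 0" and "p2 \<noteq> 0"
    and "\<alpha>1 + \<alpha>2 \<noteq> 0" and "\<alpha>1 - \<alpha>2 \<noteq> 0"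
    and "transcendental_meromorphic f"
    and "\<forall>\<^sub>\<approx>z. f z ^ n + diff_poly_eval P f z = p1 * exp (\<alpha>1 * z) + p2 * exp (\<alpha>2 * z)"
    and "is_S f (\<lambda>r. counting_N r f)"
  defines "\<phi> \<equiv> phi_aux n \<alpha>1 \<alpha>2 f"
  shows "growth_order f = 1
    \<and> (is_S f (\<lambda>r. counting_N r (\<lambda>z. 1 / f z)) \<longrightarrow>
        (\<exists>k1 s1. 1 \<le> k1 \<and> k1 \<le> int n - 1 \<and> of_int k1 * \<alpha>1 = of_nat n * \<alpha>2 \<and> s1 ^ n = p1
           \<and> f = (\<lambda>z. s1 * exp (\<alpha>1 * z / of_nat n)))
      \<or> (\<exists>k2 s2. 1 \<le> k2 \<and> k2 \<le> int n - 1 \<and> of_int k2 * \<alpha>2 = of_nat n * \<alpha>1 \<and> s2 ^ n = p2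
           \<and> f = (\<lambda>z. s2 * exp (\<alpha>2 * z / of_nat n))))
    \<and> (\<not> is_S f (\<lambda>r. counting_N r (\<lambda>z. 1 / f z)) \<longrightarrow>
        \<not> (\<forall>\<^sub>\<approx>z. \<phi> z = 0)
      \<and> (\<exists>S. is_S f S \<and>
           (\<forall>r>0. characteristic_T r f \<le> counting_N_simple_zeros r f
              + 1 / 2 * characteristic_T r \<phi> + 1 / 2 * counting_N r (\<lambda>z. 1 / \<phi> z) + S r))
      \<and> (\<forall>c. c \<noteq> 0 \<and> (\<forall>\<^sub>\<approx>z. \<phi> z = c) \<longrightarrow>
           ((of_nat n - 1) * \<alpha>1 = of_nat n * \<alpha>2 \<and>
              ((\<exists>c1. c1 ^ n = p1 \<and> f = (\<lambda>z. c1 * exp (\<alpha>1 * z / of_nat n)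
                  - 1 / \<alpha>1 * csqrt (of_nat n * c / (of_nat n - 1))))
             \<or> (\<exists>c3. c3 ^ n = p1 \<and> f = (\<lambda>z. c3 * exp (\<alpha>1 * z / of_nat n)
                  + 1 / \<alpha>1 * csqrt (of_nat n * c / (of_nat n - 1))))))
         \<or> ((of_nat n - 1) * \<alpha>2 = of_nat n * \<alpha>1 \<and>
              ((\<exists>c2. c2 ^ n = p2 \<and> f = (\<lambda>z. c2 * exp (\<alpha>2 * z / of_nat n)
                  - 1 / \<alpha>2 * csqrt (of_nat n * c / (of_nat n - 1))))
             \<or> (\<exists>c4. c4 ^ n = p2 \<and> f = (\<lambda>z. c4 * exp (\<alpha>2 * z / of_nat n)
                  + 1 / \<alpha>2 * csqrt (of_nat n * c / (of_nat n - 1)))))))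
      \<and> (\<not> (\<exists>c. \<forall>\<^sub>\<approx>z. \<phi> z = c) \<longrightarrow>
           \<not> is_S f (\<lambda>r. characteristic_T r \<phi>)
         \<and> (\<forall>A Q :: complex poly. n = 2 \<and> A \<noteq> 0 \<and> Q \<noteq> 0 \<and> degree Q \<ge> 1
              \<and> (\<forall>\<^sub>\<approx>z. \<phi> z = poly A z * exp (poly Q z)) \<longrightarrow>
                degree Q = 1 \<and>
                (\<exists>d1 d2 R. R \<noteq> 0 \<and> degree R \<le> degree A + 2 \<and>
                   (\<forall>z. f z ^ 2 = d1 * exp (\<alpha>1 * z) + d2 * exp (\<alpha>2 * z)
                                  - poly R z * exp (poly Q z))))))"
proof -
  interpret tumura_clunie n P \<alpha>1 \<alpha>2 p1 p2 f
  proof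
    show "\<alpha>1 \<noteq> \<alpha>2" using assms(8) by simp
    show "diff_poly_degree P \<le> n - 1" using assms(2) by simp
  qed (fact assms)+
  have N: "\<not> sm (countN (zero_div f))" if "\<not> is_S f (\<lambda>r. counting_N r (\<lambda>z. 1 / f z))"
    using is_S_zero_iff that by simp
  have nz: "\<not> (\<forall>\<^sub>\<approx>z. phi_aux n \<alpha>1 \<alpha>2 f z = 0)" if "\<not> is_S f (\<lambda>r. counting_N r (\<lambda>z. 1 / f z))"
    using \<phi>_zero_imp_sm N[OF that] by blast
  have nz': "nonzero_mero (phi_aux n \<alpha>1 \<alpha>2 f)" if "\<not> is_S f (\<lambda>r. counting_N r (\<lambda>z. 1 / f z))"
    using zero_or_nonzero_mero[OF \<phi>_mero] nz[OF that] by blast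
  show ?thesis unfolding \<phi>_def
    apply (intro conjI impI)
         apply (rule order_1)
        apply (erule case_I)
       apply (erule nz)
      apply (rule case_II_inequality, erule nz')
     apply (intro allI impI, elim conjE, rule const_case, assumption, assumption, erule N)
    apply (erule not_const_not_small, erule N)
    apply (intro allI impI, elim conjE, rule exp_factor_solution, assumption+)
    done
qed

end
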